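(* Let $n\ge 4$, let $S^{\lambda,\mu}$ be an irreducible representation of $B_{n-2}$, where $\lambda,\mu$ are partitions with $|\lambda|+|\mu|=n-2$, and let $W$ be an irreducible representation of $\overline{S_2}$. Then $$\mathrm{ind}^{B_2}_{\overline{S_2}}W=\begin{cases}S^{(2),\emptyset}\oplus S^{\emptyset,(2)}\oplus S^{(1),(1)}&\text{if }W=\mathbf 1,\\ S^{(1^2),\emptyset}\oplus S^{\emptyset,(1^2)}\oplus S^{(1),(1)}&\text{if }W=\epsilon_{S_2}.\end{cases}$$ Consequently, $$\mathrm{ind}^{B_n}_{B_{n-2}\times\overline{S_2}}S^{\lambda,\mu}\boxtimes W=\begin{cases}\bigoplus_{\tau\in\bar{\bar{\lambda}}}S^{\tau,\mu}\oplus\bigoplus_{\rho\in\bar{\bar{\mu}}}S^{\lambda,\rho}\oplus\bigoplus_{\tau\in\bar{\lambda},\,\rho\in\bar{\mu}}S^{\tau,\rho}&\text{if }W=\mathbf 1,\\ \bigoplus_{\tau\in\tilde{\bar{\lambda}}}S^{\tau,\mu}\oplus\bigoplus_{\rho\in\tilde{\bar{\mu}}}S^{\lambda,\rho}\oplus\bigoplus_{\tau\in\bar{\lambda},\,\rho\in\bar{\mu}}S^{\tau,\rho}&\text{if }W=\epsilon_{S_2}.\end{cases}$$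
   Context: All representations are finite-dimensional over $\mathbb{C}$. Let $F=\mathbb{Z}/2=\{0,1\}$ and $B_m=F\wr S_m=F^m\rtimes S_m$, where $S_m$ permutes the coordinates of $F^m$. $B_{m-k}\times B_k$ is identified with $F\wr(S_{m-k}\times S_k)\leqslant B_m$. $\overline{S_2}=\{(0,\sigma):\sigma\in S_2\}\leqslant B_2$; its irreducible representations are the trivial one $\mathbf 1$ and the sign representation $\epsilon_{S_2}$. $\mathbf 1$ also denotes the trivial and $\epsilon$ the sign (nontrivial one-dimensional) representation of $F$. For $D\in\{\mathbf 1,\epsilon\}$ and a representation $E$ of $S_m$, $(D;E)$ is the representation of $B_m$ on the space of $E$ in which $(f,\sigma)$ acts as $D(f_1)\cdots D(f_m)$ times the action of $\sigma$. For partitions $\lambda\vdash m-k$, $\mu\vdash k$, with Specht modules $S^\lambda,S^\mu$, set $S^{\lambda,\mu}:=\mathrm{ind}^{B_m}_{B_{m-k}\times B_k}(\mathbf 1;S^\lambda)\boxtimes(\epsilon;S^\mu)$; these are the irreducible representations of $B_m$. For a partition $\lambda$ of $m$: $\bar\lambda$ is the set of $\tau\vdash m+1$ such that $S^\tau$ is a summand of $\mathrm{ind}^{S_{m+1}}_{S_m\times S_1}S^\lambda\boxtimes\mathbf 1$; $\bar{\bar\lambda}$ is the set of $\tau\vdash m+2$ such that $S^\tau$ is a summand of $\mathrm{ind}^{S_{m+2}}_{S_m\times S_2}S^\lambda\boxtimes\mathbf 1_{S_2}$; $\tilde{\bar\lambda}$ is the set of $\tau\vdash m+2$ such that $S^\tau$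 is a summand of $\mathrm{ind}^{S_{m+2}}_{S_m\times S_2}S^\lambda\boxtimes\epsilon_{S_2}$. *)

theory Defs
  imports
    Complex_Main
    "HOL-Library.Function_Algebras"
    "HOL-Algebra.Sym_Groups"
    "HOL-Algebra.Product_Groups"
begin

section \<open>Representations\<close>

text \<open>
  A finite-dimensional complex vector space is a finite-dimensional subspace of the coordinate
  space of all functions from some type to the complex numbers. Every finite-dimensional complex
  vector space is isomorphic to one of these, and they are closed under the direct sums, tensor
  products and inductions below.
\<close>

definition cscale :: "complex \<Rightarrow> ('x \<Rightarrow> complex) \<Rightarrow> 'x \<Rightarrow> complex" where
  "cscale c v = (\<lambda>x. c * v x)"

interpretation cfun: vector_space cscale
  by unfold_locales (auto simp: cscale_def fun_eq_iff algebra_simps)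

definition clinear_on :: "('x \<Rightarrow> complex) set \<Rightarrow> (('x \<Rightarrow> complex) \<Rightarrow> 'y \<Rightarrow> complex) \<Rightarrow> bool" where
  "clinear_on V \<phi> \<longleftrightarrow>
     (\<forall>u\<in>V. \<forall>v\<in>V. \<phi> (u + v) = \<phi> u + \<phi> v) \<and> (\<forall>c. \<forall>v\<in>V. \<phi> (cscale c v) = cscale c (\<phi> v))"

text \<open>The values of \<open>act\<close> matter only for group elements in the carrier and vectors in \<open>space\<close>.\<close>

record ('g, 'x) rep =
  space :: "('x \<Rightarrow> complex) set"
  act :: "'g \<Rightarrow> ('x \<Rightarrow> complex) \<Rightarrow> 'x \<Rightarrow> complex"

definition representation :: "('g, 'm) monoid_scheme \<Rightarrow> ('g, 'x) rep \<Rightarrow> bool" where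
  "representation G R \<longleftrightarrow> group G \<and>
     (\<exists>B. finite B \<and> space R = cfun.span B) \<and>
     (\<forall>g\<in>carrier G. act R g \<in> space R \<rightarrow> space R \<and> clinear_on (space R) (act R g)) \<and>
     (\<forall>v\<in>space R. act R \<one>\<^bsub>G\<^esub> v = v) \<and>
     (\<forall>g\<in>carrier G. \<forall>h\<in>carrier G. \<forall>v\<in>space R. act R (g \<otimes>\<^bsub>G\<^esub> h) v = act R g (act R h v))"

definition rep_iso :: "('g, 'm) monoid_scheme \<Rightarrow> ('g, 'x) rep \<Rightarrow> ('g, 'y) rep \<Rightarrow> bool" where
  "rep_iso G R S \<longleftrightarrow> (\<exists>\<phi>. bij_betw \<phi> (space R) (space S) \<and> clinear_on (space R) \<phi> \<and>
     (\<forall>g\<in>carrier G. \<forall>v\<in>space R. \<phi> (act R g v) = act S g (\<phi> v)))"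

definition invariant_subspace ::
    "('g, 'm) monoid_scheme \<Rightarrow> ('g, 'x) rep \<Rightarrow> ('x \<Rightarrow> complex) set \<Rightarrow> bool" where
  "invariant_subspace G R U \<longleftrightarrow> cfun.subspace U \<and> U \<subseteq> space R \<and>
     (\<forall>g\<in>carrier G. \<forall>u\<in>U. act R g u \<in> U)"

definition irreducible_rep :: "('g, 'm) monoid_scheme \<Rightarrow> ('g, 'x) rep \<Rightarrow> bool" where
  "irreducible_rep G R \<longleftrightarrow> representation G R \<and> space R \<noteq> {0} \<and>
     (\<forall>U. invariant_subspace G R U \<longrightarrow> U = {0} \<or> U = space R)"

text \<open>\<open>is_summand G A R\<close>: \<open>A\<close> is isomorphic to a direct summand of \<open>R\<close>.\<close>

definition is_summand :: "('g, 'm) monoid_scheme \<Rightarrow> ('g, 'x) rep \<Rightarrow> ('g, 'y) rep \<Rightarrow> bool" where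
  "is_summand G A R \<longleftrightarrow> (\<exists>U U'. invariant_subspace G R U \<and> invariant_subspace G R U' \<and>
     U \<inter> U' = {0} \<and> space R = {u + u' |u u'. u \<in> U \<and> u' \<in> U'} \<and>
     rep_iso G A (R\<lparr>space := U\<rparr>))"

definition rep_plus :: "('g, 'x) rep \<Rightarrow> ('g, 'y) rep \<Rightarrow> ('g, 'x + 'y) rep"
    (infixr \<open>\<oplus>\<^sub>r\<close> 65) where
  "R \<oplus>\<^sub>r S =
     \<lparr>space = {v. (\<lambda>x. v (Inl x)) \<in> space R \<and> (\<lambda>y. v (Inr y)) \<in> space S},
      act = (\<lambda>g v. case_sum (act R g (\<lambda>x. v (Inl x))) (act S g (\<lambda>y. v (Inr y))))\<rparr>"

text \<open>For infinite \<open>I\<close> this would be the direct product; all families below are finite.\<close>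

definition rep_Sum :: "'i set \<Rightarrow> ('i \<Rightarrow> ('g, 'x) rep) \<Rightarrow> ('g, 'i \<times> 'x) rep" where
  "rep_Sum I R =
     \<lparr>space = {v. (\<forall>i\<in>I. (\<lambda>x. v (i, x)) \<in> space (R i)) \<and> (\<forall>i. i \<notin> I \<longrightarrow> (\<forall>x. v (i, x) = 0))},
      act = (\<lambda>g v (i, x). if i \<in> I then act (R i) g (\<lambda>x'. v (i, x')) x else 0)\<rparr>"

syntax
  "_rep_Sum" :: "pttrn \<Rightarrow> 'i set \<Rightarrow> ('g, 'x) rep \<Rightarrow> ('g, 'i \<times> 'x) rep"
    (\<open>(3\<Oplus>\<^sub>r _\<in>_./ _)\<close> [0, 51, 66] 66)
translations
  "\<Oplus>\<^sub>r i\<in>I. R" \<rightleftharpoons> "CONST rep_Sum I (\<lambda>i. R)"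

text \<open>
  The external tensor product, a representation of the direct product of the two groups: the pure
  tensor of \<open>v\<close> and \<open>w\<close> is the function sending \<open>(x, y)\<close> to \<open>v x * w y\<close>. For \<open>t\<close> in the span of
  the pure tensors and fixed \<open>x\<close>, the slice of \<open>t\<close> at \<open>x\<close> lies in the space of \<open>S\<close>, and
  dually for fixed \<open>y\<close>. The action applies \<open>h\<close> to the slices of the first kind and then \<open>g\<close> to
  those of the second kind, which sends the pure tensor of \<open>v\<close> and \<open>w\<close> to that of \<open>g v\<close> and \<open>h w\<close>.
\<close>

definition rep_tensor :: "('g, 'x) rep \<Rightarrow> ('h, 'y) rep \<Rightarrow> ('g \<times> 'h, 'x \<times> 'y) rep"
    (infixr \<open>\<boxtimes>\<close> 70) where
  "R \<boxtimes> S =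
     \<lparr>space = cfun.span {\<lambda>(x, y). v x * w y |v w. v \<in> space R \<and> w \<in> space S},
      act = (\<lambda>(g, h) t (x, y). act R g (\<lambda>x'. act S h (\<lambda>y'. t (x', y')) y) x)\<rparr>"

text \<open>
  The representation of a finite group \<open>G\<close> induced from a representation \<open>R\<close> of \<open>H\<close>, where the
  injective homomorphism \<open>j\<close> identifies \<open>H\<close> with a subgroup of \<open>G\<close>: functions \<open>F\<close> from \<open>G\<close> to the
  space of \<open>R\<close> (extended by zero outside the carrier) with \<open>F (g h) = h\<inverse> F g\<close>, on
  which \<open>G\<close> acts by left translation. As \<open>G\<close> is finite this is the usual extension of scalars
  from the group algebra of \<open>H\<close> to that of \<open>G\<close>, the function \<open>F\<close> corresponding to the sum of
  \<open>g \<otimes> F g\<close> over representatives \<open>g\<close> of the left cosets of \<open>H\<close>.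
\<close>

definition ind ::
    "('g, 'm) monoid_scheme \<Rightarrow> ('h, 'n) monoid_scheme \<Rightarrow> ('h \<Rightarrow> 'g) \<Rightarrow> ('h, 'x) rep \<Rightarrow> ('g, 'g \<times> 'x) rep"
  where
  "ind G H j R =
     \<lparr>space = {F. (\<forall>g. g \<notin> carrier G \<longrightarrow> (\<forall>x. F (g, x) = 0)) \<and>
        (\<forall>g\<in>carrier G. (\<lambda>x. F (g, x)) \<in> space R) \<and>
        (\<forall>g\<in>carrier G. \<forall>h\<in>carrier H.
           (\<lambda>x. F (g \<otimes>\<^bsub>G\<^esub> j h, x)) = act R (inv\<^bsub>H\<^esub> h) (\<lambda>x. F (g, x)))},
      act = (\<lambda>g F (g', x). if g' \<in> carrier G then F (inv\<^bsub>G\<^esub> g \<otimes>\<^bsub>G\<^esub> g', x) else 0)\<rparr>"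

text \<open>The one-dimensional representation afforded by a linear character.\<close>

definition char_rep :: "('g \<Rightarrow> complex) \<Rightarrow> ('g, unit) rep" where
  "char_rep \<chi> = \<lparr>space = UNIV, act = (\<lambda>g. cscale (\<chi> g))\<rparr>"

abbreviation triv_rep :: "('g, unit) rep" where
  "triv_rep \<equiv> char_rep (\<lambda>_. 1)"


section \<open>Partitions and Specht modules\<close>

definition is_partition :: "nat list \<Rightarrow> nat \<Rightarrow> bool" (infix \<open>\<turnstile>\<close> 50) where
  "lam \<turnstile> m \<longleftrightarrow> sorted_wrt (\<ge>) lam \<and> 0 \<notin> set lam \<and> sum_list lam = m"

text \<open>A tableau is the list of its rows; the tabloid of \<open>t\<close> is the list \<open>map set t\<close> of its row sets.\<close>

definition tableaux :: "nat list \<Rightarrow> nat list list set" where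
  "tableaux lam = {t. map length t = lam \<and> distinct (concat t) \<and> set (concat t) = {1..sum_list lam}}"

definition column :: "nat list list \<Rightarrow> nat \<Rightarrow> nat set" where
  "column t j = {t ! i ! j |i. i < length t \<and> j < length (t ! i)}"

definition column_stabilizer :: "nat list list \<Rightarrow> (nat \<Rightarrow> nat) set" where
  "column_stabilizer t = {\<pi>. \<pi> permutes set (concat t) \<and> (\<forall>j. \<pi> ` column t j = column t j)}"

text \<open>The signed sum of the tabloids of \<open>\<pi> t\<close> over the column stabilizer of \<open>t\<close>.\<close>

definition polytabloid :: "nat list list \<Rightarrow> nat set list \<Rightarrow> complex" where
  "polytabloid t = (\<lambda>T. \<Sum>\<pi>\<in>column_stabilizer t.
     if T = map ((`) \<pi>) (map set t) then of_int (sign \<pi>) else 0)"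

definition Specht :: "nat list \<Rightarrow> (nat \<Rightarrow> nat, nat set list) rep" where
  "Specht lam =
     \<lparr>space = cfun.span (polytabloid ` tableaux lam),
      act = (\<lambda>\<sigma> v T. v (map ((`) (inv' \<sigma>)) T))\<rparr>"

text \<open>The identification of \<open>S\<^sub>m \<times> S\<^sub>k\<close> with a subgroup of \<open>S\<^sub>m\<^sub>+\<^sub>k\<close>.\<close>

definition sym_embed :: "nat \<Rightarrow> (nat \<Rightarrow> nat) \<times> (nat \<Rightarrow> nat) \<Rightarrow> nat \<Rightarrow> nat" where
  "sym_embed m = (\<lambda>(\<sigma>, \<tau>) i. if i \<le> m then \<sigma> i else \<tau> (i - m) + m)"

definition sign_char :: "(nat \<Rightarrow> nat) \<Rightarrow> complex" where
  "sign_char \<sigma> = of_int (sign \<sigma>)"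

text \<open>
  The partitions \<open>\<tau>\<close> for which the Specht module of \<open>\<tau>\<close> is a summand of the representation of
  \<open>S\<^sub>m\<^sub>+\<^sub>k\<close> induced from the tensor product of the Specht module of \<open>lam\<close>, where \<open>lam \<turnstile> m\<close>,
  with the representation \<open>E\<close> of \<open>S\<^sub>k\<close>.
\<close>

definition sym_ind_parts :: "nat \<Rightarrow> (nat \<Rightarrow> nat, 'x) rep \<Rightarrow> nat list \<Rightarrow> nat list set" where
  "sym_ind_parts k E lam = (let m = sum_list lam in
     {\<tau>. \<tau> \<turnstile> m + k \<and>
        is_summand (sym_group (m + k)) (Specht \<tau>)
          (ind (sym_group (m + k)) (sym_group m \<times>\<times> sym_group k) (sym_embed m) (Specht lam \<boxtimes> E))})"

text \<open>The sets written \<open>lam\<close> with a bar, with two bars, and with a bar and a tilde.\<close>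

definition bar :: "nat list \<Rightarrow> nat list set" where
  "bar = sym_ind_parts 1 triv_rep"

definition barbar :: "nat list \<Rightarrow> nat list set" where
  "barbar = sym_ind_parts 2 triv_rep"

definition tildebar :: "nat list \<Rightarrow> nat list set" where
  "tildebar = sym_ind_parts 2 (char_rep sign_char)"


section \<open>The groups \<open>B\<^sub>m\<close> and their irreducible representations\<close>

type_synonym hyp = "(nat \<Rightarrow> int) \<times> (nat \<Rightarrow> nat)"

abbreviation F2 :: "int monoid" where
  "F2 \<equiv> integer_mod_group 2"

text \<open>
  The coordinate \<open>i\<close> of the tuple \<open>f\<close> acted on by \<open>\<sigma>\<close> is the coordinate of \<open>f\<close> at
  \<open>\<sigma>\<inverse> i\<close>. Tuples are extensional functions on \<open>{1..m}\<close>.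
\<close>

definition B :: "nat \<Rightarrow> hyp monoid" where
  "B m =
     \<lparr>carrier = carrier (product_group {1..m} (\<lambda>_. F2)) \<times> carrier (sym_group m),
      mult = (\<lambda>(f, \<sigma>) (g, \<tau>).
        (f \<otimes>\<^bsub>product_group {1..m} (\<lambda>_. F2)\<^esub> (\<lambda>i\<in>{1..m}. g (inv' \<sigma> i)), \<sigma> \<otimes>\<^bsub>sym_group m\<^esub> \<tau>)),
      one = (\<one>\<^bsub>product_group {1..m} (\<lambda>_. F2)\<^esub>, \<one>\<^bsub>sym_group m\<^esub>)\<rparr>"

text \<open>
  The identification of \<open>B\<^sub>m \<times> B\<^sub>k\<close> with the subgroup \<open>F \<wr> (S\<^sub>m \<times> S\<^sub>k)\<close> of \<open>B\<^sub>m\<^sub>+\<^sub>k\<close>.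
\<close>

definition B_embed :: "nat \<Rightarrow> nat \<Rightarrow> hyp \<times> hyp \<Rightarrow> hyp" where
  "B_embed m k = (\<lambda>((f, \<sigma>), (g, \<tau>)).
     (\<lambda>i\<in>{1..m + k}. if i \<le> m then f i else g (i - m), sym_embed m (\<sigma>, \<tau>)))"

definition S2bar :: "hyp monoid" where
  "S2bar = (B 2)\<lparr>carrier := {\<one>\<^bsub>product_group {1..2} (\<lambda>_. F2)\<^esub>} \<times> carrier (sym_group 2)\<rparr>"

definition eps_S2 :: "(hyp, unit) rep" where
  "eps_S2 = char_rep (\<lambda>(f, \<sigma>). sign_char \<sigma>)"

text \<open>Every irreducible representation of \<open>S2bar\<close> is the trivial or the sign representation.\<close>

lemma carrier_S2bar:
  "carrier S2bar = {(\<one>\<^bsub>product_group {1..2} (\<lambda>_. F2)\<^esub>, id),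
                    (\<one>\<^bsub>product_group {1..2} (\<lambda>_. F2)\<^esub>, transpose 1 2)}"
proof -
  have "{1..2::nat} = {1, 2}" by auto
  then have "{p. p permutes {1..2::nat}} = {id, transpose 1 2}"
    using permutes_doubleton_iff[of _ "1::nat" 2] by auto
  then show ?thesis
    by (auto simp: S2bar_def sym_group_def)
qed

lemma rep_iso_char_rep_S2bar:
  assumes W: "irreducible_rep S2bar W" and u: "u \<in> space W" "u \<noteq> 0"
    and \<chi>: "\<And>g. g \<in> carrier S2bar \<Longrightarrow> act W g u = cscale (\<chi> g) u"
  shows "rep_iso S2bar W (char_rep \<chi>)"
proof -
  obtain x where x: "u x \<noteq> 0" using u(2) by (auto simp: fun_eq_iff)
  have rep: "representation S2bar W" using W by (simp add: irreducible_rep_def)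
  then obtain E where E: "space W = cfun.span E" by (auto simp: representation_def)
  have lin: "clinear_on (space W) (act W g)" if "g \<in> carrier S2bar" for g
    using rep that by (simp add: representation_def)
  have act_mult: "act W g (cscale c u) = cscale (\<chi> g) (cscale c u)" if "g \<in> carrier S2bar" for g c
    using lin[OF that] u(1) \<chi>[OF that] by (simp add: clinear_on_def mult.commute)
  have "invariant_subspace S2bar W (cfun.span {u})"
    unfolding invariant_subspace_def
  proof (intro conjI ballI)
    show "cfun.span {u} \<subseteq> space W"
      using u(1) E by (metis cfun.span_minimal cfun.subspace_span empty_subsetI insert_subset)
    fix g w assume "g \<in> carrier S2bar" "w \<in> cfun.span {u}"
    then show "act W g w \<in> cfun.span {u}"
      by (auto simp: cfun.span_singleton act_mult)
  qed auto
  moreover have "cfun.span {u} \<noteq> {0}" using u(2) cfun.span_base[of u "{u}"] by auto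
  ultimately have V: "space W = range (\<lambda>c. cscale c u)"
    using W by (auto simp: irreducible_rep_def cfun.span_singleton)
  have "bij_betw (\<lambda>w (_::unit). w x / u x) (space W) UNIV"
  proof (rule bij_betw_byWitness[where f' = "\<lambda>c. cscale (c ()) u"])
  qed (use x in \<open>auto simp: V cscale_def fun_eq_iff\<close>)
  moreover have "clinear_on (space W) (\<lambda>w (_::unit). w x / u x)"
    by (auto simp: clinear_on_def cscale_def fun_eq_iff add_divide_distrib)
  ultimately show ?thesis
    unfolding rep_iso_def char_rep_def
    by (intro exI[of _ "\<lambda>w (_::unit). w x / u x"])
       (auto simp: V act_mult, auto simp: cscale_def)
qed

lemma irreducible_rep_S2bar:
  assumes W: "irreducible_rep S2bar W"
  shows "rep_iso S2bar W triv_rep \<or> rep_iso S2bar W eps_S2"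
proof -
  let ?o = "\<one>\<^bsub>product_group {1..2} (\<lambda>_. F2)\<^esub>"
  let ?s = "(?o, transpose 1 2) :: hyp"
  have rep: "representation S2bar W" using W by (simp add: irreducible_rep_def)
  then obtain E where E: "space W = cfun.span E" by (auto simp: representation_def)
  have one: "\<one>\<^bsub>S2bar\<^esub> = (?o, id)" by (simp add: S2bar_def B_def sym_group_def)
  have s: "?s \<in> carrier S2bar" by (simp add: carrier_S2bar)
  have ss: "?s \<otimes>\<^bsub>S2bar\<^esub> ?s = (?o, id)"
    by (auto simp: S2bar_def B_def sym_group_def fun_eq_iff restrict_def)
       (auto simp: Transposition.transpose_def split: if_splits)
  have act_one: "act W (?o, id) v = v" if "v \<in> space W" for v
    using rep that one by (simp add: representation_def)
  have act_ss: "act W ?s (act W ?s v) = v" if "v \<in> space W" for v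
    using rep that s ss act_one[OF that] by (metis representation_def)
  have act_in: "act W ?s v \<in> space W" if "v \<in> space W" for v
    using rep that s by (auto simp: representation_def)
  have lin: "clinear_on (space W) (act W ?s)" using rep s by (simp add: representation_def)
  have "0 \<in> space W" using E by (simp add: cfun.span_zero)
  then obtain v where v: "v \<in> space W" "v \<noteq> 0" using W by (auto simp: irreducible_rep_def)
  show ?thesis
  proof (cases "v + act W ?s v = 0")
    case False
    have "v + act W ?s v \<in> space W" using v act_in E by (simp add: cfun.span_add)
    moreover have "act W ?s (v + act W ?s v) = v + act W ?s v"
      using lin v act_in act_ss by (simp add: clinear_on_def add.commute)
    ultimately have "rep_iso S2bar W triv_rep"
      using False act_one by (intro rep_iso_char_rep_S2bar[OF W]) (auto simp: carrier_S2bar)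
    then show ?thesis ..
  next
    case True
    then have "act W ?s v = cscale (- 1) v"
      by (simp add: eq_neg_iff_add_eq_0 add.commute)
    then have "rep_iso S2bar W eps_S2"
      unfolding eps_S2_def using v act_one
      by (intro rep_iso_char_rep_S2bar[OF W])
         (auto simp: carrier_S2bar sign_char_def sign_id sign_swap_id)
    then show ?thesis ..
  qed
qed

text \<open>
  The representations \<open>(D; E)\<close> of \<open>B\<^sub>m\<close>; the one-dimensional representation \<open>D\<close> of \<open>F\<close> is given
  by its character.
\<close>

definition eps_F :: "int \<Rightarrow> complex" where
  "eps_F a = (if a = 0 then 1 else - 1)"

definition twisted :: "nat \<Rightarrow> (int \<Rightarrow> complex) \<Rightarrow> (nat \<Rightarrow> nat, 'x) rep \<Rightarrow> (hyp, 'x) rep" where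
  "twisted m D E =
     \<lparr>space = space E, act = (\<lambda>(f, \<sigma>) v. cscale (\<Prod>i\<in>{1..m}. D (f i)) (act E \<sigma> v))\<rparr>"

definition BSpecht ::
    "nat list \<Rightarrow> nat list \<Rightarrow> (hyp, hyp \<times> nat set list \<times> nat set list) rep" where
  "BSpecht lam \<mu> = (let l = sum_list lam; k = sum_list \<mu> in
     ind (B (l + k)) (B l \<times>\<times> B k) (B_embed l k)
       (twisted l (\<lambda>_. 1) (Specht lam) \<boxtimes> twisted k eps_F (Specht \<mu>)))"

end

theory Submission
  imports
    Defs
    "HOL-Computational_Algebra.Fundamental_Theorem_Algebra"
    "HOL-Combinatorics.Orbits"
begin

text \<open>
  Over the complex numbers a representation of a finite group is determined by its character, so
  each isomorphism is an identity between induced class functions. Inducing in stages, the induction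
  from \<open>B\<^sub>n\<^sub>-\<^sub>2 \<times> S\<^sub>2\<close> passes through \<open>B\<^sub>n\<^sub>-\<^sub>2 \<times> B\<^sub>2\<close>, where the case \<open>n = 2\<close> is a computation in a
  group of order \<open>8\<close>. After exchanging the middle factors of \<open>B\<^sub>l \<times> B\<^sub>k \<times> B\<^sub>a \<times> B\<^sub>b\<close> by a conjugation,
  induction in stages in the other order reduces everything to induction in symmetric groups, because
  \<open>(D; E)\<close> is compatible with induction of \<open>E\<close>.

  There the induced representations are sums of Specht modules, since these exhaust the irreducible
  representations: by James' submodule theorem they are irreducible and pairwise non-isomorphic, and
  there are at least as many partitions as conjugacy classes. The multiplicities are at most \<open>1\<close> because
  every element of \<open>S\<^sub>m\<^sub>+\<^sub>k\<close> with \<open>k \<le> 2\<close> is conjugate to its inverse under \<open>S\<^sub>m \<times> S\<^sub>k\<close>.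
\<close>

section \<open>Traces on finite-dimensional subspaces\<close>

text \<open>The direct sums of the claim run over sets of partitions defined by occurrence of a
  summand. No Pieri rule is proved, but a summand of multiplicity two would be counted once, so
  multiplicity freeness is indispensable. Its source is a symmetry of cycles: reflecting every cycle
  of g conjugates g to its inverse, and the axis on each cycle is free. The axes can be adjusted to
  preserve a set of at most two marked points, however these are spread over the cycles; three
  points with pairwise unequal gaps on one cycle admit no such axis.

  Characters are traces in an arbitrarily chosen basis of a subspace of functions, and the cyclic
  property \<open>tr_comm\<close> replaces every change of basis. From induced representations on,
  the work is done in the formula \<open>icf\<close>, which makes sense for arbitrary functions, so
  that stages, products and conjugate subgroups become manipulations of finite sums. The exchange of
  the middle factors is cheap there: a block permutation conjugates one embedded subgroup to the
  other, and the formula sums over all conjugates anyway.\<close>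

definition fds :: "('x \<Rightarrow> complex) set \<Rightarrow> bool" where
  "fds V \<longleftrightarrow> (\<exists>E. finite E \<and> V = cfun.span E)"

text \<open>A linear map is a total function of which only the values on \<open>V\<close> count, so
  two maps are treated as the same when they agree on \<open>V\<close>. Traces respect this by
  \<open>tr_cong\<close>.\<close>

definition lin :: "('x \<Rightarrow> complex) set \<Rightarrow> ('y \<Rightarrow> complex) set \<Rightarrow> (('x \<Rightarrow> complex) \<Rightarrow> 'y \<Rightarrow> complex) \<Rightarrow> bool"
  where "lin V W T \<longleftrightarrow> T \<in> V \<rightarrow> W \<and> clinear_on V T"

lemma fds_subspace: "fds V \<Longrightarrow> cfun.subspace V"
  by (auto simp: fds_def)

lemma fds_0: "fds V \<Longrightarrow> 0 \<in> V"
  and fds_add: "fds V \<Longrightarrow> u \<in> V \<Longrightarrow> v \<in> V \<Longrightarrow> u + v \<in> V"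
  and fds_diff: "fds V \<Longrightarrow> u \<in> V \<Longrightarrow> v \<in> V \<Longrightarrow> u - v \<in> V"
  and fds_scale: "fds V \<Longrightarrow> u \<in> V \<Longrightarrow> cscale c u \<in> V"
  and fds_sum: "fds V \<Longrightarrow> (\<And>i. i \<in> I \<Longrightarrow> f i \<in> V) \<Longrightarrow> sum f I \<in> V"
  by (auto dest!: fds_subspace intro: cfun.subspace_0 cfun.subspace_add cfun.subspace_diff
      cfun.subspace_scale cfun.subspace_sum)

text \<open>A basis of \<open>U\<close> is independent inside the span of finitely many vectors, so
  the exchange bound makes it finite.\<close>

lemma fds_mono:
  assumes "fds V" "cfun.subspace U" "U \<subseteq> V" shows "fds U"
proof -
  obtain E where E: "finite E" "V = cfun.span E" using assms(1) by (auto simp: fds_def)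
  obtain D where D: "D \<subseteq> U" "cfun.independent D" "U \<subseteq> cfun.span D"
    using cfun.maximal_independent_subset[of U] by blast
  then have "finite D" using E assms(3) cfun.independent_span_bound[of E D] by auto
  moreover have "U = cfun.span D" using D assms(2) cfun.span_minimal by blast
  ultimately show ?thesis by (auto simp: fds_def)
qed

definition bas :: "('x \<Rightarrow> complex) set \<Rightarrow> ('x \<Rightarrow> complex) set" where
  "bas V = (SOME E. finite E \<and> cfun.independent E \<and> cfun.span E = V)"

lemma bas:
  assumes "fds V"
  shows "finite (bas V)" "cfun.independent (bas V)" "cfun.span (bas V) = V"
proof -
  have "\<exists>E. finite E \<and> cfun.independent E \<and> cfun.span E = V"
  proof -
    obtain E where E: "finite E" "V = cfun.span E" using assms by (auto simp: fds_def)
    obtain D where "D \<subseteq> E" "cfun.independent D" "E \<subseteq> cfun.span D"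
      using cfun.maximal_independent_subset[of E] by blast
    with E show ?thesis
      by (intro exI[of _ D]) (metis cfun.span_minimal cfun.span_mono cfun.subspace_span finite_subset subset_antisym)
  qed
  from someI_ex[OF this]
  show "finite (bas V)" "cfun.independent (bas V)" "cfun.span (bas V) = V"
    by (simp_all add: bas_def)
qed

lemma bas_in: "fds V \<Longrightarrow> b \<in> bas V \<Longrightarrow> b \<in> V"
  using bas(3) cfun.span_base by blast

definition crd :: "('x \<Rightarrow> complex) set \<Rightarrow> ('x \<Rightarrow> complex) \<Rightarrow> ('x \<Rightarrow> complex) \<Rightarrow> complex" where
  "crd V v b = cfun.representation (bas V) v b"

lemma crd_sum: "fds V \<Longrightarrow> v \<in> V \<Longrightarrow> (\<Sum>b\<in>bas V. cscale (crd V v b) b) = v"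
  unfolding crd_def by (rule cfun.sum_representation_eq) (auto simp: bas)

lemma crd_add: "fds V \<Longrightarrow> u \<in> V \<Longrightarrow> v \<in> V \<Longrightarrow> crd V (u + v) b = crd V u b + crd V v b"
  by (simp add: crd_def cfun.representation_add bas)

lemma crd_scale: "fds V \<Longrightarrow> v \<in> V \<Longrightarrow> crd V (cscale c v) b = c * crd V v b"
  by (simp add: crd_def cfun.representation_scale bas)

lemma crd_sum_fun: "fds V \<Longrightarrow> (\<And>i. i \<in> I \<Longrightarrow> f i \<in> V) \<Longrightarrow> crd V (sum f I) b = (\<Sum>i\<in>I. crd V (f i) b)"
  by (simp add: crd_def cfun.representation_sum bas)

lemma crd_basis: "fds V \<Longrightarrow> b \<in> bas V \<Longrightarrow> crd V b c = (if c = b then 1 else 0)"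
  by (simp add: crd_def cfun.representation_basis bas)

lemma linI:
  assumes "\<And>v. v \<in> V \<Longrightarrow> T v \<in> W" "\<And>u v. u \<in> V \<Longrightarrow> v \<in> V \<Longrightarrow> T (u + v) = T u + T v"
    "\<And>c v. v \<in> V \<Longrightarrow> T (cscale c v) = cscale c (T v)"
  shows "lin V W T"
  using assms by (auto simp: lin_def clinear_on_def)

lemma lin_in: "lin V W T \<Longrightarrow> v \<in> V \<Longrightarrow> T v \<in> W"
  and lin_add: "lin V W T \<Longrightarrow> u \<in> V \<Longrightarrow> v \<in> V \<Longrightarrow> T (u + v) = T u + T v"
  and lin_scale: "lin V W T \<Longrightarrow> v \<in> V \<Longrightarrow> T (cscale c v) = cscale c (T v)"
  by (auto simp: lin_def clinear_on_def)

lemma cscale_0 [simp]: "cscale 0 v = 0" "cscale c 0 = 0"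
  by (auto simp: cscale_def fun_eq_iff)

lemma cscale_1 [simp]: "cscale 1 v = v"
  by (auto simp: cscale_def fun_eq_iff)

lemma cscale_cscale [simp]: "cscale a (cscale b v) = cscale (a * b) v"
  by (auto simp: cscale_def fun_eq_iff)

lemma cscale_m1: "cscale (- 1) v = - v"
  by (auto simp: cscale_def fun_eq_iff)

lemma lin_0: assumes "lin V W T" "0 \<in> V" shows "T 0 = 0"
  using lin_scale[OF assms, of 0] by simp

lemma lin_diff:
  assumes "lin V W T" "cfun.subspace V" "u \<in> V" "v \<in> V" shows "T (u - v) = T u - T v"
proof -
  have "u - v = u + cscale (- 1) v" by (simp add: cscale_m1)
  then show ?thesis
    using lin_add[OF assms(1,3), of "cscale (- 1) v"] lin_scale[OF assms(1,4), of "- 1"]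
      cfun.subspace_scale[OF assms(2,4), of "- 1"] by (simp add: cscale_m1)
qed

lemma lin_sum:
  assumes T: "lin V W T" and V: "cfun.subspace V" and f: "\<And>i. i \<in> I \<Longrightarrow> f i \<in> V"
  shows "T (\<Sum>i\<in>I. cscale (c i) (f i)) = (\<Sum>i\<in>I. cscale (c i) (T (f i)))"
  using f
proof (induction I rule: infinite_finite_induct)
  case (insert i I)
  have "(\<Sum>i\<in>I. cscale (c i) (f i)) \<in> V" using insert V
    by (intro cfun.subspace_sum cfun.subspace_scale) auto
  moreover have "cscale (c i) (f i) \<in> V" using insert V by (simp add: cfun.subspace_scale)
  ultimately have "T (cscale (c i) (f i) + (\<Sum>i\<in>I. cscale (c i) (f i)))
      = cscale (c i) (T (f i)) + T (\<Sum>i\<in>I. cscale (c i) (f i))"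
    using insert(4) lin_add[OF T] lin_scale[OF T] by (metis insertI1)
  moreover have "T (\<Sum>i\<in>I. cscale (c i) (f i)) = (\<Sum>i\<in>I. cscale (c i) (T (f i)))"
    using insert(3,4) by blast
  ultimately show ?case by (simp only: sum.insert[OF insert(1,2)])
qed (use lin_0[OF T] V in \<open>simp_all add: cfun.subspace_0\<close>)

lemma lin_sum': 
  assumes T: "lin V W T" and V: "cfun.subspace V" and f: "\<And>i. i \<in> I \<Longrightarrow> f i \<in> V"
  shows "T (sum f I) = (\<Sum>i\<in>I. T (f i))"
  using lin_sum[OF assms, where c = "\<lambda>_. 1"] by simp

lemma lin_crd: "lin V W T \<Longrightarrow> fds V \<Longrightarrow> v \<in> V \<Longrightarrow> T v = (\<Sum>b\<in>bas V. cscale (crd V v b) (T b))"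
  using lin_sum[of V W T "bas V" "\<lambda>b. b" "crd V v"] crd_sum[of V v] by (simp add: fds_subspace bas_in)

lemma lin_comp: "lin U V S \<Longrightarrow> lin V W T \<Longrightarrow> lin U W (\<lambda>u. T (S u))"
  by (intro linI) (auto simp: lin_in lin_add[of U V S] lin_add[of V W T] lin_scale[of U V S] lin_scale[of V W T])

lemma lin_plus: "fds W \<Longrightarrow> lin V W S \<Longrightarrow> lin V W T \<Longrightarrow> lin V W (\<lambda>v. S v + T v)"
  by (intro linI) (auto simp: lin_in lin_add[of V W S] lin_add[of V W T] lin_scale[of V W S] lin_scale[of V W T]
      fds_add cfun.scale_right_distrib)

lemma lin_mult: "fds W \<Longrightarrow> lin V W T \<Longrightarrow> lin V W (\<lambda>v. cscale c (T v))"
  by (intro linI) (auto simp: lin_in lin_add[of V W T] lin_scale[of V W T] fds_scale cfun.scale_right_distrib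
      mult.commute)

lemma lin_Sum: "fds W \<Longrightarrow> (\<And>i. i \<in> I \<Longrightarrow> lin V W (T i)) \<Longrightarrow> lin V W (\<lambda>v. \<Sum>i\<in>I. T i v)"
proof (rule linI)
  assume W: "fds W" and T: "\<And>i. i \<in> I \<Longrightarrow> lin V W (T i)"
  show "(\<Sum>i\<in>I. T i v) \<in> W" if "v \<in> V" for v
    by (rule fds_sum[OF W]) (use T that lin_in in blast)
  show "(\<Sum>i\<in>I. T i (u + v)) = (\<Sum>i\<in>I. T i u) + (\<Sum>i\<in>I. T i v)" if "u \<in> V" "v \<in> V" for u v
    unfolding sum.distrib[symmetric] by (intro sum.cong refl lin_add[OF T] that)
  show "(\<Sum>i\<in>I. T i (cscale c v)) = cscale c (\<Sum>i\<in>I. T i v)" if "v \<in> V" for c v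
    unfolding cfun.scale_sum_right by (intro sum.cong refl lin_scale[OF T] that)
qed

lemma lin_id: "U \<subseteq> V \<Longrightarrow> lin U V (\<lambda>v. v)"
  by (intro linI) auto

lemma lin_mono: "lin V W T \<Longrightarrow> V' \<subseteq> V \<Longrightarrow> W \<subseteq> W' \<Longrightarrow> lin V' W' T"
  unfolding lin_def clinear_on_def by blast

lemma lin_rank_one:
  assumes "fds V" "fds W" "w \<in> W" shows "lin V W (\<lambda>v. cscale (crd V v b) w)"
  using assms by (intro linI) (auto simp: fds_scale crd_add crd_scale cfun.scale_left_distrib)

lemma lin_inverse:
  assumes "lin V W T" "bij_betw T V W" "cfun.subspace V"
  shows "lin W V (the_inv_into V T)"
proof (intro linI)
  let ?S = "the_inv_into V T"
  have inj: "inj_on T V" and im: "T ` V = W" using assms(2) by (auto simp: bij_betw_def)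
  show S: "?S w \<in> V" if "w \<in> W" for w using that im inj by (simp add: the_inv_into_into)
  have TS: "T (?S w) = w" if "w \<in> W" for w using f_the_inv_into_f[OF inj] that im by simp
  show "?S (u + v) = ?S u + ?S v" if "u \<in> W" "v \<in> W" for u v
    using the_inv_into_f_f[OF inj, of "?S u + ?S v"] lin_add[OF assms(1) S S, of u v] S TS that
      cfun.subspace_add[OF assms(3), of "?S u" "?S v"] by simp
  show "?S (cscale c v) = cscale c (?S v)" if "v \<in> W" for c v
    using the_inv_into_f_f[OF inj, of "cscale c (?S v)"] lin_scale[OF assms(1) S, of v c] S TS that
      cfun.subspace_scale[OF assms(3), of "?S v" c] by simp
qed

text \<open>The basis \<open>bas V\<close> is an arbitrary choice. \<open>tr_comm\<close> does the
  work of a change of basis, since it compares traces on different spaces without relating their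
  bases.\<close>

definition tr :: "('x \<Rightarrow> complex) set \<Rightarrow> (('x \<Rightarrow> complex) \<Rightarrow> 'x \<Rightarrow> complex) \<Rightarrow> complex" where
  "tr V T = (\<Sum>b\<in>bas V. crd V (T b) b)"

lemma tr_cong: "fds V \<Longrightarrow> (\<And>v. v \<in> V \<Longrightarrow> S v = T v) \<Longrightarrow> tr V S = tr V T"
  by (simp add: tr_def bas_in)

text \<open>Both sides of \<open>tr_comm\<close> are this double sum of products of matrix entries,
  read in the two orders. The explicit form returns at the end of
  \<open>schur_trace\<close>.\<close>

lemma tr_comm_sum:
  assumes "fds V" "fds W" "lin V W T" "lin W V S"
  shows "tr V (\<lambda>v. S (T v)) = (\<Sum>b\<in>bas V. \<Sum>c\<in>bas W. crd W (T b) c * crd V (S c) b)"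
  unfolding tr_def
proof (rule sum.cong[OF refl])
  fix b assume b: "b \<in> bas V"
  have "S (T b) = (\<Sum>c\<in>bas W. cscale (crd W (T b) c) (S c))"
    by (rule lin_crd[OF assms(4,2)]) (use assms b bas_in lin_in in blast)
  then have "crd V (S (T b)) b = (\<Sum>c\<in>bas W. crd V (cscale (crd W (T b) c) (S c)) b)"
    using assms bas_in[OF assms(2)] by (simp add: crd_sum_fun fds_scale lin_in)
  then show "crd V (S (T b)) b = (\<Sum>c\<in>bas W. crd W (T b) c * crd V (S c) b)"
    using assms bas_in[OF assms(2)] by (simp add: crd_scale lin_in)
qed

lemma tr_comm:
  assumes "fds V" "fds W" "lin V W T" "lin W V S"
  shows "tr V (\<lambda>v. S (T v)) = tr W (\<lambda>w. T (S w))"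
  using tr_comm_sum[OF assms] tr_comm_sum[OF assms(2,1,4,3)]
    sum.swap[of "\<lambda>b c. crd W (T b) c * crd V (S c) b" "bas W" "bas V"]
  by (simp add: mult.commute)

lemma tr_scale: "fds V \<Longrightarrow> lin V V T \<Longrightarrow> tr V (\<lambda>v. cscale c (T v)) = c * tr V T"
  by (simp add: tr_def sum_distrib_left crd_scale lin_in bas_in)

lemma tr_add: "fds V \<Longrightarrow> lin V V S \<Longrightarrow> lin V V T \<Longrightarrow> tr V (\<lambda>v. S v + T v) = tr V S + tr V T"
  by (simp add: tr_def sum.distrib crd_add lin_in bas_in)

lemma tr_sum:
  "fds V \<Longrightarrow> (\<And>i. i \<in> I \<Longrightarrow> lin V V (T i)) \<Longrightarrow> tr V (\<lambda>v. \<Sum>i\<in>I. T i v) = (\<Sum>i\<in>I. tr V (T i))"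
  unfolding tr_def
proof -
  assume V: "fds V" and T: "\<And>i. i \<in> I \<Longrightarrow> lin V V (T i)"
  have "crd V (\<Sum>i\<in>I. T i b) b = (\<Sum>i\<in>I. crd V (T i b) b)" if "b \<in> bas V" for b
    by (rule crd_sum_fun[OF V]) (use T lin_in bas_in[OF V that] in blast)
  then have "(\<Sum>b\<in>bas V. crd V (\<Sum>i\<in>I. T i b) b) = (\<Sum>b\<in>bas V. \<Sum>i\<in>I. crd V (T i b) b)" by simp
  also have "\<dots> = (\<Sum>i\<in>I. \<Sum>b\<in>bas V. crd V (T i b) b)" by (rule sum.swap)
  finally show "(\<Sum>b\<in>bas V. crd V (\<Sum>i\<in>I. T i b) b) = (\<Sum>i\<in>I. \<Sum>b\<in>bas V. crd V (T i b) b)" .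
qed

lemma tr_id: "fds V \<Longrightarrow> tr V (\<lambda>v. v) = of_nat (card (bas V))"
  by (simp add: tr_def crd_basis)

lemma tr_rank_one: "fds V \<Longrightarrow> x \<in> V \<Longrightarrow> b \<in> bas V \<Longrightarrow> tr V (\<lambda>v. cscale (crd V v b) x) = crd V x b"
  by (simp add: tr_def crd_scale crd_basis if_distrib[of "\<lambda>x. x * _"] sum.delta bas cong: if_cong)

lemma tr_zero: "fds V \<Longrightarrow> tr V (\<lambda>v. 0) = 0"
  using tr_scale[of V "\<lambda>v. v" 0] lin_id[of V V] by simp

lemma card_bas_pos: assumes "fds V" "V \<noteq> {0}" shows "card (bas V) > 0"
  using bas[OF assms(1)] assms(2) by (auto simp: card_gt_0_iff)

text \<open>The maps resolve the identity of \<open>M\<close>, and moving \<open>\<iota> i\<close>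
  around the trace gives the formula. The pieces may overlap: an induced representation will be
  resolved over all group elements and not over coset representatives.\<close>

lemma tr_resolution:
  assumes V: "\<And>i. i \<in> I \<Longrightarrow> fds (V i)" and M: "fds M"
    and \<iota>: "\<And>i. i \<in> I \<Longrightarrow> lin (V i) M (\<iota> i)" and p: "\<And>i. i \<in> I \<Longrightarrow> lin M (V i) (p i)"
    and res: "\<And>m. m \<in> M \<Longrightarrow> (\<Sum>i\<in>I. \<iota> i (p i m)) = m" and T: "lin M M T"
  shows "tr M T = (\<Sum>i\<in>I. tr (V i) (\<lambda>v. p i (T (\<iota> i v))))"
proof -
  have "tr M T = tr M (\<lambda>m. \<Sum>i\<in>I. \<iota> i (p i (T m)))"
    using res T by (intro tr_cong[OF M]) (simp add: lin_in)
  also have "\<dots> = (\<Sum>i\<in>I. tr M (\<lambda>m. \<iota> i (p i (T m))))"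
    by (intro tr_sum[OF M] lin_comp[OF T] lin_comp[OF p \<iota>])
  also have "\<dots> = (\<Sum>i\<in>I. tr (V i) (\<lambda>v. p i (T (\<iota> i v))))"
    by (intro sum.cong refl tr_comm[OF M V lin_comp[OF T p] \<iota>])
  finally show ?thesis .
qed

text \<open>Only a spanning set is at stake, so \<open>p\<close> may be any choice of components,
  linear or not; \<open>fds_image\<close> takes an arbitrary section of \<open>T\<close>.\<close>

lemma fds_resolution:
  assumes I: "finite I" and V: "\<And>i. i \<in> I \<Longrightarrow> fds (V i)" and M: "cfun.subspace M"
    and \<iota>: "\<And>i. i \<in> I \<Longrightarrow> lin (V i) M (\<iota> i)" and p: "\<And>i m. i \<in> I \<Longrightarrow> m \<in> M \<Longrightarrow> p i m \<in> V i"
    and res: "\<And>m. m \<in> M \<Longrightarrow> (\<Sum>i\<in>I. \<iota> i (p i m)) = m"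
  shows "fds M"
proof -
  let ?E = "\<Union>i\<in>I. \<iota> i ` bas (V i)"
  have "m \<in> cfun.span ?E" if m: "m \<in> M" for m
  proof -
    have "\<iota> i (p i m) \<in> cfun.span ?E" if i: "i \<in> I" for i
    proof -
      have "\<iota> i (p i m) = (\<Sum>b\<in>bas (V i). cscale (crd (V i) (p i m) b) (\<iota> i b))"
        by (rule lin_crd[OF \<iota> V p]) (use i m in auto)
      also have "\<dots> \<in> cfun.span ?E"
        using i by (intro cfun.span_sum cfun.span_scale cfun.span_base) auto
      finally show ?thesis .
    qed
    then show ?thesis using res[OF m] by (metis (no_types, lifting) cfun.span_sum)
  qed
  moreover have "cfun.span ?E \<subseteq> M"
    by (rule cfun.span_minimal) (use M \<iota> V bas_in lin_in in blast)+
  moreover have "finite ?E" using I V bas(1) by blast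
  ultimately show ?thesis unfolding fds_def by (intro exI[of _ ?E]) blast
qed

lemma fds_image:
  assumes "fds V" "lin V W T" shows "fds (T ` V)"
proof -
  have "cfun.subspace (T ` V)"
  proof (rule cfun.subspaceI)
    show "0 \<in> T ` V" using lin_0[OF assms(2)] fds_0[OF assms(1)] by force
    show "x + y \<in> T ` V" if "x \<in> T ` V" "y \<in> T ` V" for x y
      using that lin_add[OF assms(2)] fds_add[OF assms(1)] by (metis (no_types, lifting) image_iff)
    show "cscale c x \<in> T ` V" if "x \<in> T ` V" for c x
      using that lin_scale[OF assms(2)] fds_scale[OF assms(1)] by (metis (no_types, lifting) image_iff)
  qed
  then show ?thesis
    using fds_resolution[where I = "{()}" and V = "\<lambda>_. V" and M = "T ` V" and \<iota> = "\<lambda>_. T" and p = "\<lambda>_. inv_into V T"]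
      assms by (auto simp: lin_def inv_into_into f_inv_into_f)
qed

section \<open>Eigenvectors over the complex numbers\<close>

definition poly_op :: "complex poly \<Rightarrow> (('x \<Rightarrow> complex) \<Rightarrow> 'x \<Rightarrow> complex) \<Rightarrow> ('x \<Rightarrow> complex) \<Rightarrow> 'x \<Rightarrow> complex"
  where "poly_op p T v = (\<Sum>i\<le>degree p. cscale (coeff p i) ((T ^^ i) v))"

lemma poly_op_bound:
  assumes "degree p \<le> n" shows "poly_op p T v = (\<Sum>i\<le>n. cscale (coeff p i) ((T ^^ i) v))"
  unfolding poly_op_def using assms
  by (intro sum.mono_neutral_left) (auto simp: coeff_eq_0)

lemma lin_funpow: "lin V V T \<Longrightarrow> lin V V (T ^^ i)"
proof (induction i)
  case (Suc i)
  then show ?case using lin_comp[of V V "T ^^ i" V T] by (simp add: comp_def)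
qed (simp add: lin_id id_def)

text \<open>The factor X - c is absorbed by changing the vector instead of the operator, so no
  algebra of operators has to be set up.\<close>

lemma poly_op_linear_factor:
  assumes T: "lin V V T" and V: "fds V" and v: "v \<in> V"
  shows "poly_op ([:- c, 1:] * q) T v = poly_op q T (T v - cscale c v)"
proof -
  let ?n = "degree q"
  have d: "degree ([:- c, 1:] * q) \<le> Suc ?n"
    using degree_mult_le[of "[:- c, 1:]" q] by simp
  have co: "coeff ([:- c, 1:] * q) i = (case i of 0 \<Rightarrow> 0 | Suc j \<Rightarrow> coeff q j) - c * coeff q i" for i
    by (simp add: coeff_pCons split: nat.split)
  have P: "(T ^^ i) v \<in> V" for i using lin_in[OF lin_funpow[OF T] v] .
  have "poly_op ([:- c, 1:] * q) T v
      = (\<Sum>i\<le>Suc ?n. cscale (case i of 0 \<Rightarrow> 0 | Suc j \<Rightarrow> coeff q j) ((T ^^ i) v))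
        - (\<Sum>i\<le>Suc ?n. cscale (c * coeff q i) ((T ^^ i) v))"
    unfolding poly_op_bound[OF d] co cfun.scale_left_diff_distrib by (rule sum_subtractf)
  also have "(\<Sum>i\<le>Suc ?n. cscale (case i of 0 \<Rightarrow> 0 | Suc j \<Rightarrow> coeff q j) ((T ^^ i) v))
      = (\<Sum>i\<le>?n. cscale (coeff q i) ((T ^^ Suc i) v))"
    by (subst sum.atMost_Suc_shift) (simp del: funpow.simps)
  also have "(\<Sum>i\<le>Suc ?n. cscale (c * coeff q i) ((T ^^ i) v)) = (\<Sum>i\<le>?n. cscale (coeff q i) (cscale c ((T ^^ i) v)))"
    by (simp add: coeff_eq_0 mult.commute)
  also have "(\<Sum>i\<le>?n. cscale (coeff q i) ((T ^^ Suc i) v)) - \<dots>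
      = (\<Sum>i\<le>?n. cscale (coeff q i) ((T ^^ i) (T v - cscale c v)))"
    unfolding sum_subtractf[symmetric]
  proof (rule sum.cong[OF refl])
    fix i
    have "(T ^^ i) (T v - cscale c v) = (T ^^ i) (T v) - (T ^^ i) (cscale c v)"
      by (rule lin_diff[OF lin_funpow[OF T]]) (use V v T in \<open>auto simp: fds_subspace lin_in fds_scale\<close>)
    also have "(T ^^ i) (cscale c v) = cscale c ((T ^^ i) v)" by (rule lin_scale[OF lin_funpow[OF T] v])
    finally show "cscale (coeff q i) ((T ^^ Suc i) v) - cscale (coeff q i) (cscale c ((T ^^ i) v))
        = cscale (coeff q i) ((T ^^ i) (T v - cscale c v))"
      by (simp only: cfun.scale_right_diff_distrib funpow_Suc_right comp_apply)
  qed
  finally show ?thesis by (simp only: poly_op_def)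
qed

text \<open>A root c of the annihilating polynomial gives a dichotomy: either T v - c v vanishes and
  \<open>v\<close> is an eigenvector, or it is a nonzero vector annihilated by a polynomial of
  smaller degree.\<close>

lemma poly_op_eigenvector:
  assumes T: "lin V V T" and V: "fds V" 
  shows "p \<noteq> 0 \<Longrightarrow> v \<in> V \<Longrightarrow> v \<noteq> 0 \<Longrightarrow> poly_op p T v = 0 \<Longrightarrow> \<exists>c u. u \<in> V \<and> u \<noteq> 0 \<and> T u = cscale c u"
proof (induction "degree p" arbitrary: p v)
  case 0
  then obtain a where "p = [:a:]" "a \<noteq> 0" by (metis degree_eq_zeroE pCons_0_0)
  then have "cscale a v = 0" using "0.prems"(4) by (simp add: poly_op_def zero_fun_def)
  then show ?case using \<open>a \<noteq> 0\<close> "0.prems"(3) cfun.scale_eq_0_iff by blast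
next
  case (Suc n)
  then have "\<not> constant (poly p)" by (simp add: constant_degree)
  then obtain c where "poly p c = 0" using fundamental_theorem_of_algebra by blast
  then obtain q where q: "p = [:- c, 1:] * q" using poly_eq_0_iff_dvd by blast
  then have "q \<noteq> 0" using Suc.prems(1) by auto
  then have "degree p = 1 + degree q"
    unfolding q by (subst degree_mult_eq) auto
  then have n: "n = degree q" using Suc(2) by simp
  let ?w = "T v - cscale c v"
  show ?case
  proof (cases "?w = 0")
    case True
    then have "T v = cscale c v" by simp
    with Suc.prems show ?thesis by blast
  next
    case False
    have "?w \<in> V" using Suc.prems(2) T V by (simp add: fds_diff lin_in fds_scale)
    moreover have "poly_op q T ?w = 0"
      using poly_op_linear_factor[OF T V Suc.prems(2), of c q] Suc.prems(4) unfolding q by simp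
    ultimately show ?thesis using Suc(1)[OF n \<open>q \<noteq> 0\<close>] False by blast
  qed
qed

lemma eigenvector_exists:
  assumes T: "lin V V T" and V: "fds V" and "V \<noteq> {0}"
  shows "\<exists>c u. u \<in> V \<and> u \<noteq> 0 \<and> T u = cscale c u"
proof -
  obtain v where v: "v \<in> V" "v \<noteq> 0" using assms(3) fds_0[OF V] by blast
  obtain E where E: "finite E" "V = cfun.span E" using V by (auto simp: fds_def)
  let ?x = "\<lambda>i. (T ^^ i) v"
  let ?n = "card E"
  have xV: "?x i \<in> V" for i using lin_in[OF lin_funpow[OF T] v(1)] .
  have "\<exists>c. (\<exists>i\<le>?n. c i \<noteq> 0) \<and> (\<Sum>i\<le>?n. cscale (c i) (?x i)) = 0"
  proof (cases "inj_on ?x {..?n}")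
    case True
    \<comment> \<open>There are \<open>?n\<close> + 1 distinct vectors in the span of
      \<open>?n\<close> many.\<close>
    have "\<not> cfun.independent (?x ` {..?n})"
    proof
      assume "cfun.independent (?x ` {..?n})"
      then have "card (?x ` {..?n}) \<le> ?n"
        using cfun.independent_span_bound[OF E(1)] xV E(2) by blast
      then show False using True by (simp add: card_image)
    qed
    then obtain d where d: "(\<Sum>y\<in>?x ` {..?n}. cscale (d y) y) = 0" "\<exists>y\<in>?x ` {..?n}. d y \<noteq> 0"
      by (auto simp: cfun.dependent_finite)
    then show ?thesis
      by (intro exI[of _ "\<lambda>i. d (?x i)"]) (auto simp: sum.reindex[OF True])
  next
    \<comment> \<open>Dependence of the image set says nothing about repetitions; two equal powers
      of \<open>T\<close> on \<open>v\<close> give a relation by themselves.\<close>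
    case False
    then obtain i j where ij: "i \<le> ?n" "j \<le> ?n" "i \<noteq> j" "?x i = ?x j" by (auto simp: inj_on_def)
    let ?c = "\<lambda>k. if k = i then 1 else if k = j then - 1 else (0::complex)"
    have "(\<Sum>k\<le>?n. cscale (?c k) (?x k)) = (\<Sum>k\<in>{i, j}. cscale (?c k) (?x k))"
      by (rule sum.mono_neutral_right) (use ij in auto)
    also have "\<dots> = 0" using ij by (simp add: cscale_m1)
    finally show ?thesis using ij by (intro exI[of _ ?c]) auto
  qed
  then obtain c where c: "\<exists>i\<le>?n. c i \<noteq> 0" "(\<Sum>i\<le>?n. cscale (c i) (?x i)) = 0" by blast
  let ?p = "\<Sum>i\<le>?n. monom (c i) i"
  have co: "coeff ?p i = (if i \<le> ?n then c i else 0)" for i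
    by (simp add: coeff_sum if_distrib cong: if_cong)
  then have "degree ?p \<le> ?n" by (intro degree_le) simp
  then have "poly_op ?p T v = 0" using c(2) by (subst poly_op_bound) (auto simp: co)
  moreover have "?p \<noteq> 0" using c(1) co by (metis coeff_0)
  ultimately show ?thesis using poly_op_eigenvector[OF T V] v by blast
qed

section \<open>Characters of finite groups\<close>

abbreviation sub :: "('g, 'x) rep \<Rightarrow> ('x \<Rightarrow> complex) set \<Rightarrow> ('g, 'x) rep" where
  "sub R U \<equiv> R\<lparr>space := U\<rparr>"

definition ghom :: "('g, 'm) monoid_scheme \<Rightarrow> ('g, 'x) rep \<Rightarrow> ('g, 'y) rep \<Rightarrow> (('x \<Rightarrow> complex) \<Rightarrow> 'y \<Rightarrow> complex) \<Rightarrow> bool"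
  where "ghom G R S T \<longleftrightarrow> lin (space R) (space S) T \<and>
    (\<forall>g\<in>carrier G. \<forall>v\<in>space R. T (act R g v) = act S g (T v))"

definition chr :: "('g, 'x) rep \<Rightarrow> 'g \<Rightarrow> complex" where
  "chr R g = tr (space R) (act R g)"

lemma rep_group: "representation G R \<Longrightarrow> group G"
  and rep_fds: "representation G R \<Longrightarrow> fds (space R)"
  and rep_lin: "representation G R \<Longrightarrow> g \<in> carrier G \<Longrightarrow> lin (space R) (space R) (act R g)"
  and rep_one: "representation G R \<Longrightarrow> v \<in> space R \<Longrightarrow> act R \<one>\<^bsub>G\<^esub> v = v"
  and rep_mult: "representation G R \<Longrightarrow> g \<in> carrier G \<Longrightarrow> h \<in> carrier G \<Longrightarrow> v \<in> space R \<Longrightarrow>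
    act R (g \<otimes>\<^bsub>G\<^esub> h) v = act R g (act R h v)"
  by (auto simp: representation_def fds_def lin_def)

lemma representationI:
  assumes "group G" "fds (space R)" "\<And>g. g \<in> carrier G \<Longrightarrow> lin (space R) (space R) (act R g)"
    "\<And>v. v \<in> space R \<Longrightarrow> act R \<one>\<^bsub>G\<^esub> v = v"
    "\<And>g h v. g \<in> carrier G \<Longrightarrow> h \<in> carrier G \<Longrightarrow> v \<in> space R \<Longrightarrow> act R (g \<otimes>\<^bsub>G\<^esub> h) v = act R g (act R h v)"
  shows "representation G R"
  unfolding representation_def
proof (intro conjI ballI)
  show "\<exists>B. finite B \<and> space R = cfun.span B" using assms(2) by (simp add: fds_def)
  fix g assume "g \<in> carrier G"
  from assms(3)[OF this] show "act R g \<in> space R \<rightarrow> space R" "clinear_on (space R) (act R g)"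
    by (simp_all add: lin_def)
qed (rule assms; assumption)+

lemma rep_in: "representation G R \<Longrightarrow> g \<in> carrier G \<Longrightarrow> v \<in> space R \<Longrightarrow> act R g v \<in> space R"
  by (rule lin_in[OF rep_lin])

lemma rep_inv:
  assumes R: "representation G R" and g: "g \<in> carrier G" and v: "v \<in> space R"
  shows "act R (inv\<^bsub>G\<^esub> g) (act R g v) = v" "act R g (act R (inv\<^bsub>G\<^esub> g) v) = v"
proof -
  interpret group G using R by (rule rep_group)
  show "act R (inv\<^bsub>G\<^esub> g) (act R g v) = v"
    using rep_mult[OF R _ g v, of "inv\<^bsub>G\<^esub> g"] rep_one[OF R v] g by simp
  show "act R g (act R (inv\<^bsub>G\<^esub> g) v) = v"
    using rep_mult[OF R g _ v, of "inv\<^bsub>G\<^esub> g"] rep_one[OF R v] g by simp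
qed

lemma (in group)
  assumes "h \<in> carrier G"
  shows sum_group_right: "(\<Sum>g\<in>carrier G. f (g \<otimes> h)) = sum f (carrier G)"
    and sum_group_left: "(\<Sum>g\<in>carrier G. f (h \<otimes> g)) = sum f (carrier G)"
proof -
  show "(\<Sum>g\<in>carrier G. f (g \<otimes> h)) = sum f (carrier G)"
    by (rule sum.reindex_bij_witness[where i = "\<lambda>g. g \<otimes> inv h" and j = "\<lambda>g. g \<otimes> h"])
       (use assms in \<open>auto simp: m_assoc\<close>)
  show "(\<Sum>g\<in>carrier G. f (h \<otimes> g)) = sum f (carrier G)"
    by (rule sum.reindex_bij_witness[where i = "\<lambda>g. inv h \<otimes> g" and j = "\<lambda>g. h \<otimes> g"])
       (use assms in \<open>auto simp: m_assoc[symmetric]\<close>)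
qed

lemma (in group) sum_group_inv: "(\<Sum>g\<in>carrier G. f (inv g)) = sum f (carrier G)"
  by (rule sum.reindex_bij_witness[where i = "\<lambda>g. inv g" and j = "\<lambda>g. inv g"]) auto

lemma order_pos: "group G \<Longrightarrow> finite (carrier G) \<Longrightarrow> 0 < card (carrier G)"
  using monoid.one_closed[OF group.is_monoid] by (auto simp: card_gt_0_iff)

lemma invariant_fds: "representation G R \<Longrightarrow> invariant_subspace G R U \<Longrightarrow> fds U"
  unfolding invariant_subspace_def using fds_mono rep_fds by blast

lemma invariant_rep:
  assumes R: "representation G R" and U: "invariant_subspace G R U"
  shows "representation G (sub R U)"
proof (rule representationI)
  have UR: "U \<subseteq> space R" using U by (simp add: invariant_subspace_def)
  show "group G" using R by (rule rep_group)
  show "fds (space (sub R U))" using invariant_fds[OF R U] by simp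
  show "lin (space (sub R U)) (space (sub R U)) (act (sub R U) g)" if "g \<in> carrier G" for g
  proof (rule linI)
    note L = rep_lin[OF R that]
    show "act (sub R U) g v \<in> space (sub R U)" if "v \<in> space (sub R U)" for v
      using that \<open>g \<in> carrier G\<close> U by (simp add: invariant_subspace_def)
  qed (use UR lin_add[OF rep_lin[OF R that]] lin_scale[OF rep_lin[OF R that]] in \<open>auto simp: subset_iff\<close>)
qed (use U R in \<open>auto simp: invariant_subspace_def rep_one rep_mult intro: subsetD\<close>)

lemma invariant_sub:
  "invariant_subspace G R U \<Longrightarrow> invariant_subspace G (sub R U) U' \<Longrightarrow> invariant_subspace G R U'"
  by (auto simp: invariant_subspace_def)

lemma invariant_space: "representation G R \<Longrightarrow> invariant_subspace G R (space R)"
  by (auto simp: invariant_subspace_def rep_in intro: fds_subspace rep_fds)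

lemma ghom_lin: "ghom G R S T \<Longrightarrow> lin (space R) (space S) T"
  by (simp add: ghom_def)

lemma ghom_act: "ghom G R S T \<Longrightarrow> g \<in> carrier G \<Longrightarrow> v \<in> space R \<Longrightarrow> T (act R g v) = act S g (T v)"
  by (simp add: ghom_def)

lemma ghom_kernel:
  assumes R: "representation G R" and S: "representation G S" and T: "ghom G R S T"
  shows "invariant_subspace G R {v \<in> space R. T v = 0}"
  unfolding invariant_subspace_def
proof (intro conjI ballI)
  note V = rep_fds[OF R] and L = ghom_lin[OF T]
  show "cfun.subspace {v \<in> space R. T v = 0}"
  proof (rule cfun.subspaceI)
    show "0 \<in> {v \<in> space R. T v = 0}" using lin_0[OF L] fds_0[OF V] by simp
    fix u v c assume *: "u \<in> {v \<in> space R. T v = 0}"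
    then show "cscale c u \<in> {v \<in> space R. T v = 0}"
      using lin_scale[OF L, of u c] fds_scale[OF V] by simp
    assume "v \<in> {v \<in> space R. T v = 0}"
    with * have "T (u + v) = 0 + 0" using lin_add[OF L, of u v] by simp
    then show "u + v \<in> {v \<in> space R. T v = 0}"
      using fds_add[OF V, of u v] * \<open>v \<in> _\<close> by simp
  qed
  fix g u assume g: "g \<in> carrier G" and u: "u \<in> {v \<in> space R. T v = 0}"
  then have "T (act R g u) = act S g 0" using ghom_act[OF T] by simp
  also have "\<dots> = 0" using lin_0[OF rep_lin[OF S g]] fds_0[OF rep_fds[OF S]] .
  finally show "act R g u \<in> {v \<in> space R. T v = 0}" using rep_in[OF R g] u by simp
qed auto

lemma ghom_image:
  assumes R: "representation G R" and S: "representation G S" and T: "ghom G R S T"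
  shows "invariant_subspace G S (T ` space R)"
  unfolding invariant_subspace_def
proof (intro conjI ballI)
  note L = ghom_lin[OF T]
  show "cfun.subspace (T ` space R)" using fds_image[OF rep_fds[OF R] L] by (rule fds_subspace)
  show "T ` space R \<subseteq> space S" using lin_in[OF L] by blast
  show "act S g u \<in> T ` space R" if "g \<in> carrier G" "u \<in> T ` space R" for g u
    using that ghom_act[OF T, symmetric] rep_in[OF R] by fastforce
qed

lemma rep_isoI:
  assumes "ghom G R S T" "bij_betw T (space R) (space S)" shows "rep_iso G R S"
  using assms by (auto simp: rep_iso_def ghom_def lin_def)

lemma rep_isoE:
  assumes "rep_iso G R S"
  obtains T where "ghom G R S T" "bij_betw T (space R) (space S)"
  using assms by (auto simp: rep_iso_def ghom_def lin_def bij_betw_def)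

lemma rep_iso_refl: "rep_iso G R R"
  by (auto simp: rep_iso_def clinear_on_def intro!: exI[of _ "\<lambda>v. v"] bij_betwI)

lemma rep_iso_inverse:
  assumes R: "representation G R" and T: "ghom G R S T" "bij_betw T (space R) (space S)"
  shows "ghom G S R (the_inv_into (space R) T)" "bij_betw (the_inv_into (space R) T) (space S) (space R)"
proof -
  let ?S = "the_inv_into (space R) T"
  have inj: "inj_on T (space R)" and im: "T ` space R = space S" using T(2) by (auto simp: bij_betw_def)
  have S: "?S w \<in> space R" "T (?S w) = w" if "w \<in> space S" for w
    using that im inj by (auto simp: the_inv_into_into f_the_inv_into_f)
  have "?S (act S g w) = act R g (?S w)" if "g \<in> carrier G" "w \<in> space S" for g w
    using the_inv_into_f_f[OF inj, of "act R g (?S w)"] ghom_act[OF T(1) that(1), of "?S w"] S[OF that(2)]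
      rep_in[OF R that(1)] by simp
  then show "ghom G S R ?S"
    using lin_inverse[OF ghom_lin[OF T(1)] T(2) fds_subspace[OF rep_fds[OF R]]] by (simp add: ghom_def)
  show "bij_betw ?S (space S) (space R)" using T(2) by (rule bij_betw_the_inv_into)
qed

lemma rep_iso_sym: "representation G R \<Longrightarrow> rep_iso G R S \<Longrightarrow> rep_iso G S R"
  by (erule rep_isoE) (rule rep_isoI[OF rep_iso_inverse])

lemma ghom_comp: "ghom G R S T \<Longrightarrow> ghom G S Q T' \<Longrightarrow> ghom G R Q (\<lambda>v. T' (T v))"
  using lin_comp[of "space R" "space S" T "space Q" T'] by (auto simp: ghom_def lin_in)

lemma rep_iso_trans: "rep_iso G R S \<Longrightarrow> rep_iso G S Q \<Longrightarrow> rep_iso G R Q"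
  by (elim rep_isoE, rule rep_isoI[OF ghom_comp]) (auto dest: bij_betw_trans simp: comp_def)

lemma chr_rep_iso:
  assumes R: "representation G R" and S: "representation G S" and "rep_iso G R S" and g: "g \<in> carrier G"
  shows "chr R g = chr S g"
proof -
  obtain T where T: "ghom G R S T" "bij_betw T (space R) (space S)" using assms(3) by (rule rep_isoE)
  let ?T = "the_inv_into (space R) T"
  have inj: "inj_on T (space R)" and im: "T ` space R = space S" using T(2) by (auto simp: bij_betw_def)
  have L: "lin (space S) (space R) ?T" using rep_iso_inverse(1)[OF R T] by (rule ghom_lin)
  have "chr R g = tr (space R) (\<lambda>v. ?T (act S g (T v)))"
    unfolding chr_def
    by (intro tr_cong rep_fds[OF R]) (use g inj in \<open>simp add: ghom_act[OF T(1), symmetric] the_inv_into_f_f rep_in[OF R]\<close>)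
  also have "\<dots> = tr (space S) (\<lambda>w. act S g (T (?T w)))"
    by (rule tr_comm[OF rep_fds[OF R] rep_fds[OF S] lin_comp[OF ghom_lin[OF T(1)] rep_lin[OF S g]] L])
  also have "\<dots> = chr S g"
    unfolding chr_def by (intro tr_cong rep_fds[OF S]) (use inj im in \<open>simp add: f_the_inv_into_f\<close>)
  finally show ?thesis .
qed

lemma chr_one: "representation G R \<Longrightarrow> chr R \<one>\<^bsub>G\<^esub> = of_nat (card (bas (space R)))"
  unfolding chr_def using tr_cong[OF rep_fds, of G R "act R \<one>\<^bsub>G\<^esub>" "\<lambda>v. v"] by (simp add: rep_one tr_id rep_fds)

lemma chr_conj:
  assumes R: "representation G R" and g: "g \<in> carrier G" and h: "h \<in> carrier G"
  shows "chr R (h \<otimes>\<^bsub>G\<^esub> g \<otimes>\<^bsub>G\<^esub> inv\<^bsub>G\<^esub> h) = chr R g"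
proof -
  interpret group G using R by (rule rep_group)
  note V = rep_fds[OF R]
  have "chr R (h \<otimes>\<^bsub>G\<^esub> g \<otimes>\<^bsub>G\<^esub> inv\<^bsub>G\<^esub> h) = tr (space R) (\<lambda>v. act R (h \<otimes>\<^bsub>G\<^esub> g) (act R (inv\<^bsub>G\<^esub> h) v))"
    unfolding chr_def by (intro tr_cong V) (use g h in \<open>simp add: rep_mult[OF R] rep_in[OF R]\<close>)
  also have "\<dots> = tr (space R) (\<lambda>v. act R (inv\<^bsub>G\<^esub> h) (act R (h \<otimes>\<^bsub>G\<^esub> g) v))"
    by (rule tr_comm[OF V V]) (use g h rep_lin[OF R] in auto)
  also have "\<dots> = chr R g"
    unfolding chr_def by (intro tr_cong V) (use g h in \<open>simp add: rep_mult[OF R] rep_in[OF R] rep_inv[OF R]\<close>)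
  finally show ?thesis .
qed

section \<open>Averaging, Maschke's theorem and Schur's lemma\<close>

definition avg :: "('g, 'm) monoid_scheme \<Rightarrow> ('g, 'x) rep \<Rightarrow> ('g, 'y) rep \<Rightarrow> (('x \<Rightarrow> complex) \<Rightarrow> 'y \<Rightarrow> complex) \<Rightarrow>
    ('x \<Rightarrow> complex) \<Rightarrow> 'y \<Rightarrow> complex" where
  "avg G R S X v = (\<Sum>g\<in>carrier G. act S (inv\<^bsub>G\<^esub> g) (X (act R g v)))"

text \<open>Replacing g by g h in the sum moves h from the inside to the outside. The sum is left
  undivided; the order of \<open>G\<close> is divided out only where a projection is wanted.\<close>

lemma ghom_avg:
  assumes R: "representation G R" and S: "representation G S" and X: "lin (space R) (space S) X"
  shows "ghom G R S (avg G R S X)"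
  unfolding ghom_def
proof (intro conjI ballI)
  interpret group G using R by (rule rep_group)
  show "lin (space R) (space S) (avg G R S X)"
    unfolding avg_def[abs_def]
    by (intro lin_Sum rep_fds[OF S] lin_comp[OF lin_comp[OF rep_lin[OF R] X] rep_lin[OF S]]) auto
  fix h v assume h: "h \<in> carrier G" and v: "v \<in> space R"
  have XV: "X (act R g v) \<in> space S" if "g \<in> carrier G" for g
    using X R v that by (simp add: lin_in rep_in)
  have "avg G R S X (act R h v) = (\<Sum>g\<in>carrier G. act S h (act S (inv\<^bsub>G\<^esub> (g \<otimes>\<^bsub>G\<^esub> h)) (X (act R (g \<otimes>\<^bsub>G\<^esub> h) v))))"
    unfolding avg_def
  proof (rule sum.cong[OF refl])
    fix g assume g: "g \<in> carrier G"
    have "act S h (act S (inv\<^bsub>G\<^esub> (g \<otimes>\<^bsub>G\<^esub> h)) (X (act R (g \<otimes>\<^bsub>G\<^esub> h) v)))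
        = act S (h \<otimes>\<^bsub>G\<^esub> inv\<^bsub>G\<^esub> (g \<otimes>\<^bsub>G\<^esub> h)) (X (act R (g \<otimes>\<^bsub>G\<^esub> h) v))"
      using g h XV by (simp add: rep_mult[OF S])
    also have "h \<otimes>\<^bsub>G\<^esub> inv\<^bsub>G\<^esub> (g \<otimes>\<^bsub>G\<^esub> h) = inv\<^bsub>G\<^esub> g" using g h by (simp add: inv_mult_group m_assoc[symmetric])
    finally show "act S (inv\<^bsub>G\<^esub> g) (X (act R g (act R h v)))
        = act S h (act S (inv\<^bsub>G\<^esub> (g \<otimes>\<^bsub>G\<^esub> h)) (X (act R (g \<otimes>\<^bsub>G\<^esub> h) v)))"
      using rep_mult[OF R g h v] by simp
  qed
  also have "\<dots> = (\<Sum>g\<in>carrier G. act S h (act S (inv\<^bsub>G\<^esub> g) (X (act R g v))))"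
    by (rule group.sum_group_right[OF is_group h, where f = "\<lambda>g. act S h (act S (inv\<^bsub>G\<^esub> g) (X (act R g v)))"])
  also have "\<dots> = act S h (avg G R S X v)"
    unfolding avg_def by (rule lin_sum'[symmetric, OF rep_lin[OF S h] fds_subspace[OF rep_fds[OF S]]])
      (use XV rep_in[OF S] in auto)
  finally show "avg G R S X (act R h v) = act S h (avg G R S X v)" .
qed

text \<open>The average of a linear projection onto \<open>U\<close> is equivariant, still takes
  values in \<open>U\<close> and still fixes \<open>U\<close> pointwise.\<close>

lemma maschke:
  assumes R: "representation G R" and fin: "finite (carrier G)" and U: "invariant_subspace G R U"
  obtains \<pi> where "ghom G R R \<pi>" "\<And>v. v \<in> space R \<Longrightarrow> \<pi> v \<in> U" "\<And>u. u \<in> U \<Longrightarrow> \<pi> u = u"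
proof -
  interpret group G using R by (rule rep_group)
  note V = rep_fds[OF R] and FU = invariant_fds[OF R U]
  have UV: "U \<subseteq> space R" and Uact: "\<And>g u. g \<in> carrier G \<Longrightarrow> u \<in> U \<Longrightarrow> act R g u \<in> U"
    using U by (auto simp: invariant_subspace_def)
  \<comment> \<open>A basis of \<open>U\<close> is extended to one of the whole space;
    \<open>P\<close> keeps the coordinates along \<open>bas U\<close> and drops the others.\<close>
  obtain E where E: "bas U \<subseteq> E" "E \<subseteq> space R" "cfun.independent E" "space R \<subseteq> cfun.span E"
    using cfun.maximal_independent_subset_extend[of "bas U" "space R"] bas[OF FU] bas_in[OF FU] UV by blast
  define P where "P v = (\<Sum>b\<in>bas U. cscale (cfun.representation E v b) b)" for v
  have PU: "P v \<in> U" for v unfolding P_def by (intro fds_sum[OF FU] fds_scale[OF FU] bas_in[OF FU])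
  have linP: "lin (space R) (space R) P"
  proof (rule linI)
    show "P v \<in> space R" for v using PU UV by blast
    show "P (u + v) = P u + P v" if "u \<in> space R" "v \<in> space R" for u v
      unfolding P_def sum.distrib[symmetric]
      using that E(4) by (intro sum.cong refl)
        (simp add: cfun.representation_add[OF E(3)] subsetD cfun.scale_left_distrib)
    show "P (cscale c v) = cscale c (P v)" if "v \<in> space R" for c v
      unfolding P_def cfun.scale_sum_right
      using that E(4) by (intro sum.cong refl) (simp add: cfun.representation_scale[OF E(3)] subsetD)
  qed
  have Pid: "P u = u" if u: "u \<in> U" for u
  proof -
    have "cfun.representation E u = cfun.representation (bas U) u"
      using cfun.representation_extend[OF E(3) _ E(1)] u bas(3)[OF FU] by simp
    then show ?thesis using crd_sum[OF FU u] by (simp add: P_def crd_def)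
  qed
  define \<pi> where "\<pi> v = cscale (1 / of_nat (card (carrier G))) (avg G R R P v)" for v
  have hom: "ghom G R R (avg G R R P)" by (rule ghom_avg[OF R R linP])
  have sum_U: "avg G R R P v \<in> U" if "v \<in> space R" for v
    unfolding avg_def by (rule fds_sum[OF FU]) (use PU Uact in auto)
  show ?thesis
  proof
    show "ghom G R R \<pi>"
      unfolding ghom_def
    proof (intro conjI ballI)
      show "lin (space R) (space R) \<pi>"
        unfolding \<pi>_def[abs_def] by (rule lin_mult[OF V ghom_lin[OF hom]])
      show "\<pi> (act R g v) = act R g (\<pi> v)" if "g \<in> carrier G" "v \<in> space R" for g v
        unfolding \<pi>_def using ghom_act[OF hom that] lin_scale[OF rep_lin[OF R that(1)]]
          lin_in[OF ghom_lin[OF hom] that(2)] by simp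
    qed
    show "\<pi> v \<in> U" if "v \<in> space R" for v unfolding \<pi>_def by (rule fds_scale[OF FU sum_U[OF that]])
    show "\<pi> u = u" if u: "u \<in> U" for u
    proof -
      have "avg G R R P u = (\<Sum>g\<in>carrier G. u)"
        unfolding avg_def using u Uact UV by (intro sum.cong refl) (simp add: Pid rep_inv[OF R] subsetD)
      also have "\<dots> = cscale (of_nat (card (carrier G))) u"
        by (simp add: cscale_def fun_eq_iff)
      finally show ?thesis using order_pos[OF is_group fin] by (simp add: \<pi>_def)
    qed
  qed
qed

lemma schur_iso:
  assumes R: "irreducible_rep G R" and S: "irreducible_rep G S" and T: "ghom G R S T"
    and nz: "\<exists>v\<in>space R. T v \<noteq> 0"
  shows "bij_betw T (space R) (space S)"
proof -
  have RR: "representation G R" and RS: "representation G S"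
    using R S by (auto simp: irreducible_rep_def)
  note L = ghom_lin[OF T] and V = rep_fds[OF RR]
  have "{v \<in> space R. T v = 0} \<noteq> space R" using nz by blast
  then have K: "{v \<in> space R. T v = 0} = {0}"
    using R ghom_kernel[OF RR RS T] by (auto simp: irreducible_rep_def)
  have "inj_on T (space R)"
  proof (rule inj_onI)
    fix u v assume uv: "u \<in> space R" "v \<in> space R" "T u = T v"
    then have "u - v \<in> {v \<in> space R. T v = 0}"
      using lin_diff[OF L fds_subspace[OF V]] fds_diff[OF V] by simp
    then show "u = v" unfolding K by simp
  qed
  moreover have "T ` space R \<noteq> {0}" using nz by blast
  then have "T ` space R = space S"
    using S ghom_image[OF RR RS T] by (auto simp: irreducible_rep_def)
  ultimately show ?thesis by (simp add: bij_betw_def)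
qed

text \<open>An eigenvalue c exists because the field is algebraically closed. Then T - c is
  equivariant with a nonzero kernel, and by \<open>schur_iso\<close> it vanishes.\<close>

lemma schur_scalar:
  assumes R: "irreducible_rep G R" and T: "ghom G R R T"
  obtains c where "\<And>v. v \<in> space R \<Longrightarrow> T v = cscale c v"
proof -
  have RR: "representation G R" using R by (auto simp: irreducible_rep_def)
  note L = ghom_lin[OF T] and V = rep_fds[OF RR]
  obtain c u where u: "u \<in> space R" "u \<noteq> 0" "T u = cscale c u"
    using eigenvector_exists[OF L V] R by (auto simp: irreducible_rep_def)
  have T': "ghom G R R (\<lambda>v. T v + cscale (- c) v)"
    unfolding ghom_def
  proof (intro conjI ballI)
    show "lin (space R) (space R) (\<lambda>v. T v + cscale (- c) v)"
      by (intro lin_plus V L lin_mult lin_id) simp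
    fix g v assume g: "g \<in> carrier G" and v: "v \<in> space R"
    note A = rep_lin[OF RR g]
    have "act R g (T v + cscale (- c) v) = act R g (T v) + cscale (- c) (act R g v)"
      by (simp only: lin_add[OF A lin_in[OF L v] fds_scale[OF V v]] lin_scale[OF A v])
    then show "T (act R g v) + cscale (- c) (act R g v) = act R g (T v + cscale (- c) v)"
      by (simp only: ghom_act[OF T g v])
  qed
  have "\<not> (\<exists>v\<in>space R. T v + cscale (- c) v \<noteq> 0)"
  proof
    assume "\<exists>v\<in>space R. T v + cscale (- c) v \<noteq> 0"
    from schur_iso[OF R R T' this] have "inj_on (\<lambda>v. T v + cscale (- c) v) (space R)"
      by (simp add: bij_betw_def)
    moreover have "T u + cscale (- c) u = T 0 + cscale (- c) 0"
      using u(3) lin_0[OF L fds_0[OF V]] by (simp add: cfun.scale_left_distrib[symmetric])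
    ultimately have "u = 0" using u(1) fds_0[OF V] by (rule inj_onD)
    then show False using u(2) by blast
  qed
  then have *: "T v + cscale (- c) v = 0" if "v \<in> space R" for v using that by blast
  have "T v = cscale c v" if "v \<in> space R" for v
  proof -
    have "T v = - cscale (- c) v" using *[OF that] by (simp only: eq_neg_iff_add_eq_0)
    also have "\<dots> = cscale c v" by (simp add: cfun.scale_minus_left)
    finally show ?thesis .
  qed
  then show ?thesis using that by blast
qed

text \<open>The second argument is evaluated at the inverse instead of being conjugated. On
  characters of finite groups this agrees with the Hermitian product, but the form is bilinear and
  no unitary structure has to be put on the representations.\<close>

definition ip :: "('g, 'm) monoid_scheme \<Rightarrow> ('g \<Rightarrow> complex) \<Rightarrow> ('g \<Rightarrow> complex) \<Rightarrow> complex" where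
  "ip G \<chi> \<psi> = (\<Sum>g\<in>carrier G. \<chi> g * \<psi> (inv\<^bsub>G\<^esub> g)) / of_nat (card (carrier G))"

lemma ip_cong:
  assumes "group G" "\<And>g. g \<in> carrier G \<Longrightarrow> \<chi> g = \<chi>' g" "\<And>g. g \<in> carrier G \<Longrightarrow> \<psi> g = \<psi>' g"
  shows "ip G \<chi> \<psi> = ip G \<chi>' \<psi>'"
  unfolding ip_def using assms by (simp add: group.inv_closed)

lemma ip_add_left: "ip G (\<lambda>g. \<chi> g + \<chi>' g) \<psi> = ip G \<chi> \<psi> + ip G \<chi>' \<psi>"
  unfolding ip_def by (simp add: distrib_right sum.distrib add_divide_distrib)

lemma ip_sum_left: "ip G (\<lambda>g. \<Sum>i\<in>I. \<chi> i g) \<psi> = (\<Sum>i\<in>I. ip G (\<chi> i) \<psi>)"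
  unfolding ip_def sum_divide_distrib[symmetric] sum_distrib_right by (subst sum.swap) simp

lemma ip_scale_left: "ip G (\<lambda>g. c * \<chi> g) \<psi> = c * ip G \<chi> \<psi>"
  unfolding ip_def by (simp add: sum_distrib_left mult.assoc)

lemma ip_sum_list_left: "ip G (\<lambda>g. \<Sum>i\<leftarrow>l. \<chi> i g) \<psi> = (\<Sum>i\<leftarrow>l. ip G (\<chi> i) \<psi>)"
proof (induction l)
  case (Cons i l)
  then show ?case using ip_add_left[of G "\<chi> i" "\<lambda>g. \<Sum>i\<leftarrow>l. \<chi> i g" \<psi>] by simp
qed (simp add: ip_def)

lemma ip_commute: "group G \<Longrightarrow> ip G \<chi> \<psi> = ip G \<psi> \<chi>"
  unfolding ip_def using group.sum_group_inv[of G "\<lambda>g. \<chi> g * \<psi> (inv\<^bsub>G\<^esub> g)"]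
  by (simp add: group.inv_inv mult.commute group.is_monoid monoid.one_closed cong: sum.cong)

text \<open>
  The averaged rank-one operators turn Schur's lemma into orthogonality of matrix coefficients.
\<close>

lemma coeff_avg:
  assumes R: "representation G R" and S: "representation G S"
    and a: "a \<in> space R" and x: "x \<in> space S"
  shows "(\<Sum>g\<in>carrier G. crd (space R) (act R g a) b * crd (space S) (act S (inv\<^bsub>G\<^esub> g) x) c) =
    crd (space S) (avg G R S (\<lambda>v. cscale (crd (space R) v b) x) a) c"
proof -
  interpret group G using R by (rule rep_group)
  note L = lin_rank_one[OF rep_fds[OF R] rep_fds[OF S] x]
  have "crd (space S) (avg G R S (\<lambda>v. cscale (crd (space R) v b) x) a) c
    = (\<Sum>g\<in>carrier G. crd (space S) (act S (inv\<^bsub>G\<^esub> g) (cscale (crd (space R) (act R g a) b) x)) c)"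
    unfolding avg_def
    by (rule crd_sum_fun[OF rep_fds[OF S]]) (use a x in \<open>auto intro!: rep_in[OF S] fds_scale[OF rep_fds[OF S]]\<close>)
  also have "\<dots> = (\<Sum>g\<in>carrier G. crd (space R) (act R g a) b * crd (space S) (act S (inv\<^bsub>G\<^esub> g) x) c)"
    using x by (intro sum.cong refl)
      (simp add: lin_scale[OF rep_lin[OF S]] crd_scale[OF rep_fds[OF S]] rep_in[OF S])
  finally show ?thesis ..
qed

text \<open>The Schur relations for matrix coefficients, contracted with two operators. With
  \<open>A\<close> and \<open>C\<close> the identity this gives the norm of an irreducible
  character; the general form says that convolution of the functions tr (g A) corresponds to
  multiplication of operators, as Gelfand's trick requires.\<close>

lemma schur_trace:
  assumes R: "irreducible_rep G R" and fin: "finite (carrier G)"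
    and A: "lin (space R) (space R) A" and C: "lin (space R) (space R) C"
  shows "(\<Sum>g\<in>carrier G. tr (space R) (\<lambda>v. act R g (A v)) * tr (space R) (\<lambda>v. act R (inv\<^bsub>G\<^esub> g) (C v)))
    = of_nat (card (carrier G)) / of_nat (card (bas (space R))) * tr (space R) (\<lambda>v. A (C v))"
proof -
  let ?V = "space R" and ?d = "of_nat (card (bas (space R))) :: complex"
    and ?n = "of_nat (card (carrier G)) :: complex"
  have RR: "representation G R" and nz: "?V \<noteq> {0}" using R by (auto simp: irreducible_rep_def)
  note V = rep_fds[OF RR]
  interpret group G using RR by (rule rep_group)
  have d: "?d \<noteq> 0" using card_bas_pos[OF V nz] by simp
  \<comment> \<open>By Schur's lemma the averaged rank-one operator is a scalar c. Its trace is c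
    times the dimension and, by cyclicity, also the order of \<open>G\<close> times one coordinate
    of \<open>x\<close>.\<close>
  have scalar: "avg G R R (\<lambda>v. cscale (crd ?V v b) x) a = cscale (?n / ?d * crd ?V x b) a"
    if b: "b \<in> bas ?V" and x: "x \<in> ?V" and a: "a \<in> ?V" for b x a
  proof -
    let ?X = "\<lambda>v. cscale (crd ?V v b) x"
    have X: "lin ?V ?V ?X" by (rule lin_rank_one[OF V V x])
    have h: "ghom G R R (avg G R R ?X)" by (rule ghom_avg[OF RR RR X])
    obtain c where c: "\<And>v. v \<in> ?V \<Longrightarrow> avg G R R ?X v = cscale c v"
      using schur_scalar[OF R h] by blast
    have "c * ?d = tr ?V (\<lambda>v. cscale c v)"
      using tr_scale[OF V lin_id[OF subset_refl], of c] tr_id[OF V] by simp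
    also have "\<dots> = tr ?V (avg G R R ?X)" using c by (intro tr_cong[OF V]) simp
    also have "\<dots> = (\<Sum>g\<in>carrier G. tr ?V (\<lambda>v. act R (inv\<^bsub>G\<^esub> g) (?X (act R g v))))"
      unfolding avg_def[abs_def]
      by (rule tr_sum[OF V]) (intro lin_comp[OF lin_comp[OF rep_lin[OF RR] X] rep_lin[OF RR]]; simp)
    also have "\<dots> = (\<Sum>g\<in>carrier G. crd ?V x b)"
    proof (rule sum.cong[OF refl])
      fix g assume g: "g \<in> carrier G"
      have "tr ?V (\<lambda>v. act R (inv\<^bsub>G\<^esub> g) (?X (act R g v))) = tr ?V (\<lambda>v. ?X (act R g (act R (inv\<^bsub>G\<^esub> g) v)))"
        by (rule tr_comm[OF V V lin_comp[OF rep_lin[OF RR g] X]]) (use g in \<open>simp add: rep_lin[OF RR]\<close>)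
      also have "\<dots> = tr ?V ?X" by (rule tr_cong[OF V]) (simp add: rep_inv[OF RR g])
      also have "\<dots> = crd ?V x b" by (rule tr_rank_one[OF V x b])
      finally show "tr ?V (\<lambda>v. act R (inv\<^bsub>G\<^esub> g) (?X (act R g v))) = crd ?V x b" .
    qed
    finally have "c = ?n / ?d * crd ?V x b" using d by (simp add: field_simps)
    then show ?thesis using c[OF a] by simp
  qed
  have AB: "A b \<in> ?V" "C b \<in> ?V" if "b \<in> bas ?V" for b
    using lin_in[OF A] lin_in[OF C] bas_in[OF V that] by auto
  have "(\<Sum>g\<in>carrier G. tr ?V (\<lambda>v. act R g (A v)) * tr ?V (\<lambda>v. act R (inv\<^bsub>G\<^esub> g) (C v)))
    = (\<Sum>g\<in>carrier G. \<Sum>b\<in>bas ?V. \<Sum>c\<in>bas ?V. crd ?V (act R g (A b)) b * crd ?V (act R (inv\<^bsub>G\<^esub> g) (C c)) c)"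
    by (simp add: tr_def sum_product)
  also have "\<dots> = (\<Sum>b\<in>bas ?V. \<Sum>c\<in>bas ?V. \<Sum>g\<in>carrier G.
      crd ?V (act R g (A b)) b * crd ?V (act R (inv\<^bsub>G\<^esub> g) (C c)) c)"
    by (subst sum.swap) (intro sum.cong refl sum.swap)
  also have "\<dots> = (\<Sum>b\<in>bas ?V. \<Sum>c\<in>bas ?V. ?n / ?d * (crd ?V (C c) b * crd ?V (A b) c))"
    by (intro sum.cong refl)
       (simp add: coeff_avg[OF RR RR] AB scalar crd_scale[OF V])
  also have "\<dots> = ?n / ?d * (\<Sum>c\<in>bas ?V. \<Sum>b\<in>bas ?V. crd ?V (C c) b * crd ?V (A b) c)"
    by (subst sum.swap) (simp add: sum_distrib_left)
  also have "(\<Sum>c\<in>bas ?V. \<Sum>b\<in>bas ?V. crd ?V (C c) b * crd ?V (A b) c) = tr ?V (\<lambda>v. A (C v))"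
    by (rule tr_comm_sum[OF V V C A, symmetric])
  finally show ?thesis .
qed

lemma ip_chr_self:
  assumes R: "irreducible_rep G R" and fin: "finite (carrier G)" shows "ip G (chr R) (chr R) = 1"
proof -
  have RR: "representation G R" and nz: "space R \<noteq> {0}" using R by (auto simp: irreducible_rep_def)
  note V = rep_fds[OF RR]
  have "card (bas (space R)) > 0" by (rule card_bas_pos[OF V nz])
  then show ?thesis
    using schur_trace[OF R fin lin_id[OF subset_refl] lin_id[OF subset_refl]] order_pos[OF rep_group[OF RR] fin]
    by (simp add: ip_def chr_def tr_id[OF V])
qed

text \<open>A nonzero averaged rank-one operator would be an isomorphism by Schur's lemma. So all of
  them vanish, and with them all the sums of products of matrix coefficients that make up the inner
  product.\<close>

lemma ip_chr_non_iso:
  assumes R: "irreducible_rep G R" and S: "irreducible_rep G S" and "\<not> rep_iso G R S"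
  shows "ip G (chr R) (chr S) = 0"
proof -
  have RR: "representation G R" and RS: "representation G S" using R S by (auto simp: irreducible_rep_def)
  note V = rep_fds[OF RR] and W = rep_fds[OF RS]
  have zero: "avg G R S (\<lambda>v. cscale (crd (space R) v b) x) a = 0" if x: "x \<in> space S" and a: "a \<in> space R" for b x a
  proof (rule ccontr)
    assume nz: "avg G R S (\<lambda>v. cscale (crd (space R) v b) x) a \<noteq> 0"
    have h: "ghom G R S (avg G R S (\<lambda>v. cscale (crd (space R) v b) x))"
      by (rule ghom_avg[OF RR RS lin_rank_one[OF V W x]])
    have "bij_betw (avg G R S (\<lambda>v. cscale (crd (space R) v b) x)) (space R) (space S)"
      by (rule schur_iso[OF R S h]) (use a nz in blast)
    then show False using rep_isoI[OF h] assms(3) by blast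
  qed
  have "(\<Sum>g\<in>carrier G. chr R g * chr S (inv\<^bsub>G\<^esub> g)) =
    (\<Sum>g\<in>carrier G. \<Sum>b\<in>bas (space R). \<Sum>c\<in>bas (space S).
       crd (space R) (act R g b) b * crd (space S) (act S (inv\<^bsub>G\<^esub> g) c) c)"
    by (simp add: chr_def tr_def sum_product)
  also have "\<dots> = (\<Sum>b\<in>bas (space R). \<Sum>c\<in>bas (space S). \<Sum>g\<in>carrier G.
      crd (space R) (act R g b) b * crd (space S) (act S (inv\<^bsub>G\<^esub> g) c) c)"
    by (subst sum.swap) (intro sum.cong refl sum.swap)
  also have "\<dots> = (\<Sum>b\<in>bas (space R). \<Sum>c\<in>bas (space S). crd (space S) 0 c)"
    by (intro sum.cong refl) (simp add: coeff_avg[OF RR RS] bas_in[OF V] bas_in[OF W] zero)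
  also have "\<dots> = 0" using crd_scale[OF W fds_0[OF W], of 0] by simp
  finally show ?thesis by (simp add: ip_def)
qed

lemma ip_chr_irreducible:
  assumes R: "irreducible_rep G R" and S: "irreducible_rep G S" and fin: "finite (carrier G)"
  shows "ip G (chr R) (chr S) = (if rep_iso G R S then 1 else 0)"
proof (cases "rep_iso G R S")
  case True
  have RR: "representation G R" and RS: "representation G S" using R S by (auto simp: irreducible_rep_def)
  have "ip G (chr R) (chr S) = ip G (chr R) (chr R)"
    by (rule ip_cong[OF rep_group[OF RR]]) (simp_all add: chr_rep_iso[OF RR RS True])
  then show ?thesis using True ip_chr_self[OF R fin] by simp
qed (simp add: ip_chr_non_iso[OF R S])

text \<open>The complement is the kernel of Maschke's projection. The projection is exported as
  well, because gluing isomorphisms in \<open>rep_iso_direct_sum\<close> needs both components of a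
  vector.\<close>

lemma complement:
  assumes R: "representation G R" and fin: "finite (carrier G)" and U: "invariant_subspace G R U"
  obtains U' \<pi> where "invariant_subspace G R U'" "ghom G R R \<pi>" "\<And>v. v \<in> space R \<Longrightarrow> \<pi> v \<in> U"
    "\<And>u. u \<in> U \<Longrightarrow> \<pi> u = u" "U' = {v \<in> space R. \<pi> v = 0}" "\<And>v. v \<in> space R \<Longrightarrow> v - \<pi> v \<in> U'"
    "U \<inter> U' = {0}" "space R = {u + u' |u u'. u \<in> U \<and> u' \<in> U'}"
    "\<And>g. g \<in> carrier G \<Longrightarrow> chr R g = chr (sub R U) g + chr (sub R U') g"
proof -
  obtain \<pi> where \<pi>: "ghom G R R \<pi>" "\<And>v. v \<in> space R \<Longrightarrow> \<pi> v \<in> U" "\<And>u. u \<in> U \<Longrightarrow> \<pi> u = u"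
    using maschke[OF assms] by blast
  let ?U' = "{v \<in> space R. \<pi> v = 0}"
  note V = rep_fds[OF R] and L = ghom_lin[OF \<pi>(1)]
  have UV: "U \<subseteq> space R" and "0 \<in> U" using U by (auto simp: invariant_subspace_def cfun.subspace_0)
  have U': "invariant_subspace G R ?U'" by (rule ghom_kernel[OF R R \<pi>(1)])
  have diff: "v - \<pi> v \<in> ?U'" if v: "v \<in> space R" for v
  proof -
    have "\<pi> v \<in> space R" using \<pi>(2)[OF v] UV by blast
    moreover from this have "\<pi> (v - \<pi> v) = \<pi> v - \<pi> (\<pi> v)" by (rule lin_diff[OF L fds_subspace[OF V] v])
    ultimately show ?thesis using fds_diff[OF V v] \<pi>(3)[OF \<pi>(2)[OF v]] by simp
  qed
  have inter: "U \<inter> ?U' = {0}" using \<pi>(3) \<open>0 \<in> U\<close> fds_0[OF V] by auto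
  have "v \<in> {u + u' |u u'. u \<in> U \<and> u' \<in> ?U'}" if v: "v \<in> space R" for v
  proof -
    have "v = \<pi> v + (v - \<pi> v)" by simp
    then show ?thesis using \<pi>(2)[OF v] diff[OF v] by blast
  qed
  then have sum: "space R = {u + u' |u u'. u \<in> U \<and> u' \<in> ?U'}"
    using UV fds_add[OF V] by blast
  have chr: "chr R g = chr (sub R U) g + chr (sub R ?U') g" if g: "g \<in> carrier G" for g
  proof -
    \<comment> \<open>The identity is resolved as \<pi> plus (1 - \<pi>), indexed by the two truth
      values.\<close>
    have "tr (space R) (act R g) = (\<Sum>i\<in>{True, False}. tr (if i then U else ?U')
        (\<lambda>v. (if i then \<pi> else (\<lambda>v. v - \<pi> v)) (act R g v)))"
    proof (rule tr_resolution[where \<iota> = "\<lambda>i v. v"])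
      show "fds (space R)" by (rule V)
      show "fds (if i then U else ?U')" for i
        using invariant_fds[OF R U] invariant_fds[OF R U'] by simp
      show "lin (if i then U else ?U') (space R) (\<lambda>v. v)" for i
        using UV by (intro lin_id) auto
      show "lin (space R) (if i then U else ?U') (if i then \<pi> else (\<lambda>v. v - \<pi> v))" for i
      proof (cases i)
        case True
        then show ?thesis using \<pi>(2) L by (auto simp: lin_def)
      next
        case False
        have "lin (space R) ?U' (\<lambda>v. v - \<pi> v)"
        proof (rule linI)
          fix u v c assume u: "u \<in> space R"
          show "u - \<pi> u \<in> ?U'" using diff[OF u] .
          show "cscale c u - \<pi> (cscale c u) = cscale c (u - \<pi> u)"
            using lin_scale[OF L u] by (simp add: cfun.scale_right_diff_distrib)
          assume "v \<in> space R"
          then show "u + v - \<pi> (u + v) = u - \<pi> u + (v - \<pi> v)"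
            unfolding lin_add[OF L u \<open>v \<in> space R\<close>] by (simp only: add_diff_add)
        qed
        then show ?thesis using False by simp
      qed
      show "(\<Sum>i\<in>{True, False}. (if i then \<pi> else (\<lambda>v. v - \<pi> v)) m) = m" for m by simp
      show "lin (space R) (space R) (act R g)" by (rule rep_lin[OF R g])
    qed
    also have "\<dots> = tr U (\<lambda>v. \<pi> (act R g v)) + tr ?U' (\<lambda>v. act R g v - \<pi> (act R g v))" by simp
    also have "tr U (\<lambda>v. \<pi> (act R g v)) = tr U (act R g)"
      using U g \<pi>(3) by (intro tr_cong[OF invariant_fds[OF R U]]) (auto simp: invariant_subspace_def)
    also have "tr ?U' (\<lambda>v. act R g v - \<pi> (act R g v)) = tr ?U' (act R g)"
      using U' g by (intro tr_cong[OF invariant_fds[OF R U']]) (auto simp: invariant_subspace_def)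
    finally show ?thesis by (simp add: chr_def)
  qed
  show ?thesis by (rule that[OF U' \<pi> refl diff inter sum chr])
qed

lemma is_summand_iff:
  assumes "representation G R" "finite (carrier G)"
  shows "is_summand G A R \<longleftrightarrow> (\<exists>U. invariant_subspace G R U \<and> rep_iso G A (sub R U))"
proof
  assume "\<exists>U. invariant_subspace G R U \<and> rep_iso G A (sub R U)"
  then obtain U where U: "invariant_subspace G R U" "rep_iso G A (sub R U)" by blast
  obtain U' where "invariant_subspace G R U'" "U \<inter> U' = {0}" "space R = {u + u' |u u'. u \<in> U \<and> u' \<in> U'}"
    by (rule complement[OF assms U(1)]) (rule that; assumption)
  with U show "is_summand G A R" unfolding is_summand_def by blast
qed (auto simp: is_summand_def)

lemma dim_pos: "representation G R \<Longrightarrow> space R \<noteq> {0} \<Longrightarrow> card (bas (space R)) > 0"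
  by (rule card_bas_pos[OF rep_fds])

text \<open>Dimensions are character values at the identity.\<close>

lemma dim_complement:
  assumes R: "representation G R" and U: "invariant_subspace G R U" "invariant_subspace G R U'"
    and chr: "\<And>g. g \<in> carrier G \<Longrightarrow> chr R g = chr (sub R U) g + chr (sub R U') g"
  shows "card (bas (space R)) = card (bas U) + card (bas U')"
proof -
  interpret group G using R by (rule rep_group)
  have "(of_nat (card (bas (space R))) :: complex) = of_nat (card (bas U) + card (bas U'))"
    using chr[OF one_closed] chr_one[OF R] chr_one[OF invariant_rep[OF R U(1)]]
      chr_one[OF invariant_rep[OF R U(2)]] by simp
  then show ?thesis using of_nat_eq_iff by blast
qed

lemma chr_zero: "representation G R \<Longrightarrow> space R = {0} \<Longrightarrow> chr R g = 0"
proof -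
  assume R: "representation G R" "space R = {0}"
  have "bas (space R) \<subseteq> {0}" using bas_in[OF rep_fds[OF R(1)]] R(2) by blast
  moreover have "0 \<notin> bas (space R)" using bas(2)[OF rep_fds[OF R(1)]] cfun.dependent_zero by blast
  ultimately have "bas (space R) = {}" by blast
  then show ?thesis by (simp add: chr_def tr_def)
qed

text \<open>Only what characters can see is recorded, namely a list of irreducible subspaces whose
  characters add up to that of \<open>R\<close>. The splitting of the space serves to step down in
  dimension and is then forgotten.\<close>

lemma decomposition:
  assumes "representation G R" and fin: "finite (carrier G)"
  shows "\<exists>Us. (\<forall>U\<in>set Us. invariant_subspace G R U \<and> irreducible_rep G (sub R U)) \<and>
    (\<forall>g\<in>carrier G. chr R g = (\<Sum>U\<leftarrow>Us. chr (sub R U) g))"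
  using assms(1)
proof (induction "card (bas (space R))" arbitrary: R rule: less_induct)
  case less
  note R = less.prems
  consider "space R = {0}" | "irreducible_rep G R"
    | U where "invariant_subspace G R U" "U \<noteq> {0}" "U \<noteq> space R"
    using R by (auto simp: irreducible_rep_def)
  then show ?case
  proof cases
    case 1
    then show ?thesis using chr_zero[OF R] by (intro exI[of _ "[]"]) simp
  next
    case 2
    have "sub R (space R) = R" by simp
    then show ?thesis using 2 invariant_space[OF R] by (intro exI[of _ "[space R]"]) simp
  next
    case 3
    obtain U' \<pi> where U': "invariant_subspace G R U'" and int: "U \<inter> U' = {0}"
      and sp: "space R = {u + u' |u u'. u \<in> U \<and> u' \<in> U'}"
      and chr: "\<And>g. g \<in> carrier G \<Longrightarrow> chr R g = chr (sub R U) g + chr (sub R U') g"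
      by (rule complement[OF R fin 3(1)]) (rule that; assumption)
    have rU: "representation G (sub R U)" and rU': "representation G (sub R U')"
      using invariant_rep[OF R] 3 U' by auto
    have dim: "card (bas (space R)) = card (bas U) + card (bas U')"
      by (rule dim_complement[OF R 3(1) U' chr])
    have "U' \<noteq> {0}"
    proof
      assume "U' = {0}"
      then have "space R = U" unfolding sp by simp
      then show False using 3(3) by simp
    qed
    then have lt: "card (bas U) < card (bas (space R))" "card (bas U') < card (bas (space R))"
      using dim dim_pos[OF rU] dim_pos[OF rU'] 3(2) by auto
    obtain Us where Us: "\<forall>P\<in>set Us. invariant_subspace G (sub R U) P \<and> irreducible_rep G (sub (sub R U) P)"
      "\<forall>g\<in>carrier G. chr (sub R U) g = (\<Sum>P\<leftarrow>Us. chr (sub (sub R U) P) g)"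
      using less.hyps[of "sub R U"] lt rU by auto
    obtain Us' where Us': "\<forall>P\<in>set Us'. invariant_subspace G (sub R U') P \<and> irreducible_rep G (sub (sub R U') P)"
      "\<forall>g\<in>carrier G. chr (sub R U') g = (\<Sum>P\<leftarrow>Us'. chr (sub (sub R U') P) g)"
      using less.hyps[of "sub R U'"] lt rU' by auto
    show ?thesis
      by (rule exI[of _ "Us @ Us'"])
         (use Us Us' chr invariant_sub[OF 3(1)] invariant_sub[OF U'] in auto)
  qed
qed

text \<open>The number k counts the members of a decomposition that are isomorphic to
  \<open>S\<close>; a positive count exhibits one of them.\<close>

lemma ip_chr_nat:
  assumes R: "representation G R" and S: "irreducible_rep G S" and fin: "finite (carrier G)"
  obtains k :: nat where "ip G (chr R) (chr S) = of_nat k"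
    "k > 0 \<Longrightarrow> \<exists>U. invariant_subspace G R U \<and> rep_iso G S (sub R U)"
proof -
  obtain Us where Us: "\<forall>U\<in>set Us. invariant_subspace G R U \<and> irreducible_rep G (sub R U)"
    "\<forall>g\<in>carrier G. chr R g = (\<Sum>U\<leftarrow>Us. chr (sub R U) g)"
    using decomposition[OF R fin] by blast
  have RS: "representation G S" using S by (simp add: irreducible_rep_def)
  have "ip G (chr R) (chr S) = ip G (\<lambda>g. \<Sum>U\<leftarrow>Us. chr (sub R U) g) (chr S)"
    using Us(2) by (intro ip_cong[OF rep_group[OF R]]) auto
  also have "\<dots> = (\<Sum>U\<leftarrow>Us. ip G (chr (sub R U)) (chr S))" by (rule ip_sum_list_left)
  also have "\<dots> = (\<Sum>U\<leftarrow>Us. if rep_iso G (sub R U) S then 1 else 0)"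
    using Us(1) by (intro arg_cong[of _ _ sum_list] map_cong refl) (simp add: ip_chr_irreducible[OF _ S fin])
  also have "\<dots> = of_nat (length (filter (\<lambda>U. rep_iso G (sub R U) S) Us))"
    by (induction Us) auto
  finally have ip: "ip G (chr R) (chr S) = of_nat (length (filter (\<lambda>U. rep_iso G (sub R U) S) Us))" .
  show ?thesis
  proof (rule that[OF ip])
    assume "0 < length (filter (\<lambda>U. rep_iso G (sub R U) S) Us)"
    then obtain U where "U \<in> set Us" "rep_iso G (sub R U) S"
      by (auto simp: filter_empty_conv)
    then show "\<exists>U. invariant_subspace G R U \<and> rep_iso G S (sub R U)"
      using Us(1) rep_iso_sym by (metis irreducible_rep_def)
  qed
qed

text \<open>\<open>\<Phi>\<close> applies one isomorphism to the component in \<open>U\<close> and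
  the other to the component in \<open>U'\<close>. The projection \<rho> on the target recovers the
  two components, which yields injectivity.\<close>

lemma rep_iso_direct_sum:
  assumes R: "representation G R" and S: "representation G S" and fin: "finite (carrier G)"
    and \<pi>: "ghom G R R \<pi>" "\<And>v. v \<in> space R \<Longrightarrow> \<pi> v \<in> U" "\<And>u. u \<in> U \<Longrightarrow> \<pi> u = u"
      "\<And>v. v \<in> space R \<Longrightarrow> v - \<pi> v \<in> U'" "U' = {v \<in> space R. \<pi> v = 0}" and U: "U \<subseteq> space R"
    and \<rho>: "ghom G S S \<rho>" "\<And>v. v \<in> space S \<Longrightarrow> \<rho> v \<in> P" "\<And>u. u \<in> P \<Longrightarrow> \<rho> u = u"
      "\<And>v. v \<in> space S \<Longrightarrow> v - \<rho> v \<in> P'" "P' = {v \<in> space S. \<rho> v = 0}" and P: "P \<subseteq> space S"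
    and iso: "rep_iso G (sub R U) (sub S P)" "rep_iso G (sub R U') (sub S P')"
  shows "rep_iso G R S"
proof -
  obtain \<phi> where \<phi>: "ghom G (sub R U) (sub S P) \<phi>" "bij_betw \<phi> U P"
    using iso(1) by (auto elim: rep_isoE)
  obtain \<psi> where \<psi>: "ghom G (sub R U') (sub S P') \<psi>" "bij_betw \<psi> U' P'"
    using iso(2) by (auto elim: rep_isoE)
  have U': "U' \<subseteq> space R" and P': "P' \<subseteq> space S" using \<pi>(5) \<rho>(5) by auto
  note V = rep_fds[OF R] and W = rep_fds[OF S] and L = ghom_lin[OF \<pi>(1)] and M = ghom_lin[OF \<rho>(1)]
  have L\<phi>: "lin U (space S) \<phi>" and L\<psi>: "lin U' (space S) \<psi>"
    using ghom_lin[OF \<phi>(1)] ghom_lin[OF \<psi>(1)] P P' by (auto intro: lin_mono)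
  have \<pi>L: "lin (space R) U \<pi>" using L \<pi>(2) by (auto simp: lin_def)
  have dL: "lin (space R) U' (\<lambda>v. v - \<pi> v)"
  proof (rule linI)
    fix u v c assume u: "u \<in> space R"
    show "u - \<pi> u \<in> U'" using \<pi>(4)[OF u] .
    show "cscale c u - \<pi> (cscale c u) = cscale c (u - \<pi> u)"
      using lin_scale[OF L u] by (simp add: cfun.scale_right_diff_distrib)
    assume v: "v \<in> space R"
    show "u + v - \<pi> (u + v) = u - \<pi> u + (v - \<pi> v)"
      unfolding lin_add[OF L u v] by (simp only: add_diff_add)
  qed
  define \<Phi> where "\<Phi> v = \<phi> (\<pi> v) + \<psi> (v - \<pi> v)" for v
  have L\<Phi>: "lin (space R) (space S) \<Phi>"
    unfolding \<Phi>_def[abs_def] by (intro lin_plus[OF W] lin_comp[OF \<pi>L L\<phi>] lin_comp[OF dL L\<psi>])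
  have "ghom G R S \<Phi>"
    unfolding ghom_def
  proof (intro conjI ballI L\<Phi>)
    fix g v assume g: "g \<in> carrier G" and v: "v \<in> space R"
    have a: "\<pi> v \<in> U" "v - \<pi> v \<in> U'" "\<pi> v \<in> space R" using \<pi>(2,4)[OF v] U by auto
    have "act R g v - act R g (\<pi> v) = act R g (v - \<pi> v)"
      using lin_diff[OF rep_lin[OF R g] fds_subspace[OF V] v a(3)] by simp
    then have "\<Phi> (act R g v) = \<phi> (act R g (\<pi> v)) + \<psi> (act R g (v - \<pi> v))"
      by (simp only: \<Phi>_def ghom_act[OF \<pi>(1) g v])
    also have "\<dots> = act S g (\<phi> (\<pi> v)) + act S g (\<psi> (v - \<pi> v))"
      using ghom_act[OF \<phi>(1) g, of "\<pi> v"] ghom_act[OF \<psi>(1) g, of "v - \<pi> v"] a by simp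
    also have "\<dots> = act S g (\<Phi> v)"
      unfolding \<Phi>_def by (rule lin_add[OF rep_lin[OF S g] lin_in[OF L\<phi> a(1)] lin_in[OF L\<psi> a(2)], symmetric])
    finally show "\<Phi> (act R g v) = act S g (\<Phi> v)" .
  qed
  moreover have "bij_betw \<Phi> (space R) (space S)"
  proof -
    have \<phi>P: "\<phi> u \<in> P" if "u \<in> U" for u using \<phi>(2) that by (auto simp: bij_betw_def)
    have \<psi>P: "\<psi> u \<in> P'" if "u \<in> U'" for u using \<psi>(2) that by (auto simp: bij_betw_def)
    have \<rho>\<Phi>: "\<rho> (\<phi> u + \<psi> u') = \<phi> u" if u: "u \<in> U" "u' \<in> U'" for u u'
    proof -
      have "\<rho> (\<phi> u + \<psi> u') = \<rho> (\<phi> u) + \<rho> (\<psi> u')"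
        by (rule lin_add[OF M]) (use \<phi>P \<psi>P P P' u in auto)
      then show ?thesis using \<phi>P[OF u(1)] \<psi>P[OF u(2)] \<rho>(3,5) by simp
    qed
    have "inj_on \<Phi> (space R)"
    proof (rule inj_onI)
      fix u v assume u: "u \<in> space R" and v: "v \<in> space R" and eq: "\<Phi> u = \<Phi> v"
      have 1: "\<phi> (\<pi> u) = \<phi> (\<pi> v)"
        using arg_cong[OF eq, of \<rho>] \<rho>\<Phi>[OF \<pi>(2,4)[OF u]] \<rho>\<Phi>[OF \<pi>(2,4)[OF v]] by (simp add: \<Phi>_def)
      then have 2: "\<pi> u = \<pi> v" using \<phi>(2) \<pi>(2) u v by (auto simp: bij_betw_def dest: inj_onD)
      have "\<psi> (u - \<pi> u) = \<psi> (v - \<pi> v)" using eq 1 unfolding \<Phi>_def by simp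
      then have "u - \<pi> u = v - \<pi> v" using \<psi>(2) \<pi>(4) u v by (auto simp: bij_betw_def dest: inj_onD)
      then show "u = v" using 2 by simp
    qed
    moreover have "w \<in> \<Phi> ` space R" if w: "w \<in> space S" for w
    proof -
      obtain u where u: "u \<in> U" "\<phi> u = \<rho> w" using \<phi>(2) \<rho>(2)[OF w] by (auto simp: bij_betw_def)
      obtain u' where u': "u' \<in> U'" "\<psi> u' = w - \<rho> w" using \<psi>(2) \<rho>(4)[OF w] by (auto simp: bij_betw_def)
      have uR: "u \<in> space R" "u' \<in> space R" using u u' U U' by auto
      have "\<pi> (u + u') = \<pi> u + \<pi> u'" by (rule lin_add[OF L uR])
      then have "\<pi> (u + u') = u" using \<pi>(3)[OF u(1)] u'(1) \<pi>(5) by simp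
      then have "\<Phi> (u + u') = w" using u(2) u'(2) unfolding \<Phi>_def by simp
      then show ?thesis using fds_add[OF V uR] by blast
    qed
    ultimately show ?thesis using lin_in[OF L\<Phi>] by (auto simp: bij_betw_def)
  qed
  ultimately show ?thesis by (rule rep_isoI)
qed

text \<open>Induction on the dimension. An irreducible constituent of \<open>R\<close> has positive
  multiplicity in \<open>S\<close> as well, because multiplicities are read off from the character;
  splitting it off on both sides leaves smaller representations with equal characters.\<close>

theorem chr_eq_imp_rep_iso:
  assumes "representation G R" "representation G S" and fin: "finite (carrier G)"
    and "\<And>g. g \<in> carrier G \<Longrightarrow> chr R g = chr S g"
  shows "rep_iso G R S"
  using assms(1,2,4)
proof (induction "card (bas (space R))" arbitrary: R S rule: less_induct)
  case less
  note R = less.prems(1) and S = less.prems(2) and eq = less.prems(3)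
  interpret group G using R by (rule rep_group)
  show ?case
  proof (cases "space R = {0}")
    case True
    then have "card (bas (space S)) = 0"
      using eq[OF one_closed] chr_zero[OF R] chr_one[OF S] by simp
    then have "space S = {0}" using dim_pos[OF S] by auto
    moreover have "ghom G R S (\<lambda>_. 0)"
      using fds_0[OF rep_fds[OF S]] True lin_0[OF rep_lin[OF S]] unfolding ghom_def by (auto intro!: linI)
    ultimately show ?thesis using True by (intro rep_isoI[of _ _ _ "\<lambda>_. 0"]) (auto simp: bij_betw_def)
  next
    case False
    obtain Us where Us: "\<forall>U\<in>set Us. invariant_subspace G R U \<and> irreducible_rep G (sub R U)"
      "\<forall>g\<in>carrier G. chr R g = (\<Sum>U\<leftarrow>Us. chr (sub R U) g)"
      using decomposition[OF R fin] by blast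
    have "Us \<noteq> []" using Us(2)[rule_format, OF one_closed] chr_one[OF R] dim_pos[OF R False] by auto
    then obtain U where "U \<in> set Us" by fastforce
    then have U: "invariant_subspace G R U" "irreducible_rep G (sub R U)" using Us(1) by auto
    have rU: "representation G (sub R U)" by (rule invariant_rep[OF R U(1)])
    obtain U' \<pi> where U': "invariant_subspace G R U'" and \<pi>: "ghom G R R \<pi>" "\<And>v. v \<in> space R \<Longrightarrow> \<pi> v \<in> U"
      "\<And>u. u \<in> U \<Longrightarrow> \<pi> u = u" "U' = {v \<in> space R. \<pi> v = 0}" "\<And>v. v \<in> space R \<Longrightarrow> v - \<pi> v \<in> U'"
      and cR: "\<And>g. g \<in> carrier G \<Longrightarrow> chr R g = chr (sub R U) g + chr (sub R U') g"
      by (rule complement[OF R fin U(1)]) (rule that; assumption)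
    obtain k where k: "ip G (chr (sub R U')) (chr (sub R U)) = of_nat k"
      by (rule ip_chr_nat[OF invariant_rep[OF R U'] U(2) fin]) (rule that; assumption)
    have "ip G (chr S) (chr (sub R U)) = ip G (\<lambda>g. chr (sub R U) g + chr (sub R U') g) (chr (sub R U))"
      by (rule ip_cong[OF is_group]) (simp_all add: eq[symmetric] cR)
    also have "\<dots> = of_nat (1 + k)"
      by (simp add: ip_add_left k ip_chr_self[OF U(2) fin])
    finally have "ip G (chr S) (chr (sub R U)) = of_nat (1 + k)" .
    moreover obtain k' where "ip G (chr S) (chr (sub R U)) = of_nat k'"
      "k' > 0 \<Longrightarrow> \<exists>P. invariant_subspace G S P \<and> rep_iso G (sub R U) (sub S P)"
      by (rule ip_chr_nat[OF S U(2) fin]) (rule that; assumption)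
    ultimately obtain P where P: "invariant_subspace G S P" "rep_iso G (sub R U) (sub S P)"
      by (metis of_nat_eq_iff zero_less_Suc plus_1_eq_Suc)
    have rP: "representation G (sub S P)" by (rule invariant_rep[OF S P(1)])
    obtain P' \<rho> where P': "invariant_subspace G S P'" and \<rho>: "ghom G S S \<rho>" "\<And>v. v \<in> space S \<Longrightarrow> \<rho> v \<in> P"
      "\<And>u. u \<in> P \<Longrightarrow> \<rho> u = u" "P' = {v \<in> space S. \<rho> v = 0}" "\<And>v. v \<in> space S \<Longrightarrow> v - \<rho> v \<in> P'"
      and cS: "\<And>g. g \<in> carrier G \<Longrightarrow> chr S g = chr (sub S P) g + chr (sub S P') g"
      by (rule complement[OF S fin P(1)]) (rule that; assumption)
    have "space (sub R U) \<noteq> {0}" using U(2) by (simp add: irreducible_rep_def)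
    then have lt: "card (bas U') < card (bas (space R))"
      using dim_complement[OF R U(1) U' cR] dim_pos[OF rU] by simp
    have "chr (sub R U') g = chr (sub S P') g" if g: "g \<in> carrier G" for g
      using cR[OF g] cS[OF g] eq[OF g] chr_rep_iso[OF rU rP P(2) g] by simp
    then have iso': "rep_iso G (sub R U') (sub S P')"
      using lt invariant_rep[OF R U'] invariant_rep[OF S P'] by (intro less.hyps) auto
    show ?thesis
      by (rule rep_iso_direct_sum[OF R S fin \<pi>(1-3,5,4) _ \<rho>(1-3,5,4) _ P(2) iso'])
         (use U(1) P(1) in \<open>auto simp: invariant_subspace_def\<close>)
  qed
qed

section \<open>Characters of induced representations and tensor products\<close>

text \<open>
  Frobenius' formula for the induced character, written as a sum over pairs so that \<open>j\<close> need not
  be injective and no conjugate has to be tested for membership in a subgroup.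
\<close>

definition icf :: "('g, 'm) monoid_scheme \<Rightarrow> ('h, 'n) monoid_scheme \<Rightarrow> ('h \<Rightarrow> 'g) \<Rightarrow> ('h \<Rightarrow> complex) \<Rightarrow> 'g \<Rightarrow> complex"
  where "icf G H j \<chi> g = (\<Sum>x\<in>carrier G. \<Sum>h\<in>carrier H. if g \<otimes>\<^bsub>G\<^esub> x = x \<otimes>\<^bsub>G\<^esub> j h then \<chi> h else 0) / of_nat (card (carrier H))"

locale induction_data = G: group G + H: group H
  for G :: "('g, 'm) monoid_scheme" and H :: "('h, 'n) monoid_scheme" +
  fixes j :: "'h \<Rightarrow> 'g" and R :: "('h, 'x) rep"
  assumes fin_G: "finite (carrier G)" and fin_H: "finite (carrier H)"
    and j: "j \<in> hom H G" and R: "representation H R"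
begin

lemma j_in: "h \<in> carrier H \<Longrightarrow> j h \<in> carrier G"
  and j_mult: "h \<in> carrier H \<Longrightarrow> k \<in> carrier H \<Longrightarrow> j (h \<otimes>\<^bsub>H\<^esub> k) = j h \<otimes>\<^bsub>G\<^esub> j k"
  using j by (auto simp: hom_def)

abbreviation "n \<equiv> of_nat (card (carrier H)) :: complex"

lemma n: "n \<noteq> 0"
  using order_pos[OF H.is_group fin_H] by simp

abbreviation "V \<equiv> space R"
abbreviation "M \<equiv> space (ind G H j R)"

text \<open>Elements of the induced space are stored as functions of pairs; the slice at g is the
  vector that the corresponding function on \<open>G\<close> takes at g.\<close>

definition slice :: "'g \<Rightarrow> ('g \<times> 'x \<Rightarrow> complex) \<Rightarrow> 'x \<Rightarrow> complex" where
  "slice g f = (\<lambda>x. f (g, x))"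

lemma V: "fds V" using R by (rule rep_fds)

lemma M_iff: "f \<in> M \<longleftrightarrow> (\<forall>g. g \<notin> carrier G \<longrightarrow> slice g f = 0) \<and> (\<forall>g\<in>carrier G. slice g f \<in> V) \<and>
  (\<forall>g\<in>carrier G. \<forall>h\<in>carrier H. slice (g \<otimes>\<^bsub>G\<^esub> j h) f = act R (inv\<^bsub>H\<^esub> h) (slice g f))"
  by (auto simp: ind_def slice_def fun_eq_iff)

lemma slice_add: "slice g (f + f') = slice g f + slice g f'"
  and slice_scale: "slice g (cscale c f) = cscale c (slice g f)"
  and slice_zero: "slice g 0 = 0"
  by (auto simp: slice_def cscale_def fun_eq_iff)

lemma slice_sum: "slice g (\<Sum>i\<in>I. f i) = (\<Sum>i\<in>I. slice g (f i))"
proof (induction I rule: infinite_finite_induct)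
  case (insert i I)
  then show ?case by (simp only: sum.insert[OF insert(1,2)] slice_add)
qed (simp_all only: sum.infinite sum.empty slice_zero not_False_eq_True)

lemma slice_eqI: "(\<And>g. slice g f = slice g f') \<Longrightarrow> f = f'"
  by (auto simp: slice_def fun_eq_iff)

lemma M_subspace: "cfun.subspace M"
proof (rule cfun.subspaceI)
  note L = rep_lin[OF R]
  show "0 \<in> M" using lin_0[OF L] fds_0[OF V] by (simp add: M_iff slice_zero)
  fix f f' c assume f: "f \<in> M"
  then show "cscale c f \<in> M" using lin_scale[OF L] fds_scale[OF V] by (simp add: M_iff slice_scale)
  assume "f' \<in> M"
  with f show "f + f' \<in> M"
    using lin_add[OF L] fds_add[OF V] unfolding M_iff slice_add by (metis H.inv_closed add.right_neutral)
qed

lemma slice_act: "slice x (act (ind G H j R) g f) = (if x \<in> carrier G then slice (inv\<^bsub>G\<^esub> g \<otimes>\<^bsub>G\<^esub> x) f else 0)"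
  by (auto simp: slice_def ind_def fun_eq_iff)

lemma act_M: "g \<in> carrier G \<Longrightarrow> f \<in> M \<Longrightarrow> act (ind G H j R) g f \<in> M"
  unfolding M_iff slice_act by (simp add: j_in G.m_assoc[symmetric])

text \<open>The element of the induced space generated by the value \<open>v\<close> at
  \<open>x0\<close>, supported on the coset of \<open>x0\<close>. When a given function is rebuilt
  from all its values, each of its values is produced once by every element of \<open>H\<close>;
  this is what the factor 1 / n compensates.\<close>

definition \<iota> :: "'g \<Rightarrow> ('x \<Rightarrow> complex) \<Rightarrow> 'g \<times> 'x \<Rightarrow> complex" where
  "\<iota> x0 v = (\<lambda>(g, x). if g \<in> carrier G
     then (cscale (1 / n) (\<Sum>h\<in>carrier H. if g \<otimes>\<^bsub>G\<^esub> j h = x0 then act R h v else 0)) x else 0)"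

lemma slice_\<iota>: "slice g (\<iota> x0 v) = (if g \<in> carrier G
     then cscale (1 / n) (\<Sum>h\<in>carrier H. if g \<otimes>\<^bsub>G\<^esub> j h = x0 then act R h v else 0) else 0)"
  by (auto simp: slice_def \<iota>_def fun_eq_iff)

lemma term_in: "v \<in> V \<Longrightarrow> h \<in> carrier H \<Longrightarrow> (if b then act R h v else 0) \<in> V"
  using rep_in[OF R] fds_0[OF V] by simp

lemma \<iota>_in: assumes v: "v \<in> V" shows "\<iota> x0 v \<in> M"
  unfolding M_iff
proof (intro conjI allI impI ballI)
  show "slice g (\<iota> x0 v) = 0" if "g \<notin> carrier G" for g using that by (simp add: slice_\<iota>)
  fix g assume g: "g \<in> carrier G"
  show "slice g (\<iota> x0 v) \<in> V"
    using g fds_sum[OF V, of "carrier H"] term_in[OF v] by (simp add: slice_\<iota> fds_scale[OF V])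
  fix k assume k: "k \<in> carrier H"
  have "(\<Sum>h\<in>carrier H. if g \<otimes>\<^bsub>G\<^esub> j k \<otimes>\<^bsub>G\<^esub> j h = x0 then act R h v else 0)
      = (\<Sum>h\<in>carrier H. if g \<otimes>\<^bsub>G\<^esub> j (k \<otimes>\<^bsub>H\<^esub> h) = x0 then act R (inv\<^bsub>H\<^esub> k \<otimes>\<^bsub>H\<^esub> (k \<otimes>\<^bsub>H\<^esub> h)) v else 0)"
    using g k by (intro sum.cong refl) (simp add: j_mult j_in G.m_assoc H.m_assoc[symmetric])
  also have "\<dots> = (\<Sum>h\<in>carrier H. if g \<otimes>\<^bsub>G\<^esub> j h = x0 then act R (inv\<^bsub>H\<^esub> k \<otimes>\<^bsub>H\<^esub> h) v else 0)"
    by (rule group.sum_group_left[OF H.is_group k, where f = "\<lambda>h. if g \<otimes>\<^bsub>G\<^esub> j h = x0 then act R (inv\<^bsub>H\<^esub> k \<otimes>\<^bsub>H\<^esub> h) v else 0"])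
  also have "\<dots> = (\<Sum>h\<in>carrier H. act R (inv\<^bsub>H\<^esub> k) (if g \<otimes>\<^bsub>G\<^esub> j h = x0 then act R h v else 0))"
    using k v lin_0[OF rep_lin[OF R] fds_0[OF V]] by (intro sum.cong refl) (simp add: rep_mult[OF R])
  also have "\<dots> = act R (inv\<^bsub>H\<^esub> k) (\<Sum>h\<in>carrier H. if g \<otimes>\<^bsub>G\<^esub> j h = x0 then act R h v else 0)"
    by (rule lin_sum'[symmetric, OF rep_lin[OF R] fds_subspace[OF V]]) (use k term_in[OF v] in auto)
  finally have e: "(\<Sum>h\<in>carrier H. if g \<otimes>\<^bsub>G\<^esub> j k \<otimes>\<^bsub>G\<^esub> j h = x0 then act R h v else 0)
      = act R (inv\<^bsub>H\<^esub> k) (\<Sum>h\<in>carrier H. if g \<otimes>\<^bsub>G\<^esub> j h = x0 then act R h v else 0)" .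
  have "(\<Sum>h\<in>carrier H. if g \<otimes>\<^bsub>G\<^esub> j h = x0 then act R h v else 0) \<in> V"
    by (rule fds_sum[OF V]) (rule term_in[OF v])
  then show "slice (g \<otimes>\<^bsub>G\<^esub> j k) (\<iota> x0 v) = act R (inv\<^bsub>H\<^esub> k) (slice g (\<iota> x0 v))"
    using g k by (simp add: slice_\<iota> j_in e lin_scale[OF rep_lin[OF R]])
qed

lemma \<iota>_lin: "lin V M (\<iota> x0)"
proof (rule linI)
  show "\<iota> x0 v \<in> M" if "v \<in> V" for v by (rule \<iota>_in[OF that])
  have L: "lin V V (\<lambda>v. \<Sum>h\<in>carrier H. if b h then act R h v else 0)" for b
  proof (rule lin_Sum[OF V])
    fix h assume "h \<in> carrier H"
    then show "lin V V (\<lambda>v. if b h then act R h v else 0)"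
      using rep_lin[OF R] by (cases "b h") (auto intro: linI fds_0[OF V])
  qed
  show "\<iota> x0 (u + v) = \<iota> x0 u + \<iota> x0 v" if "u \<in> V" "v \<in> V" for u v
    by (rule slice_eqI)
       (simp add: slice_add slice_\<iota> lin_add[OF L that] cfun.scale_right_distrib)
  show "\<iota> x0 (cscale c v) = cscale c (\<iota> x0 v)" if "v \<in> V" for c v
    by (rule slice_eqI) (simp add: slice_scale slice_\<iota> lin_scale[OF L that] mult.commute)
qed

lemma \<iota>_slice: assumes f: "f \<in> M" shows "(\<Sum>x\<in>carrier G. \<iota> x (slice x f)) = f"
proof (rule slice_eqI)
  fix g
  show "slice g (\<Sum>x\<in>carrier G. \<iota> x (slice x f)) = slice g f"
  proof (cases "g \<in> carrier G")
    case True
    have "slice g (\<Sum>x\<in>carrier G. \<iota> x (slice x f)) = cscale (1 / n) (\<Sum>x\<in>carrier G. \<Sum>h\<in>carrier H.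
        if g \<otimes>\<^bsub>G\<^esub> j h = x then act R h (slice x f) else 0)"
      using True by (simp add: slice_sum slice_\<iota> cfun.scale_sum_right)
    also have "(\<Sum>x\<in>carrier G. \<Sum>h\<in>carrier H. if g \<otimes>\<^bsub>G\<^esub> j h = x then act R h (slice x f) else 0)
      = (\<Sum>h\<in>carrier H. \<Sum>x\<in>carrier G. if g \<otimes>\<^bsub>G\<^esub> j h = x then act R h (slice x f) else 0)"
      by (rule sum.swap)
    also have "\<dots> = (\<Sum>h\<in>carrier H. slice g f)"
    proof (rule sum.cong[OF refl])
      fix h assume h: "h \<in> carrier H"
      have "(\<Sum>x\<in>carrier G. if g \<otimes>\<^bsub>G\<^esub> j h = x then act R h (slice x f) else 0) = act R h (slice (g \<otimes>\<^bsub>G\<^esub> j h) f)"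
        using True h fin_G by (simp add: sum.delta' j_in)
      also have "\<dots> = slice g f" using f True h by (simp add: M_iff rep_inv[OF R])
      finally show "(\<Sum>x\<in>carrier G. if g \<otimes>\<^bsub>G\<^esub> j h = x then act R h (slice x f) else 0) = slice g f" .
    qed
    also have "\<dots> = cscale n (slice g f)" by (simp add: cscale_def fun_eq_iff)
    finally show ?thesis using n by simp
  next
    case False
    then show ?thesis using f by (simp add: slice_sum slice_\<iota> M_iff)
  qed
qed

lemma M: "fds M"
  by (rule fds_resolution[where I = "carrier G" and V = "\<lambda>_. V" and \<iota> = \<iota> and p = slice])
     (use fin_G V M_subspace \<iota>_lin \<iota>_slice in \<open>auto simp: M_iff\<close>)

lemma act_lin: "g \<in> carrier G \<Longrightarrow> lin M M (act (ind G H j R) g)"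
proof (rule linI)
  show "act (ind G H j R) g (u + v) = act (ind G H j R) g u + act (ind G H j R) g v" for u v
    by (rule slice_eqI) (simp add: slice_act slice_add)
  show "act (ind G H j R) g (cscale c v) = cscale c (act (ind G H j R) g v)" for c v
    by (rule slice_eqI) (simp add: slice_act slice_scale)
qed (rule act_M)

lemma representation_ind: "representation G (ind G H j R)"
proof (rule representationI)
  fix f assume f: "f \<in> M"
  then have out: "slice x f = 0" if "x \<notin> carrier G" for x using that by (simp add: M_iff)
  show "act (ind G H j R) \<one>\<^bsub>G\<^esub> f = f"
    by (rule slice_eqI) (simp add: slice_act out)
  show "act (ind G H j R) (g \<otimes>\<^bsub>G\<^esub> h) f = act (ind G H j R) g (act (ind G H j R) h f)"
    if "g \<in> carrier G" "h \<in> carrier G" for g h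
    by (rule slice_eqI) (use that in \<open>simp add: slice_act G.inv_mult_group G.m_assoc\<close>)
qed (use G.is_group M act_lin in auto)

text \<open>The identity is resolved over all x in \<open>G\<close>. The diagonal part of g at x
  retains exactly the h with g x = x (j h), which are the terms of Frobenius' formula.\<close>

lemma chr_ind:
  assumes g: "g \<in> carrier G" shows "chr (ind G H j R) g = icf G H j (chr R) g"
proof -
  have "chr (ind G H j R) g = (\<Sum>x\<in>carrier G. tr V (\<lambda>v. slice x (act (ind G H j R) g (\<iota> x v))))"
    unfolding chr_def
    by (rule tr_resolution[OF V M \<iota>_lin _ \<iota>_slice act_lin[OF g]])
       (rule linI, simp only: M_iff, simp only: slice_add, simp only: slice_scale)
  also have "\<dots> = (\<Sum>x\<in>carrier G. (\<Sum>h\<in>carrier H. if g \<otimes>\<^bsub>G\<^esub> x = x \<otimes>\<^bsub>G\<^esub> j h then chr R h else 0) / n)"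
  proof (rule sum.cong[OF refl])
    fix x assume x: "x \<in> carrier G"
    have iff: "inv\<^bsub>G\<^esub> g \<otimes>\<^bsub>G\<^esub> x \<otimes>\<^bsub>G\<^esub> j h = x \<longleftrightarrow> g \<otimes>\<^bsub>G\<^esub> x = x \<otimes>\<^bsub>G\<^esub> j h" if "h \<in> carrier H" for h
    proof -
      have "inv\<^bsub>G\<^esub> g \<otimes>\<^bsub>G\<^esub> x \<otimes>\<^bsub>G\<^esub> j h = x \<longleftrightarrow> inv\<^bsub>G\<^esub> g \<otimes>\<^bsub>G\<^esub> (x \<otimes>\<^bsub>G\<^esub> j h) = x"
        using that g x by (simp add: G.m_assoc j_in)
      also have "\<dots> \<longleftrightarrow> x \<otimes>\<^bsub>G\<^esub> j h = g \<otimes>\<^bsub>G\<^esub> x"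
        using G.inv_solve_left'[of x g "x \<otimes>\<^bsub>G\<^esub> j h"] that g x by (simp add: j_in)
      finally show ?thesis by auto
    qed
    have L: "lin V V (\<lambda>v. if b then act R h v else 0)" if "h \<in> carrier H" for b h
      using rep_lin[OF R that] by (cases b) (auto intro: linI fds_0[OF V])
    have "tr V (\<lambda>v. slice x (act (ind G H j R) g (\<iota> x v)))
      = tr V (\<lambda>v. cscale (1 / n) (\<Sum>h\<in>carrier H. if g \<otimes>\<^bsub>G\<^esub> x = x \<otimes>\<^bsub>G\<^esub> j h then act R h v else 0))"
      using x g by (intro tr_cong[OF V]) (simp add: slice_act slice_\<iota> iff cong: sum.cong)
    also have "\<dots> = 1 / n * (\<Sum>h\<in>carrier H. tr V (\<lambda>v. if g \<otimes>\<^bsub>G\<^esub> x = x \<otimes>\<^bsub>G\<^esub> j h then act R h v else 0))"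
    proof -
      have "tr V (\<lambda>v. \<Sum>h\<in>carrier H. if g \<otimes>\<^bsub>G\<^esub> x = x \<otimes>\<^bsub>G\<^esub> j h then act R h v else 0)
        = (\<Sum>h\<in>carrier H. tr V (\<lambda>v. if g \<otimes>\<^bsub>G\<^esub> x = x \<otimes>\<^bsub>G\<^esub> j h then act R h v else 0))"
        by (rule tr_sum[OF V]) (rule L)
      moreover have "lin V V (\<lambda>v. \<Sum>h\<in>carrier H. if g \<otimes>\<^bsub>G\<^esub> x = x \<otimes>\<^bsub>G\<^esub> j h then act R h v else 0)"
        by (rule lin_Sum[OF V]) (rule L)
      ultimately show ?thesis using tr_scale[OF V] by simp
    qed
    also have "\<dots> = 1 / n * (\<Sum>h\<in>carrier H. if g \<otimes>\<^bsub>G\<^esub> x = x \<otimes>\<^bsub>G\<^esub> j h then chr R h else 0)"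
      by (intro arg_cong[of _ _ "(*) (1 / n)"] sum.cong refl) (simp add: chr_def tr_zero[OF V])
    finally show "tr V (\<lambda>v. slice x (act (ind G H j R) g (\<iota> x v)))
      = (\<Sum>h\<in>carrier H. if g \<otimes>\<^bsub>G\<^esub> x = x \<otimes>\<^bsub>G\<^esub> j h then chr R h else 0) / n" by simp
  qed
  finally show ?thesis by (simp add: icf_def sum_divide_distrib)
qed

end

section \<open>External tensor products\<close>

definition pure :: "('x \<Rightarrow> complex) \<Rightarrow> ('y \<Rightarrow> complex) \<Rightarrow> 'x \<times> 'y \<Rightarrow> complex" where
  "pure v w = (\<lambda>(x, y). v x * w y)"

lemma pure_add_left: "pure (u + v) w = pure u w + pure v w"
  and pure_add_right: "pure v (w + w') = pure v w + pure v w'"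
  and pure_scale_left: "pure (cscale c v) w = cscale c (pure v w)"
  and pure_scale_right: "pure v (cscale c w) = cscale c (pure v w)"
  and pure_zero: "pure 0 w = 0" "pure v 0 = 0"
  by (auto simp: pure_def fun_eq_iff cscale_def algebra_simps)

lemma pure_sum_right: "pure v (\<Sum>i\<in>I. f i) = (\<Sum>i\<in>I. pure v (f i))"
proof (induction I rule: infinite_finite_induct)
  case (insert i I)
  then show ?case by (simp only: sum.insert[OF insert(1,2)] pure_add_right)
qed (simp_all only: sum.infinite sum.empty pure_zero not_False_eq_True)

lemma sum_apply: "(\<Sum>i\<in>I. f i) x = (\<Sum>i\<in>I. (f i x :: complex))"
  by (induction I rule: infinite_finite_induct) auto

lemma space_tensor: "space (R \<boxtimes> S) = cfun.span {pure v w |v w. v \<in> space R \<and> w \<in> space S}"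
  by (simp add: rep_tensor_def pure_def)

text \<open>Along a basis of the second factor a tensor is a family of vectors of the first factor,
  so the tensor product can be handled as a direct sum of copies of \<open>space R\<close>.\<close>

lemma tensor_expand:
  assumes V: "fds (space R)" and W: "fds (space S)"
  shows "t \<in> space (R \<boxtimes> S) \<longleftrightarrow> (\<exists>v. (\<forall>c\<in>bas (space S). v c \<in> space R) \<and> t = (\<Sum>c\<in>bas (space S). pure (v c) c))"
proof
  let ?P = "\<lambda>t v. (\<forall>c\<in>bas (space S). v c \<in> space R) \<and> t = (\<Sum>c\<in>bas (space S). pure (v c) c)"
  assume "t \<in> space (R \<boxtimes> S)"
  then have "t \<in> cfun.span {pure v w |v w. v \<in> space R \<and> w \<in> space S}" by (simp only: space_tensor)
  then show "\<exists>v. ?P t v"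
  proof (induction rule: cfun.span_induct_alt)
    case base
    have "?P 0 (\<lambda>_. 0)" using fds_0[OF V] by (simp only: pure_zero sum.neutral_const simp_thms) blast
    then show ?case by (rule exI[of "?P 0"])
  next
    case (step a p t)
    then obtain u w where p: "p = pure u w" and u: "u \<in> space R" and w: "w \<in> space S" by blast
    obtain v where v: "?P t v" using step by blast
    have "p = pure u (\<Sum>c\<in>bas (space S). cscale (crd (space S) w c) c)"
      unfolding p crd_sum[OF W w] ..
    also have "\<dots> = (\<Sum>c\<in>bas (space S). pure (cscale (crd (space S) w c) u) c)"
      by (simp only: pure_sum_right pure_scale_right pure_scale_left)
    finally have "cscale a p + t = (\<Sum>c\<in>bas (space S). pure (cscale a (cscale (crd (space S) w c) u) + v c) c)"
      using v by (simp only: pure_add_left pure_scale_left cfun.scale_sum_right sum.distrib)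
    moreover have "\<forall>c\<in>bas (space S). cscale a (cscale (crd (space S) w c) u) + v c \<in> space R"
      by (intro ballI fds_add[OF V] fds_scale[OF V] u bspec[OF conjunct1[OF v]])
    ultimately show ?case by (intro exI conjI)
  qed
next
  assume "\<exists>v. (\<forall>c\<in>bas (space S). v c \<in> space R) \<and> t = (\<Sum>c\<in>bas (space S). pure (v c) c)"
  then obtain v where v: "\<forall>c\<in>bas (space S). v c \<in> space R" "t = (\<Sum>c\<in>bas (space S). pure (v c) c)"
    by (elim exE conjE)
  show "t \<in> space (R \<boxtimes> S)"
    unfolding space_tensor v(2) using v(1) bas_in[OF W] by (intro cfun.span_sum cfun.span_base) blast
qed

locale tensor_data =
  fixes G :: "('g, 'm) monoid_scheme" and H :: "('h, 'n) monoid_scheme"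
    and R :: "('g, 'x) rep" and S :: "('h, 'y) rep"
  assumes R: "representation G R" and S: "representation H S"
begin

abbreviation "V \<equiv> space R"
abbreviation "W \<equiv> space S"
abbreviation "M \<equiv> space (R \<boxtimes> S)"

lemma V: "fds V" and W: "fds W" using R S by (auto intro: rep_fds)

lemma pure_in: "v \<in> V \<Longrightarrow> w \<in> W \<Longrightarrow> pure v w \<in> M"
  unfolding space_tensor by (intro cfun.span_base) blast

text \<open>The action is defined through slices and its linearity is not visible in advance. It is
  therefore computed on whole sums of pure tensors, and linearity is read off afterwards in
  \<open>act_lin\<close>.\<close>

lemma act_sum_pure:
  assumes g: "g \<in> carrier G" and h: "h \<in> carrier H" and v: "\<And>i. i \<in> I \<Longrightarrow> v i \<in> V" and w: "\<And>i. i \<in> I \<Longrightarrow> w i \<in> W"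
  shows "act (R \<boxtimes> S) (g, h) (\<Sum>i\<in>I. pure (v i) (w i)) = (\<Sum>i\<in>I. pure (act R g (v i)) (act S h (w i)))"
proof (rule ext, clarify)
  fix x y
  have "(\<lambda>y'. (\<Sum>i\<in>I. pure (v i) (w i)) (x', y')) = (\<Sum>i\<in>I. cscale (v i x') (w i))" for x'
    by (simp add: fun_eq_iff sum_apply pure_def cscale_def)
  moreover have "act S h (\<Sum>i\<in>I. cscale (v i x') (w i)) = (\<Sum>i\<in>I. cscale (v i x') (act S h (w i)))" for x'
    by (rule lin_sum[OF rep_lin[OF S h] fds_subspace[OF W] w])
  ultimately have "(\<lambda>x'. act S h (\<lambda>y'. (\<Sum>i\<in>I. pure (v i) (w i)) (x', y')) y)
      = (\<lambda>x'. (\<Sum>i\<in>I. cscale (v i x') (act S h (w i))) y)"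
    by (simp only:)
  also have "\<dots> = (\<Sum>i\<in>I. cscale (act S h (w i) y) (v i))"
    by (simp add: fun_eq_iff sum_apply cscale_def mult.commute)
  finally have "(\<lambda>x'. act S h (\<lambda>y'. (\<Sum>i\<in>I. pure (v i) (w i)) (x', y')) y)
      = (\<Sum>i\<in>I. cscale (act S h (w i) y) (v i))" .
  moreover have "act R g (\<Sum>i\<in>I. cscale (act S h (w i) y) (v i)) = (\<Sum>i\<in>I. cscale (act S h (w i) y) (act R g (v i)))"
    by (rule lin_sum[OF rep_lin[OF R g] fds_subspace[OF V] v])
  ultimately show "act (R \<boxtimes> S) (g, h) (\<Sum>i\<in>I. pure (v i) (w i)) (x, y)
      = (\<Sum>i\<in>I. pure (act R g (v i)) (act S h (w i))) (x, y)"
    by (simp add: rep_tensor_def sum_apply cscale_def pure_def mult.commute)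
qed

lemma act_pure:
  assumes "g \<in> carrier G" "h \<in> carrier H" "v \<in> V" "w \<in> W"
  shows "act (R \<boxtimes> S) (g, h) (pure v w) = pure (act R g v) (act S h w)"
  using act_sum_pure[OF assms(1,2), of "{()}" "\<lambda>_. v" "\<lambda>_. w"] assms by simp

text \<open>The coefficient of the basis vector \<open>c\<close> of the second factor, taken slice
  by slice.\<close>

definition p :: "('y \<Rightarrow> complex) \<Rightarrow> ('x \<times> 'y \<Rightarrow> complex) \<Rightarrow> 'x \<Rightarrow> complex" where
  "p c t = (\<lambda>x. crd W (\<lambda>y. t (x, y)) c)"

lemma p_expand:
  assumes "c \<in> bas W" shows "p c (\<Sum>d\<in>bas W. pure (v d) d) = v c"
proof
  fix x
  have "(\<lambda>y. (\<Sum>d\<in>bas W. pure (v d) d) (x, y)) = (\<Sum>d\<in>bas W. cscale (v d x) d)"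
    by (simp add: fun_eq_iff sum_apply pure_def cscale_def)
  then have "p c (\<Sum>d\<in>bas W. pure (v d) d) x = (\<Sum>d\<in>bas W. v d x * crd W d c)"
    using bas_in[OF W] by (simp add: p_def crd_sum_fun[OF W] crd_scale[OF W] fds_scale[OF W])
  also have "\<dots> = v c x"
    using assms bas(1)[OF W] by (simp add: crd_basis[OF W] if_distrib[of "(*) _"] cong: if_cong)
  finally show "p c (\<Sum>d\<in>bas W. pure (v d) d) x = v c x" .
qed

lemma p_pure:
  assumes "w \<in> W" shows "p c (pure v w) = cscale (crd W w c) v"
proof
  fix x
  have "(\<lambda>y. pure v w (x, y)) = cscale (v x) w" by (simp add: pure_def cscale_def)
  then show "p c (pure v w) x = cscale (crd W w c) v x"
    using crd_scale[OF W assms] by (simp add: p_def cscale_def)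
qed

lemma M_cases:
  assumes "t \<in> M" obtains v where "\<And>c. c \<in> bas W \<Longrightarrow> v c \<in> V" "t = (\<Sum>c\<in>bas W. pure (v c) c)"
proof -
  have "\<exists>v. (\<forall>c\<in>bas W. v c \<in> V) \<and> t = (\<Sum>c\<in>bas W. pure (v c) c)"
    using assms by (simp only: tensor_expand[OF V W])
  then obtain v where v: "\<forall>c\<in>bas W. v c \<in> V" "t = (\<Sum>c\<in>bas W. pure (v c) c)" by (elim exE conjE)
  show ?thesis by (rule that[OF _ v(2)]) (rule bspec[OF v(1)])
qed

lemma p_lin: assumes c: "c \<in> bas W" shows "lin M V (p c)"
proof (rule linI)
  fix t a assume t: "t \<in> M"
  obtain v where v: "\<And>c. c \<in> bas W \<Longrightarrow> v c \<in> V" "t = (\<Sum>c\<in>bas W. pure (v c) c)"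
    by (rule M_cases[OF t]) (rule that; assumption)
  show "p c t \<in> V" unfolding v(2) p_expand[OF c] by (rule v(1)[OF c])
  have "cscale a t = (\<Sum>c\<in>bas W. pure (cscale a (v c)) c)"
    unfolding v(2) by (simp only: cfun.scale_sum_right pure_scale_left)
  then show "p c (cscale a t) = cscale a (p c t)"
    unfolding v(2) by (simp only: p_expand[OF c, of v] p_expand[OF c, of "\<lambda>c. cscale a (v c)"])
  fix t' assume t': "t' \<in> M"
  obtain v' where v': "\<And>c. c \<in> bas W \<Longrightarrow> v' c \<in> V" "t' = (\<Sum>c\<in>bas W. pure (v' c) c)"
    by (rule M_cases[OF t']) (rule that; assumption)
  have "t + t' = (\<Sum>c\<in>bas W. pure (v c + v' c) c)"
    unfolding v(2) v'(2) by (simp only: pure_add_left sum.distrib)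
  then show "p c (t + t') = p c t + p c t'"
    unfolding v(2) v'(2) by (simp only: p_expand[OF c, of v] p_expand[OF c, of v'] p_expand[OF c, of "\<lambda>c. v c + v' c"])
qed

lemma \<iota>_lin: "w \<in> W \<Longrightarrow> lin V M (\<lambda>v. pure v w)"
  by (rule linI) (simp_all only: pure_in pure_add_left pure_scale_left)

lemma \<iota>_p: "t \<in> M \<Longrightarrow> (\<Sum>c\<in>bas W. pure (p c t) c) = t"
  by (erule M_cases) (simp add: p_expand cong: sum.cong)

lemma M_subspace: "cfun.subspace M" by (simp add: space_tensor)

lemma M: "fds M"
  by (rule fds_resolution[where I = "bas W" and V = "\<lambda>_. V" and \<iota> = "\<lambda>c v. pure v c" and p = p])
     (use V bas[OF W] bas_in[OF W] M_subspace \<iota>_lin \<iota>_p lin_in[OF p_lin] in auto)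

lemma act_expand:
  assumes g: "g \<in> carrier G" and h: "h \<in> carrier H" and t: "t \<in> M"
  shows "act (R \<boxtimes> S) (g, h) t = (\<Sum>c\<in>bas W. pure (act R g (p c t)) (act S h c))"
proof -
  have "act (R \<boxtimes> S) (g, h) t = act (R \<boxtimes> S) (g, h) (\<Sum>c\<in>bas W. pure (p c t) c)" by (simp only: \<iota>_p[OF t])
  also have "\<dots> = (\<Sum>c\<in>bas W. pure (act R g (p c t)) (act S h c))"
    by (rule act_sum_pure[OF g h]) (auto intro: lin_in[OF p_lin] t bas_in[OF W])
  finally show ?thesis .
qed

lemma act_lin:
  assumes g: "g \<in> carrier G" and h: "h \<in> carrier H" shows "lin M M (act (R \<boxtimes> S) (g, h))"
proof -
  have "lin M M (\<lambda>t. \<Sum>c\<in>bas W. pure (act R g (p c t)) (act S h c))"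
    by (intro lin_Sum[OF M] lin_comp[OF lin_comp[OF p_lin rep_lin[OF R g]] \<iota>_lin])
       (auto intro: rep_in[OF S h] bas_in[OF W])
  then show ?thesis
    unfolding lin_def clinear_on_def using act_expand[OF g h] M_subspace
    by (simp add: Pi_iff cfun.subspace_add cfun.subspace_scale)
qed

lemma representation_tensor: "representation (G \<times>\<times> H) (R \<boxtimes> S)"
proof (rule representationI)
  show "group (G \<times>\<times> H)" using R S by (intro DirProd_group) (auto intro: rep_group)
  show "fds M" by (rule M)
  show "lin M M (act (R \<boxtimes> S) g)" if "g \<in> carrier (G \<times>\<times> H)" for g using that act_lin by auto
  fix t assume t: "t \<in> M"
  have pc: "p c t \<in> V" if "c \<in> bas W" for c by (rule lin_in[OF p_lin[OF that] t])
  interpret G: group G using R by (rule rep_group)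
  interpret H: group H using S by (rule rep_group)
  show "act (R \<boxtimes> S) \<one>\<^bsub>G \<times>\<times> H\<^esub> t = t"
    using act_expand[OF G.one_closed H.one_closed t] \<iota>_p[OF t]
    by (simp add: rep_one[OF R] rep_one[OF S] pc bas_in[OF W] cong: sum.cong)
  fix a b assume "a \<in> carrier (G \<times>\<times> H)" "b \<in> carrier (G \<times>\<times> H)"
  then obtain g h g' h' where a: "a = (g, h)" "g \<in> carrier G" "h \<in> carrier H"
    and b: "b = (g', h')" "g' \<in> carrier G" "h' \<in> carrier H" by auto
  show "act (R \<boxtimes> S) (a \<otimes>\<^bsub>G \<times>\<times> H\<^esub> b) t = act (R \<boxtimes> S) a (act (R \<boxtimes> S) b t)"
    using a b act_expand[OF _ _ t] act_sum_pure[of g h "bas W" "\<lambda>c. act R g' (p c t)" "\<lambda>c. act S h' c"]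
    by (simp add: rep_in[OF R] rep_in[OF S] pc bas_in[OF W] rep_mult[OF R] rep_mult[OF S] cong: sum.cong)
qed

text \<open>The copy of \<open>V\<close> belonging to the basis vector c contributes the diagonal
  entry of h at c times the trace of g.\<close>

lemma chr_tensor:
  assumes g: "g \<in> carrier G" and h: "h \<in> carrier H" shows "chr (R \<boxtimes> S) (g, h) = chr R g * chr S h"
proof -
  have "chr (R \<boxtimes> S) (g, h) = (\<Sum>c\<in>bas W. tr V (\<lambda>v. p c (act (R \<boxtimes> S) (g, h) (pure v c))))"
    unfolding chr_def
    by (rule tr_resolution[OF V M \<iota>_lin p_lin \<iota>_p act_lin[OF g h]]) (auto intro: bas_in[OF W])
  also have "\<dots> = (\<Sum>c\<in>bas W. crd W (act S h c) c * chr R g)"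
  proof (rule sum.cong[OF refl])
    fix c assume c: "c \<in> bas W"
    have "tr V (\<lambda>v. p c (act (R \<boxtimes> S) (g, h) (pure v c))) = tr V (\<lambda>v. cscale (crd W (act S h c) c) (act R g v))"
      using c by (intro tr_cong[OF V]) (simp add: act_pure[OF g h] p_pure rep_in[OF S h] bas_in[OF W])
    then show "tr V (\<lambda>v. p c (act (R \<boxtimes> S) (g, h) (pure v c))) = crd W (act S h c) c * chr R g"
      using tr_scale[OF V rep_lin[OF R g]] by (simp add: chr_def)
  qed
  also have "\<dots> = chr R g * chr S h" by (simp add: chr_def[of S] tr_def[of W] sum_distrib_left mult.commute)
  finally show ?thesis .
qed

end

section \<open>Sums and restrictions\<close>

lemma fds_UNIV_unit: "fds (UNIV :: (unit \<Rightarrow> complex) set)"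
  and card_bas_unit: "card (bas (UNIV :: (unit \<Rightarrow> complex) set)) = 1"
proof -
  let ?e = "\<lambda>_::unit. 1 :: complex"
  have sp: "cfun.span {?e} = UNIV"
  proof -
    have "v \<in> cfun.span {?e}" for v
    proof -
      have "v = cscale (v ()) ?e" by (simp add: cscale_def fun_eq_iff)
      then show ?thesis unfolding cfun.span_singleton by blast
    qed
    then show ?thesis by blast
  qed
  then show F: "fds (UNIV :: (unit \<Rightarrow> complex) set)" unfolding fds_def by (intro exI[of _ "{?e}"]) simp
  have "?e \<noteq> 0" by (simp add: fun_eq_iff)
  then have "cfun.independent {?e}" by (metis cfun.dependent_single)
  then have "card {?e} = cfun.dim (UNIV :: (unit \<Rightarrow> complex) set)"
    using sp by (intro cfun.basis_card_eq_dim) auto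
  moreover have "card (bas (UNIV :: (unit \<Rightarrow> complex) set)) = cfun.dim (UNIV :: (unit \<Rightarrow> complex) set)"
    using bas[OF F] by (intro cfun.basis_card_eq_dim) auto
  ultimately show "card (bas (UNIV :: (unit \<Rightarrow> complex) set)) = 1" by simp
qed

lemma representation_char_rep:
  assumes "group G" "\<chi> \<one>\<^bsub>G\<^esub> = 1" "\<And>g h. g \<in> carrier G \<Longrightarrow> h \<in> carrier G \<Longrightarrow> \<chi> (g \<otimes>\<^bsub>G\<^esub> h) = \<chi> g * \<chi> h"
  shows "representation G (char_rep \<chi>)"
  by (rule representationI)
     (use assms fds_UNIV_unit in \<open>auto simp: char_rep_def cfun.scale_right_distrib mult.commute intro!: linI\<close>)

lemma chr_char_rep: "chr (char_rep \<chi>) g = \<chi> g"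
  using tr_scale[OF fds_UNIV_unit lin_id[OF subset_refl], of "\<chi> g"] tr_id[OF fds_UNIV_unit] card_bas_unit
  by (simp add: chr_def char_rep_def)

lemma ip_chr_chr_nat:
  assumes R: "representation G R" and S: "representation G S" and fin: "finite (carrier G)"
  shows "\<exists>k::nat. ip G (chr R) (chr S) = of_nat k"
proof -
  obtain Us where Us: "\<forall>U\<in>set Us. invariant_subspace G R U \<and> irreducible_rep G (sub R U)"
    "\<forall>g\<in>carrier G. chr R g = (\<Sum>U\<leftarrow>Us. chr (sub R U) g)"
    using decomposition[OF R fin] by blast
  have "ip G (chr R) (chr S) = ip G (\<lambda>g. \<Sum>U\<leftarrow>Us. chr (sub R U) g) (chr S)"
    using Us(2) by (intro ip_cong[OF rep_group[OF R]]) auto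
  also have "\<dots> = (\<Sum>U\<leftarrow>Us. ip G (chr (sub R U)) (chr S))" by (rule ip_sum_list_left)
  also have "\<dots> \<in> \<nat>"
    using Us(1)
  proof (induction Us)
    case (Cons U Us)
    then have "irreducible_rep G (sub R U)" by simp
    then obtain k :: nat where "ip G (chr S) (chr (sub R U)) = of_nat k"
      by (rule ip_chr_nat[OF S _ fin]) (rule that; assumption)
    then show ?case using Cons ip_commute[OF rep_group[OF R], of "chr (sub R U)" "chr S"] by simp
  qed simp
  finally show ?thesis by (simp add: Nats_def image_iff)
qed

text \<open>Expanding the square: the cross terms are twice an inner product of characters, which is
  a natural number.\<close>

lemma ip_chr_split:
  assumes R: "representation G R" and fin: "finite (carrier G)"
    and U: "invariant_subspace G R U" "invariant_subspace G R U'"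
    and chr: "\<And>g. g \<in> carrier G \<Longrightarrow> chr R g = chr (sub R U) g + chr (sub R U') g"
  shows "\<exists>k::nat. ip G (chr R) (chr R) = ip G (chr (sub R U)) (chr (sub R U)) +
    ip G (chr (sub R U')) (chr (sub R U')) + of_nat k"
proof -
  note G = rep_group[OF R] and rU = invariant_rep[OF R U(1)] and rU' = invariant_rep[OF R U(2)]
  let ?a = "chr (sub R U)" and ?b = "chr (sub R U')"
  obtain k :: nat where k: "ip G ?a ?b = of_nat k" using ip_chr_chr_nat[OF rU rU' fin] by blast
  have "ip G (chr R) (chr R) = ip G (\<lambda>g. ?a g + ?b g) (chr R)" by (rule ip_cong[OF G]) (simp_all add: chr)
  also have "\<dots> = ip G ?a (chr R) + ip G ?b (chr R)" by (rule ip_add_left)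
  also have "ip G ?a (chr R) = ip G (chr R) ?a" by (rule ip_commute[OF G])
  also have "\<dots> = ip G (\<lambda>g. ?a g + ?b g) ?a" by (rule ip_cong[OF G]) (simp_all add: chr)
  also have "\<dots> = ip G ?a ?a + ip G ?b ?a" by (rule ip_add_left)
  also have "ip G ?b (chr R) = ip G (chr R) ?b" by (rule ip_commute[OF G])
  also have "\<dots> = ip G (\<lambda>g. ?a g + ?b g) ?b" by (rule ip_cong[OF G]) (simp_all add: chr)
  also have "\<dots> = ip G ?a ?b + ip G ?b ?b" by (rule ip_add_left)
  finally have "ip G (chr R) (chr R) = ip G ?a ?a + ip G ?b ?b + of_nat (2 * k)"
    using ip_commute[OF G, of ?b ?a] k by simp
  then show ?thesis by blast
qed

lemma ip_chr_self_pos: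
  assumes R: "representation G R" and fin: "finite (carrier G)" and nz: "space R \<noteq> {0}"
  shows "\<exists>k. ip G (chr R) (chr R) = of_nat (Suc k)"
proof -
  obtain Us where Us: "\<forall>U\<in>set Us. invariant_subspace G R U \<and> irreducible_rep G (sub R U)"
    "\<forall>g\<in>carrier G. chr R g = (\<Sum>U\<leftarrow>Us. chr (sub R U) g)"
    using decomposition[OF R fin] by blast
  have "Us \<noteq> []"
    using Us(2)[rule_format, OF monoid.one_closed[OF group.is_monoid[OF rep_group[OF R]]]]
      chr_one[OF R] dim_pos[OF R nz] by auto
  then obtain U where "U \<in> set Us" by fastforce
  then have U: "invariant_subspace G R U" "irreducible_rep G (sub R U)" using Us(1) by auto
  obtain U' where U': "invariant_subspace G R U'"
    and chr: "\<And>g. g \<in> carrier G \<Longrightarrow> chr R g = chr (sub R U) g + chr (sub R U') g"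
    by (rule complement[OF R fin U(1)]) (rule that; assumption)
  obtain k l :: nat where "ip G (chr R) (chr R) = ip G (chr (sub R U)) (chr (sub R U)) +
      ip G (chr (sub R U')) (chr (sub R U')) + of_nat k"
    "ip G (chr (sub R U')) (chr (sub R U')) = of_nat l"
    using ip_chr_split[OF R fin U(1) U' chr] ip_chr_chr_nat[OF invariant_rep[OF R U'] invariant_rep[OF R U'] fin] by blast
  then have "ip G (chr R) (chr R) = of_nat (Suc (l + k))" using ip_chr_self[OF U(2) fin] by simp
  then show ?thesis by blast
qed

text \<open>Two nonzero complementary pieces would each contribute at least 1 to the norm, and the
  cross terms are not negative; norm 1 leaves no room for a proper invariant subspace.\<close>

lemma irreducibleI:
  assumes R: "representation G R" and fin: "finite (carrier G)" and ip: "ip G (chr R) (chr R) = 1"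
  shows "irreducible_rep G R"
  unfolding irreducible_rep_def
proof (intro conjI allI impI R notI)
  assume "space R = {0}"
  then have "ip G (chr R) (chr R) = 0" using chr_zero[OF R] by (simp add: ip_def)
  then show False using ip by simp
next
  fix U assume U: "invariant_subspace G R U"
  show "U = {0} \<or> U = space R"
  proof (rule ccontr)
    assume nt: "\<not> (U = {0} \<or> U = space R)"
    obtain U' where U': "invariant_subspace G R U'" "space R = {u + u' |u u'. u \<in> U \<and> u' \<in> U'}"
      and chr: "\<And>g. g \<in> carrier G \<Longrightarrow> chr R g = chr (sub R U) g + chr (sub R U') g"
      by (rule complement[OF R fin U]) (rule that; assumption)
    have "U' \<noteq> {0}"
    proof
      assume "U' = {0}"
      then have "space R = U" unfolding U'(2) by simp
      then show False using nt by simp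
    qed
    then obtain a b where "ip G (chr (sub R U)) (chr (sub R U)) = of_nat (Suc a)"
      "ip G (chr (sub R U')) (chr (sub R U')) = of_nat (Suc b)"
      using ip_chr_self_pos[OF invariant_rep[OF R U] fin] ip_chr_self_pos[OF invariant_rep[OF R U'(1)] fin] nt
      by auto
    moreover obtain k :: nat where "ip G (chr R) (chr R) = ip G (chr (sub R U)) (chr (sub R U)) +
      ip G (chr (sub R U')) (chr (sub R U')) + of_nat k"
      using ip_chr_split[OF R fin U U'(1) chr] by blast
    ultimately have "(of_nat 1 :: complex) = of_nat (Suc a + Suc b + k)" using ip by simp
    then have "1 = Suc a + Suc b + k" by (simp only: of_nat_eq_iff)
    then show False by simp
  qed
qed

lemma irreducible_char_rep:
  assumes R: "representation G (char_rep \<chi>)" and fin: "finite (carrier G)"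
  shows "irreducible_rep G (char_rep \<chi>)"
proof (rule irreducibleI[OF R fin])
  interpret group G using R by (rule rep_group)
  have "chr (char_rep \<chi>) g * chr (char_rep \<chi>) (inv\<^bsub>G\<^esub> g) = 1" if g: "g \<in> carrier G" for g
  proof -
    let ?e = "\<lambda>_::unit. 1 :: complex"
    have e: "?e \<in> space (char_rep \<chi>)" by (simp add: char_rep_def)
    have "cscale (\<chi> g) (cscale (\<chi> (inv\<^bsub>G\<^esub> g)) ?e) = ?e"
      using rep_inv(2)[OF R g e] by (simp add: char_rep_def)
    then have "\<chi> g * \<chi> (inv\<^bsub>G\<^esub> g) = 1" by (simp add: cscale_def fun_eq_iff)
    then show ?thesis by (simp add: chr_char_rep)
  qed
  then show "ip G (chr (char_rep \<chi>)) (chr (char_rep \<chi>)) = 1"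
    using order_pos[OF is_group fin] by (simp add: ip_def)
qed

text \<open>The norm of the product character is the product of the norms, and norm 1 implies
  irreducibility.\<close>

lemma irreducible_tensor:
  assumes R: "irreducible_rep G R" and S: "irreducible_rep H S"
    and fin: "finite (carrier G)" "finite (carrier H)"
  shows "irreducible_rep (G \<times>\<times> H) (R \<boxtimes> S)"
proof -
  have RR: "representation G R" and RS: "representation H S" using R S by (auto simp: irreducible_rep_def)
  have 1: "ip G (chr R) (chr R) = 1" "ip H (chr S) (chr S) = 1"
    using ip_chr_self[OF R fin(1)] ip_chr_self[OF S fin(2)] by auto
  interpret tensor_data G H R S using RR RS by unfold_locales
  interpret G: group G using RR by (rule rep_group)
  interpret H: group H using RS by (rule rep_group)
  have "ip (G \<times>\<times> H) (chr (R \<boxtimes> S)) (chr (R \<boxtimes> S)) = ip G (chr R) (chr R) * ip H (chr S) (chr S)"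
    unfolding ip_def sum_product times_divide_times_eq
    by (simp add: DirProd_def[of G H] sum.cartesian_product card_cartesian_product)
       (auto simp: chr_tensor inv_DirProd[OF G.is_group H.is_group, unfolded DirProd_def] intro!: sum.cong)
  then show ?thesis
    using 1 representation_tensor fin
    by (intro irreducibleI) (auto simp: DirProd_def)
qed

lemma representation_restrict:
  assumes R: "representation G R" and H: "group H" and j: "j \<in> hom H G"
  shows "representation H \<lparr>space = space R, act = \<lambda>h. act R (j h)\<rparr>"
proof -
  interpret H: group H by fact
  interpret G: group G using R by (rule rep_group)
  interpret group_hom H G j using j by unfold_locales
  show ?thesis
    by (rule representationI)
       (use H rep_fds[OF R] rep_lin[OF R] rep_one[OF R] rep_mult[OF R] in auto)
qed

lemma chr_restrict: "chr \<lparr>space = space R, act = \<lambda>h. act R (j h)\<rparr> h = chr R (j h)"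
  by (simp add: chr_def)

text \<open>The two summands have different coordinate types, whereas the family in
  \<open>tr_resolution\<close> has only one. The trace is therefore split by hand with
  \<open>tr_comm\<close>.\<close>

lemma
  assumes R: "representation G R" and S: "representation G S"
  shows representation_plus: "representation G (R \<oplus>\<^sub>r S)"
    and chr_plus: "g \<in> carrier G \<Longrightarrow> chr (R \<oplus>\<^sub>r S) g = chr R g + chr S g"
proof -
  let ?M = "space (R \<oplus>\<^sub>r S)"
  let ?p = "\<lambda>m x. m (Inl x)" and ?q = "\<lambda>m y. m (Inr y)"
  let ?i = "\<lambda>v. case_sum v (\<lambda>_. 0)" and ?k = "\<lambda>w. case_sum (\<lambda>_. 0) w"
  note V = rep_fds[OF R] and W = rep_fds[OF S]
  have M: "m \<in> ?M \<longleftrightarrow> ?p m \<in> space R \<and> ?q m \<in> space S" for m by (simp add: rep_plus_def)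
  have p_add: "?p (m + m') = ?p m + ?p m'" and q_add: "?q (m + m') = ?q m + ?q m'"
    and p_scale: "?p (cscale c m) = cscale c (?p m)" and q_scale: "?q (cscale c m) = cscale c (?q m)"
    for m m' :: "'c + 'd \<Rightarrow> complex" and c by (auto simp: cscale_def)
  have p0: "?p 0 = 0" and q0: "?q 0 = 0" and zero: "(\<lambda>_. 0) = 0" by (auto simp: fun_eq_iff)
  have sM: "cfun.subspace ?M"
  proof (rule cfun.subspaceI)
    show "0 \<in> ?M" unfolding M p0 q0 using fds_0[OF V] fds_0[OF W] by blast
    show "m + m' \<in> ?M" if "m \<in> ?M" "m' \<in> ?M" for m m'
      using that unfolding M p_add q_add using fds_add[OF V] fds_add[OF W] by blast
    show "cscale c m \<in> ?M" if "m \<in> ?M" for c m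
      using that unfolding M p_scale q_scale using fds_scale[OF V] fds_scale[OF W] by blast
  qed
  have i: "lin (space R) ?M ?i" and k: "lin (space S) ?M ?k"
    using fds_0[OF V] fds_0[OF W]
    by (auto intro!: linI simp: M zero fun_eq_iff cscale_def split: sum.split)
  have p: "lin ?M (space R) ?p" and q: "lin ?M (space S) ?q"
    by (rule linI; simp only: M p_add q_add p_scale q_scale)+
  have res: "?i (?p m) + ?k (?q m) = m" for m :: "'c + 'd \<Rightarrow> complex" by (auto simp: fun_eq_iff split: sum.split)
  have fM: "fds ?M"
  proof -
    let ?E = "?i ` bas (space R) \<union> ?k ` bas (space S)"
    have "m \<in> cfun.span ?E" if m: "m \<in> ?M" for m
    proof -
      have "?i (?p m) \<in> cfun.span ?E"
        unfolding lin_crd[OF i V lin_in[OF p m]] by (intro cfun.span_sum cfun.span_scale cfun.span_base) blast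
      moreover have "?k (?q m) \<in> cfun.span ?E"
        unfolding lin_crd[OF k W lin_in[OF q m]] by (intro cfun.span_sum cfun.span_scale cfun.span_base) blast
      ultimately show ?thesis using cfun.span_add res by metis
    qed
    moreover have "cfun.span ?E \<subseteq> ?M"
      by (rule cfun.span_minimal[OF _ sM]) (use lin_in[OF i] lin_in[OF k] bas_in[OF V] bas_in[OF W] in auto)
    moreover have "finite ?E" using bas(1)[OF V] bas(1)[OF W] by simp
    ultimately show ?thesis unfolding fds_def by (intro exI[of _ ?E]) blast
  qed
  have act: "?p (act (R \<oplus>\<^sub>r S) g m) = act R g (?p m)" "?q (act (R \<oplus>\<^sub>r S) g m) = act S g (?q m)" for g m
    by (simp_all add: rep_plus_def)
  have ext: "m = m'" if "?p m = ?p m'" "?q m = ?q m'" for m m' :: "'c + 'd \<Rightarrow> complex"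
    using that by (auto simp: fun_eq_iff split_sum_all)
  have L: "lin ?M ?M (act (R \<oplus>\<^sub>r S) g)" if g: "g \<in> carrier G" for g
  proof (rule linI)
    fix m c assume m: "m \<in> ?M"
    then have pm: "?p m \<in> space R" "?q m \<in> space S" by (auto simp: M)
    show "act (R \<oplus>\<^sub>r S) g m \<in> ?M" unfolding M act using rep_in[OF R g pm(1)] rep_in[OF S g pm(2)] by blast
    show "act (R \<oplus>\<^sub>r S) g (cscale c m) = cscale c (act (R \<oplus>\<^sub>r S) g m)"
      by (rule ext) (simp_all only: act p_scale q_scale lin_scale[OF rep_lin[OF R g] pm(1)] lin_scale[OF rep_lin[OF S g] pm(2)])
    fix m' assume m': "m' \<in> ?M"
    then have pm': "?p m' \<in> space R" "?q m' \<in> space S" by (auto simp: M)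
    show "act (R \<oplus>\<^sub>r S) g (m + m') = act (R \<oplus>\<^sub>r S) g m + act (R \<oplus>\<^sub>r S) g m'"
      by (rule ext) (simp_all only: act p_add q_add lin_add[OF rep_lin[OF R g] pm(1) pm'(1)]
          lin_add[OF rep_lin[OF S g] pm(2) pm'(2)])
  qed
  show "representation G (R \<oplus>\<^sub>r S)"
  proof (rule representationI[OF rep_group[OF R] fM L])
    fix m assume m: "m \<in> ?M"
    then have pm: "?p m \<in> space R" "?q m \<in> space S" by (auto simp: M)
    show "act (R \<oplus>\<^sub>r S) \<one>\<^bsub>G\<^esub> m = m"
      by (rule ext) (simp_all only: act rep_one[OF R pm(1)] rep_one[OF S pm(2)])
    fix g h assume g: "g \<in> carrier G" "h \<in> carrier G"
    show "act (R \<oplus>\<^sub>r S) (g \<otimes>\<^bsub>G\<^esub> h) m = act (R \<oplus>\<^sub>r S) g (act (R \<oplus>\<^sub>r S) h m)"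
      by (rule ext) (simp_all only: act rep_mult[OF R g pm(1)] rep_mult[OF S g pm(2)])
  qed
  show "chr (R \<oplus>\<^sub>r S) g = chr R g + chr S g" if g: "g \<in> carrier G"
  proof -
    note A = L[OF g]
    have "chr (R \<oplus>\<^sub>r S) g = tr ?M (\<lambda>m. ?i (?p (act (R \<oplus>\<^sub>r S) g m)) + ?k (?q (act (R \<oplus>\<^sub>r S) g m)))"
      unfolding chr_def by (rule tr_cong[OF fM]) (simp only: res)
    also have "\<dots> = tr ?M (\<lambda>m. ?i (?p (act (R \<oplus>\<^sub>r S) g m))) + tr ?M (\<lambda>m. ?k (?q (act (R \<oplus>\<^sub>r S) g m)))"
      by (rule tr_add[OF fM lin_comp[OF lin_comp[OF A p] i] lin_comp[OF lin_comp[OF A q] k]])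
    also have "tr ?M (\<lambda>m. ?i (?p (act (R \<oplus>\<^sub>r S) g m))) = tr (space R) (\<lambda>v. ?p (act (R \<oplus>\<^sub>r S) g (?i v)))"
      by (rule tr_comm[OF fM V lin_comp[OF A p] i])
    also have "tr ?M (\<lambda>m. ?k (?q (act (R \<oplus>\<^sub>r S) g m))) = tr (space S) (\<lambda>v. ?q (act (R \<oplus>\<^sub>r S) g (?k v)))"
      by (rule tr_comm[OF fM W lin_comp[OF A q] k])
    finally show ?thesis unfolding act by (simp add: chr_def)
  qed
qed

lemma
  assumes I: "finite I" and G: "group G" and R: "\<And>i. i \<in> I \<Longrightarrow> representation G (R i)"
  shows representation_Sum: "representation G (rep_Sum I R)"
    and chr_Sum: "g \<in> carrier G \<Longrightarrow> chr (rep_Sum I R) g = (\<Sum>i\<in>I. chr (R i) g)"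
proof -
  let ?M = "space (rep_Sum I R)"
  let ?p = "\<lambda>i m x. m (i, x)"
  let ?i = "\<lambda>i v. \<lambda>(i', x). if i' = i then v x else 0"
  note V = rep_fds[OF R]
  have M: "m \<in> ?M \<longleftrightarrow> (\<forall>i\<in>I. ?p i m \<in> space (R i)) \<and> (\<forall>i. i \<notin> I \<longrightarrow> ?p i m = 0)" for m
    by (simp add: rep_Sum_def fun_eq_iff)
  have p_add: "?p i (m + m') = ?p i m + ?p i m'" 
    and p_scale: "?p i (cscale c m) = cscale c (?p i m)" and p_zero: "?p i 0 = 0"
    for i m m' c by (auto simp: cscale_def fun_eq_iff)
  have pi: "?p i (?i k v) = (if i = k then v else 0)" for i k v by (auto simp: fun_eq_iff)
  have ext: "m = m'" if "\<And>i. ?p i m = ?p i m'" for m m' using that by (auto simp: fun_eq_iff)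
  have sM: "cfun.subspace ?M"
  proof (rule cfun.subspaceI)
    show "0 \<in> ?M" unfolding M p_zero using fds_0[OF V] by blast
    show "m + m' \<in> ?M" if "m \<in> ?M" "m' \<in> ?M" for m m'
      using that unfolding M p_add using fds_add[OF V] by (auto simp: fun_eq_iff)
    show "cscale c m \<in> ?M" if "m \<in> ?M" for c m
      using that unfolding M p_scale using fds_scale[OF V] by (auto simp: fun_eq_iff cscale_def)
  qed
  have i: "lin (space (R k)) ?M (?i k)" if k: "k \<in> I" for k
  proof (rule linI)
    show "?i k v \<in> ?M" if "v \<in> space (R k)" for v
      unfolding M pi using that k fds_0[OF V] by auto
  qed (auto simp: fun_eq_iff cscale_def)
  have p: "lin ?M (space (R k)) (?p k)" if k: "k \<in> I" for k
    by (rule linI) (use k in \<open>simp_all only: M p_add p_scale\<close>)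
  have res: "(\<Sum>k\<in>I. ?i k (?p k m)) = m" if m: "m \<in> ?M" for m
  proof (rule ext)
    fix i
    have "?p i (\<Sum>k\<in>I. ?i k (?p k m)) = (\<Sum>k\<in>I. ?p i (?i k (?p k m)))"
      by (simp only: sum_apply fun_eq_iff simp_thms)
    also have "\<dots> = (\<Sum>k\<in>I. if i = k then ?p k m else 0)" by (simp only: pi)
    also have "\<dots> = (if i \<in> I then ?p i m else 0)" using I by (simp add: sum.delta')
    also have "\<dots> = ?p i m" using m by (simp add: M)
    finally show "?p i (\<Sum>k\<in>I. ?i k (?p k m)) = ?p i m" .
  qed
  have fM: "fds ?M"
    by (rule fds_resolution[where V = "\<lambda>i. space (R i)" and \<iota> = ?i and p = ?p])
       (use I V sM i res lin_in[OF p] in auto)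
  have act: "?p i (act (rep_Sum I R) g m) = (if i \<in> I then act (R i) g (?p i m) else 0)" for i g m
    by (auto simp: rep_Sum_def fun_eq_iff)
  have L: "lin ?M ?M (act (rep_Sum I R) g)" if g: "g \<in> carrier G" for g
  proof (rule linI)
    fix m c assume m: "m \<in> ?M"
    then have pm: "?p i m \<in> space (R i)" if "i \<in> I" for i using that by (auto simp: M)
    show "act (rep_Sum I R) g m \<in> ?M" unfolding M act using rep_in[OF R g pm] by auto
    show "act (rep_Sum I R) g (cscale c m) = cscale c (act (rep_Sum I R) g m)"
    proof (rule ext)
      show "?p i (act (rep_Sum I R) g (cscale c m)) = ?p i (cscale c (act (rep_Sum I R) g m))" for i
        unfolding p_scale act using lin_scale[OF rep_lin[OF R g] pm, of i] by simp
    qed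
    fix m' assume m': "m' \<in> ?M"
    then have pm': "?p i m' \<in> space (R i)" if "i \<in> I" for i using that by (auto simp: M)
    show "act (rep_Sum I R) g (m + m') = act (rep_Sum I R) g m + act (rep_Sum I R) g m'"
    proof (rule ext)
      show "?p i (act (rep_Sum I R) g (m + m')) = ?p i (act (rep_Sum I R) g m + act (rep_Sum I R) g m')" for i
        unfolding p_add act using lin_add[OF rep_lin[OF R g] pm pm', of i] by simp
    qed
  qed
  show "representation G (rep_Sum I R)"
  proof (rule representationI[OF G fM L])
    fix m assume m: "m \<in> ?M"
    then have pm: "?p i m \<in> space (R i)" if "i \<in> I" for i using that by (auto simp: M)
    have out: "?p i m = 0" if "i \<notin> I" for i using m that by (auto simp: M)
    show "act (rep_Sum I R) \<one>\<^bsub>G\<^esub> m = m"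
    proof (rule ext)
      show "?p i (act (rep_Sum I R) \<one>\<^bsub>G\<^esub> m) = ?p i m" for i
        unfolding act using rep_one[OF R pm] out by simp
    qed
    fix g h assume g: "g \<in> carrier G" "h \<in> carrier G"
    show "act (rep_Sum I R) (g \<otimes>\<^bsub>G\<^esub> h) m = act (rep_Sum I R) g (act (rep_Sum I R) h m)"
    proof (rule ext)
      show "?p i (act (rep_Sum I R) (g \<otimes>\<^bsub>G\<^esub> h) m) = ?p i (act (rep_Sum I R) g (act (rep_Sum I R) h m))" for i
        unfolding act using rep_mult[OF R g pm] by simp
    qed
  qed
  show "chr (rep_Sum I R) g = (\<Sum>i\<in>I. chr (R i) g)" if g: "g \<in> carrier G"
  proof -
    have "chr (rep_Sum I R) g = (\<Sum>k\<in>I. tr (space (R k)) (\<lambda>v. ?p k (act (rep_Sum I R) g (?i k v))))"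
      unfolding chr_def by (rule tr_resolution[OF V fM i p res L[OF g]])
    then show ?thesis unfolding act by (simp add: chr_def cong: sum.cong)
  qed
qed

text \<open>
  If every element of \<open>G\<close> is conjugate to its inverse under \<open>H\<close>, then for \<open>A\<close> in the commutant of
  \<open>H\<close> the function sending \<open>g\<close> to the trace of \<open>g A\<close> is invariant under inversion. Convolution
  of two such functions is commutative (Gelfand's trick), so the commutant has no matrix units.
\<close>

lemma multiplicity_free_restriction:
  assumes R: "irreducible_rep G R" and fin: "finite (carrier G)" and finH: "finite (carrier H)"
    and H: "group H" and j: "j \<in> hom H G"
    and conj: "\<And>g. g \<in> carrier G \<Longrightarrow> \<exists>h\<in>carrier H. inv\<^bsub>G\<^esub> g = j h \<otimes>\<^bsub>G\<^esub> g \<otimes>\<^bsub>G\<^esub> inv\<^bsub>G\<^esub> j h"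
    and P: "irreducible_rep H P"
  shows "ip H (\<lambda>h. chr R (j h)) (chr P) \<in> {0, 1}"
proof (rule ccontr)
  assume contra: "ip H (\<lambda>h. chr R (j h)) (chr P) \<notin> {0, 1}"
  have RR: "representation G R" and nzR: "space R \<noteq> {0}" using R by (auto simp: irreducible_rep_def)
  have RP: "representation H P" using P by (auto simp: irreducible_rep_def)
  interpret G: group G using RR by (rule rep_group)
  interpret H: group H by fact
  have jin: "h \<in> carrier H \<Longrightarrow> j h \<in> carrier G" for h using j by (auto simp: hom_def)
  note V = rep_fds[OF RR]
  let ?V = "space R"
  let ?Q = "\<lparr>space = space R, act = \<lambda>h. act R (j h)\<rparr>"
  have Q: "representation H ?Q" by (rule representation_restrict[OF RR H j])
  have cQ: "chr ?Q h = chr R (j h)" for h by (rule chr_restrict)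
  obtain k :: nat where k: "ip H (chr ?Q) (chr P) = of_nat k"
    "k > 0 \<Longrightarrow> \<exists>U. invariant_subspace H ?Q U \<and> rep_iso H P (sub ?Q U)"
    by (rule ip_chr_nat[OF Q P finH]) (rule that; assumption)
  \<comment> \<open>A multiplicity other than 0 and 1 gives one copy \<open>U\<close> of
    \<open>P\<close> and, since a complement of \<open>U\<close> still has positive multiplicity, a
    second copy \<open>U2\<close> inside that complement.\<close>
  have k2: "k \<ge> 2" using contra k(1) unfolding cQ by (cases "k = 0"; cases "k = 1") auto
  then obtain U where U: "invariant_subspace H ?Q U" "rep_iso H P (sub ?Q U)" using k(2) by auto
  have rU: "representation H (sub ?Q U)" by (rule invariant_rep[OF Q U(1)])
  obtain U' \<pi> where U': "invariant_subspace H ?Q U'" and \<pi>: "ghom H ?Q ?Q \<pi>" "\<And>v. v \<in> space ?Q \<Longrightarrow> \<pi> v \<in> U"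
      "\<And>u. u \<in> U \<Longrightarrow> \<pi> u = u" "U' = {v \<in> space ?Q. \<pi> v = 0}"
    and chr: "\<And>h. h \<in> carrier H \<Longrightarrow> chr ?Q h = chr (sub ?Q U) h + chr (sub ?Q U') h"
    by (rule complement[OF Q finH U(1)]) (rule that; assumption)
  have rU': "representation H (sub ?Q U')" by (rule invariant_rep[OF Q U'])
  obtain k' :: nat where k': "ip H (chr (sub ?Q U')) (chr P) = of_nat k'"
    "k' > 0 \<Longrightarrow> \<exists>U. invariant_subspace H (sub ?Q U') U \<and> rep_iso H P (sub (sub ?Q U') U)"
    by (rule ip_chr_nat[OF rU' P finH]) (rule that; assumption)
  have "ip H (chr ?Q) (chr P) = ip H (\<lambda>h. chr (sub ?Q U) h + chr (sub ?Q U') h) (chr P)"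
    by (rule ip_cong[OF H]) (simp_all add: chr)
  also have "\<dots> = ip H (chr (sub ?Q U)) (chr P) + of_nat k'" by (simp only: ip_add_left k'(1))
  also have "ip H (chr (sub ?Q U)) (chr P) = ip H (chr P) (chr P)"
    by (rule ip_cong[OF H]) (simp_all add: chr_rep_iso[OF RP rU U(2)])
  finally have "(of_nat k :: complex) = of_nat (1 + k')" using k(1) ip_chr_self[OF P finH] by simp
  then have "k' > 0" using k2 by (simp only: of_nat_eq_iff)
  then obtain U2 where "invariant_subspace H (sub ?Q U') U2" "rep_iso H P (sub (sub ?Q U') U2)"
    using k'(2) by blast
  then have U2: "invariant_subspace H ?Q U2" "rep_iso H P (sub ?Q U2)" and U2U': "U2 \<subseteq> U'"
    using invariant_sub[OF U'] by (auto simp: invariant_subspace_def)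
  have rU2: "representation H (sub ?Q U2)" by (rule invariant_rep[OF Q U2(1)])
  obtain \<rho> where \<rho>: "ghom H ?Q ?Q \<rho>" "\<And>v. v \<in> space ?Q \<Longrightarrow> \<rho> v \<in> U2" "\<And>u. u \<in> U2 \<Longrightarrow> \<rho> u = u"
    by (rule maschke[OF Q finH U2(1)]) (rule that; assumption)
  have "rep_iso H (sub ?Q U) (sub ?Q U2)" by (rule rep_iso_trans[OF rep_iso_sym[OF RP U(2)] U2(2)])
  then obtain \<phi> where \<phi>: "ghom H (sub ?Q U) (sub ?Q U2) \<phi>" "bij_betw \<phi> U U2"
    by (auto elim: rep_isoE)
  define \<psi> where "\<psi> = the_inv_into U \<phi>"
  have \<psi>: "ghom H (sub ?Q U2) (sub ?Q U) \<psi>"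
    using rep_iso_inverse(1)[OF rU \<phi>(1)] \<phi>(2) by (simp add: \<psi>_def)
  have \<psi>\<phi>: "\<psi> (\<phi> u) = u" if "u \<in> U" for u
    using that \<phi>(2) by (simp add: \<psi>_def bij_betw_def the_inv_into_f_f)
  have \<phi>\<psi>: "\<phi> (\<psi> u) = u" if "u \<in> U2" for u
    using that \<phi>(2) by (simp add: \<psi>_def bij_betw_def f_the_inv_into_f)
  have UV: "U \<subseteq> ?V" "U2 \<subseteq> ?V" using U(1) U2(1) by (auto simp: invariant_subspace_def)
  have \<pi>0: "\<pi> u = 0" if "u \<in> U2" for u using that U2U' \<pi>(4) by blast
  let ?comm = "\<lambda>A. lin ?V ?V A \<and> (\<forall>h\<in>carrier H. \<forall>v\<in>?V. A (act R (j h) v) = act R (j h) (A v))"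
  let ?t = "\<lambda>A g. tr ?V (\<lambda>v. act R g (A v))"
  \<comment> \<open>\<open>A\<close> and \<open>D\<close> are the matrix units exchanging two isomorphic copies \<open>U\<close> and \<open>U2\<close> of \<open>P\<close>\<close>
  define A where "A v = \<phi> (\<pi> v)" for v
  define D where "D v = \<psi> (\<rho> (v + cscale (- 1) (\<pi> v)))" for v
  have \<pi>V: "\<pi> v \<in> U" "\<pi> v \<in> ?V" if "v \<in> ?V" for v using \<pi>(2)[of v] that UV by auto
  have L\<pi>: "lin ?V ?V \<pi>" using ghom_lin[OF \<pi>(1)] by simp
  have L\<pi>': "lin ?V U \<pi>" using L\<pi> \<pi>(2) by (auto simp: lin_def)
  have L\<rho>: "lin ?V U2 \<rho>" using ghom_lin[OF \<rho>(1)] \<rho>(2) by (auto simp: lin_def)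
  have L\<phi>: "lin U ?V \<phi>" using ghom_lin[OF \<phi>(1)] UV by (auto intro: lin_mono)
  have L\<psi>: "lin U2 ?V \<psi>" using ghom_lin[OF \<psi>] UV by (auto intro: lin_mono)
  have cA: "?comm A"
  proof (intro conjI ballI)
    show "lin ?V ?V A" unfolding A_def[abs_def] by (rule lin_comp[OF L\<pi>' L\<phi>])
    show "A (act R (j h) v) = act R (j h) (A v)" if h: "h \<in> carrier H" and v: "v \<in> ?V" for h v
      using ghom_act[OF \<pi>(1) h, of v] ghom_act[OF \<phi>(1) h, of "\<pi> v"] v \<pi>V by (simp add: A_def)
  qed
  have Ld: "lin ?V ?V (\<lambda>v. v + cscale (- 1) (\<pi> v))"
    by (intro lin_plus V lin_id lin_mult L\<pi>) simp
  have cD: "?comm D"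
  proof (intro conjI ballI)
    show "lin ?V ?V D" unfolding D_def[abs_def] by (rule lin_comp[OF lin_comp[OF Ld L\<rho>] L\<psi>])
    fix h v assume h: "h \<in> carrier H" and v: "v \<in> ?V"
    note LR = rep_lin[OF RR jin[OF h]]
    have "act R (j h) v + cscale (- 1) (\<pi> (act R (j h) v)) = act R (j h) (v + cscale (- 1) (\<pi> v))"
      using ghom_act[OF \<pi>(1) h, of v] v
      by (simp only: lin_add[OF LR v fds_scale[OF V \<pi>V(2)[OF v]]] lin_scale[OF LR \<pi>V(2)[OF v]] rep.simps)
    moreover have d: "v + cscale (- 1) (\<pi> v) \<in> ?V" by (rule lin_in[OF Ld v])
    ultimately show "D (act R (j h) v) = act R (j h) (D v)"
      using ghom_act[OF \<rho>(1) h, of "v + cscale (- 1) (\<pi> v)"] 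
        ghom_act[OF \<psi> h, of "\<rho> (v + cscale (- 1) (\<pi> v))"] lin_in[OF L\<rho> d] by (simp only: D_def rep.simps)
  qed
  have comp: "?comm (\<lambda>v. X (Y v))" if X: "?comm X" and Y: "?comm Y" for X Y
  proof (intro conjI ballI)
    show "lin ?V ?V (\<lambda>v. X (Y v))" by (rule lin_comp[OF conjunct1[OF Y] conjunct1[OF X]])
    fix h v assume h: "h \<in> carrier H" "v \<in> ?V"
    have "Y v \<in> ?V" by (rule lin_in[OF conjunct1[OF Y] h(2)])
    then show "X (Y (act R (j h) v)) = act R (j h) (X (Y v))" using X Y h by simp
  qed
  \<comment> \<open>\<open>X\<close> commutes with the element that conjugates g to its inverse, so
    the conjugation cancels under the trace.\<close>
  have sym: "?t X (inv\<^bsub>G\<^esub> g) = ?t X g" if X: "?comm X" and g: "g \<in> carrier G" for X g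
  proof -
    obtain h where h: "h \<in> carrier H" "inv\<^bsub>G\<^esub> g = j h \<otimes>\<^bsub>G\<^esub> g \<otimes>\<^bsub>G\<^esub> inv\<^bsub>G\<^esub> j h" using conj[OF g] by blast
    note jh = jin[OF h(1)]
    have LX: "lin ?V ?V X" using X by simp
    have X_inv: "act R (inv\<^bsub>G\<^esub> j h) (X (act R (j h) v)) = X v" if v: "v \<in> ?V" for v
      using X h(1) v rep_inv(1)[OF RR jh lin_in[OF LX v]] by simp
    have "?t X (inv\<^bsub>G\<^esub> g) = tr ?V (\<lambda>v. act R (j h) (act R g (act R (inv\<^bsub>G\<^esub> j h) (X v))))"
      unfolding h(2) using jh g lin_in[OF LX]
      by (intro tr_cong[OF V]) (simp add: rep_mult[OF RR] rep_in[OF RR])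
    also have "\<dots> = tr ?V (\<lambda>v. act R g (act R (inv\<^bsub>G\<^esub> j h) (X (act R (j h) v))))"
      by (rule tr_comm[OF V V lin_comp[OF lin_comp[OF LX rep_lin[OF RR]] rep_lin[OF RR g]] rep_lin[OF RR jh]])
         (use jh in simp)
    also have "\<dots> = ?t X g" by (rule tr_cong[OF V]) (simp only: X_inv)
    finally show ?thesis .
  qed
  let ?c = "of_nat (card (carrier G)) / of_nat (card (bas ?V)) :: complex"
  have c: "?c \<noteq> 0" using card_bas_pos[OF V nzR] order_pos[OF G.is_group fin] by simp
  \<comment> \<open>Convolution of the trace functions of \<open>X\<close> and \<open>Y\<close> is,
    up to the scalar \<open>?c\<close>, the trace function of \<open>Y\<close> after
    \<open>X\<close>.\<close>
  have conv: "(\<Sum>x\<in>carrier G. ?t X x * ?t Y (inv\<^bsub>G\<^esub> x \<otimes>\<^bsub>G\<^esub> g)) = ?c * ?t (\<lambda>v. Y (X v)) g"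
    if X: "lin ?V ?V X" and Y: "lin ?V ?V Y" and g: "g \<in> carrier G" for X Y g
  proof -
    have "(\<Sum>x\<in>carrier G. ?t X x * ?t Y (inv\<^bsub>G\<^esub> x \<otimes>\<^bsub>G\<^esub> g))
      = (\<Sum>x\<in>carrier G. ?t X x * tr ?V (\<lambda>v. act R (inv\<^bsub>G\<^esub> x) (act R g (Y v))))"
      using g lin_in[OF Y] by (intro sum.cong refl arg_cong2[of _ _ _ _ "(*)"] tr_cong[OF V]) (simp add: rep_mult[OF RR])
    also have "\<dots> = ?c * tr ?V (\<lambda>v. X (act R g (Y v)))"
      by (rule schur_trace[OF R fin X lin_comp[OF Y rep_lin[OF RR g]]])
    also have "tr ?V (\<lambda>v. X (act R g (Y v))) = tr ?V (\<lambda>v. act R g (Y (X v)))"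
      by (rule tr_comm[OF V V lin_comp[OF Y rep_lin[OF RR g]] X])
    finally show ?thesis .
  qed
  \<comment> \<open>Inversion reverses the order of a convolution but fixes each of the trace
    functions, so both orders of \<open>A\<close> and \<open>D\<close> have the same trace
    function.\<close>
  have commute: "?t (\<lambda>v. A (D v)) g = ?t (\<lambda>v. D (A v)) g" if g: "g \<in> carrier G" for g
  proof -
    have "?c * ?t (\<lambda>v. A (D v)) g = ?c * ?t (\<lambda>v. A (D v)) (inv\<^bsub>G\<^esub> g)"
      using sym[OF comp[OF cA cD] g] by simp
    also have "\<dots> = (\<Sum>x\<in>carrier G. ?t D x * ?t A (inv\<^bsub>G\<^esub> x \<otimes>\<^bsub>G\<^esub> inv\<^bsub>G\<^esub> g))"
      by (rule conv[symmetric]) (use cA cD g in auto)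
    also have "\<dots> = (\<Sum>x\<in>carrier G. ?t D (inv\<^bsub>G\<^esub> (g \<otimes>\<^bsub>G\<^esub> x) \<otimes>\<^bsub>G\<^esub> g) * ?t A (g \<otimes>\<^bsub>G\<^esub> x))"
    proof (rule sum.cong[OF refl])
      fix x assume x: "x \<in> carrier G"
      have "inv\<^bsub>G\<^esub> x \<otimes>\<^bsub>G\<^esub> inv\<^bsub>G\<^esub> g = inv\<^bsub>G\<^esub> (g \<otimes>\<^bsub>G\<^esub> x)" using x g by (simp add: G.inv_mult_group)
      moreover have "inv\<^bsub>G\<^esub> (g \<otimes>\<^bsub>G\<^esub> x) \<otimes>\<^bsub>G\<^esub> g = inv\<^bsub>G\<^esub> x" using x g by (simp add: G.inv_mult_group G.m_assoc)
      ultimately show "?t D x * ?t A (inv\<^bsub>G\<^esub> x \<otimes>\<^bsub>G\<^esub> inv\<^bsub>G\<^esub> g)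
          = ?t D (inv\<^bsub>G\<^esub> (g \<otimes>\<^bsub>G\<^esub> x) \<otimes>\<^bsub>G\<^esub> g) * ?t A (g \<otimes>\<^bsub>G\<^esub> x)"
        using sym[OF cD x] sym[OF cA, of "g \<otimes>\<^bsub>G\<^esub> x"] x g by simp
    qed
    also have "\<dots> = (\<Sum>x\<in>carrier G. ?t D (inv\<^bsub>G\<^esub> x \<otimes>\<^bsub>G\<^esub> g) * ?t A x)"
      by (rule group.sum_group_left[OF G.is_group g, where f = "\<lambda>x. ?t D (inv\<^bsub>G\<^esub> x \<otimes>\<^bsub>G\<^esub> g) * ?t A x"])
    also have "\<dots> = (\<Sum>x\<in>carrier G. ?t A x * ?t D (inv\<^bsub>G\<^esub> x \<otimes>\<^bsub>G\<^esub> g))" by (simp only: mult.commute)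
    also have "\<dots> = ?c * ?t (\<lambda>v. D (A v)) g" by (rule conv) (use cA cD g in auto)
    finally show ?thesis using c by simp
  qed
  have DA: "D (A v) = \<pi> v" if v: "v \<in> ?V" for v
  proof -
    have "\<phi> (\<pi> v) \<in> U2" using \<phi>(2) \<pi>V[OF v] by (auto simp: bij_betw_def)
    then have "\<rho> (\<phi> (\<pi> v) + cscale (- 1) (\<pi> (\<phi> (\<pi> v)))) = \<phi> (\<pi> v)"
      using \<pi>0 \<rho>(3) by simp
    then show ?thesis using \<psi>\<phi> \<pi>V[OF v] by (simp only: D_def A_def)
  qed
  have LP: "lin ?V ?V (\<lambda>v. A (D v))" and LP': "lin ?V ?V (\<lambda>v. D (A v))"
    using comp[OF cA cD] comp[OF cD cA] by auto
  \<comment> \<open>D A is the projection onto \<open>U\<close>, so its square has trace the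
    dimension of \<open>U\<close>. The previous facts allow one factor D A to be exchanged for A D;
    but A D takes values in \<open>U2\<close>, where D A vanishes. Hence the dimension is 0.\<close>
  have "?c * tr ?V (\<lambda>v. D (A (D (A v)))) = (\<Sum>g\<in>carrier G. ?t (\<lambda>v. D (A v)) g * ?t (\<lambda>v. D (A v)) (inv\<^bsub>G\<^esub> g))"
    using schur_trace[OF R fin LP' LP'] by simp
  also have "\<dots> = (\<Sum>g\<in>carrier G. ?t (\<lambda>v. D (A v)) g * ?t (\<lambda>v. A (D v)) (inv\<^bsub>G\<^esub> g))"
    by (intro sum.cong refl) (simp only: commute G.inv_closed)
  also have "\<dots> = ?c * tr ?V (\<lambda>v. D (A (A (D v))))"
    using schur_trace[OF R fin LP' LP] by simp
  also have "tr ?V (\<lambda>v. D (A (A (D v)))) = tr ?V (\<lambda>v. 0)"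
  proof (rule tr_cong[OF V])
    fix v assume v: "v \<in> ?V"
    have LD: "lin ?V ?V D" and LA: "lin ?V ?V A" using cA cD by auto
    have w: "D v \<in> ?V" using lin_in[OF LD v] .
    have "A (D v) = \<phi> (\<pi> (D v))" by (simp add: A_def)
    then have "A (D v) \<in> U2" using \<phi>(2) \<pi>V[OF w] by (auto simp: bij_betw_def)
    then have "D (A (A (D v))) = 0" using DA[of "A (D v)"] \<pi>0 UV by auto
    then show "D (A (A (D v))) = 0" .
  qed
  also have "tr ?V (\<lambda>v. 0) = 0" by (rule tr_zero[OF V])
  also have "tr ?V (\<lambda>v. D (A (D (A v)))) = tr ?V \<pi>"
    by (rule tr_cong[OF V]) (use DA \<pi>V \<pi>(3) in simp)
  also have "tr ?V \<pi> = tr U (\<lambda>u. u)"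
  proof -
    have FU: "fds U" by (rule invariant_fds[OF Q U(1)])
    have "tr ?V \<pi> = tr U \<pi>" by (rule tr_comm[OF V FU L\<pi>' lin_id[OF UV(1)]])
    also have "\<dots> = tr U (\<lambda>u. u)" by (rule tr_cong[OF FU \<pi>(3)])
    finally show ?thesis .
  qed
  also have "tr U (\<lambda>u. u) = of_nat (card (bas U))" by (rule tr_id[OF invariant_fds[OF Q U(1)]])
  finally have "card (bas U) = 0" using c by simp
  then have "space (sub ?Q U) = {0}" using dim_pos[OF rU] by auto
  then have "chr P h = 0" if "h \<in> carrier H" for h
    using chr_rep_iso[OF RP rU U(2) that] chr_zero[OF rU] by simp
  then have "ip H (chr P) (chr P) = 0" by (simp add: ip_def)
  then show False using ip_chr_self[OF P finH] by simp
qed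

section \<open>Tableaux\<close>

lemma tableaux_rows: "t \<in> tableaux lam \<Longrightarrow> length t = length lam"
  "t \<in> tableaux lam \<Longrightarrow> i < length lam \<Longrightarrow> length (t ! i) = lam ! i"
  "t \<in> tableaux lam \<Longrightarrow> set (concat t) = {1..sum_list lam}"
  unfolding tableaux_def by (auto simp: list_eq_iff_nth_eq)

lemma tableaux_inj:
  assumes "lam \<turnstile> m" and t: "t \<in> tableaux lam"
    and i: "i < length lam" "j < lam ! i" and i': "i' < length lam" "j' < lam ! i'"
    and eq: "t ! i ! j = t ! i' ! j'"
  shows "i = i' \<and> j = j'"
proof -
  \<comment> \<open>Distinctness of the concatenation does not tell two empty rows apart; they are
    excluded because the parts of a partition are positive.\<close>
  have ne: "t ! k \<noteq> []" if "k < length lam" for k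
  proof -
    have "lam ! k \<noteq> 0" using assms(1) that nth_mem[OF that] unfolding is_partition_def by metis
    then show ?thesis using tableaux_rows(2)[OF t that] by auto
  qed
  have d: "distinct (concat t)" using t by (simp add: tableaux_def)
  have "[] \<notin> set t" using ne tableaux_rows(1)[OF t] by (metis in_set_conv_nth)
  then have "distinct t" using d by (simp add: distinct_concat_iff removeAll_id)
  have l: "j < length (t ! i)" "j' < length (t ! i')" "i < length t" "i' < length t"
    using i i' tableaux_rows[OF t] by auto
  have "t ! i = t ! i'"
  proof (rule ccontr)
    assume "t ! i \<noteq> t ! i'"
    then have "set (t ! i) \<inter> set (t ! i') = {}" using d l by (simp add: distinct_concat_iff)
    moreover have "t ! i ! j \<in> set (t ! i) \<inter> set (t ! i')" using l eq by (metis IntI nth_mem)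
    ultimately show False by blast
  qed
  then have "i = i'" using \<open>distinct t\<close> l by (simp add: nth_eq_iff_index_eq)
  moreover have "distinct (t ! i)" using d l by (simp add: distinct_concat_iff)
  ultimately show ?thesis using l eq by (simp add: nth_eq_iff_index_eq)
qed

text \<open>The inverse of reading entries. From here on a tableau is used through the row
  \<open>rw\<close> and the column \<open>cl\<close> of each number, both counted from 0.\<close>

definition pos :: "nat list list \<Rightarrow> nat \<Rightarrow> nat \<times> nat" where
  "pos t x = (SOME p. fst p < length t \<and> snd p < length (t ! fst p) \<and> t ! fst p ! snd p = x)"

abbreviation "rw t x \<equiv> fst (pos t x)"
abbreviation "cl t x \<equiv> snd (pos t x)"
abbreviation "tb t \<equiv> map set t"
abbreviation "pm \<sigma> \<equiv> map ((`) \<sigma>)"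

lemma pos:
  assumes t: "t \<in> tableaux lam" and x: "x \<in> {1..sum_list lam}"
  shows "rw t x < length lam" "cl t x < lam ! rw t x" "t ! rw t x ! cl t x = x"
proof -
  have "x \<in> set (concat t)" using tableaux_rows(3)[OF t] x by blast
  then obtain xs where "xs \<in> set t" "x \<in> set xs" by auto
  then obtain i j where "i < length t" "j < length (t ! i)" "t ! i ! j = x" by (metis in_set_conv_nth)
  then have "\<exists>p. fst p < length t \<and> snd p < length (t ! fst p) \<and> t ! fst p ! snd p = x"
    by (intro exI[of _ "(i, j)"]) simp
  from someI_ex[OF this, folded pos_def]
  show "rw t x < length lam" "cl t x < lam ! rw t x" "t ! rw t x ! cl t x = x"
    using tableaux_rows[OF t] by auto
qed

lemma entry_in: "t \<in> tableaux lam \<Longrightarrow> i < length lam \<Longrightarrow> j < lam ! i \<Longrightarrow> t ! i ! j \<in> {1..sum_list lam}"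
  using tableaux_rows by (metis nth_mem in_set_conv_nth UN_I set_concat)

lemma pos_entry:
  assumes "lam \<turnstile> m" and t: "t \<in> tableaux lam" and i: "i < length lam" "j < lam ! i"
  shows "rw t (t ! i ! j) = i" "cl t (t ! i ! j) = j"
  using tableaux_inj[OF assms(1) t _ _ i] pos[OF t entry_in[OF t i]] by auto

lemma pos_eqD:
  assumes "t \<in> tableaux lam" "x \<in> {1..sum_list lam}" "y \<in> {1..sum_list lam}" "rw t x = rw t y" "cl t x = cl t y"
  shows "x = y"
  using pos(3)[OF assms(1,2)] pos(3)[OF assms(1,3)] assms(4,5) by metis

lemma column_eq:
  assumes "lam \<turnstile> m" and t: "t \<in> tableaux lam"
  shows "column t j = {x \<in> {1..m}. cl t x = j}"
proof -
  have m: "sum_list lam = m" using assms(1) by (simp add: is_partition_def)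
  show ?thesis
  proof (intro Set.set_eqI iffI)
    fix x assume "x \<in> column t j"
    then obtain i where "x = t ! i ! j" "i < length t" "j < length (t ! i)" by (auto simp: column_def)
    then show "x \<in> {x \<in> {1..m}. cl t x = j}"
      using pos_entry[OF assms] entry_in[OF t] tableaux_rows[OF t] m by auto
  next
    fix x assume "x \<in> {x \<in> {1..m}. cl t x = j}"
    then have "x \<in> {1..sum_list lam}" "cl t x = j" using m by auto
    then show "x \<in> column t j"
      using pos[OF t, of x] tableaux_rows(1)[OF t] tableaux_rows(2)[OF t, of "rw t x"] unfolding column_def
      by (intro CollectI exI[of _ "rw t x"]) simp
  qed
qed

lemma tb_nth:
  assumes "lam \<turnstile> m" and t: "t \<in> tableaux lam" and i: "i < length lam"
  shows "tb t ! i = {x \<in> {1..m}. rw t x = i}"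
proof -
  have m: "sum_list lam = m" using assms(1) by (simp add: is_partition_def)
  have "tb t ! i = set (t ! i)" using i tableaux_rows[OF t] by simp
  also have "\<dots> = {x \<in> {1..m}. rw t x = i}"
  proof (intro Set.set_eqI iffI)
    fix x assume "x \<in> set (t ! i)"
    then obtain j where "x = t ! i ! j" "j < lam ! i" using tableaux_rows[OF t] i by (metis in_set_conv_nth)
    then show "x \<in> {x \<in> {1..m}. rw t x = i}" using pos_entry[OF assms] entry_in[OF t i] m by auto
  next
    fix x assume "x \<in> {x \<in> {1..m}. rw t x = i}"
    then have "x \<in> {1..sum_list lam}" "rw t x = i" using m by auto
    then show "x \<in> set (t ! i)"
      using pos[OF t, of x] tableaux_rows(2)[OF t i] by (metis nth_mem)
  qed
  finally show ?thesis .
qed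

lemma pm_comp: "pm (\<sigma> \<circ> \<tau>) T = pm \<sigma> (pm \<tau> T)"
  by (simp add: image_comp)

lemma pm_id [simp]: "pm id T = T"
  by simp

lemma pm_inv: "bij \<sigma> \<Longrightarrow> pm (inv' \<sigma>) (pm \<sigma> T) = T" "bij \<sigma> \<Longrightarrow> pm \<sigma> (pm (inv' \<sigma>) T) = T"
  unfolding pm_comp[symmetric] by (simp_all only: bij_is_inj bij_is_surj inv_o_cancel surj_iff[THEN iffD1] pm_id)

lemma tableaux_map:
  assumes t: "t \<in> tableaux lam" and s: "\<sigma> permutes {1..sum_list lam}"
  shows "map (map \<sigma>) t \<in> tableaux lam"
proof -
  have c: "concat (map (map \<sigma>) t) = map \<sigma> (concat t)" by (simp add: map_concat)
  have "inj \<sigma>" using s by (rule permutes_inj)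
  then have "distinct (map \<sigma> (concat t))"
    using t unfolding tableaux_def distinct_map by (blast intro: inj_on_subset)
  moreover have "set (map \<sigma> (concat t)) = {1..sum_list lam}"
    using tableaux_rows(3)[OF t] permutes_image[OF s] by (simp only: set_map)
  moreover have "map length (map (map \<sigma>) t) = lam" using t by (simp add: tableaux_def comp_def)
  ultimately show ?thesis unfolding tableaux_def mem_Collect_eq c by (intro conjI)
qed

lemma tb_map: "tb (map (map \<sigma>) t) = pm \<sigma> (tb t)"
  by (simp add: comp_def)

lemma column_map: "column (map (map \<sigma>) t) j = \<sigma> ` column t j"
proof -
  have "column (map (map \<sigma>) t) j = {\<sigma> (t ! i ! j) |i. i < length t \<and> j < length (t ! i)}"
    unfolding column_def by (intro Collect_cong ex_cong1) auto
  also have "\<dots> = \<sigma> ` column t j" unfolding column_def by blast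
  finally show ?thesis .
qed

lemma column_stabilizer_iff:
  assumes "lam \<turnstile> m" and t: "t \<in> tableaux lam"
  shows "\<pi> \<in> column_stabilizer t \<longleftrightarrow> \<pi> permutes {1..m} \<and> (\<forall>x\<in>{1..m}. cl t (\<pi> x) = cl t x)"
proof -
  have X: "set (concat t) = {1..m}" using tableaux_rows(3)[OF t] assms(1) by (simp add: is_partition_def)
  show ?thesis
  proof
    assume "\<pi> \<in> column_stabilizer t"
    then have *: "\<pi> permutes {1..m}" "\<And>j. \<pi> ` column t j = column t j"
      unfolding column_stabilizer_def X by auto
    have "cl t (\<pi> x) = cl t x" if "x \<in> {1..m}" for x
      using *(2)[of "cl t x"] that unfolding column_eq[OF assms] by auto
    then show "\<pi> permutes {1..m} \<and> (\<forall>x\<in>{1..m}. cl t (\<pi> x) = cl t x)" using * by blast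
  next
    assume *: "\<pi> permutes {1..m} \<and> (\<forall>x\<in>{1..m}. cl t (\<pi> x) = cl t x)"
    have "\<pi> ` column t j = column t j" for j
    proof (rule card_subset_eq)
      show "finite (column t j)" unfolding column_eq[OF assms] by simp
      show "\<pi> ` column t j \<subseteq> column t j"
        unfolding column_eq[OF assms] using * permutes_in_image[of \<pi> "{1..m}"]
        by (auto simp del: atLeastAtMost_iff)
      show "card (\<pi> ` column t j) = card (column t j)"
        using * by (intro card_image) (meson inj_on_subset permutes_inj subset_UNIV)
    qed
    then show "\<pi> \<in> column_stabilizer t" unfolding column_stabilizer_def X using * by blast
  qed
qed

lemma column_stabilizer_group:
  assumes "lam \<turnstile> m" and t: "t \<in> tableaux lam"
  shows "id \<in> column_stabilizer t" "finite (column_stabilizer t)"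
    "\<pi> \<in> column_stabilizer t \<Longrightarrow> \<pi> permutes {1..m}"
    "\<pi> \<in> column_stabilizer t \<Longrightarrow> \<rho> \<in> column_stabilizer t \<Longrightarrow> \<pi> \<circ> \<rho> \<in> column_stabilizer t"
    "\<pi> \<in> column_stabilizer t \<Longrightarrow> inv' \<pi> \<in> column_stabilizer t"
proof -
  note iff = column_stabilizer_iff[OF assms]
  show "id \<in> column_stabilizer t" unfolding iff by (simp add: permutes_id)
  have "column_stabilizer t \<subseteq> {\<pi>. \<pi> permutes {1..m}}" using iff by blast
  then show "finite (column_stabilizer t)" by (rule finite_subset) (simp add: finite_permutations)
  show "\<pi> \<in> column_stabilizer t \<Longrightarrow> \<pi> permutes {1..m}" using iff by blast
  show "\<pi> \<in> column_stabilizer t \<Longrightarrow> \<rho> \<in> column_stabilizer t \<Longrightarrow> \<pi> \<circ> \<rho> \<in> column_stabilizer t"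
    unfolding iff using permutes_in_image[of \<rho> "{1..m}"]
    by (auto intro: permutes_compose simp del: atLeastAtMost_iff)
  show "\<pi> \<in> column_stabilizer t \<Longrightarrow> inv' \<pi> \<in> column_stabilizer t"
    unfolding iff
  proof (intro conjI ballI)
    assume \<pi>: "\<pi> permutes {1..m} \<and> (\<forall>x\<in>{1..m}. cl t (\<pi> x) = cl t x)"
    then show "inv' \<pi> permutes {1..m}" by (simp add: permutes_inv)
    fix x assume "x \<in> {1..m}"
    then have "inv' \<pi> x \<in> {1..m}" using \<pi> permutes_in_image[OF permutes_inv] by metis
    then show "cl t (inv' \<pi> x) = cl t x" using \<pi> permutes_inverses(1)[of \<pi> "{1..m}" x] by metis
  qed
qed

lemma sum_column_stabilizer:
  assumes "lam \<turnstile> m" and t: "t \<in> tableaux lam" and \<rho>: "\<rho> \<in> column_stabilizer t"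
  shows "(\<Sum>\<pi>\<in>column_stabilizer t. f (\<rho> \<circ> \<pi>)) = (\<Sum>\<pi>\<in>column_stabilizer t. f \<pi>)"
    and "(\<Sum>\<pi>\<in>column_stabilizer t. f (inv' \<pi>)) = (\<Sum>\<pi>\<in>column_stabilizer t. f \<pi>)"
proof -
  note cs = column_stabilizer_group[OF assms(1,2)]
  have "bij \<rho>" using cs(3)[OF \<rho>] by (rule permutes_bij)
  show "(\<Sum>\<pi>\<in>column_stabilizer t. f (\<rho> \<circ> \<pi>)) = (\<Sum>\<pi>\<in>column_stabilizer t. f \<pi>)"
    by (rule sum.reindex_bij_witness[where i = "\<lambda>\<pi>. inv' \<rho> \<circ> \<pi>" and j = "\<lambda>\<pi>. \<rho> \<circ> \<pi>"])
       (use cs \<rho> permutes_inv_o[OF cs(3)[OF \<rho>]] in \<open>auto simp: o_assoc\<close>)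
  show "(\<Sum>\<pi>\<in>column_stabilizer t. f (inv' \<pi>)) = (\<Sum>\<pi>\<in>column_stabilizer t. f \<pi>)"
    by (rule sum.reindex_bij_witness[where i = "\<lambda>\<pi>. inv' \<pi>" and j = "\<lambda>\<pi>. inv' \<pi>"])
       (use cs in \<open>auto simp: inv_inv_eq[OF permutes_bij[OF cs(3)]]\<close>)
qed

lemma column_transpose:
  assumes "lam \<turnstile> m" and t: "t \<in> tableaux lam" and "x \<in> {1..m}" "y \<in> {1..m}" "cl t x = cl t y"
  shows "transpose x y \<in> column_stabilizer t"
  unfolding column_stabilizer_iff[OF assms(1,2)]
  using assms(3-) permutes_swap_id[OF assms(3,4)] by (auto simp: Transposition.transpose_def)

text \<open>Hypothesis of the basic combinatorial lemma on pairs of tableaux. Its failure yields a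
  transposition in the column stabilizer of \<open>t\<close> that fixes the tabloid of
  \<open>s\<close>.\<close>

definition meets_once :: "nat \<Rightarrow> nat list list \<Rightarrow> nat list list \<Rightarrow> bool" where
  "meets_once m t s \<longleftrightarrow> (\<forall>x\<in>{1..m}. \<forall>y\<in>{1..m}. cl t x = cl t y \<and> rw s x = rw s y \<longrightarrow> x = y)"

section \<open>Dominance of shapes by counting entries in the first rows\<close>

lemma card_rows:
  assumes "lam \<turnstile> m" and t: "t \<in> tableaux lam" and k: "k \<le> length lam"
  shows "card {x \<in> {1..m}. rw t x < k} = sum_list (take k lam)"
proof -
  have m: "sum_list lam = m" using assms(1) by (simp add: is_partition_def)
  have "bij_betw (\<lambda>(i, j). t ! i ! j) (Sigma {..<k} (\<lambda>i. {..<lam ! i})) {x \<in> {1..m}. rw t x < k}"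
    by (rule bij_betw_byWitness[where f' = "pos t"])
       (use k m pos[OF t] pos_entry[OF assms(1,2)] entry_in[OF t] in \<open>auto simp: prod_eq_iff case_prod_beta\<close>)
  from bij_betw_same_card[OF this] have "card {x \<in> {1..m}. rw t x < k} = (\<Sum>i<k. lam ! i)"
    by simp
  also have "\<dots> = sum_list (take k lam)"
    using k by (simp add: sum_list_sum_nth atLeast0LessThan min_def)
  finally show ?thesis .
qed

text \<open>Row lengths decrease weakly, so all cells above a given cell in its column
  exist.\<close>

lemma column_below:
  assumes "lam \<turnstile> m" and t: "t \<in> tableaux lam" and x: "x \<in> {1..m}" and k: "k \<le> rw t x"
  shows "card {y \<in> {1..m}. cl t y = cl t x \<and> rw t y < k} = k"
proof -
  have m: "sum_list lam = m" using assms(1) by (simp add: is_partition_def)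
  have x': "x \<in> {1..sum_list lam}" using x m by simp
  have cell: "i < length lam" "cl t x < lam ! i" if "i < k" for i
  proof -
    have "sorted_wrt (\<ge>) lam" using assms(1) by (simp add: is_partition_def)
    moreover have "i < rw t x" "rw t x < length lam" using that k pos[OF t x'] by auto
    ultimately have "lam ! i \<ge> lam ! rw t x" by (simp add: sorted_wrt_iff_nth_less)
    then show "i < length lam" "cl t x < lam ! i" using pos[OF t x'] that k by auto
  qed
  have "bij_betw (\<lambda>i. t ! i ! cl t x) {..<k} {y \<in> {1..m}. cl t y = cl t x \<and> rw t y < k}"
    by (rule bij_betw_byWitness[where f' = "\<lambda>y. rw t y"])
       (use cell m pos_entry[OF assms(1,2)] entry_in[OF t] pos[OF t] in \<open>auto, metis\<close>)
  from bij_betw_same_card[OF this] show ?thesis by simp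
qed

text \<open>A column of \<open>t\<close> has at most one entry in each row of \<open>s\<close>,
  hence at most k in the first k rows. If it reaches row k in \<open>t\<close>, it has exactly k
  entries above; otherwise it lies above row k completely.\<close>

lemma meets_once_column:
  assumes lam: "lam \<turnstile> m" and t: "t \<in> tableaux lam" and ts: "meets_once m t s"
  shows "card {x \<in> {1..m}. cl t x = j \<and> rw s x < k} \<le> card {x \<in> {1..m}. cl t x = j \<and> rw t x < k}"
proof (cases "\<exists>x\<in>{1..m}. cl t x = j \<and> k \<le> rw t x")
  case True
  then obtain x where "x \<in> {1..m}" "cl t x = j" "k \<le> rw t x" by blast
  then have "card {x \<in> {1..m}. cl t x = j \<and> rw t x < k} = k" using column_below[OF lam t] by blast
  moreover have "card {x \<in> {1..m}. cl t x = j \<and> rw s x < k} \<le> card {..<k}"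
  proof (rule card_inj_on_le)
    show "inj_on (rw s) {x \<in> {1..m}. cl t x = j \<and> rw s x < k}"
      using ts unfolding meets_once_def inj_on_def by blast
  qed auto
  ultimately show ?thesis by simp
next
  case False
  then show ?thesis by (intro card_mono) auto
qed

lemma card_by_columns:
  fixes m N :: nat and c :: "nat \<Rightarrow> nat"
  assumes "\<And>x. x \<in> {1..m} \<Longrightarrow> c x < N"
  shows "card {x \<in> {1..m}. P x} = (\<Sum>j<N. card {x \<in> {1..m}. c x = j \<and> P x})"
proof -
  have "{x \<in> {1..m}. P x} = (\<Union>j<N. {x \<in> {1..m}. c x = j \<and> P x})" using assms by auto
  also have "card \<dots> = (\<Sum>j<N. card {x \<in> {1..m}. c x = j \<and> P x})"
    by (rule card_UN_disjoint) auto
  finally show ?thesis .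
qed

lemma cl_bound:
  assumes "lam \<turnstile> m" and t: "t \<in> tableaux lam" and x: "x \<in> {1..m}"
  shows "cl t x < m + 1"
proof -
  have m: "sum_list lam = m" using assms(1) by (simp add: is_partition_def)
  have x': "x \<in> {1..sum_list lam}" using x m by simp
  have "lam ! rw t x \<le> sum_list lam" using pos(1)[OF t x'] by (simp add: elem_le_sum_list)
  then show ?thesis using pos(2)[OF t x'] m by simp
qed

lemma meets_once_dominance:
  assumes lam: "lam \<turnstile> m" and t: "t \<in> tableaux lam" and ts: "meets_once m t s"
  shows "card {x \<in> {1..m}. rw s x < k} \<le> card {x \<in> {1..m}. rw t x < k}"
proof -
  note cc = card_by_columns[where m = m and c = "cl t" and N = "m + 1", OF cl_bound[OF lam t]]
  have "card {x \<in> {1..m}. rw s x < k} = (\<Sum>j<m + 1. card {x \<in> {1..m}. cl t x = j \<and> rw s x < k})"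
    by (rule cc)
  also have "\<dots> \<le> (\<Sum>j<m + 1. card {x \<in> {1..m}. cl t x = j \<and> rw t x < k})"
    by (intro sum_mono meets_once_column[OF lam t ts])
  also have "\<dots> = card {x \<in> {1..m}. rw t x < k}" by (rule cc[symmetric])
  finally show ?thesis .
qed

text \<open>For equal shapes the totals over all columns agree, so the columnwise inequalities are
  equalities: the entries of each column of \<open>t\<close> occupy the same set of rows in
  \<open>s\<close> as in \<open>t\<close>. Rearranging each column accordingly is the required
  permutation.\<close>

lemma meets_once_same_shape:
  assumes lam: "lam \<turnstile> m" and t: "t \<in> tableaux lam" and s: "s \<in> tableaux lam" and ts: "meets_once m t s"
  obtains \<pi> where "\<pi> \<in> column_stabilizer t" "tb s = pm \<pi> (tb t)"
proof -
  have m: "sum_list lam = m" using lam by (simp add: is_partition_def)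
  let ?S = "\<lambda>j k. {x \<in> {1..m}. cl t x = j \<and> rw s x < k}"
  let ?T = "\<lambda>j k. {x \<in> {1..m}. cl t x = j \<and> rw t x < k}"
  note cc = card_by_columns[where m = m and c = "cl t" and N = "m + 1", OF cl_bound[OF lam t]]
  have eq: "card (?S j k) = card (?T j k)" if "k \<le> length lam" "j < m + 1" for j k
  proof (rule ccontr)
    assume "card (?S j k) \<noteq> card (?T j k)"
    then have "card (?S j k) < card (?T j k)" using meets_once_column[OF lam t ts] le_neq_implies_less by blast
    then have "(\<Sum>j<m + 1. card (?S j k)) < (\<Sum>j<m + 1. card (?T j k))"
      using meets_once_column[OF lam t ts] that(2) by (intro sum_strict_mono_ex1) auto
    then show False
      using card_rows[OF lam t that(1)] card_rows[OF lam s that(1)]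
      cc[where P = "\<lambda>x. rw s x < k"] cc[where P = "\<lambda>x. rw t x < k"] by linarith
  qed
  \<comment> \<open>In the column of x the count for \<open>t\<close> grows when k passes the row of
    x, hence so does the count for \<open>s\<close>; the new entry is the one wanted.\<close>
  have ex: "\<exists>y\<in>{1..m}. cl t y = cl t x \<and> rw s y = rw t x" if x: "x \<in> {1..m}" for x
  proof (rule ccontr)
    assume no: "\<not> (\<exists>y\<in>{1..m}. cl t y = cl t x \<and> rw s y = rw t x)"
    let ?k = "rw t x" and ?j = "cl t x"
    have k: "Suc ?k \<le> length lam" using pos(1)[OF t, of x] x m by auto
    have "?S ?j (Suc ?k) = ?S ?j ?k" using no by (auto simp: less_Suc_eq)
    then have "card (?T ?j (Suc ?k)) = card (?T ?j ?k)"
      using eq[of "Suc ?k" ?j] eq[of ?k ?j] k cl_bound[OF lam t x] by simp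
    moreover have "?T ?j ?k \<subset> ?T ?j (Suc ?k)" using x by auto
    then have "card (?T ?j ?k) < card (?T ?j (Suc ?k))" by (intro psubset_card_mono) auto
    ultimately show False by simp
  qed
  obtain f where f: "\<forall>x\<in>{1..m}. f x \<in> {1..m} \<and> cl t (f x) = cl t x \<and> rw s (f x) = rw t x"
    using bchoice[of "{1..m}" "\<lambda>x y. y \<in> {1..m} \<and> cl t y = cl t x \<and> rw s y = rw t x"] ex by blast
  define \<pi> where "\<pi> x = (if x \<in> {1..m} then f x else x)" for x
  have \<pi>: "\<pi> x \<in> {1..m}" "cl t (\<pi> x) = cl t x" "rw s (\<pi> x) = rw t x" if "x \<in> {1..m}" for x
    using bspec[OF f that] that by (simp_all add: \<pi>_def)
  have "inj_on \<pi> {1..m}"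
  proof (rule inj_onI)
    fix x y assume xy: "x \<in> {1..m}" "y \<in> {1..m}" "\<pi> x = \<pi> y"
    have "cl t x = cl t y" unfolding \<pi>(2)[OF xy(1), symmetric] \<pi>(2)[OF xy(2), symmetric] xy(3) ..
    moreover have "rw t x = rw t y" unfolding \<pi>(3)[OF xy(1), symmetric] \<pi>(3)[OF xy(2), symmetric] xy(3) ..
    ultimately show "x = y" using pos_eqD[OF t, of x y] xy m by blast
  qed
  moreover have "\<pi> ` {1..m} \<subseteq> {1..m}" using \<pi>(1) by blast
  ultimately have "bij_betw \<pi> {1..m} {1..m}"
    by (simp add: bij_betw_def card_image card_subset_eq)
  then have perm: "\<pi> permutes {1..m}" by (rule bij_imp_permutes) (auto simp: \<pi>_def)
  then have cs: "\<pi> \<in> column_stabilizer t" unfolding column_stabilizer_iff[OF lam t] using \<pi> by blast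
  have "tb s = pm \<pi> (tb t)"
  proof (rule nth_equalityI)
    show "length (tb s) = length (pm \<pi> (tb t))" using tableaux_rows(1)[OF s] tableaux_rows(1)[OF t] by simp
    fix i assume "i < length (tb s)"
    then have i: "i < length lam" using tableaux_rows(1)[OF s] by simp
    have "pm \<pi> (tb t) ! i = \<pi> ` {x \<in> {1..m}. rw t x = i}"
      using tb_nth[OF lam t i] i tableaux_rows(1)[OF t] by (simp add: nth_map)
    also have "\<dots> = {x \<in> {1..m}. rw s x = i}"
    proof (intro Set.set_eqI iffI)
      fix y assume y: "y \<in> {x \<in> {1..m}. rw s x = i}"
      then obtain x where x: "x \<in> {1..m}" "y = \<pi> x" using permutes_image[OF perm] by blast
      then show "y \<in> \<pi> ` {x \<in> {1..m}. rw t x = i}" using y \<pi>(3)[OF x(1)] by auto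
    qed (use \<pi> in auto)
    finally show "tb s ! i = pm \<pi> (tb t) ! i" using tb_nth[OF lam s i] by simp
  qed
  with cs show ?thesis by (rule that)
qed

text \<open>Row and column together determine a number.\<close>

lemma pm_fixes_tabloid:
  assumes lam: "lam \<turnstile> m" and t: "t \<in> tableaux lam" and \<pi>: "\<pi> \<in> column_stabilizer t" and fixed: "pm \<pi> (tb t) = tb t"
  shows "\<pi> = id"
proof
  fix x
  have m: "sum_list lam = m" using lam by (simp add: is_partition_def)
  have perm: "\<pi> permutes {1..m}" using \<pi> column_stabilizer_iff[OF lam t] by blast
  show "\<pi> x = id x"
  proof (cases "x \<in> {1..m}")
    case True
    let ?i = "rw t x"
    have i: "?i < length lam" using pos(1)[OF t] True m by simp
    have "pm \<pi> (tb t) ! ?i = \<pi> ` (tb t ! ?i)" using i tableaux_rows(1)[OF t] by (simp add: nth_map)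
    then have "\<pi> ` {y \<in> {1..m}. rw t y = ?i} = {y \<in> {1..m}. rw t y = ?i}"
      using tb_nth[OF lam t i] unfolding fixed by simp
    then have "\<pi> x \<in> {y \<in> {1..m}. rw t y = ?i}" using True by blast
    moreover have "cl t (\<pi> x) = cl t x" using \<pi> True column_stabilizer_iff[OF lam t] by blast
    ultimately show ?thesis using pos_eqD[OF t, of "\<pi> x" x] True m by simp
  qed (use perm in \<open>simp add: permutes_not_in\<close>)
qed

section \<open>Specht modules\<close>

lemma finite_tableaux: "finite (tableaux lam)"
proof -
  let ?X = "{1..sum_list lam}"
  let ?L = "{xs. set xs \<subseteq> ?X \<and> length xs \<le> sum_list lam}"
  have "tableaux lam \<subseteq> {t. set t \<subseteq> ?L \<and> length t = length lam}"
  proof (rule subsetI)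
    fix t assume t: "t \<in> tableaux lam"
    have "xs \<in> ?L" if xs: "xs \<in> set t" for xs
    proof -
    have "length xs \<in> set lam" using t xs unfolding tableaux_def by force
    moreover have "set xs \<subseteq> ?X" using xs tableaux_rows(3)[OF t] by (auto simp del: atLeastAtMost_iff)
    ultimately show "xs \<in> ?L" by (simp add: member_le_sum_list)
    qed
    then show "t \<in> {t. set t \<subseteq> ?L \<and> length t = length lam}" using tableaux_rows(1)[OF t] by blast
  qed
  moreover have "finite ?L" by (rule finite_lists_length_le) simp
  then have "finite {t. set t \<subseteq> ?L \<and> length t = length lam}" by (rule finite_lists_length_eq)
  ultimately show ?thesis by (rule finite_subset)
qed

lemma card_rows_take:
  assumes lam: "lam \<turnstile> m" and t: "t \<in> tableaux lam"
  shows "card {x \<in> {1..m}. rw t x < k} = sum_list (take k lam)"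
proof (cases "k \<le> length lam")
  case False
  have m: "sum_list lam = m" using lam by (simp add: is_partition_def)
  have "{x \<in> {1..m}. rw t x < k} = {1..m}" using pos(1)[OF t] False m by fastforce
  then show ?thesis using False m by simp
qed (rule card_rows[OF assms])

text \<open>Differences of partial sums are the parts. Positivity fixes the length: a longer list
  would have to continue with a zero.\<close>

lemma partition_eqI:
  assumes lam: "lam \<turnstile> m" and mu: "mu \<turnstile> m" and eq: "\<And>k. sum_list (take k lam) = sum_list (take k mu)"
  shows "lam = mu"
proof -
  have aux: "\<not> length a < length b"
    if a: "a \<turnstile> m" and b: "b \<turnstile> m" and eq: "\<And>k. sum_list (take k a) = sum_list (take k b)" for a b
  proof
    assume lt: "length a < length b"
    have "sum_list (take (Suc (length a)) b) = sum_list (take (length a) b) + b ! length a"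
      using lt by (simp add: take_Suc_conv_app_nth)
    moreover have "sum_list (take (Suc (length a)) b) = sum_list (take (length a) b)"
      using eq[of "Suc (length a)"] eq[of "length a"] by simp
    ultimately have "b ! length a = 0" by simp
    then show False using b lt unfolding is_partition_def by (metis nth_mem)
  qed
  have len: "length lam = length mu" using aux[OF lam mu eq] aux[OF mu lam eq[symmetric]] by simp
  then show ?thesis
  proof (rule nth_equalityI)
    fix i assume "i < length lam"
    then show "lam ! i = mu ! i"
      using eq[of i] eq[of "Suc i"] len by (simp add: take_Suc_conv_app_nth)
  qed
qed

abbreviation pact :: "(nat \<Rightarrow> nat) \<Rightarrow> (nat set list \<Rightarrow> complex) \<Rightarrow> nat set list \<Rightarrow> complex" where
  "pact \<sigma> v \<equiv> \<lambda>T. v (pm (inv' \<sigma>) T)"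

lemma pact_comp: "bij \<sigma> \<Longrightarrow> bij \<tau> \<Longrightarrow> pact (\<sigma> \<circ> \<tau>) v = pact \<sigma> (pact \<tau> v)"
  by (simp only: o_inv_distrib pm_comp)

lemma lin_pact: "(\<And>v. v \<in> V \<Longrightarrow> pact \<sigma> v \<in> W) \<Longrightarrow> lin V W (pact \<sigma>)"
  by (rule linI) (auto simp: cscale_def fun_eq_iff)

lemma permutation_if: "\<pi> permutes {1..m::nat} \<Longrightarrow> permutation \<pi>"
  by (auto simp: permutation_permutes)

lemma conj_column_stabilizer:
  assumes t: "t \<in> tableaux lam" and s: "\<sigma> permutes {1..sum_list lam}" and p: "\<pi> \<in> column_stabilizer t"
  shows "\<sigma> \<circ> \<pi> \<circ> inv' \<sigma> \<in> column_stabilizer (map (map \<sigma>) t)"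
proof -
  note t' = tableaux_map[OF t s]
  have p': "\<pi> permutes {1..sum_list lam}" "\<And>j. \<pi> ` column t j = column t j"
    using p tableaux_rows(3)[OF t] by (auto simp: column_stabilizer_def)
  have "\<sigma> \<circ> \<pi> \<circ> inv' \<sigma> permutes {1..sum_list lam}"
    by (intro permutes_compose permutes_inv s p')
  moreover have "(\<sigma> \<circ> \<pi> \<circ> inv' \<sigma>) ` column (map (map \<sigma>) t) j = column (map (map \<sigma>) t) j" for j
    unfolding column_map image_comp[symmetric] 
    using p'(2)[of j] permutes_inj[OF s] by (simp add: image_inv_f_f)
  ultimately show ?thesis unfolding column_stabilizer_def using tableaux_rows(3)[OF t'] by simp
qed

text \<open>The column stabilizer of the moved tableau is a conjugate of that of \<open>t\<close>,
  and the sign is invariant under conjugation.\<close>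

lemma pact_polytabloid:
  assumes t: "t \<in> tableaux lam" and s: "\<sigma> permutes {1..sum_list lam}"
  shows "pact \<sigma> (polytabloid t) = polytabloid (map (map \<sigma>) t)"
proof
  fix T
  have b: "bij \<sigma>" using s by (rule permutes_bij)
  have bck: "map (map (inv' \<sigma>)) (map (map \<sigma>) t) = t"
    using permutes_inverses(2)[OF s] by (simp add: comp_def)
  have ii: "inv' (inv' \<sigma>) = \<sigma>" using b by (rule inv_inv_eq)
  have mem: "\<rho> \<in> column_stabilizer (map (map \<sigma>) t) \<Longrightarrow> inv' \<sigma> \<circ> \<rho> \<circ> \<sigma> \<in> column_stabilizer t" for \<rho>
    using conj_column_stabilizer[OF tableaux_map[OF t s] permutes_inv[OF s], of \<rho>] unfolding ii bck .
  have io: "\<sigma> \<circ> inv' \<sigma> = id" "inv' \<sigma> \<circ> \<sigma> = id" using permutes_inv_o[OF s] by auto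
  have "polytabloid (map (map \<sigma>) t) T = (\<Sum>\<pi>\<in>column_stabilizer t.
      if T = pm (\<sigma> \<circ> \<pi> \<circ> inv' \<sigma>) (tb (map (map \<sigma>) t)) then of_int (sign (\<sigma> \<circ> \<pi> \<circ> inv' \<sigma>)) else 0)"
    unfolding polytabloid_def
  proof (rule sum.reindex_bij_witness[where i = "\<lambda>\<pi>. \<sigma> \<circ> \<pi> \<circ> inv' \<sigma>" and j = "\<lambda>\<rho>. inv' \<sigma> \<circ> \<rho> \<circ> \<sigma>"])
    fix \<rho> assume "\<rho> \<in> column_stabilizer (map (map \<sigma>) t)"
    show "\<sigma> \<circ> (inv' \<sigma> \<circ> \<rho> \<circ> \<sigma>) \<circ> inv' \<sigma> = \<rho>"
      by (metis (no_types, lifting) comp_assoc io(1) comp_id id_comp)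
    then show "(if T = pm (\<sigma> \<circ> (inv' \<sigma> \<circ> \<rho> \<circ> \<sigma>) \<circ> inv' \<sigma>) (tb (map (map \<sigma>) t)) then of_int (sign (\<sigma> \<circ> (inv' \<sigma> \<circ> \<rho> \<circ> \<sigma>) \<circ> inv' \<sigma>)) else 0)
      = (if T = pm \<rho> (tb (map (map \<sigma>) t)) then of_int (sign \<rho>) else (0::complex))" by (simp only:)
    show "inv' \<sigma> \<circ> \<rho> \<circ> \<sigma> \<in> column_stabilizer t" by (rule mem) fact
  next
    fix \<pi> assume "\<pi> \<in> column_stabilizer t"
    then show "\<sigma> \<circ> \<pi> \<circ> inv' \<sigma> \<in> column_stabilizer (map (map \<sigma>) t)" by (rule conj_column_stabilizer[OF t s])
    show "inv' \<sigma> \<circ> (\<sigma> \<circ> \<pi> \<circ> inv' \<sigma>) \<circ> \<sigma> = \<pi>"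
      by (metis (no_types, lifting) comp_assoc io(2) comp_id id_comp)
  qed
  also have "\<dots> = (\<Sum>\<pi>\<in>column_stabilizer t. if pm (inv' \<sigma>) T = pm \<pi> (tb t) then of_int (sign \<pi>) else 0)"
  proof (rule sum.cong[OF refl])
    fix \<pi> assume "\<pi> \<in> column_stabilizer t"
    then have "\<pi> permutes {1..sum_list lam}" using tableaux_rows(3)[OF t] by (simp add: column_stabilizer_def)
    then have "sign (\<sigma> \<circ> \<pi> \<circ> inv' \<sigma>) = sign \<pi>"
      using s permutes_inv[OF s]
      by (simp add: sign_compose permutation_if permutes_compose sign_inverse permutation_compose)
    moreover have "pm (\<sigma> \<circ> \<pi> \<circ> inv' \<sigma>) (tb (map (map \<sigma>) t)) = pm \<sigma> (pm \<pi> (tb t))"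
      unfolding tb_map pm_comp by (simp only: pm_inv(1)[OF b])
    moreover have "T = pm \<sigma> (pm \<pi> (tb t)) \<longleftrightarrow> pm (inv' \<sigma>) T = pm \<pi> (tb t)"
      using pm_inv[OF b] by metis
    ultimately show "(if T = pm (\<sigma> \<circ> \<pi> \<circ> inv' \<sigma>) (tb (map (map \<sigma>) t)) then of_int (sign (\<sigma> \<circ> \<pi> \<circ> inv' \<sigma>)) else 0)
      = (if pm (inv' \<sigma>) T = pm \<pi> (tb t) then of_int (sign \<pi>) else (0::complex))" by (simp only:)
  qed
  finally show "pact \<sigma> (polytabloid t) T = polytabloid (map (map \<sigma>) t) T" by (simp only: polytabloid_def)
qed

lemma space_Specht: "space (Specht lam) = cfun.span (polytabloid ` tableaux lam)"
  and act_Specht: "act (Specht lam) \<sigma> = pact \<sigma>"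
  by (simp_all add: Specht_def)

lemma polytabloid_in: "t \<in> tableaux lam \<Longrightarrow> polytabloid t \<in> space (Specht lam)"
  unfolding space_Specht by (intro cfun.span_base imageI)

lemma fds_Specht: "fds (space (Specht lam))"
  unfolding space_Specht fds_def using finite_tableaux by blast

lemma pact_in:
  assumes s: "\<sigma> permutes {1..sum_list lam}" and v: "v \<in> space (Specht lam)"
  shows "pact \<sigma> v \<in> space (Specht lam)"
proof -
  have L: "lin UNIV UNIV (pact \<sigma>)" by (rule lin_pact) simp
  have "v \<in> cfun.span (polytabloid ` tableaux lam)" using v by (simp add: space_Specht)
  then show ?thesis
  proof (induction rule: cfun.span_induct_alt)
    case base
    have "pact \<sigma> 0 = 0" by (simp add: fun_eq_iff)
    then show ?case using fds_0[OF fds_Specht] by (simp only:)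
  next
    case (step c x y)
    then obtain t where t: "t \<in> tableaux lam" "x = polytabloid t" by blast
    have "pact \<sigma> x \<in> space (Specht lam)"
      unfolding t(2) pact_polytabloid[OF t(1) s] by (rule polytabloid_in[OF tableaux_map[OF t(1) s]])
    moreover have "pact \<sigma> (cscale c x + y) = cscale c (pact \<sigma> x) + pact \<sigma> y"
      by (simp add: fun_eq_iff cscale_def)
    ultimately show ?case using step.IH fds_add[OF fds_Specht] fds_scale[OF fds_Specht] by (simp only:)
  qed
qed

lemma representation_Specht:
  assumes "sum_list lam = m" shows "representation (sym_group m) (Specht lam)"
proof (rule representationI[OF sym_group_is_group fds_Specht])
  fix \<sigma> assume "\<sigma> \<in> carrier (sym_group m)"
  then have s: "\<sigma> permutes {1..sum_list lam}" using assms by (simp add: sym_group_carrier)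
  show "lin (space (Specht lam)) (space (Specht lam)) (act (Specht lam) \<sigma>)"
    unfolding act_Specht by (rule lin_pact) (rule pact_in[OF s])
  fix \<tau> v assume "\<tau> \<in> carrier (sym_group m)"
  then have "\<tau> permutes {1..sum_list lam}" using assms by (simp add: sym_group_carrier)
  with s show "act (Specht lam) (\<sigma> \<otimes>\<^bsub>sym_group m\<^esub> \<tau>) v = act (Specht lam) \<sigma> (act (Specht lam) \<tau> v)"
    unfolding act_Specht sym_group_mult by (simp only: pact_comp permutes_bij)
next
  fix v show "act (Specht lam) \<one>\<^bsub>sym_group m\<^esub> v = v"
    unfolding act_Specht sym_group_one by simp
qed

text \<open>The column antisymmetrizer of James' theory, an element of the group algebra, applied to
  an arbitrary function of tabloids.\<close>

definition ksum :: "nat list list \<Rightarrow> (nat set list \<Rightarrow> complex) \<Rightarrow> nat set list \<Rightarrow> complex" where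
  "ksum t v T = (\<Sum>\<pi>\<in>column_stabilizer t. of_int (sign \<pi>) * v (pm (inv' \<pi>) T))"

text \<open>Takes the place of the permutation module on tabloids of shape \<open>lam\<close>:
  functions live on all lists of sets, and this condition singles out the relevant ones.\<close>

definition tabloid_supported :: "nat list \<Rightarrow> (nat set list \<Rightarrow> complex) \<Rightarrow> bool" where
  "tabloid_supported lam v \<longleftrightarrow> (\<forall>T. v T \<noteq> 0 \<longrightarrow> (\<exists>s\<in>tableaux lam. T = tb s))"

lemma polytabloid_nonzero:
  assumes lam: "lam \<turnstile> m" and t: "t \<in> tableaux lam" and nz: "polytabloid t T \<noteq> 0"
  obtains \<pi> where "\<pi> \<in> column_stabilizer t" "T = pm \<pi> (tb t)"
proof -
  have "\<exists>\<pi>\<in>column_stabilizer t. T = pm \<pi> (tb t)"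
  proof (rule ccontr)
    assume "\<not> (\<exists>\<pi>\<in>column_stabilizer t. T = pm \<pi> (tb t))"
    then have "polytabloid t T = (\<Sum>\<pi>\<in>column_stabilizer t. 0)"
      unfolding polytabloid_def by (intro sum.cong refl) metis
    then show False using nz by simp
  qed
  then show ?thesis using that by blast
qed

lemma Specht_tabloid_supported:
  assumes lam: "lam \<turnstile> m" and v: "v \<in> space (Specht lam)"
  shows "tabloid_supported lam v"
proof -
  have m: "sum_list lam = m" using lam by (simp add: is_partition_def)
  have "v \<in> cfun.span (polytabloid ` tableaux lam)" using v by (simp add: space_Specht)
  then show ?thesis
  proof (induction rule: cfun.span_induct_alt)
    case base
    show ?case by (simp add: tabloid_supported_def)
  next
    case (step c x y)
    then obtain t where t: "t \<in> tableaux lam" "x = polytabloid t" by blast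
    have "\<exists>s\<in>tableaux lam. T = tb s" if "x T \<noteq> 0" for T
    proof -
      have "polytabloid t T \<noteq> 0" using that t(2) by simp
      then obtain \<pi> where p: "\<pi> \<in> column_stabilizer t" "T = pm \<pi> (tb t)"
        by (rule polytabloid_nonzero[OF lam t(1)])
      then have "map (map \<pi>) t \<in> tableaux lam"
        using column_stabilizer_group(3)[OF lam t(1)] m by (intro tableaux_map[OF t(1)]) simp
      then show ?thesis using p(2) unfolding tb_map[symmetric] by blast
    qed
    moreover have "x T \<noteq> 0 \<or> y T \<noteq> 0" if "(cscale c x + y) T \<noteq> 0" for T
      using that by (auto simp: cscale_def)
    ultimately show ?case using step.IH unfolding tabloid_supported_def by blast
  qed
qed

text \<open>Distinct elements of the column stabilizer move the tabloid of \<open>t\<close> to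
  distinct tabloids, so nothing cancels in the sum.\<close>

lemma polytabloid_value:
  assumes lam: "lam \<turnstile> m" and t: "t \<in> tableaux lam" and p: "\<pi> \<in> column_stabilizer t"
  shows "polytabloid t (pm \<pi> (tb t)) = of_int (sign \<pi>)"
proof -
  note cs = column_stabilizer_group[OF lam t]
  have eq: "pm \<pi> (tb t) = pm \<rho> (tb t) \<longleftrightarrow> \<rho> = \<pi>" if r: "\<rho> \<in> column_stabilizer t" for \<rho>
  proof
    assume e: "pm \<pi> (tb t) = pm \<rho> (tb t)"
    have bp: "bij \<pi>" using cs(3)[OF p] by (rule permutes_bij)
    have "pm (inv' \<pi> \<circ> \<rho>) (tb t) = tb t" unfolding pm_comp e[symmetric] by (rule pm_inv(1)[OF bp])
    then have "inv' \<pi> \<circ> \<rho> = id" using pm_fixes_tabloid[OF lam t cs(4)[OF cs(5)[OF p] r]] by blast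
    then have "\<pi> \<circ> (inv' \<pi> \<circ> \<rho>) = \<pi>" by simp
    then show "\<rho> = \<pi>" using permutes_inv_o(1)[OF cs(3)[OF p]] by (simp add: o_assoc)
  qed simp
  have "polytabloid t (pm \<pi> (tb t)) = (\<Sum>\<rho>\<in>column_stabilizer t. if \<rho> = \<pi> then of_int (sign \<rho>) else 0)"
    unfolding polytabloid_def by (intro sum.cong refl) (simp only: eq)
  then show ?thesis using p cs(2) by (simp add: sum.delta)
qed

text \<open>Left translation by \<rho> permutes the terms and multiplies all signs by that of
  \<rho>.\<close>

lemma ksum_translate:
  assumes lam: "lam \<turnstile> m" and t: "t \<in> tableaux lam" and r: "\<rho> \<in> column_stabilizer t"
  shows "ksum t v (pm \<rho> T) = of_int (sign \<rho>) * ksum t v T"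
proof -
  note cs = column_stabilizer_group[OF lam t]
  have b: "bij \<pi>" if "\<pi> \<in> column_stabilizer t" for \<pi> using cs(3)[OF that] by (rule permutes_bij)
  have "ksum t v (pm \<rho> T) = (\<Sum>\<pi>\<in>column_stabilizer t. of_int (sign (\<rho> \<circ> \<pi>)) * v (pm (inv' (\<rho> \<circ> \<pi>)) (pm \<rho> T)))"
    unfolding ksum_def by (rule sum_column_stabilizer(1)[OF lam t r, symmetric])
  also have "\<dots> = (\<Sum>\<pi>\<in>column_stabilizer t. of_int (sign \<rho>) * (of_int (sign \<pi>) * v (pm (inv' \<pi>) T)))"
  proof (rule sum.cong[OF refl])
    fix \<pi> assume p: "\<pi> \<in> column_stabilizer t"
    have "pm (inv' (\<rho> \<circ> \<pi>)) (pm \<rho> T) = pm (inv' \<pi>) T"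
      unfolding o_inv_distrib[OF b[OF r] b[OF p]] pm_comp by (simp only: pm_inv(1)[OF b[OF r]])
    moreover have "sign (\<rho> \<circ> \<pi>) = sign \<rho> * sign \<pi>"
      using cs(3)[OF p] cs(3)[OF r] by (simp add: sign_compose permutation_if)
    ultimately show "of_int (sign (\<rho> \<circ> \<pi>)) * v (pm (inv' (\<rho> \<circ> \<pi>)) (pm \<rho> T))
        = of_int (sign \<rho>) * (of_int (sign \<pi>) * v (pm (inv' \<pi>) T))" by (simp only: of_int_mult mult.assoc)
  qed
  finally show ?thesis by (simp only: ksum_def sum_distrib_left)
qed

lemma pm_transpose_tabloid:
  assumes mu: "mu \<turnstile> m" and s: "s \<in> tableaux mu" and x: "x \<in> {1..m}" "y \<in> {1..m}" and xy: "rw s x = rw s y"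
  shows "pm (transpose x y) (tb s) = tb s"
proof (rule nth_equalityI)
  fix i assume "i < length (pm (transpose x y) (tb s))"
  then have i: "i < length mu" using tableaux_rows(1)[OF s] by simp
  have "x \<in> tb s ! i \<longleftrightarrow> y \<in> tb s ! i" unfolding tb_nth[OF mu s i] using x xy by simp
  then show "pm (transpose x y) (tb s) ! i = tb s ! i"
    using i tableaux_rows(1)[OF s] by simp
qed simp

text \<open>
  If two entries share a column of \<open>t\<close> and a row of the tabloid \<open>T\<close>, their transposition fixes \<open>T\<close>
  but changes the sign of the value at \<open>T\<close>, which therefore vanishes.
\<close>

lemma ksum_nonzero:
  assumes lam: "lam \<turnstile> m" and mu: "mu \<turnstile> m" and t: "t \<in> tableaux lam"
    and v: "tabloid_supported mu v" and nz: "ksum t v T \<noteq> 0"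
  obtains s where "s \<in> tableaux mu" "T = tb s" "meets_once m t s"
proof -
  note cs = column_stabilizer_group[OF lam t]
  have m: "sum_list mu = m" using mu by (simp add: is_partition_def)
  have "\<exists>\<pi>\<in>column_stabilizer t. v (pm (inv' \<pi>) T) \<noteq> 0"
    using nz unfolding ksum_def by (metis (no_types, lifting) mult_zero_right sum.neutral)
  then obtain \<pi> where p: "\<pi> \<in> column_stabilizer t" "v (pm (inv' \<pi>) T) \<noteq> 0" by blast
  then obtain s0 where s0: "s0 \<in> tableaux mu" "pm (inv' \<pi>) T = tb s0"
    using v unfolding tabloid_supported_def by blast
  let ?s = "map (map \<pi>) s0"
  have s: "?s \<in> tableaux mu" using tableaux_map[OF s0(1)] cs(3)[OF p(1)] m by simp
  have T: "T = tb ?s"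
    unfolding tb_map s0(2)[symmetric] by (rule pm_inv(2)[OF permutes_bij[OF cs(3)[OF p(1)]], symmetric])
  have "meets_once m t ?s"
    unfolding meets_once_def
  proof (intro ballI impI, elim conjE)
    fix x y assume x: "x \<in> {1..m}" "y \<in> {1..m}" "cl t x = cl t y" "rw ?s x = rw ?s y"
    show "x = y"
    proof (rule ccontr)
      assume "x \<noteq> y"
      have "ksum t v (pm (transpose x y) T) = of_int (sign (transpose x y)) * ksum t v T"
        by (rule ksum_translate[OF lam t column_transpose[OF lam t x(1-3)]])
      moreover have "pm (transpose x y) T = T"
        unfolding T by (rule pm_transpose_tabloid[OF mu s x(1,2,4)])
      ultimately show False using nz \<open>x \<noteq> y\<close> by (simp only: sign_swap_id if_False) simp
    qed
  qed
  with s T show ?thesis by (rule that)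
qed

text \<open>By \<open>ksum_nonzero\<close> and \<open>meets_once_same_shape\<close> the result lives
  on the column translates of the tabloid of \<open>t\<close>, and the sign rule leaves one free
  value there. So the antisymmetrizer has a one-dimensional image on its own shape.\<close>

lemma ksum_same_shape:
  assumes lam: "lam \<turnstile> m" and t: "t \<in> tableaux lam" and v: "tabloid_supported lam v"
  shows "ksum t v = cscale (ksum t v (tb t)) (polytabloid t)"
proof
  fix T
  show "ksum t v T = cscale (ksum t v (tb t)) (polytabloid t) T"
  proof (cases "\<exists>\<pi>\<in>column_stabilizer t. T = pm \<pi> (tb t)")
    case True
    then obtain \<pi> where p: "\<pi> \<in> column_stabilizer t" "T = pm \<pi> (tb t)" by blast
    show ?thesis
      unfolding p(2) cscale_def ksum_translate[OF lam t p(1)] polytabloid_value[OF lam t p(1)] by simp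
  next
    case False
    have "polytabloid t T = 0" using polytabloid_nonzero[OF lam t, of T] False by blast
    moreover have "ksum t v T = 0"
    proof (rule ccontr)
      assume "ksum t v T \<noteq> 0"
      then obtain s where s: "s \<in> tableaux lam" "T = tb s" "meets_once m t s"
        by (rule ksum_nonzero[OF lam lam t v]) (rule that; assumption)
      obtain \<pi> where "\<pi> \<in> column_stabilizer t" "tb s = pm \<pi> (tb t)"
        by (rule meets_once_same_shape[OF lam t s(1,3)]) (rule that; assumption)
      then show False using False s(2) by blast
    qed
    ultimately show ?thesis by (simp add: cscale_def)
  qed
qed

lemma ksum_as_sum: "ksum t v = (\<Sum>\<pi>\<in>column_stabilizer t. cscale (of_int (sign \<pi>)) (pact \<pi> v))"
  by (simp add: fun_eq_iff ksum_def sum_apply cscale_def)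

lemma tableaux_transitive:
  assumes lam: "lam \<turnstile> m" and t: "t \<in> tableaux lam" and s: "s \<in> tableaux lam"
  obtains \<sigma> where "\<sigma> permutes {1..m}" "s = map (map \<sigma>) t"
proof -
  have m: "sum_list lam = m" using lam by (simp add: is_partition_def)
  define \<sigma> where "\<sigma> x = (if x \<in> {1..m} then s ! rw t x ! cl t x else x)" for x
  have P: "rw t x < length lam" "cl t x < lam ! rw t x" if "x \<in> {1..m}" for x
    using pos[OF t, of x] that m by auto
  have \<sigma>: "\<sigma> x \<in> {1..m}" "rw s (\<sigma> x) = rw t x" "cl s (\<sigma> x) = cl t x" if "x \<in> {1..m}" for x
    using entry_in[OF s P[OF that]] pos_entry[OF lam s P[OF that]] that m unfolding \<sigma>_def by auto
  have "inj_on \<sigma> {1..m}"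
  proof (rule inj_onI)
    fix x y assume xy: "x \<in> {1..m}" "y \<in> {1..m}" "\<sigma> x = \<sigma> y"
    have "cl t x = cl t y" unfolding \<sigma>(3)[OF xy(1), symmetric] \<sigma>(3)[OF xy(2), symmetric] xy(3) ..
    moreover have "rw t x = rw t y" unfolding \<sigma>(2)[OF xy(1), symmetric] \<sigma>(2)[OF xy(2), symmetric] xy(3) ..
    ultimately show "x = y" using pos_eqD[OF t, of x y] xy m by blast
  qed
  moreover have "\<sigma> ` {1..m} \<subseteq> {1..m}" using \<sigma>(1) by blast
  ultimately have "bij_betw \<sigma> {1..m} {1..m}"
    by (simp add: bij_betw_def card_image card_subset_eq)
  then have perm: "\<sigma> permutes {1..m}" by (rule bij_imp_permutes) (auto simp: \<sigma>_def)
  have "s = map (map \<sigma>) t"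
  proof (intro nth_equalityI)
    show "length s = length (map (map \<sigma>) t)" using tableaux_rows(1)[OF s] tableaux_rows(1)[OF t] by simp
    fix i assume "i < length s"
    then have i: "i < length lam" "i < length t" using tableaux_rows(1)[OF s] tableaux_rows(1)[OF t] by auto
    show "length (s ! i) = length (map (map \<sigma>) t ! i)"
      using i tableaux_rows(2)[OF s] tableaux_rows(2)[OF t] by simp
    fix j assume "j < length (s ! i)"
    then have j: "j < lam ! i" "j < length (t ! i)"
      using i tableaux_rows(2)[OF s] tableaux_rows(2)[OF t] by auto
    have "\<sigma> (t ! i ! j) = s ! i ! j"
      using entry_in[OF t i(1) j(1)] pos_entry[OF lam t i(1) j(1)] m unfolding \<sigma>_def by simp
    then show "s ! i ! j = map (map \<sigma>) t ! i ! j" using i j by simp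
  qed
  with perm show ?thesis by (rule that)
qed

lemma tableaux_nonempty: "tableaux lam \<noteq> {}"
proof -
  have "\<exists>t. map length t = lam \<and> concat t = xs" if "length xs = sum_list lam" for xs :: "nat list"
    using that
  proof (induction lam arbitrary: xs)
    case (Cons a lam)
    then obtain t where "map length t = lam" "concat t = drop a xs" by (metis add_diff_cancel_left' length_drop sum_list.Cons)
    then show ?case using Cons.prems by (intro exI[of _ "take a xs # t"]) auto
  qed simp
  from this[of "[1..<Suc (sum_list lam)]"] obtain t where t: "map length t = lam" "concat t = [1..<Suc (sum_list lam)]"
    by (auto simp del: upt_Suc)
  have "set [1..<Suc (sum_list lam)] = {1..sum_list lam}" by (simp only: set_upt atLeastLessThanSuc_atLeastAtMost)
  then have "t \<in> tableaux lam" unfolding tableaux_def mem_Collect_eq t by (simp only: distinct_upt simp_thms)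
  then show ?thesis by blast
qed

text \<open>James' submodule theorem. If some antisymmetrized vector of \<open>U\<close> is nonzero
  at the tabloid of its tableau, \<open>U\<close> contains a polytabloid and, by transitivity on
  tableaux, all of them. Otherwise \<open>U\<close> is orthogonal to all polytabloids and hence to
  itself.\<close>

theorem irreducible_Specht:
  assumes lam: "lam \<turnstile> m" shows "irreducible_rep (sym_group m) (Specht lam)"
proof -
  have m: "sum_list lam = m" using lam by (simp add: is_partition_def)
  note R = representation_Specht[OF m]
  obtain t0 where t0: "t0 \<in> tableaux lam" using tableaux_nonempty by blast
  have one: "polytabloid t (tb t) = 1" if "t \<in> tableaux lam" for t
    using polytabloid_value[OF lam that column_stabilizer_group(1)[OF lam that]] by simp
  show ?thesis
    unfolding irreducible_rep_def
  proof (intro conjI allI impI R)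
    have "polytabloid t0 \<noteq> 0" using one[OF t0] by auto
    then show "space (Specht lam) \<noteq> {0}" using polytabloid_in[OF t0] by blast
    fix U assume U: "invariant_subspace (sym_group m) (Specht lam) U"
    have FU: "fds U" by (rule invariant_fds[OF R U])
    have US: "U \<subseteq> space (Specht lam)" using U by (simp add: invariant_subspace_def)
    have Uact: "pact \<sigma> u \<in> U" if "\<sigma> permutes {1..m}" "u \<in> U" for \<sigma> u
      using U that unfolding invariant_subspace_def act_Specht by (simp add: sym_group_carrier)
    have kU: "ksum t u \<in> U" if t: "t \<in> tableaux lam" and u: "u \<in> U" for t u
      unfolding ksum_as_sum using column_stabilizer_group(3)[OF lam t] u
      by (intro fds_sum[OF FU] fds_scale[OF FU] Uact)
    show "U = {0} \<or> U = space (Specht lam)"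
    proof (cases "\<exists>t\<in>tableaux lam. \<exists>u\<in>U. ksum t u (tb t) \<noteq> 0")
      case True
      then obtain t u where t: "t \<in> tableaux lam" and u: "u \<in> U" and nz: "ksum t u (tb t) \<noteq> 0" by blast
      let ?c = "ksum t u (tb t)"
      have "cscale (1 / ?c) (ksum t u) \<in> U" by (rule fds_scale[OF FU kU[OF t u]])
      moreover have "cscale (1 / ?c) (ksum t u) = polytabloid t"
        using nz by (subst ksum_same_shape[OF lam t Specht_tabloid_supported[OF lam]]) (use US u in auto)
      ultimately have pU: "polytabloid t \<in> U" by (simp only:)
      have "polytabloid s \<in> U" if s: "s \<in> tableaux lam" for s
      proof -
        obtain \<sigma> where s': "\<sigma> permutes {1..m}" "s = map (map \<sigma>) t"
          by (rule tableaux_transitive[OF lam t s]) (rule that; assumption)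
        then have "polytabloid s = pact \<sigma> (polytabloid t)" using pact_polytabloid[OF t, of \<sigma>] m by simp
        then show ?thesis using Uact[OF s'(1) pU] by (simp only:)
      qed
      then have "space (Specht lam) \<subseteq> U"
        unfolding space_Specht by (intro cfun.span_minimal fds_subspace[OF FU]) blast
      then show ?thesis using US by blast
    next
      case False
      have "u = 0" if u: "u \<in> U" for u
      proof -
        let ?S = "tb ` tableaux lam"
        have fin: "finite ?S" using finite_tableaux by simp
        \<comment> \<open>The antisymmetrizer is self-adjoint for the Hermitian product, because
          inversion in the column stabilizer preserves signs. The pairing with a polytabloid is
          therefore the conjugate of a value that is zero in this case.\<close>
        have orth: "(\<Sum>T\<in>?S. cnj (u T) * polytabloid t T) = 0" if t: "t \<in> tableaux lam" for t
        proof -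
          note cs = column_stabilizer_group[OF lam t]
          have mem: "pm \<pi> (tb t) \<in> ?S" if "\<pi> \<in> column_stabilizer t" for \<pi>
            unfolding tb_map[symmetric] using tableaux_map[OF t] cs(3)[OF that] m by blast
          have "(\<Sum>T\<in>?S. cnj (u T) * polytabloid t T) = (\<Sum>T\<in>?S. \<Sum>\<pi>\<in>column_stabilizer t.
              if T = pm \<pi> (tb t) then cnj (u T) * of_int (sign \<pi>) else 0)"
            unfolding polytabloid_def sum_distrib_left by (intro sum.cong refl) simp
          also have "\<dots> = (\<Sum>\<pi>\<in>column_stabilizer t. \<Sum>T\<in>?S.
              if T = pm \<pi> (tb t) then cnj (u T) * of_int (sign \<pi>) else 0)" by (rule sum.swap)
          also have "\<dots> = (\<Sum>\<pi>\<in>column_stabilizer t. cnj (u (pm \<pi> (tb t))) * of_int (sign \<pi>))"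
            by (intro sum.cong refl) (simp only: sum.delta[OF fin] mem if_True)
          also have "\<dots> = (\<Sum>\<pi>\<in>column_stabilizer t. cnj (u (pm (inv' \<pi>) (tb t))) * of_int (sign (inv' \<pi>)))"
            by (rule sum_column_stabilizer(2)[OF lam t, symmetric, where f = "\<lambda>\<pi>. cnj (u (pm \<pi> (tb t))) * of_int (sign \<pi>)"])
               (rule cs(1))
          also have "\<dots> = cnj (ksum t u (tb t))"
            unfolding ksum_def cnj_sum
            by (intro sum.cong refl) (simp add: sign_inverse[OF permutation_if[OF cs(3)]] del: map_map)
          also have "\<dots> = 0" using False t u by simp
          finally show ?thesis .
        qed
        have "(\<Sum>T\<in>?S. cnj (u T) * v T) = 0" if v: "v \<in> space (Specht lam)" for v
        proof -
          have "v \<in> cfun.span (polytabloid ` tableaux lam)" using v by (simp add: space_Specht)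
          then show ?thesis
          proof (induction rule: cfun.span_induct_alt)
            case (step c x y)
            then obtain t where t: "t \<in> tableaux lam" "x = polytabloid t" by blast
            have "(\<Sum>T\<in>?S. cnj (u T) * (cscale c x + y) T)
                = c * (\<Sum>T\<in>?S. cnj (u T) * x T) + (\<Sum>T\<in>?S. cnj (u T) * y T)"
              unfolding sum_distrib_left sum.distrib[symmetric]
              by (intro sum.cong refl) (simp add: cscale_def algebra_simps)
            then show ?case using orth[OF t(1)] step.IH t(2) by simp
          qed simp
        qed
        \<comment> \<open>\<open>U\<close> lies in the Specht module, so \<open>u\<close> itself may
          be inserted. Positivity of the Hermitian product, which a bilinear one over the complex
          numbers would not have, gives \<open>u\<close> = 0.\<close>
        from this[of u] have "(\<Sum>T\<in>?S. cnj (u T) * u T) = 0" using u US by blast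
        also have "(\<Sum>T\<in>?S. cnj (u T) * u T) = of_real (\<Sum>T\<in>?S. (cmod (u T))\<^sup>2)"
          unfolding of_real_sum by (intro sum.cong refl) (simp only: complex_norm_square[symmetric] mult.commute[of "cnj _"])
        finally have "(\<Sum>T\<in>?S. (cmod (u T))\<^sup>2) = 0" by (simp only: of_real_eq_0_iff)
        then have z: "u T = 0" if "T \<in> ?S" for T
          using that fin by (auto simp: sum_nonneg_eq_0_iff)
        have "u T = 0" for T
          using z Specht_tabloid_supported[OF lam, of u] u US unfolding tabloid_supported_def by blast
        then show ?thesis by (simp add: fun_eq_iff)
      qed
      then have "U = {0}" using fds_0[OF FU] by blast
      then show ?thesis by blast
    qed
  qed
qed

text \<open>A polytabloid is an antisymmetrized tabloid, and the square of the antisymmetrizer is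
  the order of the column stabilizer times itself.\<close>

lemma ksum_polytabloid:
  assumes lam: "lam \<turnstile> m" and t: "t \<in> tableaux lam"
  shows "ksum t (polytabloid t) = cscale (of_nat (card (column_stabilizer t))) (polytabloid t)"
proof -
  have m: "sum_list lam = m" using lam by (simp add: is_partition_def)
  note cs = column_stabilizer_group[OF lam t]
  have "ksum t (polytabloid t) (tb t) = (\<Sum>\<pi>\<in>column_stabilizer t. 1)"
    unfolding ksum_def
  proof (rule sum.cong[OF refl])
    fix \<pi> assume p: "\<pi> \<in> column_stabilizer t"
    have "sign (inv' \<pi>) = sign \<pi>" by (rule sign_inverse[OF permutation_if[OF cs(3)[OF p]]])
    then show "of_int (sign \<pi>) * polytabloid t (pm (inv' \<pi>) (tb t)) = 1"
      unfolding polytabloid_value[OF lam t cs(5)[OF p]] by (simp flip: of_int_mult)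
  qed
  then have "ksum t (polytabloid t) (tb t) = of_nat (card (column_stabilizer t))" by simp
  then show ?thesis
    using ksum_same_shape[OF lam t Specht_tabloid_supported[OF lam polytabloid_in[OF t]]] by simp
qed

text \<open>An isomorphism commutes with the antisymmetrizer of \<open>t\<close>, so the image of
  the polytabloid is an eigenvector with nonzero eigenvalue. It is nonzero at a tabloid of shape
  \<open>mu\<close>, whose rows then meet the columns of \<open>t\<close> at most once, and this
  forces dominance.\<close>

lemma Specht_iso_dominance:
  assumes lam: "lam \<turnstile> m" and mu: "mu \<turnstile> m" and iso: "rep_iso (sym_group m) (Specht lam) (Specht mu)"
  shows "sum_list (take k mu) \<le> sum_list (take k lam)"
proof -
  have m: "sum_list lam = m" using lam by (simp add: is_partition_def)
  obtain t where t: "t \<in> tableaux lam" using tableaux_nonempty by blast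
  note cs = column_stabilizer_group[OF lam t]
  obtain \<theta> where h: "ghom (sym_group m) (Specht lam) (Specht mu) \<theta>"
    and bij: "bij_betw \<theta> (space (Specht lam)) (space (Specht mu))"
    using iso by (rule rep_isoE)
  let ?p = "polytabloid t"
  note p = polytabloid_in[OF t] and L = ghom_lin[OF h]
  have one: "?p (tb t) = 1" using polytabloid_value[OF lam t cs(1)] by simp
  have "?p \<noteq> 0" using one by auto
  have q: "\<theta> ?p \<in> space (Specht mu)" by (rule lin_in[OF L p])
  have "\<theta> (ksum t ?p) = (\<Sum>\<pi>\<in>column_stabilizer t. cscale (of_int (sign \<pi>)) (\<theta> (pact \<pi> ?p)))"
    unfolding ksum_as_sum
    by (rule lin_sum[OF L fds_subspace[OF fds_Specht]]) (use pact_in p cs(3) m in auto)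
  also have "\<dots> = ksum t (\<theta> ?p)"
    unfolding ksum_as_sum
  proof (rule sum.cong[OF refl])
    fix \<pi> assume "\<pi> \<in> column_stabilizer t"
    then have "\<theta> (act (Specht lam) \<pi> ?p) = act (Specht mu) \<pi> (\<theta> ?p)"
      by (intro ghom_act[OF h _ p]) (simp only: sym_group_carrier cs(3))
    then show "cscale (of_int (sign \<pi>)) (\<theta> (pact \<pi> ?p)) = cscale (of_int (sign \<pi>)) (pact \<pi> (\<theta> ?p))"
      by (simp only: act_Specht)
  qed
  finally have k: "ksum t (\<theta> ?p) = cscale (of_nat (card (column_stabilizer t))) (\<theta> ?p)"
    using lin_scale[OF L p] by (simp only: ksum_polytabloid[OF lam t])
  have "\<theta> ?p \<noteq> 0"
  proof
    assume "\<theta> ?p = 0"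
    then have "\<theta> ?p = \<theta> 0" using lin_0[OF L fds_0[OF fds_Specht]] by simp
    then have "?p = 0" using bij p fds_0[OF fds_Specht] unfolding bij_betw_def by (metis inj_onD)
    then show False using \<open>?p \<noteq> 0\<close> by blast
  qed
  then obtain T where "\<theta> ?p T \<noteq> 0" by (auto simp: fun_eq_iff)
  moreover have "card (column_stabilizer t) \<noteq> 0" using cs(1,2) by auto
  ultimately have "ksum t (\<theta> ?p) T \<noteq> 0" unfolding k cscale_def by simp
  then obtain s where s: "s \<in> tableaux mu" "T = tb s" "meets_once m t s"
    by (rule ksum_nonzero[OF lam mu t Specht_tabloid_supported[OF mu q]]) (rule that; assumption)
  show ?thesis
    using meets_once_dominance[OF lam t s(3), of k] card_rows_take[OF lam t, of k] card_rows_take[OF mu s(1), of k] by simp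
qed

theorem Specht_iso_iff:
  assumes lam: "lam \<turnstile> m" and mu: "mu \<turnstile> m"
  shows "rep_iso (sym_group m) (Specht lam) (Specht mu) \<longleftrightarrow> lam = mu"
proof
  assume iso: "rep_iso (sym_group m) (Specht lam) (Specht mu)"
  have "sum_list lam = m" using lam by (simp add: is_partition_def)
  then have iso': "rep_iso (sym_group m) (Specht mu) (Specht lam)"
    by (intro rep_iso_sym[OF representation_Specht iso])
  show "lam = mu"
    using Specht_iso_dominance[OF lam mu iso] Specht_iso_dominance[OF mu lam iso']
    by (intro partition_eqI[OF lam mu]) (simp add: le_antisym)
qed (simp add: rep_iso_refl)

section \<open>Classification of the irreducible representations of the symmetric group\<close>

lemma card_orbit: 
  assumes "permutation g" shows "card (orbit g x) = least_power g x"
proof -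
  have "orbit g x = set (support g x)"
    unfolding orbit_altdef_bounded[OF least_power_of_permutation[OF assms]] by (auto simp: image_iff)
  then show ?thesis using cycle_of_permutation[OF assms, of x] distinct_card by fastforce
qed

lemma orbit_eq: "permutation g \<Longrightarrow> y \<in> orbit g x \<Longrightarrow> orbit g y = orbit g x"
  by (rule orbit_cyclic_eq3[OF cyclic_on_orbit'])

lemma orbit_funpow: "permutation g \<Longrightarrow> x \<in> orbit g y \<Longrightarrow> \<exists>n. (g ^^ n) y = x"
  using orbit_altdef_permutation by fastforce

lemma funpow_eq_iff_dvd:
  assumes "permutation g" "i \<le> j" shows "(g ^^ i) x = (g ^^ j) x \<longleftrightarrow> least_power g x dvd j - i"
proof -
  have "bij g" using assms(1) by (rule permutation_bijective)
  then have "inj (g ^^ i)" by (intro inj_fn bij_is_inj)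
  moreover have "(g ^^ j) x = (g ^^ i) ((g ^^ (j - i)) x)"
    using assms(2) by (metis comp_apply funpow_add le_add_diff_inverse)
  ultimately show ?thesis
    using least_power_dvd[OF assms(1)] by (metis injD)
qed

text \<open>Which powers agree at a point depends only on the length of its cycle. This makes
  transport along cycles independent of the chosen exponent.\<close>

lemma funpow_transfer:
  assumes "permutation g" "permutation g'" "least_power g' y = least_power g x"
  shows "(g ^^ i) x = (g ^^ j) x \<longleftrightarrow> (g' ^^ i) y = (g' ^^ j) y"
proof (cases "i \<le> j")
  case True
  then show ?thesis using funpow_eq_iff_dvd[OF assms(1)] funpow_eq_iff_dvd[OF assms(2)] assms(3) by simp
next
  case False
  then have "j \<le> i" by simp
  then have "(g ^^ j) x = (g ^^ i) x \<longleftrightarrow> (g' ^^ j) y = (g' ^^ i) y"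
    using funpow_eq_iff_dvd[OF assms(1)] funpow_eq_iff_dvd[OF assms(2)] assms(3) by simp
  then show ?thesis by metis
qed

text \<open>
  Two permutations are conjugate once base points \<open>p\<close> of the cycles of \<open>g\<close> are matched with base
  points \<open>q\<close> of the cycles of \<open>g'\<close> of the same length: transport along the cycles.
\<close>

lemma conjugating_permutation:
  assumes X: "finite X" and g: "g permutes X" and g': "g' permutes X"
    and p: "\<And>x. x \<in> X \<Longrightarrow> p x \<in> orbit g x"
    and p_const: "\<And>x y. x \<in> X \<Longrightarrow> y \<in> X \<Longrightarrow> orbit g x = orbit g y \<Longrightarrow> p x = p y"
    and q: "\<And>x. x \<in> X \<Longrightarrow> q x \<in> X"
    and q_const: "\<And>x y. x \<in> X \<Longrightarrow> y \<in> X \<Longrightarrow> orbit g x = orbit g y \<Longrightarrow> q x = q y"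
    and len: "\<And>x. x \<in> X \<Longrightarrow> card (orbit g' (q x)) = card (orbit g x)"
    and sep: "\<And>x y. x \<in> X \<Longrightarrow> y \<in> X \<Longrightarrow> orbit g' (q x) = orbit g' (q y) \<Longrightarrow> orbit g x = orbit g y"
  obtains s where "s permutes X" "s \<circ> g = g' \<circ> s"
    "\<And>x n. x \<in> X \<Longrightarrow> (g ^^ n) (p x) = x \<Longrightarrow> s x = (g' ^^ n) (q x)"
proof -
  have pg: "permutation g" "permutation g'" using X g g' by (auto simp: permutation_permutes)
  have orb_p: "orbit g (p x) = orbit g x" if "x \<in> X" for x by (rule orbit_eq[OF pg(1) p[OF that]])
  have lp: "least_power g' (q x) = least_power g (p x)" if "x \<in> X" for x
    using len[OF that] card_orbit[OF pg(1), of "p x"] card_orbit[OF pg(2), of "q x"] orb_p[OF that] by simp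
  have ex: "\<exists>n. (g ^^ n) (p x) = x" if "x \<in> X" for x
    using orb_p[OF that] permutation_self_in_orbit[OF pg(1), of x] by (intro orbit_funpow[OF pg(1)]) simp
  define N where "N x = (SOME n. (g ^^ n) (p x) = x)" for x
  have N: "(g ^^ N x) (p x) = x" if "x \<in> X" for x unfolding N_def by (rule someI_ex[OF ex[OF that]])
  define s where "s x = (if x \<in> X then (g' ^^ N x) (q x) else x)" for x
  have s: "s x = (g' ^^ n) (q x)" if x: "x \<in> X" and n: "(g ^^ n) (p x) = x" for x n
    using funpow_transfer[OF pg lp[OF x], of "N x" n] N[OF x] n x by (simp add: s_def)
  have gX: "g x \<in> X" if "x \<in> X" for x using permutes_in_image[OF g] that by blast
  have funX: "(g' ^^ n) x \<in> X" if "x \<in> X" for x n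
    using that by (induction n) (auto simp: permutes_in_image[OF g'])
  have sX: "s x \<in> X" if "x \<in> X" for x using funX[OF q[OF that]] that by (simp add: s_def)
  have sorb: "orbit g' (s x) = orbit g' (q x)" if "x \<in> X" for x
    using that funpow_in_orbit[OF permutation_self_in_orbit[OF pg(2)], of "N x" "q x"]
    by (intro orbit_eq[OF pg(2)]) (simp add: s_def)
  have "inj_on s X"
  proof (rule inj_onI)
    fix x y assume x: "x \<in> X" and y: "y \<in> X" and eq: "s x = s y"
    have o: "orbit g x = orbit g y" by (rule sep[OF x y]) (use sorb[OF x] sorb[OF y] eq in simp)
    have "(g' ^^ N x) (q x) = (g' ^^ N y) (q x)" using eq x y q_const[OF x y o] by (simp add: s_def)
    then have "(g ^^ N x) (p x) = (g ^^ N y) (p x)" by (simp only: funpow_transfer[OF pg lp[OF x]])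
    moreover have "(g ^^ N y) (p x) = y" unfolding p_const[OF x y o] by (rule N[OF y])
    ultimately show "x = y" by (simp only: N[OF x])
  qed
  moreover have "s ` X \<subseteq> X" using sX by blast
  ultimately have "bij_betw s X X" using X by (simp add: bij_betw_def card_image card_subset_eq)
  then have perm: "s permutes X" by (rule bij_imp_permutes) (auto simp: s_def)
  have "s (g x) = g' (s x)" for x
  proof (cases "x \<in> X")
    case True
    have o: "orbit g (g x) = orbit g x" by (rule permutation_orbit_step[OF pg(1)])
    have "(g ^^ Suc (N x)) (p (g x)) = g x"
      using N[OF True] p_const[OF gX[OF True] True o] by simp
    then have "s (g x) = (g' ^^ Suc (N x)) (q (g x))" by (rule s[OF gX[OF True]])
    then show ?thesis using q_const[OF gX[OF True] True o] True by (simp add: s_def)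
  next
    case False
    then show ?thesis using g g' by (simp add: s_def permutes_not_in)
  qed
  then have "s \<circ> g = g' \<circ> s" by (simp add: fun_eq_iff)
  with perm s show ?thesis using that by blast
qed

text \<open>Each cycle is run through forwards from a base point p and mapped to the same cycle run
  through backwards from q. On a cycle with both marked points, p = \<open>a\<close> and q =
  \<open>b\<close> give the reflection that exchanges them. On any other cycle p = q is fixed, and
  it is the marked point if there is one.\<close>

lemma conj_to_inverse:
  assumes X: "finite X" and g: "g permutes X" and a: "a \<in> X" and b: "b \<in> X"
  obtains s where "s permutes X" "s \<circ> g = inv' g \<circ> s" "s ` {a, b} = {a, b}"
proof -
  have pg: "permutation g" using X g by (auto simp: permutation_permutes)
  have g': "inv' g permutes X" using g by (rule permutes_inv)
  have pg': "permutation (inv' g)" using X g' by (auto simp: permutation_permutes)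
  have orb: "orbit (inv' g) x = orbit g x" for x by (rule orbit_inv_eq[OF pg])
  have self: "x \<in> orbit g x" for x by (rule permutation_self_in_orbit[OF pg])
  have oX: "orbit g x \<subseteq> X" if "x \<in> X" for x using permutes_orbit_subset[OF g that] .
  define p where "p x = (if a \<in> orbit g x then a else if b \<in> orbit g x then b else SOME y. y \<in> orbit g x)" for x
  define q where "q x = (if a \<in> orbit g x \<and> b \<in> orbit g x then b else p x)" for x
  have p: "p x \<in> orbit g x" for x unfolding p_def using someI[of "\<lambda>y. y \<in> orbit g x", OF self] by auto
  have q: "q x \<in> orbit g x" for x using p by (auto simp: q_def)
  have oq: "orbit g (q x) = orbit g x" for x by (rule orbit_eq[OF pg q])
  obtain s where s: "s permutes X" "s \<circ> g = inv' g \<circ> s"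
    "\<And>x n. x \<in> X \<Longrightarrow> (g ^^ n) (p x) = x \<Longrightarrow> s x = (inv' g ^^ n) (q x)"
  proof (rule conjugating_permutation[OF X g g', of p q])
    show "p x \<in> orbit g x" for x by (rule p)
    show "p x = p y" "q x = q y" if "orbit g x = orbit g y" for x y
      using that by (simp_all add: p_def q_def)
    show "q x \<in> X" if "x \<in> X" for x using q oX[OF that] by blast
    show "card (orbit (inv' g) (q x)) = card (orbit g x)" for x by (simp only: orb oq)
    show "orbit g x = orbit g y" if "orbit (inv' g) (q x) = orbit (inv' g) (q y)" for x y
      using that by (simp only: orb oq)
  qed (rule that; assumption)
  have sa: "s a = (if b \<in> orbit g a then b else a)"
    using s(3)[OF a, of 0] self[of a] by (auto simp: p_def q_def)
  have sb: "s b = (if a \<in> orbit g b then a else b)"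
  proof (cases "a \<in> orbit g b")
    case True
    \<comment> \<open>\<open>b\<close> lies n steps after \<open>a\<close>, so it is sent to the
      point n steps before \<open>b\<close>, which is \<open>a\<close>.\<close>
    obtain n where n: "(g ^^ n) a = b"
      using orbit_funpow[OF pg, of b a] orbit_eq[OF pg True] self[of b] by auto
    have "inv' g ^^ n = inv' (g ^^ n)" using permutation_bijective[OF pg] by (simp add: inv_fn)
    moreover have "inv' (g ^^ n) b = a" using n permutation_bijective[OF pg] by (metis bij_fn bij_is_inj inv_f_f)
    moreover have "p b = a" "q b = b" using True self[of b] by (auto simp: p_def q_def)
    ultimately show ?thesis using s(3)[OF b, of n] n True by simp
  next
    case False
    then show ?thesis using s(3)[OF b, of 0] self[of b] by (simp add: p_def q_def)
  qed
  have "b \<in> orbit g a \<longleftrightarrow> a \<in> orbit g b" using orbit_eq[OF pg] self by metis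
  then have "s ` {a, b} = {a, b}" using sa sb by auto
  with s(1,2) show ?thesis by (rule that)
qed

text \<open>Elements are paired off one at a time; the common multiset of labels guarantees a
  partner. It serves to match cycles of equal length.\<close>

lemma matching_bijection:
  assumes "finite A" "finite C" "image_mset f (mset_set A) = image_mset f' (mset_set C)"
  obtains \<beta> where "bij_betw \<beta> A C" "\<And>a. a \<in> A \<Longrightarrow> f' (\<beta> a) = f a"
proof -
  have "\<exists>\<beta>. bij_betw \<beta> A C \<and> (\<forall>a\<in>A. f' (\<beta> a) = f a)"
    using assms
  proof (induction A arbitrary: C rule: finite_induct)
    case empty
    then have "C = {}" by (auto simp: mset_set_empty_iff)
    then show ?case by (intro exI[of _ undefined]) (simp add: bij_betw_def)
  next
    case (insert a A)
    have "f a \<in># image_mset f' (mset_set C)" using insert.hyps by (simp flip: insert.prems(2))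
    then obtain c where c: "c \<in> C" "f' c = f a" using insert.prems(1) by auto
    have "mset_set C = add_mset c (mset_set (C - {c}))"
      using c(1) insert.prems(1) by (simp add: mset_set.remove)
    then have "image_mset f (mset_set A) = image_mset f' (mset_set (C - {c}))"
      using insert c by simp
    from insert.IH[OF _ this] insert.prems(1) obtain \<beta>
      where \<beta>: "bij_betw \<beta> A (C - {c})" "\<forall>a\<in>A. f' (\<beta> a) = f a" by auto
    have "bij_betw (\<beta>(a := c)) A (C - {c})"
      using \<beta>(1) insert.hyps(2) by (subst bij_betw_cong[of A _ \<beta>]) auto
    moreover have "bij_betw (\<beta>(a := c)) {a} {c}" by (simp add: bij_betw_def)
    ultimately have "bij_betw (\<beta>(a := c)) (A \<union> {a}) ((C - {c}) \<union> {c})"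
      by (rule bij_betw_combine) auto
    moreover have "A \<union> {a} = insert a A" "(C - {c}) \<union> {c} = C" using c(1) by auto
    ultimately have "bij_betw (\<beta>(a := c)) (insert a A) C" by simp
    moreover have "\<forall>x\<in>insert a A. f' ((\<beta>(a := c)) x) = f x" using \<beta>(2) c(2) insert.hyps(2) by auto
    ultimately show ?case by blast
  qed
  then show ?thesis using that by blast
qed

text \<open>The cycle type, in decreasing order so that it is a partition. Fixed points are orbits
  of size 1 and count as parts.\<close>

definition ctype :: "nat \<Rightarrow> (nat \<Rightarrow> nat) \<Rightarrow> nat list" where
  "ctype n g = rev (sorted_list_of_multiset (image_mset card (mset_set (orbit g ` {1..n}))))"

lemma ctype_partition:
  assumes g: "g permutes {1..n}" shows "ctype n g \<turnstile> n"
proof -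
  have pg: "permutation g" using g by (rule permutation_if)
  have self: "x \<in> orbit g x" for x by (rule permutation_self_in_orbit[OF pg])
  let ?O = "orbit g ` {1..n}"
  have "sum_list (ctype n g) = (\<Sum>Q\<in>?O. card Q)"
    by (simp add: ctype_def sum_unfold_sum_mset flip: sum_mset_sum_list)
  also have "\<dots> = card (\<Union> ?O)"
  proof (rule card_Union_disjoint[symmetric])
    show "pairwise disjnt ?O"
    proof (rule pairwiseI)
      fix P Q assume "P \<in> ?O" "Q \<in> ?O" "P \<noteq> Q"
      then show "disjnt P Q" unfolding disjnt_def using orbit_eq[OF pg] by blast
    qed
    show "finite P" if "P \<in> ?O" for P using that finite_orbit[OF self] by blast
  qed
  also have "\<Union> ?O = {1..n}" using permutes_orbit_subset[OF g] self by blast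
  finally have "sum_list (ctype n g) = n" by simp
  moreover have "0 \<notin> set (ctype n g)"
    using finite_orbit[OF self] orbit_nonempty[of g] by (auto simp: ctype_def card_eq_0_iff)
  moreover have "sorted_wrt (\<ge>) (ctype n g)"
    by (simp add: ctype_def sorted_wrt_rev)
  ultimately show ?thesis by (simp add: is_partition_def)
qed

lemma ctype_eq_conj:
  assumes g: "g permutes {1..n}" and g': "g' permutes {1..n}" and eq: "ctype n g = ctype n g'"
  obtains s where "s permutes {1..n}" "s \<circ> g = g' \<circ> s"
proof -
  let ?X = "{1..n}"
  have pg: "permutation g" "permutation g'" using g g' by (auto intro: permutation_if)
  have "image_mset card (mset_set (orbit g ` ?X)) = image_mset card (mset_set (orbit g' ` ?X))"
    using eq unfolding ctype_def by (metis mset_sorted_list_of_multiset rev_rev_ident)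
  then obtain \<beta> where \<beta>: "bij_betw \<beta> (orbit g ` ?X) (orbit g' ` ?X)"
    "\<And>Q. Q \<in> orbit g ` ?X \<Longrightarrow> card (\<beta> Q) = card Q"
    by (rule matching_bijection[rotated 2]) (auto intro: that)
  define p where "p x = (SOME y. y \<in> orbit g x)" for x
  define q where "q x = (SOME y. y \<in> ?X \<and> orbit g' y = \<beta> (orbit g x))" for x
  have q: "q x \<in> ?X" "orbit g' (q x) = \<beta> (orbit g x)" if "x \<in> ?X" for x
  proof -
    have "\<beta> (orbit g x) \<in> orbit g' ` ?X" using \<beta>(1) that by (auto simp: bij_betw_def simp del: atLeastAtMost_iff)
    then have "\<exists>y. y \<in> ?X \<and> orbit g' y = \<beta> (orbit g x)" by blast
    from someI_ex[OF this] show "q x \<in> ?X" "orbit g' (q x) = \<beta> (orbit g x)" unfolding q_def by auto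
  qed
  show ?thesis
  proof (rule conjugating_permutation[OF _ g g', of p q])
    show "p x \<in> orbit g x" for x unfolding p_def using permutation_self_in_orbit[OF pg(1)] by (rule someI)
    show "p x = p y" "q x = q y" if "orbit g x = orbit g y" for x y
      using that by (simp_all add: p_def q_def)
    show "card (orbit g' (q x)) = card (orbit g x)" if "x \<in> ?X" for x
      using q(2)[OF that] \<beta>(2) that by simp
    show "orbit g x = orbit g y" if "x \<in> ?X" "y \<in> ?X" "orbit g' (q x) = orbit g' (q y)" for x y
      using that q(2) \<beta>(1) unfolding bij_betw_def by (metis image_eqI inj_onD)
  qed (use q that in auto)
qed

lemma finite_partitions: "finite {lam. lam \<turnstile> n}"
proof -
  have "lam \<turnstile> n \<Longrightarrow> set lam \<subseteq> {..n} \<and> length lam \<le> n" for lam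
  proof -
    assume lam: "lam \<turnstile> n"
    have "length l \<le> sum_list l" if "0 \<notin> set l" for l :: "nat list"
      using that
    proof (induction l)
      case (Cons a l)
      then show ?case by (cases a) auto
    qed simp
    then show ?thesis using lam member_le_sum_list by (fastforce simp: is_partition_def)
  qed
  then have "{lam. lam \<turnstile> n} \<subseteq> {xs. set xs \<subseteq> {..n} \<and> length xs \<le> n}" by blast
  then show ?thesis by (rule finite_subset) (rule finite_lists_length_le, simp)
qed

lemma finite_sym_group: "finite (carrier (sym_group n))"
  by (simp add: sym_group_def finite_permutations)

lemma orthonormal_independent:
  assumes "finite S" and orth: "\<And>f f'. f \<in> S \<Longrightarrow> f' \<in> S \<Longrightarrow> ip G f f' = (if f = f' then 1 else 0)"
  shows "cfun.independent S"
proof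
  assume "cfun.dependent S"
  then obtain u where u: "(\<Sum>f\<in>S. cscale (u f) f) = 0" "\<exists>f\<in>S. u f \<noteq> 0"
    using cfun.dependent_finite[OF assms(1)] by auto
  then obtain f where f: "f \<in> S" "u f \<noteq> 0" by blast
  have "ip G (\<lambda>g. \<Sum>f\<in>S. u f * f g) f = (\<Sum>f'\<in>S. u f' * ip G f' f)"
    unfolding ip_sum_left by (simp add: ip_scale_left)
  also have "\<dots> = (\<Sum>f'\<in>S. if f' = f then u f else 0)"
    by (intro sum.cong refl) (simp add: orth f(1))
  also have "\<dots> = u f" using assms(1) f(1) by simp
  finally have "ip G (\<lambda>g. \<Sum>f\<in>S. u f * f g) f = u f" .
  moreover have "(\<lambda>g. \<Sum>f\<in>S. u f * f g) = (\<lambda>g. 0)"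
    using u(1) by (simp add: fun_eq_iff sum_apply cscale_def)
  ultimately show False using f(2) by (simp add: ip_def)
qed

text \<open>
  The irreducible characters are orthonormal in the space of class functions, which has dimension at
  most the number of cycle types; the Specht modules already account for all of it.
\<close>

theorem Specht_exhaustive:
  assumes V: "irreducible_rep (sym_group n) V"
  shows "\<exists>lam. lam \<turnstile> n \<and> rep_iso (sym_group n) V (Specht lam)"
proof (rule ccontr)
  assume none: "\<not> (\<exists>lam. lam \<turnstile> n \<and> rep_iso (sym_group n) V (Specht lam))"
  let ?G = "sym_group n"
  let ?P = "{lam. lam \<turnstile> n}"
  note fin = finite_sym_group[of n]
  interpret group ?G by (rule sym_group_is_group)
  \<comment> \<open>Functions on the group live in a space of functions on the whole type, so
    characters are set to 0 outside the carrier before linear independence is considered.\<close>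
  define res where "res \<chi> = (\<lambda>g. if g \<in> carrier ?G then \<chi> g else (0::complex))" for \<chi> :: "(nat \<Rightarrow> nat) \<Rightarrow> complex"
  have ip_res: "ip ?G (res \<chi>) (res \<psi>) = ip ?G \<chi> \<psi>" for \<chi> \<psi>
    by (rule ip_cong[OF is_group]) (simp_all add: res_def)
  let ?f = "\<lambda>lam. res (chr (Specht lam))"
  have orth: "ip ?G (?f lam) (?f mu) = (if lam = mu then 1 else 0)" if "lam \<turnstile> n" "mu \<turnstile> n" for lam mu
    unfolding ip_res using ip_chr_irreducible[OF irreducible_Specht[OF that(1)] irreducible_Specht[OF that(2)] fin]
      Specht_iso_iff[OF that] by simp
  have orthV: "ip ?G (?f lam) (res (chr V)) = 0" "ip ?G (res (chr V)) (?f lam) = 0" if "lam \<turnstile> n" for lam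
  proof -
    show "ip ?G (res (chr V)) (?f lam) = 0"
      unfolding ip_res using ip_chr_irreducible[OF V irreducible_Specht[OF that] fin] none that by auto
    then show "ip ?G (?f lam) (res (chr V)) = 0" using ip_commute[OF is_group] by metis
  qed
  have VV: "ip ?G (res (chr V)) (res (chr V)) = 1" unfolding ip_res by (rule ip_chr_self[OF V fin])
  let ?S = "insert (res (chr V)) (?f ` ?P)"
  have inj: "inj_on ?f ?P"
  proof (rule inj_onI)
    fix lam mu assume "lam \<in> ?P" "mu \<in> ?P" "?f lam = ?f mu"
    then show "lam = mu" using orth[of lam mu] orth[of mu mu] by (auto split: if_splits)
  qed
  have notin: "res (chr V) \<notin> ?f ` ?P"
  proof
    assume "res (chr V) \<in> ?f ` ?P"
    then obtain lam where "lam \<turnstile> n" "res (chr V) = ?f lam" by blast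
    then show False using VV orthV(1)[of lam] by simp
  qed
  have finS: "finite ?S" using finite_partitions by simp
  have card: "card ?S = Suc (card ?P)" using finite_partitions notin by (simp add: card_image[OF inj])
  have ind: "cfun.independent ?S"
  proof (rule orthonormal_independent[OF finS, of ?G])
    fix f f' assume "f \<in> ?S" "f' \<in> ?S"
    then consider "f = res (chr V)" "f' = res (chr V)" | lam where "lam \<turnstile> n" "f = ?f lam" "f' = res (chr V)"
      | lam where "lam \<turnstile> n" "f' = ?f lam" "f = res (chr V)" | lam mu where "lam \<turnstile> n" "mu \<turnstile> n" "f = ?f lam" "f' = ?f mu"
      by blast
    then show "ip ?G f f' = (if f = f' then 1 else 0)"
    proof cases
      case 1 then show ?thesis using VV by simp
    next
      case (2 lam)
      have "f \<in> ?f ` ?P" using 2(1,2) by (intro image_eqI[of _ _ lam]) simp_all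
      then have "f \<noteq> f'" using notin 2(3) by metis
      then show ?thesis using orthV(1)[OF 2(1)] 2(2,3) by simp
    next
      case (3 lam)
      have "f' \<in> ?f ` ?P" using 3(1,2) by (intro image_eqI[of _ _ lam]) simp_all
      then have "f \<noteq> f'" using notin 3(3) by metis
      then show ?thesis using orthV(2)[OF 3(1)] 3(2,3) by simp
    next
      case (4 lam mu)
      then have "f = f' \<longleftrightarrow> lam = mu" using inj by (auto dest: inj_onD)
      then show ?thesis using orth[OF 4(1,2)] 4(3,4) by simp
    qed
  qed
  \<comment> \<open>Indicator functions of the cycle types. Elements of equal cycle type are
    conjugate, so every character is a combination of these.\<close>
  let ?D = "(\<lambda>lam g. if g \<in> carrier ?G \<and> ctype n g = lam then 1 else (0::complex)) ` ?P"
  have span: "res (chr R) \<in> cfun.span ?D" if R: "representation ?G R" for R :: "(nat \<Rightarrow> nat, 'z) rep"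
  proof -
    have "\<exists>c. \<forall>g\<in>carrier ?G. ctype n g = lam \<longrightarrow> chr R g = c" for lam
    proof (cases "\<exists>g\<in>carrier ?G. ctype n g = lam")
      case True
      then obtain g where g: "g \<in> carrier ?G" "ctype n g = lam" by blast
      have "chr R h = chr R g" if h: "h \<in> carrier ?G" "ctype n h = lam" for h
      proof -
        obtain s where s: "s permutes {1..n}" "s \<circ> g = h \<circ> s"
        proof (rule ctype_eq_conj)
          show "g permutes {1..n}" "h permutes {1..n}" using g h by (auto simp: sym_group_carrier)
          show "ctype n g = ctype n h" using g h by simp
        qed (rule that; assumption)
        have sG: "s \<in> carrier ?G" using s(1) by (simp add: sym_group_carrier)
        have "s \<otimes>\<^bsub>?G\<^esub> g \<otimes>\<^bsub>?G\<^esub> inv\<^bsub>?G\<^esub> s = h \<otimes>\<^bsub>?G\<^esub> s \<otimes>\<^bsub>?G\<^esub> inv\<^bsub>?G\<^esub> s"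
          using s(2) by (simp add: sym_group_mult)
        also have "\<dots> = h"
          by (simp only: m_assoc[OF h(1) sG inv_closed[OF sG]] r_inv[OF sG] r_one[OF h(1)])
        finally show ?thesis using chr_conj[OF R g(1) sG] by simp
      qed
      then show ?thesis by blast
    qed blast
    then obtain c where c: "\<And>lam g. g \<in> carrier ?G \<Longrightarrow> ctype n g = lam \<Longrightarrow> chr R g = c lam" by metis
    have "res (chr R) = (\<Sum>lam\<in>?P. cscale (c lam) (\<lambda>g. if g \<in> carrier ?G \<and> ctype n g = lam then 1 else 0))"
    proof
      fix g
      show "res (chr R) g = (\<Sum>lam\<in>?P. cscale (c lam) (\<lambda>g. if g \<in> carrier ?G \<and> ctype n g = lam then 1 else 0)) g"
      proof (cases "g \<in> carrier ?G")
        case True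
        then have "ctype n g \<in> ?P" using ctype_partition by (simp add: sym_group_carrier)
        then show ?thesis using True c[OF True refl] finite_partitions[of n]
          by (simp add: sum_apply cscale_def res_def if_distrib[of "(*) _"] cong: if_cong)
      qed (simp add: sum_apply cscale_def res_def)
    qed
    also have "\<dots> \<in> cfun.span ?D" by (intro cfun.span_sum cfun.span_scale cfun.span_base imageI)
    finally show ?thesis .
  qed
  have "?S \<subseteq> cfun.span ?D"
    using span[of V] V span[OF representation_Specht] by (auto simp: irreducible_rep_def is_partition_def)
  then have "card ?S \<le> card ?D"
    using cfun.independent_span_bound[OF _ ind, of ?D] finite_partitions by blast
  also have "\<dots> \<le> card ?P" by (rule card_image_le[OF finite_partitions])
  finally show False using card by simp
qed

text \<open>Orthonormality and completeness of the Specht characters, applied to each irreducible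
  piece of a decomposition and added up.\<close>

lemma chr_Specht_expansion:
  assumes R: "representation (sym_group n) R" and g: "g \<in> carrier (sym_group n)"
  shows "chr R g = (\<Sum>lam\<in>{lam. lam \<turnstile> n}. ip (sym_group n) (chr R) (chr (Specht lam)) * chr (Specht lam) g)"
proof -
  let ?G = "sym_group n" and ?P = "{lam. lam \<turnstile> n}"
  note fin = finite_sym_group[of n]
  obtain Us where Us: "\<forall>U\<in>set Us. invariant_subspace ?G R U \<and> irreducible_rep ?G (sub R U)"
    "\<forall>g\<in>carrier ?G. chr R g = (\<Sum>U\<leftarrow>Us. chr (sub R U) g)"
    using decomposition[OF R fin] by blast
  have irr: "chr (sub R U) g = (\<Sum>lam\<in>?P. ip ?G (chr (sub R U)) (chr (Specht lam)) * chr (Specht lam) g)"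
    if "U \<in> set Us" for U
  proof -
    have U: "irreducible_rep ?G (sub R U)" using Us(1) that by blast
    obtain mu where mu: "mu \<turnstile> n" "rep_iso ?G (sub R U) (Specht mu)" using Specht_exhaustive[OF U] by blast
    have rU: "representation ?G (sub R U)" using U by (simp add: irreducible_rep_def)
    have m: "sum_list mu = n" using mu(1) by (simp add: is_partition_def)
    have eq: "chr (sub R U) g = chr (Specht mu) g" if "g \<in> carrier ?G" for g
      by (rule chr_rep_iso[OF rU representation_Specht[OF m] mu(2) that])
    have ip: "ip ?G (chr (sub R U)) (chr (Specht lam)) = (if lam = mu then 1 else 0)" if "lam \<turnstile> n" for lam
    proof -
      have "ip ?G (chr (sub R U)) (chr (Specht lam)) = ip ?G (chr (Specht mu)) (chr (Specht lam))"
        by (rule ip_cong[OF sym_group_is_group]) (simp_all add: eq)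
      then show ?thesis
        using ip_chr_irreducible[OF irreducible_Specht[OF mu(1)] irreducible_Specht[OF that] fin]
          Specht_iso_iff[OF mu(1) that] by auto
    qed
    have "(\<Sum>lam\<in>?P. ip ?G (chr (sub R U)) (chr (Specht lam)) * chr (Specht lam) g)
        = (\<Sum>lam\<in>?P. if lam = mu then chr (Specht mu) g else 0)"
      by (intro sum.cong refl) (simp add: ip)
    then show ?thesis using mu(1) finite_partitions eq[OF g] by simp
  qed
  have "chr R g = (\<Sum>U\<leftarrow>Us. \<Sum>lam\<in>?P. ip ?G (chr (sub R U)) (chr (Specht lam)) * chr (Specht lam) g)"
    using Us(2) g irr by (simp cong: map_cong)
  also have "\<dots> = (\<Sum>lam\<in>?P. (\<Sum>U\<leftarrow>Us. ip ?G (chr (sub R U)) (chr (Specht lam))) * chr (Specht lam) g)"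
    by (induction Us) (simp_all add: sum.distrib distrib_right)
  also have "\<dots> = (\<Sum>lam\<in>?P. ip ?G (\<lambda>g. \<Sum>U\<leftarrow>Us. chr (sub R U) g) (chr (Specht lam)) * chr (Specht lam) g)"
    by (simp only: ip_sum_list_left)
  also have "\<dots> = (\<Sum>lam\<in>?P. ip ?G (chr R) (chr (Specht lam)) * chr (Specht lam) g)"
    using Us(2) by (intro sum.cong refl arg_cong2[of _ _ _ _ "(*)"] ip_cong[OF sym_group_is_group]) auto
  finally show ?thesis .
qed

section \<open>Induced class functions and branching\<close>

lemma icf_cong:
  assumes "\<And>h. h \<in> carrier H \<Longrightarrow> \<chi> h = \<psi> h" shows "icf G H j \<chi> g = icf G H j \<psi> g"
  unfolding icf_def using assms by (intro arg_cong2[of _ _ _ _ "(/)"] sum.cong refl) simp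

lemma icf_add: "icf G H j (\<lambda>h. \<chi> h + \<psi> h) g = icf G H j \<chi> g + icf G H j \<psi> g"
  unfolding icf_def add_divide_distrib[symmetric] sum.distrib[symmetric]
  by (intro arg_cong2[of _ _ _ _ "(/)"] sum.cong refl) simp

lemma icf_sum: "icf G H j (\<lambda>h. \<Sum>i\<in>I. \<chi> i h) g = (\<Sum>i\<in>I. icf G H j (\<chi> i) g)"
proof (induction I rule: infinite_finite_induct)
  case (insert i I)
  then show ?case using icf_add[of G H j "\<chi> i" "\<lambda>h. \<Sum>i\<in>I. \<chi> i h"] by simp
qed (simp_all add: icf_def)

lemma (in group) conj_eq_iff:
  assumes "g \<in> carrier G" "x \<in> carrier G" "y \<in> carrier G"
  shows "g \<otimes> x = x \<otimes> y \<longleftrightarrow> g = x \<otimes> y \<otimes> inv x" "g \<otimes> x = x \<otimes> y \<longleftrightarrow> y = inv x \<otimes> g \<otimes> x"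
proof -
  show "g \<otimes> x = x \<otimes> y \<longleftrightarrow> g = x \<otimes> y \<otimes> inv x"
    using assms inv_solve_right[of g "x \<otimes> y" x] by auto
  show "g \<otimes> x = x \<otimes> y \<longleftrightarrow> y = inv x \<otimes> g \<otimes> x"
    using assms inv_solve_left[of y x "g \<otimes> x"] by (auto simp: m_assoc)
qed

text \<open>Summing over g first leaves, for each x and h, the single element conjugate to j h by x;
  at its inverse the class function \<psi> has the same value as at the inverse of j h.\<close>

lemma frobenius:
  assumes G: "group G" and H: "group H" and fin: "finite (carrier G)" and j: "j \<in> hom H G"
    and \<psi>: "\<And>g x. g \<in> carrier G \<Longrightarrow> x \<in> carrier G \<Longrightarrow> \<psi> (x \<otimes>\<^bsub>G\<^esub> g \<otimes>\<^bsub>G\<^esub> inv\<^bsub>G\<^esub> x) = \<psi> g"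
  shows "ip G (icf G H j \<chi>) \<psi> = ip H \<chi> (\<lambda>h. \<psi> (j h))"
proof -
  interpret G: group G by fact
  interpret H: group H by fact
  interpret h: group_hom H G j using j by unfold_locales
  let ?c = "of_nat (card (carrier G)) :: complex"
  have c: "?c \<noteq> 0" using order_pos[OF G fin] by simp
  have "(\<Sum>g\<in>carrier G. \<Sum>x\<in>carrier G. \<Sum>h\<in>carrier H. (if g \<otimes>\<^bsub>G\<^esub> x = x \<otimes>\<^bsub>G\<^esub> j h then \<chi> h else 0) * \<psi> (inv\<^bsub>G\<^esub> g))
    = (\<Sum>x\<in>carrier G. \<Sum>h\<in>carrier H. \<Sum>g\<in>carrier G. (if g \<otimes>\<^bsub>G\<^esub> x = x \<otimes>\<^bsub>G\<^esub> j h then \<chi> h else 0) * \<psi> (inv\<^bsub>G\<^esub> g))"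
    by (subst sum.swap) (intro sum.cong refl sum.swap)
  also have "\<dots> = (\<Sum>x\<in>carrier G. \<Sum>h\<in>carrier H. \<chi> h * \<psi> (j (inv\<^bsub>H\<^esub> h)))"
  proof (intro sum.cong refl)
    fix x h assume x: "x \<in> carrier G" and h: "h \<in> carrier H"
    let ?y = "x \<otimes>\<^bsub>G\<^esub> j h \<otimes>\<^bsub>G\<^esub> inv\<^bsub>G\<^esub> x"
    have y: "?y \<in> carrier G" using x h by simp
    have "(\<Sum>g\<in>carrier G. (if g \<otimes>\<^bsub>G\<^esub> x = x \<otimes>\<^bsub>G\<^esub> j h then \<chi> h else 0) * \<psi> (inv\<^bsub>G\<^esub> g))
      = (\<Sum>g\<in>carrier G. if g = ?y then \<chi> h * \<psi> (inv\<^bsub>G\<^esub> ?y) else 0)"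
      using x h by (intro sum.cong refl) (simp add: G.conj_eq_iff(1))
    also have "\<dots> = \<chi> h * \<psi> (inv\<^bsub>G\<^esub> ?y)" using y fin by simp
    also have "inv\<^bsub>G\<^esub> ?y = x \<otimes>\<^bsub>G\<^esub> j (inv\<^bsub>H\<^esub> h) \<otimes>\<^bsub>G\<^esub> inv\<^bsub>G\<^esub> x" using x h by (simp add: G.inv_mult_group G.m_assoc)
    also have "\<psi> \<dots> = \<psi> (j (inv\<^bsub>H\<^esub> h))" using x h by (intro \<psi>) auto
    finally show "(\<Sum>g\<in>carrier G. (if g \<otimes>\<^bsub>G\<^esub> x = x \<otimes>\<^bsub>G\<^esub> j h then \<chi> h else 0) * \<psi> (inv\<^bsub>G\<^esub> g)) = \<chi> h * \<psi> (j (inv\<^bsub>H\<^esub> h))" .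
  qed
  also have "\<dots> = ?c * (\<Sum>h\<in>carrier H. \<chi> h * \<psi> (j (inv\<^bsub>H\<^esub> h)))" by simp
  finally show ?thesis
    using c by (simp add: ip_def icf_def sum_divide_distrib[symmetric] sum_distrib_right)
qed

lemma sum_rotate:
  "(\<Sum>x\<in>A. \<Sum>y\<in>C. \<Sum>z\<in>D. f x y z) = (\<Sum>y\<in>C. \<Sum>z\<in>D. \<Sum>x\<in>A. f x y z)"
  by (subst sum.swap) (intro sum.cong refl sum.swap)

text \<open>For given x, y and h exactly one k in \<open>K\<close> satisfies the inner condition,
  and the outer one then concerns only the product of x and j y. Translating x by j y frees the sum
  over y.\<close>

lemma icf_trans:
  assumes G: "group G" and K: "group K" and fin: "finite (carrier K)"
    and j: "j \<in> hom K G" and i: "\<And>h. h \<in> carrier H \<Longrightarrow> i h \<in> carrier K" and g: "g \<in> carrier G"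
  shows "icf G K j (icf K H i \<chi>) g = icf G H (\<lambda>h. j (i h)) \<chi> g"
proof -
  interpret G: group G by fact
  interpret K: group K by fact
  interpret h: group_hom K G j using j by unfold_locales
  let ?c = "of_nat (card (carrier K)) :: complex" and ?d = "of_nat (card (carrier H)) :: complex"
  have c: "?c \<noteq> 0" using order_pos[OF K fin] by simp
  define F where "F z = (\<Sum>h\<in>carrier H. if g \<otimes>\<^bsub>G\<^esub> z = z \<otimes>\<^bsub>G\<^esub> j (i h) then \<chi> h else 0)" for z
  have inner: "(\<Sum>k\<in>carrier K. if g \<otimes>\<^bsub>G\<^esub> x = x \<otimes>\<^bsub>G\<^esub> j k then if k \<otimes>\<^bsub>K\<^esub> y = y \<otimes>\<^bsub>K\<^esub> i h then \<chi> h else 0 else 0)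
      = (if g \<otimes>\<^bsub>G\<^esub> (x \<otimes>\<^bsub>G\<^esub> j y) = x \<otimes>\<^bsub>G\<^esub> j y \<otimes>\<^bsub>G\<^esub> j (i h) then \<chi> h else 0)"
    if x: "x \<in> carrier G" and y: "y \<in> carrier K" and h: "h \<in> carrier H" for x y h
  proof -
    let ?k = "y \<otimes>\<^bsub>K\<^esub> i h \<otimes>\<^bsub>K\<^esub> inv\<^bsub>K\<^esub> y"
    have k: "?k \<in> carrier K" using y i[OF h] by simp
    have "(\<Sum>k\<in>carrier K. if g \<otimes>\<^bsub>G\<^esub> x = x \<otimes>\<^bsub>G\<^esub> j k then if k \<otimes>\<^bsub>K\<^esub> y = y \<otimes>\<^bsub>K\<^esub> i h then \<chi> h else 0 else 0)
      = (\<Sum>k\<in>carrier K. if k = ?k then if g \<otimes>\<^bsub>G\<^esub> x = x \<otimes>\<^bsub>G\<^esub> j ?k then \<chi> h else 0 else 0)"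
      using y i[OF h] by (intro sum.cong refl) (simp add: K.conj_eq_iff(1))
    also have "\<dots> = (if g \<otimes>\<^bsub>G\<^esub> x = x \<otimes>\<^bsub>G\<^esub> j ?k then \<chi> h else 0)" using k fin by simp
    also have "g \<otimes>\<^bsub>G\<^esub> x = x \<otimes>\<^bsub>G\<^esub> j ?k \<longleftrightarrow> g \<otimes>\<^bsub>G\<^esub> x = x \<otimes>\<^bsub>G\<^esub> j y \<otimes>\<^bsub>G\<^esub> j (i h) \<otimes>\<^bsub>G\<^esub> inv\<^bsub>G\<^esub> j y"
      using x y i[OF h] by (simp add: G.m_assoc)
    also have "\<dots> \<longleftrightarrow> g \<otimes>\<^bsub>G\<^esub> x \<otimes>\<^bsub>G\<^esub> j y = x \<otimes>\<^bsub>G\<^esub> j y \<otimes>\<^bsub>G\<^esub> j (i h)"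
      using G.inv_solve_right[of "g \<otimes>\<^bsub>G\<^esub> x" "x \<otimes>\<^bsub>G\<^esub> j y \<otimes>\<^bsub>G\<^esub> j (i h)" "j y"] x y g i[OF h] by auto
    also have "\<dots> \<longleftrightarrow> g \<otimes>\<^bsub>G\<^esub> (x \<otimes>\<^bsub>G\<^esub> j y) = x \<otimes>\<^bsub>G\<^esub> j y \<otimes>\<^bsub>G\<^esub> j (i h)"
      using x y g by (simp add: G.m_assoc)
    finally show ?thesis .
  qed
  have "icf G K j (icf K H i \<chi>) g = (\<Sum>x\<in>carrier G. \<Sum>k\<in>carrier K. \<Sum>y\<in>carrier K. \<Sum>h\<in>carrier H.
      if g \<otimes>\<^bsub>G\<^esub> x = x \<otimes>\<^bsub>G\<^esub> j k then if k \<otimes>\<^bsub>K\<^esub> y = y \<otimes>\<^bsub>K\<^esub> i h then \<chi> h else 0 else 0) / ?d / ?c"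
    unfolding icf_def sum_divide_distrib
    by (intro sum.cong refl arg_cong2[of _ _ _ _ "(/)"]) (auto simp: sum_divide_distrib)
  also have "\<dots> = (\<Sum>x\<in>carrier G. \<Sum>y\<in>carrier K. \<Sum>h\<in>carrier H. \<Sum>k\<in>carrier K.
      if g \<otimes>\<^bsub>G\<^esub> x = x \<otimes>\<^bsub>G\<^esub> j k then if k \<otimes>\<^bsub>K\<^esub> y = y \<otimes>\<^bsub>K\<^esub> i h then \<chi> h else 0 else 0) / ?d / ?c"
    by (rule arg_cong[where f = "\<lambda>z. z / ?d / ?c"], rule sum.cong[OF refl], rule sum_rotate)
  also have "\<dots> = (\<Sum>x\<in>carrier G. \<Sum>y\<in>carrier K. F (x \<otimes>\<^bsub>G\<^esub> j y)) / ?d / ?c"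
    unfolding F_def by (intro arg_cong2[of _ _ _ _ "(/)"] sum.cong refl inner)
  also have "(\<Sum>x\<in>carrier G. \<Sum>y\<in>carrier K. F (x \<otimes>\<^bsub>G\<^esub> j y)) = (\<Sum>y\<in>carrier K. \<Sum>x\<in>carrier G. F (x \<otimes>\<^bsub>G\<^esub> j y))"
    by (rule sum.swap)
  also have "\<dots> = (\<Sum>y\<in>carrier K. \<Sum>x\<in>carrier G. F x)"
    by (intro sum.cong refl group.sum_group_right[OF G]) simp
  also have "\<dots> = ?c * (\<Sum>x\<in>carrier G. F x)" by simp
  finally have "icf G K j (icf K H i \<chi>) g = (\<Sum>x\<in>carrier G. F x) / ?d" using c by simp
  then show ?thesis by (simp only: icf_def[of G H] F_def)
qed

lemma icf_prod:
  "icf (G1 \<times>\<times> G2) (H1 \<times>\<times> H2) (\<lambda>(a, b). (j1 a, j2 b)) (\<lambda>(a, b). \<chi>1 a * \<chi>2 b) (g1, g2)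
    = icf G1 H1 j1 \<chi>1 g1 * icf G2 H2 j2 \<chi>2 g2"
proof -
  let ?a = "\<lambda>x h. if g1 \<otimes>\<^bsub>G1\<^esub> x = x \<otimes>\<^bsub>G1\<^esub> j1 h then \<chi>1 h else 0"
  let ?b = "\<lambda>x h. if g2 \<otimes>\<^bsub>G2\<^esub> x = x \<otimes>\<^bsub>G2\<^esub> j2 h then \<chi>2 h else 0"
  have "(\<Sum>x\<in>carrier (G1 \<times>\<times> G2). \<Sum>h\<in>carrier (H1 \<times>\<times> H2).
      if (g1, g2) \<otimes>\<^bsub>G1 \<times>\<times> G2\<^esub> x = x \<otimes>\<^bsub>G1 \<times>\<times> G2\<^esub> (\<lambda>(a, b). (j1 a, j2 b)) h then (\<lambda>(a, b). \<chi>1 a * \<chi>2 b) h else 0)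
    = (\<Sum>(x, x')\<in>carrier G1 \<times> carrier G2. \<Sum>(h, h')\<in>carrier H1 \<times> carrier H2. ?a x h * ?b x' h')"
    unfolding DirProd_def by (intro sum.cong refl) (auto intro!: sum.cong)
  also have "\<dots> = (\<Sum>x\<in>carrier G1. \<Sum>x'\<in>carrier G2. \<Sum>h\<in>carrier H1. \<Sum>h'\<in>carrier H2. ?a x h * ?b x' h')"
    by (simp only: sum.cartesian_product[symmetric])
  also have "\<dots> = (\<Sum>x\<in>carrier G1. \<Sum>x'\<in>carrier G2. (\<Sum>h\<in>carrier H1. ?a x h) * (\<Sum>h'\<in>carrier H2. ?b x' h'))"
    by (simp only: sum_product)
  also have "\<dots> = (\<Sum>x\<in>carrier G1. \<Sum>h\<in>carrier H1. ?a x h) * (\<Sum>x'\<in>carrier G2. \<Sum>h'\<in>carrier H2. ?b x' h')"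
    by (rule sum_product[symmetric])
  finally show ?thesis by (simp add: icf_def DirProd_def card_cartesian_product)
qed

text \<open>After the groups are matched by \<theta>, the two embeddings differ by conjugation with
  \<open>w\<close>. Shifting the summation variable x by the inverse of \<open>w\<close> absorbs the
  conjugation.\<close>

lemma icf_reindex:
  assumes G: "group G" and \<theta>: "bij_betw \<theta> (carrier H) (carrier H')" and w: "w \<in> carrier G" and g: "g \<in> carrier G"
    and j: "\<And>h. h \<in> carrier H \<Longrightarrow> j h \<in> carrier G" and j': "\<And>h. h \<in> carrier H \<Longrightarrow> j' (\<theta> h) \<in> carrier G"
    and conj: "\<And>h. h \<in> carrier H \<Longrightarrow> j h \<otimes>\<^bsub>G\<^esub> w = w \<otimes>\<^bsub>G\<^esub> j' (\<theta> h)"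
    and \<chi>: "\<And>h. h \<in> carrier H \<Longrightarrow> \<chi> h = \<chi>' (\<theta> h)"
  shows "icf G H j \<chi> g = icf G H' j' \<chi>' g"
proof -
  interpret group G by fact
  let ?F = "\<lambda>x. \<Sum>h\<in>carrier H. if g \<otimes>\<^bsub>G\<^esub> x = x \<otimes>\<^bsub>G\<^esub> j h then \<chi> h else 0"
  have "?F (x \<otimes>\<^bsub>G\<^esub> w) = (\<Sum>h\<in>carrier H'. if g \<otimes>\<^bsub>G\<^esub> (x \<otimes>\<^bsub>G\<^esub> w) = (x \<otimes>\<^bsub>G\<^esub> w) \<otimes>\<^bsub>G\<^esub> j (inv_into (carrier H) \<theta> h) then \<chi>' h else 0)" for x
    using bij_betw_inv_into_left[OF \<theta>] \<chi>
    by (subst sum.reindex_bij_betw[OF \<theta>, symmetric]) (intro sum.cong refl, simp)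
  have iff: "g \<otimes>\<^bsub>G\<^esub> (x \<otimes>\<^bsub>G\<^esub> inv\<^bsub>G\<^esub> w) = x \<otimes>\<^bsub>G\<^esub> inv\<^bsub>G\<^esub> w \<otimes>\<^bsub>G\<^esub> j h \<longleftrightarrow> g \<otimes>\<^bsub>G\<^esub> x = x \<otimes>\<^bsub>G\<^esub> j' (\<theta> h)"
    if x: "x \<in> carrier G" and h: "h \<in> carrier H" for x h
  proof -
    have e: "j h = w \<otimes>\<^bsub>G\<^esub> j' (\<theta> h) \<otimes>\<^bsub>G\<^esub> inv\<^bsub>G\<^esub> w"
      using conj[OF h] inv_solve_right[of "j h" "w \<otimes>\<^bsub>G\<^esub> j' (\<theta> h)" w] j[OF h] j'[OF h] w by auto
    have "x \<otimes>\<^bsub>G\<^esub> inv\<^bsub>G\<^esub> w \<otimes>\<^bsub>G\<^esub> j h = x \<otimes>\<^bsub>G\<^esub> (inv\<^bsub>G\<^esub> w \<otimes>\<^bsub>G\<^esub> w) \<otimes>\<^bsub>G\<^esub> j' (\<theta> h) \<otimes>\<^bsub>G\<^esub> inv\<^bsub>G\<^esub> w"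
      unfolding e using x w j'[OF h] by (simp add: m_assoc del: l_inv Units_l_inv)
    also have "\<dots> = x \<otimes>\<^bsub>G\<^esub> j' (\<theta> h) \<otimes>\<^bsub>G\<^esub> inv\<^bsub>G\<^esub> w" using x w by simp
    finally have "x \<otimes>\<^bsub>G\<^esub> inv\<^bsub>G\<^esub> w \<otimes>\<^bsub>G\<^esub> j h = x \<otimes>\<^bsub>G\<^esub> j' (\<theta> h) \<otimes>\<^bsub>G\<^esub> inv\<^bsub>G\<^esub> w" .
    moreover have "g \<otimes>\<^bsub>G\<^esub> (x \<otimes>\<^bsub>G\<^esub> inv\<^bsub>G\<^esub> w) = g \<otimes>\<^bsub>G\<^esub> x \<otimes>\<^bsub>G\<^esub> inv\<^bsub>G\<^esub> w" using x w g by (simp add: m_assoc)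
    ultimately show ?thesis using x w g j'[OF h] by simp
  qed
  have "(\<Sum>x\<in>carrier G. ?F x) = (\<Sum>x\<in>carrier G. ?F (x \<otimes>\<^bsub>G\<^esub> inv\<^bsub>G\<^esub> w))"
    by (rule group.sum_group_right[OF G inv_closed[OF w], symmetric])
  also have "\<dots> = (\<Sum>x\<in>carrier G. \<Sum>h\<in>carrier H. if g \<otimes>\<^bsub>G\<^esub> x = x \<otimes>\<^bsub>G\<^esub> j' (\<theta> h) then \<chi>' (\<theta> h) else 0)"
    by (intro sum.cong refl) (simp add: iff \<chi>)
  also have "\<dots> = (\<Sum>x\<in>carrier G. \<Sum>h\<in>carrier H'. if g \<otimes>\<^bsub>G\<^esub> x = x \<otimes>\<^bsub>G\<^esub> j' h then \<chi>' h else 0)"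
    by (intro sum.cong refl sum.reindex_bij_betw[OF \<theta>, where g = "\<lambda>h. if g \<otimes>\<^bsub>G\<^esub> _ = _ \<otimes>\<^bsub>G\<^esub> j' h then \<chi>' h else 0"])
  finally show ?thesis using bij_betw_same_card[OF \<theta>] by (simp add: icf_def)
qed

text \<open>Induction along a bijection onto the group averages a class function over conjugates of
  the argument. It is applied to embeddings with a trivial second or first factor.\<close>

lemma icf_iso:
  assumes G: "group G" and fin: "finite (carrier G)" and j: "bij_betw j (carrier H) (carrier G)" and g: "g \<in> carrier G"
    and \<psi>: "\<And>x. x \<in> carrier G \<Longrightarrow> \<psi> (x \<otimes>\<^bsub>G\<^esub> g \<otimes>\<^bsub>G\<^esub> inv\<^bsub>G\<^esub> x) = \<psi> g"
    and \<chi>: "\<And>h. h \<in> carrier H \<Longrightarrow> \<chi> h = \<psi> (j h)"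
  shows "icf G H j \<chi> g = \<psi> g"
proof -
  interpret group G by fact
  let ?c = "of_nat (card (carrier G)) :: complex"
  have c: "?c \<noteq> 0" using order_pos[OF G fin] by simp
  have "(\<Sum>h\<in>carrier H. if g \<otimes>\<^bsub>G\<^esub> x = x \<otimes>\<^bsub>G\<^esub> j h then \<chi> h else 0) = \<psi> g" if x: "x \<in> carrier G" for x
  proof -
    let ?y = "inv\<^bsub>G\<^esub> x \<otimes>\<^bsub>G\<^esub> g \<otimes>\<^bsub>G\<^esub> x"
    have y: "?y \<in> carrier G" using x g by simp
    have "(\<Sum>h\<in>carrier H. if g \<otimes>\<^bsub>G\<^esub> x = x \<otimes>\<^bsub>G\<^esub> j h then \<chi> h else 0)
      = (\<Sum>h\<in>carrier H. if g \<otimes>\<^bsub>G\<^esub> x = x \<otimes>\<^bsub>G\<^esub> j h then \<psi> (j h) else 0)" by (intro sum.cong refl) (simp add: \<chi>)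
    also have "\<dots> = (\<Sum>k\<in>carrier G. if g \<otimes>\<^bsub>G\<^esub> x = x \<otimes>\<^bsub>G\<^esub> k then \<psi> k else 0)"
      by (rule sum.reindex_bij_betw[OF j, where g = "\<lambda>k. if g \<otimes>\<^bsub>G\<^esub> x = x \<otimes>\<^bsub>G\<^esub> k then \<psi> k else 0"])
    also have "\<dots> = (\<Sum>k\<in>carrier G. if k = ?y then \<psi> ?y else 0)"
      using x g by (intro sum.cong refl) (simp add: conj_eq_iff(2))
    also have "\<dots> = \<psi> ?y" using y fin by simp
    also have "\<dots> = \<psi> g" using \<psi>[of "inv\<^bsub>G\<^esub> x"] x g by simp
    finally show ?thesis .
  qed
  then have "(\<Sum>x\<in>carrier G. \<Sum>h\<in>carrier H. if g \<otimes>\<^bsub>G\<^esub> x = x \<otimes>\<^bsub>G\<^esub> j h then \<chi> h else 0) = ?c * \<psi> g" by simp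
  then show ?thesis using c bij_betw_same_card[OF j] by (simp add: icf_def)
qed

text \<open>Turns the occurrence conditions that define the sets of partitions into conditions on
  characters.\<close>

lemma is_summand_ip:
  assumes R: "representation G R" and V: "irreducible_rep G V" and fin: "finite (carrier G)"
  shows "is_summand G V R \<longleftrightarrow> ip G (chr R) (chr V) \<noteq> 0"
proof
  have RV: "representation G V" using V by (simp add: irreducible_rep_def)
  assume "is_summand G V R"
  then obtain U where U: "invariant_subspace G R U" "rep_iso G V (sub R U)"
    using is_summand_iff[OF R fin] by blast
  obtain U' where U': "invariant_subspace G R U'"
    and chr: "\<And>g. g \<in> carrier G \<Longrightarrow> chr R g = chr (sub R U) g + chr (sub R U') g"
    by (rule complement[OF R fin U(1)]) (rule that; assumption)
  obtain k :: nat where k: "ip G (chr (sub R U')) (chr V) = of_nat k"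
    using ip_chr_chr_nat[OF invariant_rep[OF R U'] RV fin] by blast
  have "ip G (chr R) (chr V) = ip G (\<lambda>g. chr V g + chr (sub R U') g) (chr V)"
    by (rule ip_cong[OF rep_group[OF R]])
       (simp_all add: chr chr_rep_iso[OF RV invariant_rep[OF R U(1)] U(2)])
  also have "\<dots> = of_nat (Suc k)" by (simp add: ip_add_left k ip_chr_self[OF V fin])
  finally show "ip G (chr R) (chr V) \<noteq> 0" by (simp del: of_nat_Suc)
next
  assume nz: "ip G (chr R) (chr V) \<noteq> 0"
  obtain k :: nat where k: "ip G (chr R) (chr V) = of_nat k"
    "k > 0 \<Longrightarrow> \<exists>U. invariant_subspace G R U \<and> rep_iso G V (sub R U)"
    by (rule ip_chr_nat[OF R V fin]) (rule that; assumption)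
  then show "is_summand G V R" using is_summand_iff[OF R fin] nz by (cases "k = 0") auto
qed

lemma finite_DirProd: "finite (carrier G) \<Longrightarrow> finite (carrier H) \<Longrightarrow> finite (carrier (G \<times>\<times> H))"
  by (simp add: DirProd_def)

section \<open>Young subgroups with two blocks\<close>

lemma sym_embed_comp:
  assumes "\<sigma> permutes {1..m}" "\<tau> permutes {1..k}"
  shows "sym_embed m (\<sigma>', \<tau>') \<circ> sym_embed m (\<sigma>, \<tau>) = sym_embed m (\<sigma>' \<circ> \<sigma>, \<tau>' \<circ> \<tau>)"
proof
  fix i
  \<comment> \<open>The index 0 falls into the branch of the first block although it is outside all
    blocks, so it is a case of its own.\<close>
  have "i \<le> m \<Longrightarrow> \<sigma> i \<le> m" using permutes_in_image[OF assms(1), of i] permutes_not_in[OF assms(1), of i] by (cases "i = 0") auto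
  moreover have "i > m \<Longrightarrow> \<tau> (i - m) > 0"
    using permutes_in_image[OF assms(2), of "i - m"] permutes_not_in[OF assms(2), of "i - m"] by (cases "i - m \<le> k") auto
  ultimately show "(sym_embed m (\<sigma>', \<tau>') \<circ> sym_embed m (\<sigma>, \<tau>)) i = sym_embed m (\<sigma>' \<circ> \<sigma>, \<tau>' \<circ> \<tau>) i"
    by (auto simp: sym_embed_def)
qed

lemma sym_embed_id: "sym_embed m (id, id) = id"
  by (auto simp: sym_embed_def)

lemma sym_embed_permutes:
  assumes "\<sigma> permutes {1..m}" "\<tau> permutes {1..k}" shows "sym_embed m (\<sigma>, \<tau>) permutes {1..m + k}"
proof -
  have c: "sym_embed m (\<sigma>, \<tau>) \<circ> sym_embed m (inv' \<sigma>, inv' \<tau>) = id"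
    using sym_embed_comp[OF permutes_inv[OF assms(1)] permutes_inv[OF assms(2)], of \<sigma> \<tau>]
      permutes_inv_o[OF assms(1)] permutes_inv_o[OF assms(2)] by (simp add: sym_embed_id)
  have d: "sym_embed m (inv' \<sigma>, inv' \<tau>) \<circ> sym_embed m (\<sigma>, \<tau>) = id"
    using sym_embed_comp[OF assms, of "inv' \<sigma>" "inv' \<tau>"]
      permutes_inv_o[OF assms(1)] permutes_inv_o[OF assms(2)] by (simp add: sym_embed_id)
  have "bij (sym_embed m (\<sigma>, \<tau>))" by (rule o_bij[OF d c])
  moreover have "sym_embed m (\<sigma>, \<tau>) i = i" if "i \<notin> {1..m + k}" for i
  proof (cases "i \<le> m")
    case True
    then show ?thesis using that permutes_not_in[OF assms(1), of i] by (auto simp: sym_embed_def)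
  next
    case False
    then have "\<tau> (i - m) = i - m" using that by (intro permutes_not_in[OF assms(2)]) auto
    then show ?thesis using False by (simp add: sym_embed_def)
  qed
  ultimately show ?thesis unfolding permutes_def bij_iff by blast
qed

lemma sym_embed_inv:
  assumes "\<sigma> permutes {1..m}" "\<tau> permutes {1..k}"
  shows "inv' (sym_embed m (\<sigma>, \<tau>)) = sym_embed m (inv' \<sigma>, inv' \<tau>)"
proof (rule inv_unique_comp)
  show "sym_embed m (\<sigma>, \<tau>) \<circ> sym_embed m (inv' \<sigma>, inv' \<tau>) = id"
    using sym_embed_comp[OF permutes_inv[OF assms(1)] permutes_inv[OF assms(2)], of \<sigma> \<tau>]
      permutes_inv_o[OF assms(1)] permutes_inv_o[OF assms(2)] by (simp add: sym_embed_id)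
  show "sym_embed m (inv' \<sigma>, inv' \<tau>) \<circ> sym_embed m (\<sigma>, \<tau>) = id"
    using sym_embed_comp[OF assms, of "inv' \<sigma>" "inv' \<tau>"]
      permutes_inv_o[OF assms(1)] permutes_inv_o[OF assms(2)] by (simp add: sym_embed_id)
qed

lemma sym_embed_hom: "sym_embed m \<in> hom (sym_group m \<times>\<times> sym_group k) (sym_group (m + k))"
proof (rule homI)
  fix x y assume "x \<in> carrier (sym_group m \<times>\<times> sym_group k)" "y \<in> carrier (sym_group m \<times>\<times> sym_group k)"
  then obtain \<sigma> \<tau> \<sigma>' \<tau>' where x: "x = (\<sigma>', \<tau>')" "\<sigma>' permutes {1..m}" "\<tau>' permutes {1..k}"
    and y: "y = (\<sigma>, \<tau>)" "\<sigma> permutes {1..m}" "\<tau> permutes {1..k}"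
    by (auto simp: sym_group_carrier)
  show "sym_embed m x \<in> carrier (sym_group (m + k))" using sym_embed_permutes x by (simp add: sym_group_carrier)
  show "sym_embed m (x \<otimes>\<^bsub>sym_group m \<times>\<times> sym_group k\<^esub> y) = sym_embed m x \<otimes>\<^bsub>sym_group (m + k)\<^esub> sym_embed m y"
    using sym_embed_comp[OF y(2,3), of \<sigma>' \<tau>'] x y by (simp add: sym_group_mult)
qed

text \<open>Recognises elements of the Young subgroup by their second block, which is all that is
  known about the permutation from \<open>conj_to_inverse\<close>.\<close>

lemma sym_embed_surj:
  assumes s: "s permutes {1..m + k}" and im: "s ` {m + 1..m + k} = {m + 1..m + k}"
  obtains \<sigma> \<tau> where "\<sigma> permutes {1..m}" "\<tau> permutes {1..k}" "s = sym_embed m (\<sigma>, \<tau>)"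
proof -
  define \<sigma> where "\<sigma> i = (if i \<le> m then s i else i)" for i
  define \<tau> where "\<tau> i = (if i = 0 then 0 else s (i + m) - m)" for i
  have inj: "inj s" using s by (rule permutes_inj)
  have hi: "s i \<in> {m + 1..m + k} \<longleftrightarrow> i \<in> {m + 1..m + k}" for i
    using im inj by (metis inj_image_mem_iff)
  have out: "s i = i" if "i \<notin> {1..m + k}" for i using permutes_not_in[OF s that] .
  have tot: "s i \<in> {1..m + k} \<longleftrightarrow> i \<in> {1..m + k}" for i by (rule permutes_in_image[OF s])
  have lo: "s i \<in> {1..m}" if "i \<in> {1..m}" for i using hi[of i] tot[of i] that by auto
  have s1: "\<sigma> permutes {1..m}"
  proof (rule bij_imp_permutes)
    have "inj_on \<sigma> {1..m}" using inj by (auto simp: inj_on_def \<sigma>_def dest: injD)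
    moreover have "\<sigma> ` {1..m} \<subseteq> {1..m}" using lo by (auto simp: \<sigma>_def)
    ultimately show "bij_betw \<sigma> {1..m} {1..m}" by (simp add: bij_betw_def card_image card_subset_eq)
    show "\<sigma> i = i" if "i \<notin> {1..m}" for i using that out[of 0] by (cases "i = 0") (auto simp: \<sigma>_def)
  qed
  have up: "\<tau> i + m = s (i + m)" "\<tau> i \<in> {1..k}" if "i \<in> {1..k}" for i
    using hi[of "i + m"] that by (auto simp: \<tau>_def)
  have s2: "\<tau> permutes {1..k}"
  proof (rule bij_imp_permutes)
    have "inj_on \<tau> {1..k}"
    proof (rule inj_onI)
      fix i j assume "i \<in> {1..k}" "j \<in> {1..k}" "\<tau> i = \<tau> j"
      then have "s (i + m) = s (j + m)" using up by metis
      then show "i = j" using injD[OF inj] by fastforce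
    qed
    moreover have "\<tau> ` {1..k} \<subseteq> {1..k}" using up(2) by blast
    ultimately show "bij_betw \<tau> {1..k} {1..k}" by (simp add: bij_betw_def card_image card_subset_eq)
    show "\<tau> i = i" if "i \<notin> {1..k}" for i using that out[of "i + m"] by (cases "i = 0") (auto simp: \<tau>_def)
  qed
  have "s = sym_embed m (\<sigma>, \<tau>)"
  proof
    fix i
    show "s i = sym_embed m (\<sigma>, \<tau>) i"
    proof (cases "i \<le> m")
      case i: False
      show ?thesis
      proof (cases "i \<le> m + k")
        case True
        then have "\<tau> (i - m) + m = s (i - m + m)" using i by (intro up(1)) auto
        then show ?thesis using i by (simp add: sym_embed_def)
      next
        case False
        then show ?thesis using i out[of i] by (simp add: sym_embed_def \<tau>_def)
      qed
    qed (simp add: sym_embed_def \<sigma>_def)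
  qed
  with s1 s2 show ?thesis by (rule that)
qed

text \<open>One setting for the three kinds of sets in the claim: k = 1 with the trivial character,
  k = 2 with the trivial or the sign character.\<close>

locale branching =
  fixes m k :: nat and lam :: "nat list" and \<chi> :: "(nat \<Rightarrow> nat) \<Rightarrow> complex"
  assumes lam: "lam \<turnstile> m" and k: "k = 1 \<or> k = 2" and \<chi>: "representation (sym_group k) (char_rep \<chi>)"
begin

abbreviation "GG \<equiv> sym_group (m + k)"
abbreviation "HH \<equiv> sym_group m \<times>\<times> sym_group k"
abbreviation "PP \<equiv> Specht lam \<boxtimes> char_rep \<chi>"
abbreviation "RR \<equiv> ind GG HH (sym_embed m) PP"

lemma sum_lam: "sum_list lam = m" using lam by (simp add: is_partition_def)

lemma irreducible_PP: "irreducible_rep HH PP"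
  by (rule irreducible_tensor[OF irreducible_Specht[OF lam] irreducible_char_rep[OF \<chi> finite_sym_group]
        finite_sym_group finite_sym_group])

lemma representation_PP: "representation HH PP"
  using irreducible_PP by (simp add: irreducible_rep_def)

sublocale induction_data GG HH "sym_embed m" PP
proof -
  show "induction_data GG HH (sym_embed m) PP"
    unfolding induction_data_def induction_data_axioms_def
    using sym_group_is_group finite_sym_group finite_DirProd[OF finite_sym_group finite_sym_group] sym_embed_hom
      representation_PP rep_group[OF representation_PP] by blast
qed

text \<open>Frobenius reciprocity turns the multiplicity into one in a restriction, to which
  \<open>multiplicity_free_restriction\<close> applies.\<close>

lemma multiplicity_le_1:
  assumes \<tau>: "\<tau> \<turnstile> m + k" shows "ip GG (chr RR) (chr (Specht \<tau>)) \<in> {0, 1}"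
proof -
  let ?S = "Specht \<tau>"
  note irr = irreducible_Specht[OF \<tau>]
  have RS: "representation GG ?S" using irr by (simp add: irreducible_rep_def)
  have "ip GG (chr RR) (chr ?S) = ip GG (icf GG HH (sym_embed m) (chr PP)) (chr ?S)"
    by (rule ip_cong[OF sym_group_is_group]) (simp_all add: chr_ind)
  also have "\<dots> = ip HH (chr PP) (\<lambda>h. chr ?S (sym_embed m h))"
  proof (rule frobenius)
    show "chr ?S (x \<otimes>\<^bsub>GG\<^esub> g \<otimes>\<^bsub>GG\<^esub> inv\<^bsub>GG\<^esub> x) = chr ?S g" if "g \<in> carrier GG" "x \<in> carrier GG" for g x
      by (rule chr_conj[OF RS that])
  qed (rule sym_group_is_group rep_group[OF representation_PP] finite_sym_group sym_embed_hom)+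
  also have "\<dots> = ip HH (\<lambda>h. chr ?S (sym_embed m h)) (chr PP)"
    by (rule ip_commute[OF rep_group[OF representation_PP]])
  also have "\<dots> \<in> {0, 1}"
  proof (rule multiplicity_free_restriction[OF irr finite_sym_group
        finite_DirProd[OF finite_sym_group finite_sym_group] rep_group[OF representation_PP] sym_embed_hom _ irreducible_PP])
    fix g assume gG: "g \<in> carrier GG"
    then have g: "g permutes {1..m + k}" by (simp add: sym_group_carrier)
    have ab: "m + 1 \<in> {1..m + k}" "m + k \<in> {1..m + k}" using k by auto
    obtain s where s: "s permutes {1..m + k}" "s \<circ> g = inv' g \<circ> s" "s ` {m + 1, m + k} = {m + 1, m + k}"
      by (rule conj_to_inverse[OF finite_atLeastAtMost g ab]) (rule that; assumption)
    \<comment> \<open>Here k is at most 2: the second block consists of the two marked points, which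
      coincide for k = 1.\<close>
    have "{m + 1, m + k} = {m + 1..m + k}" using k by auto
    then have "s ` {m + 1..m + k} = {m + 1..m + k}" using s(3) by (simp only:)
    then obtain \<sigma> \<rho> where st: "\<sigma> permutes {1..m}" "\<rho> permutes {1..k}" "s = sym_embed m (\<sigma>, \<rho>)"
      by (rule sym_embed_surj[OF s(1)])
    have "inv' g = s \<circ> g \<circ> inv' s"
      using s(2) permutes_inv_o(1)[OF s(1)] by (simp add: o_assoc[symmetric])
    then have "inv\<^bsub>GG\<^esub> g = sym_embed m (\<sigma>, \<rho>) \<otimes>\<^bsub>GG\<^esub> g \<otimes>\<^bsub>GG\<^esub> inv\<^bsub>GG\<^esub> sym_embed m (\<sigma>, \<rho>)"
      using gG s(1) st(3) by (simp add: sym_group_mult sym_group_carrier)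
    moreover have "(\<sigma>, \<rho>) \<in> carrier HH" using st by (simp add: sym_group_carrier)
    ultimately show "\<exists>h\<in>carrier HH. inv\<^bsub>GG\<^esub> g = sym_embed m h \<otimes>\<^bsub>GG\<^esub> g \<otimes>\<^bsub>GG\<^esub> inv\<^bsub>GG\<^esub> sym_embed m h" by blast
  qed
  finally show ?thesis .
qed

lemma parts_eq: "sym_ind_parts k (char_rep \<chi>) lam = {\<tau>. \<tau> \<turnstile> m + k \<and> ip GG (chr RR) (chr (Specht \<tau>)) \<noteq> 0}"
  using is_summand_ip[OF representation_ind irreducible_Specht finite_sym_group]
  unfolding sym_ind_parts_def Let_def sum_lam by blast

lemma finite_parts: "finite (sym_ind_parts k (char_rep \<chi>) lam)"
  unfolding parts_eq by (rule finite_subset[OF _ finite_partitions[of "m + k"]]) blast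

lemma parts_partition: "\<tau> \<in> sym_ind_parts k (char_rep \<chi>) lam \<Longrightarrow> \<tau> \<turnstile> m + k"
  unfolding parts_eq by blast

text \<open>The multiplicities being 0 or 1, the expansion in Specht characters is a plain sum over
  the partitions that occur.\<close>

lemma icf_Specht:
  assumes g: "g \<in> carrier GG"
  shows "icf GG HH (sym_embed m) (\<lambda>(a, b). chr (Specht lam) a * \<chi> b) g
    = (\<Sum>\<tau>\<in>sym_ind_parts k (char_rep \<chi>) lam. chr (Specht \<tau>) g)"
proof -
  let ?P = "{\<tau>. \<tau> \<turnstile> m + k}"
  interpret t: tensor_data "sym_group m" "sym_group k" "Specht lam" "char_rep \<chi>"
    using representation_Specht[OF sum_lam] \<chi> by unfold_locales
  have "icf GG HH (sym_embed m) (\<lambda>(a, b). chr (Specht lam) a * \<chi> b) g = icf GG HH (sym_embed m) (chr PP) g"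
    by (rule icf_cong) (auto simp: t.chr_tensor chr_char_rep)
  also have "\<dots> = chr RR g" by (rule chr_ind[OF g, symmetric])
  also have "\<dots> = (\<Sum>\<tau>\<in>?P. ip GG (chr RR) (chr (Specht \<tau>)) * chr (Specht \<tau>) g)"
    by (rule chr_Specht_expansion[OF representation_ind g])
  also have "\<dots> = (\<Sum>\<tau>\<in>sym_ind_parts k (char_rep \<chi>) lam. chr (Specht \<tau>) g)"
    using multiplicity_le_1 finite_partitions unfolding parts_eq by (intro sum.mono_neutral_cong_right) fastforce+
  finally show ?thesis .
qed

end

section \<open>Hyperoctahedral groups\<close>

text \<open>The tuples in the carrier of \<open>B m\<close> with explicit representatives 0 and 1,
  so that computations in product and quotient groups become arithmetic mod 2.\<close>

definition Fv :: "nat \<Rightarrow> (nat \<Rightarrow> int) set" where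
  "Fv m = {1..m} \<rightarrow>\<^sub>E {0..<2}"

lemma restrict_Fv_iff: "restrict f {1..m} \<in> Fv m \<longleftrightarrow> (\<forall>i\<in>{1..m}. f i \<in> {0..<2})"
  unfolding Fv_def by (rule restrict_PiE_iff)

lemma Fv_mem: "f \<in> Fv m \<Longrightarrow> i \<in> {1..m} \<Longrightarrow> f i \<in> {0..<2}"
  unfolding Fv_def by (rule PiE_mem)

lemma Fv_arb: "f \<in> Fv m \<Longrightarrow> i \<notin> {1..m} \<Longrightarrow> f i = undefined"
  unfolding Fv_def by (rule PiE_arb)

definition vadd :: "nat \<Rightarrow> (nat \<Rightarrow> int) \<Rightarrow> (nat \<Rightarrow> int) \<Rightarrow> nat \<Rightarrow> int" where
  "vadd m f g = (\<lambda>i\<in>{1..m}. (f i + g i) mod 2)"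

definition vsh :: "nat \<Rightarrow> (nat \<Rightarrow> nat) \<Rightarrow> (nat \<Rightarrow> int) \<Rightarrow> nat \<Rightarrow> int" where
  "vsh m \<sigma> f = (\<lambda>i\<in>{1..m}. f (inv' \<sigma> i))"

definition vzero :: "nat \<Rightarrow> nat \<Rightarrow> int" where
  "vzero m = (\<lambda>i\<in>{1..m}. 0)"

lemma carrier_B: "carrier (B m) = Fv m \<times> {p. p permutes {1..m}}"
  by (simp add: B_def sym_group_def carrier_integer_mod_group Fv_def)

lemma mult_B: "(f, \<sigma>) \<otimes>\<^bsub>B m\<^esub> (g, \<tau>) = (vadd m f (vsh m \<sigma> g), \<sigma> \<circ> \<tau>)"
  by (auto simp: B_def sym_group_def vadd_def vsh_def mult_integer_mod_group fun_eq_iff restrict_def)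

lemma one_B: "\<one>\<^bsub>B m\<^esub> = (vzero m, id)"
  by (simp add: B_def sym_group_def vzero_def)

lemma Fv_ext: "f \<in> Fv m \<Longrightarrow> g \<in> Fv m \<Longrightarrow> (\<And>i. i \<in> {1..m} \<Longrightarrow> f i = g i) \<Longrightarrow> f = g"
  unfolding Fv_def by (rule PiE_ext)

lemma Fv_cases: "f \<in> Fv m \<Longrightarrow> i \<in> {1..m} \<Longrightarrow> f i = 0 \<or> f i = 1"
  using Fv_mem[of f m i] by auto

lemma Fv_mod: "f \<in> Fv m \<Longrightarrow> i \<in> {1..m} \<Longrightarrow> f i mod 2 = f i"
  using Fv_cases by fastforce

lemma vadd_in [simp]: "vadd m f g \<in> Fv m" unfolding vadd_def restrict_Fv_iff by simp
lemma vzero_in [simp]: "vzero m \<in> Fv m" unfolding vzero_def restrict_Fv_iff by simp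

lemma vsh_in [simp]: "\<sigma> permutes {1..m} \<Longrightarrow> f \<in> Fv m \<Longrightarrow> vsh m \<sigma> f \<in> Fv m"
  unfolding vsh_def restrict_Fv_iff
  by (intro ballI Fv_mem[of f m]) (simp_all only: permutes_in_image[OF permutes_inv])

lemma vadd_apply: "i \<in> {1..m} \<Longrightarrow> vadd m f g i = (f i + g i) mod 2"
  and vsh_apply: "i \<in> {1..m} \<Longrightarrow> vsh m \<sigma> f i = f (inv' \<sigma> i)"
  and vzero_apply: "i \<in> {1..m} \<Longrightarrow> vzero m i = 0"
  by (simp_all add: vadd_def vsh_def vzero_def)

lemma vadd_assoc: "vadd m (vadd m f g) h = vadd m f (vadd m g h)"
  by (rule Fv_ext[of _ m]) (simp_all add: vadd_apply mod_simps add.assoc)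

lemma vadd_zero: "f \<in> Fv m \<Longrightarrow> vadd m (vzero m) f = f" "f \<in> Fv m \<Longrightarrow> vadd m f (vzero m) = f"
  by (rule Fv_ext[of _ m], simp_all only: vadd_in vadd_apply vzero_apply Fv_mod add_0 add_0_right)+

lemma vadd_self: "f \<in> Fv m \<Longrightarrow> vadd m f f = vzero m"
  by (rule Fv_ext[of _ m]) (use Fv_cases[of f m] in \<open>auto simp: vadd_apply vzero_apply\<close>)

lemma vsh_add:
  assumes "\<sigma> permutes {1..m}" shows "vsh m \<sigma> (vadd m f g) = vadd m (vsh m \<sigma> f) (vsh m \<sigma> g)"
proof (rule Fv_ext[of _ m])
  fix i assume i: "i \<in> {1..m}"
  have "inv' \<sigma> i \<in> {1..m}" using permutes_in_image[OF permutes_inv[OF assms], of i] i by blast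
  then show "vsh m \<sigma> (vadd m f g) i = vadd m (vsh m \<sigma> f) (vsh m \<sigma> g) i"
    by (simp only: vsh_apply[OF i] vadd_apply[OF i] vadd_apply)
qed (use assms in simp_all)

lemma vsh_comp:
  assumes "\<sigma> permutes {1..m}" "\<tau> permutes {1..m}" "f \<in> Fv m"
  shows "vsh m (\<sigma> \<circ> \<tau>) f = vsh m \<sigma> (vsh m \<tau> f)"
proof (rule Fv_ext[of _ m])
  fix i assume i: "i \<in> {1..m}"
  have "inv' \<sigma> i \<in> {1..m}" using permutes_in_image[OF permutes_inv[OF assms(1)], of i] i by blast
  then show "vsh m (\<sigma> \<circ> \<tau>) f i = vsh m \<sigma> (vsh m \<tau> f) i"
    using o_inv_distrib[OF permutes_bij[OF assms(1)] permutes_bij[OF assms(2)]]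
    by (simp only: vsh_apply[OF i] vsh_apply comp_apply)
qed (use assms in \<open>simp_all add: permutes_compose\<close>)

lemma vsh_id: "f \<in> Fv m \<Longrightarrow> vsh m id f = f"
  by (rule Fv_ext[of _ m]) (simp_all add: vsh_apply permutes_id)

lemma vsh_inv:
  assumes "\<sigma> permutes {1..m}" "f \<in> Fv m"
  shows "vsh m (inv' \<sigma>) (vsh m \<sigma> f) = f" "vsh m \<sigma> (vsh m (inv' \<sigma>) f) = f"
  using vsh_comp[OF permutes_inv[OF assms(1)] assms] vsh_comp[OF assms(1) permutes_inv[OF assms(1)] assms(2)]
    permutes_inv_o[OF assms(1)] vsh_id[OF assms(2)] by simp_all

lemma vsh_zero: "\<sigma> permutes {1..m} \<Longrightarrow> vsh m \<sigma> (vzero m) = vzero m"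
proof (rule Fv_ext[of _ m])
  fix i assume s: "\<sigma> permutes {1..m}" and i: "i \<in> {1..m}"
  have "inv' \<sigma> i \<in> {1..m}" using permutes_in_image[OF permutes_inv[OF s], of i] i by blast
  then show "vsh m \<sigma> (vzero m) i = vzero m i" by (simp only: vsh_apply[OF i] vzero_apply[OF i] vzero_apply)
qed simp_all

lemma group_B: "group (B m)"
proof (rule groupI)
  show "\<one>\<^bsub>B m\<^esub> \<in> carrier (B m)" by (simp add: carrier_B one_B permutes_id)
  fix x y z assume "x \<in> carrier (B m)"
  then obtain f \<sigma> where x: "x = (f, \<sigma>)" "f \<in> Fv m" "\<sigma> permutes {1..m}" by (auto simp: carrier_B)
  show "\<one>\<^bsub>B m\<^esub> \<otimes>\<^bsub>B m\<^esub> x = x" using x by (simp add: one_B mult_B vsh_id vadd_zero)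
  show "\<exists>y\<in>carrier (B m). y \<otimes>\<^bsub>B m\<^esub> x = \<one>\<^bsub>B m\<^esub>"
    using x permutes_inv[OF x(3)] permutes_inv_o[OF x(3)]
    by (intro bexI[of _ "(vsh m (inv' \<sigma>) f, inv' \<sigma>)"]) (simp_all add: mult_B one_B carrier_B vadd_self)
  assume "y \<in> carrier (B m)"
  then obtain g \<tau> where y: "y = (g, \<tau>)" "g \<in> Fv m" "\<tau> permutes {1..m}" by (auto simp: carrier_B)
  show "x \<otimes>\<^bsub>B m\<^esub> y \<in> carrier (B m)" using x y by (simp add: mult_B carrier_B permutes_compose)
  assume "z \<in> carrier (B m)"
  then obtain h \<rho> where z: "z = (h, \<rho>)" "h \<in> Fv m" "\<rho> permutes {1..m}" by (auto simp: carrier_B)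
  show "x \<otimes>\<^bsub>B m\<^esub> y \<otimes>\<^bsub>B m\<^esub> z = x \<otimes>\<^bsub>B m\<^esub> (y \<otimes>\<^bsub>B m\<^esub> z)"
    using x y z by (simp add: mult_B vsh_comp vsh_add vadd_assoc comp_assoc)
qed

lemma finite_Fv: "finite (Fv m)" unfolding Fv_def by (intro finite_PiE) auto

lemma finite_B: "finite (carrier (B m))"
  unfolding carrier_B by (intro finite_cartesian_product finite_Fv finite_permutations) simp

definition F2_char :: "(int \<Rightarrow> complex) \<Rightarrow> bool" where
  "F2_char D \<longleftrightarrow> D 0 = 1 \<and> D 1 * D 1 = 1"

lemma F2_char_triv: "F2_char (\<lambda>_. 1)" and F2_char_eps: "F2_char eps_F"
  by (simp_all add: F2_char_def eps_F_def)

definition Dp :: "nat \<Rightarrow> (int \<Rightarrow> complex) \<Rightarrow> (nat \<Rightarrow> int) \<Rightarrow> complex" where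
  "Dp m D f = (\<Prod>i\<in>{1..m}. D (f i))"

lemma Dp_triv [simp]: "Dp m (\<lambda>_. 1) f = 1" by (simp add: Dp_def)

lemma Dp_add:
  assumes "F2_char D" "f \<in> Fv m" "g \<in> Fv m" shows "Dp m D (vadd m f g) = Dp m D f * Dp m D g"
  unfolding Dp_def prod.distrib[symmetric]
proof (rule prod.cong[OF refl])
  fix i assume i: "i \<in> {1..m}"
  show "D (vadd m f g i) = D (f i) * D (g i)"
    using assms(1) Fv_cases[OF assms(2) i] Fv_cases[OF assms(3) i] unfolding vadd_apply[OF i] F2_char_def by auto
qed

lemma Dp_sh:
  assumes "\<sigma> permutes {1..m}" shows "Dp m D (vsh m \<sigma> f) = Dp m D f"
proof -
  have "Dp m D (vsh m \<sigma> f) = (\<Prod>i\<in>{1..m}. ((\<lambda>i. D (f i)) \<circ> inv' \<sigma>) i)"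
    unfolding Dp_def by (intro prod.cong refl) (simp add: vsh_apply)
  also have "\<dots> = Dp m D f" unfolding Dp_def by (rule prod.permute[OF permutes_inv[OF assms], symmetric])
  finally show ?thesis .
qed

lemma Dp_zero: "F2_char D \<Longrightarrow> Dp m D (vzero m) = 1"
  by (simp add: Dp_def vzero_apply F2_char_def)

text \<open>The character \<open>Dp m D\<close> of the tuples is invariant under permuting
  coordinates; this makes the twisted action multiplicative on the semidirect product.\<close>

lemma
  assumes E: "representation (sym_group m) E" and D: "F2_char D"
  shows representation_twisted: "representation (B m) (twisted m D E)"
    and chr_twisted: "(f, \<sigma>) \<in> carrier (B m) \<Longrightarrow> chr (twisted m D E) (f, \<sigma>) = Dp m D f * chr E \<sigma>"
proof -
  note V = rep_fds[OF E]
  have act: "act (twisted m D E) (f, \<sigma>) v = cscale (Dp m D f) (act E \<sigma> v)" for f \<sigma> v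
    by (simp add: twisted_def Dp_def)
  have sp: "space (twisted m D E) = space E" by (simp add: twisted_def)
  have LE: "lin (space E) (space E) (act E \<sigma>)" if "\<sigma> permutes {1..m}" for \<sigma>
    using rep_lin[OF E] that by (simp add: sym_group_carrier)
  show "representation (B m) (twisted m D E)"
  proof (rule representationI[OF group_B])
    show "fds (space (twisted m D E))" using V sp by simp
    fix x assume "x \<in> carrier (B m)"
    then obtain f \<sigma> where x: "x = (f, \<sigma>)" "f \<in> Fv m" "\<sigma> permutes {1..m}" by (auto simp: carrier_B)
    have "act (twisted m D E) x = (\<lambda>v. cscale (Dp m D f) (act E \<sigma> v))" unfolding x(1) by (rule ext) (rule act)
    then show "lin (space (twisted m D E)) (space (twisted m D E)) (act (twisted m D E) x)"
      unfolding sp using lin_mult[OF V LE[OF x(3)]] by simp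
    fix y v assume "y \<in> carrier (B m)" and v: "v \<in> space (twisted m D E)"
    then obtain g \<tau> where y: "y = (g, \<tau>)" "g \<in> Fv m" "\<tau> permutes {1..m}" by (auto simp: carrier_B)
    have v': "v \<in> space E" using v sp by simp
    have "act E (\<sigma> \<circ> \<tau>) v = act E \<sigma> (act E \<tau> v)"
      using rep_mult[OF E, of \<sigma> \<tau> v] x y v' by (simp add: sym_group_carrier sym_group_mult)
    moreover have "act E \<sigma> (cscale (Dp m D g) (act E \<tau> v)) = cscale (Dp m D g) (act E \<sigma> (act E \<tau> v))"
      by (rule lin_scale[OF LE[OF x(3)] lin_in[OF LE[OF y(3)] v']])
    ultimately show "act (twisted m D E) (x \<otimes>\<^bsub>B m\<^esub> y) v = act (twisted m D E) x (act (twisted m D E) y v)"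
      unfolding x(1) y(1) mult_B act using Dp_add[OF D x(2) vsh_in[OF x(3) y(2)]] Dp_sh[OF x(3)] by simp
  next
    fix v assume "v \<in> space (twisted m D E)"
    then show "act (twisted m D E) \<one>\<^bsub>B m\<^esub> v = v"
      unfolding one_B act using rep_one[OF E, of v] by (simp add: sp sym_group_one Dp_zero[OF D])
  qed
  assume "(f, \<sigma>) \<in> carrier (B m)"
  then have s: "\<sigma> permutes {1..m}" by (simp add: carrier_B)
  have "chr (twisted m D E) (f, \<sigma>) = tr (space E) (\<lambda>v. cscale (Dp m D f) (act E \<sigma> v))"
    unfolding chr_def sp by (rule tr_cong[OF V]) (rule act)
  then show "chr (twisted m D E) (f, \<sigma>) = Dp m D f * chr E \<sigma>"
    using tr_scale[OF V LE[OF s]] by (simp add: chr_def)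
qed

section \<open>Concatenation of tuples and products of hyperoctahedral groups\<close>

definition cat :: "nat \<Rightarrow> nat \<Rightarrow> (nat \<Rightarrow> int) \<Rightarrow> (nat \<Rightarrow> int) \<Rightarrow> nat \<Rightarrow> int" where
  "cat p q f g = (\<lambda>i\<in>{1..p + q}. if i \<le> p then f i else g (i - p))"

lemma B_embed_cat: "B_embed p q ((f, \<sigma>), (g, \<tau>)) = (cat p q f g, sym_embed p (\<sigma>, \<tau>))"
  by (simp add: B_embed_def cat_def)

lemma cat_apply: "i \<in> {1..p} \<Longrightarrow> cat p q f g i = f i" "i \<in> {1..q} \<Longrightarrow> cat p q f g (i + p) = g i"
  by (auto simp: cat_def)

lemma split_index:
  fixes i :: nat
  assumes "i \<in> {1..p + q}"
  obtains "i \<in> {1..p}" | j where "j \<in> {1..q}" "i = j + p"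
proof (cases "i \<le> p")
  case True then show ?thesis using assms that(1) by simp
next
  case False then show ?thesis using assms that(2)[of "i - p"] by auto
qed

lemma cat_in [simp]:
  assumes "f \<in> Fv p" "g \<in> Fv q" shows "cat p q f g \<in> Fv (p + q)"
  unfolding cat_def restrict_Fv_iff
proof
  fix i assume i: "i \<in> {1..p + q}"
  show "(if i \<le> p then f i else g (i - p)) \<in> {0..<2}"
  proof (cases "i \<le> p")
    case True
    then show ?thesis using i Fv_mem[OF assms(1), of i] by simp
  next
    case False
    then have "i - p \<in> {1..q}" using i by auto
    then show ?thesis using False Fv_mem[OF assms(2), of "i - p"] by simp
  qed
qed

lemma cat_bij: "bij_betw (\<lambda>(f, g). cat p q f g) (Fv p \<times> Fv q) (Fv (p + q))"
proof (rule bij_betw_byWitness[where f' = "\<lambda>h. (\<lambda>i\<in>{1..p}. h i, \<lambda>i\<in>{1..q}. h (i + p))"])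
  show "\<forall>x\<in>Fv p \<times> Fv q. (\<lambda>i\<in>{1..p}. (case x of (f, g) \<Rightarrow> cat p q f g) i, \<lambda>i\<in>{1..q}. (case x of (f, g) \<Rightarrow> cat p q f g) (i + p)) = x"
  proof (clarify, intro conjI)
    fix f g assume f: "f \<in> Fv p" and g: "g \<in> Fv q"
    show "(\<lambda>i\<in>{1..p}. cat p q f g i) = f"
      using Fv_arb[OF f] by (auto simp: fun_eq_iff cat_def)
    show "(\<lambda>i\<in>{1..q}. cat p q f g (i + p)) = g"
      using Fv_arb[OF g] by (auto simp: fun_eq_iff cat_def)
  qed
  show "\<forall>h\<in>Fv (p + q). (case (\<lambda>i\<in>{1..p}. h i, \<lambda>i\<in>{1..q}. h (i + p)) of (f, g) \<Rightarrow> cat p q f g) = h"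
  proof
    fix h assume h: "h \<in> Fv (p + q)"
    show "(case (\<lambda>i\<in>{1..p}. h i, \<lambda>i\<in>{1..q}. h (i + p)) of (f, g) \<Rightarrow> cat p q f g) = h"
      using Fv_arb[OF h] by (auto simp: fun_eq_iff cat_def)
  qed
  show "(\<lambda>(f, g). cat p q f g) ` (Fv p \<times> Fv q) \<subseteq> Fv (p + q)" by auto
  show "(\<lambda>h. (\<lambda>i\<in>{1..p}. h i, \<lambda>i\<in>{1..q}. h (i + p))) ` Fv (p + q) \<subseteq> Fv p \<times> Fv q"
  proof (rule image_subsetI, rule SigmaI)
    fix h assume h: "h \<in> Fv (p + q)"
    show "(\<lambda>i\<in>{1..p}. h i) \<in> Fv p" "(\<lambda>i\<in>{1..q}. h (i + p)) \<in> Fv q"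
      unfolding restrict_Fv_iff by (intro ballI Fv_mem[OF h]; auto)+
  qed
qed

lemma cat_eqI:
  assumes "h \<in> Fv (p + q)" "h' \<in> Fv (p + q)" "\<And>i. i \<in> {1..p} \<Longrightarrow> h i = h' i"
    "\<And>i. i \<in> {1..q} \<Longrightarrow> h (i + p) = h' (i + p)"
  shows "h = h'"
proof (rule Fv_ext[OF assms(1,2)])
  fix i assume "i \<in> {1..p + q}"
  then show "h i = h' i" by (rule split_index) (use assms in auto)
qed

lemma vadd_cat:
  assumes "f \<in> Fv p" "g \<in> Fv q" "f' \<in> Fv p" "g' \<in> Fv q"
  shows "vadd (p + q) (cat p q f g) (cat p q f' g') = cat p q (vadd p f f') (vadd q g g')"
  by (rule cat_eqI[of _ p q]) (use assms in \<open>simp_all add: vadd_apply cat_apply\<close>)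

lemma sym_embed_apply:
  "i \<in> {1..m} \<Longrightarrow> sym_embed m (\<sigma>, \<tau>) i = \<sigma> i" "i \<in> {1..k} \<Longrightarrow> sym_embed m (\<sigma>, \<tau>) (i + m) = \<tau> i + m"
  by (auto simp: sym_embed_def)

lemma vsh_cat:
  assumes s: "\<sigma> permutes {1..p}" "\<tau> permutes {1..q}" and f: "f \<in> Fv p" "g \<in> Fv q"
  shows "vsh (p + q) (sym_embed p (\<sigma>, \<tau>)) (cat p q f g) = cat p q (vsh p \<sigma> f) (vsh q \<tau> g)"
proof (rule cat_eqI)
  show "vsh (p + q) (sym_embed p (\<sigma>, \<tau>)) (cat p q f g) \<in> Fv (p + q)"
    by (rule vsh_in[OF sym_embed_permutes[OF s] cat_in[OF f]])
  show "cat p q (vsh p \<sigma> f) (vsh q \<tau> g) \<in> Fv (p + q)" using s f by simp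
  fix i
  have i1: "inv' \<sigma> i \<in> {1..p}" if "i \<in> {1..p}" using that permutes_in_image[OF permutes_inv[OF s(1)], of i] by blast
  have i2: "inv' \<tau> i \<in> {1..q}" if "i \<in> {1..q}" using that permutes_in_image[OF permutes_inv[OF s(2)], of i] by blast
  show "vsh (p + q) (sym_embed p (\<sigma>, \<tau>)) (cat p q f g) i = cat p q (vsh p \<sigma> f) (vsh q \<tau> g) i" if i: "i \<in> {1..p}"
  proof -
    have "i \<in> {1..p + q}" using i by simp
    then show ?thesis
      using i i1[OF i] by (simp only: vsh_apply sym_embed_inv[OF s] sym_embed_apply cat_apply)
  qed
  show "vsh (p + q) (sym_embed p (\<sigma>, \<tau>)) (cat p q f g) (i + p) = cat p q (vsh p \<sigma> f) (vsh q \<tau> g) (i + p)" if i: "i \<in> {1..q}"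
  proof -
    have "i + p \<in> {1..p + q}" using i by simp
    then show ?thesis
      using i i2[OF i] sym_embed_apply(2)[OF i] by (simp only: vsh_apply sym_embed_inv[OF s] cat_apply)
  qed
qed

lemma Dp_cat: "Dp (p + q) D (cat p q f g) = Dp p D f * Dp q D g"
proof -
  have "Dp (p + q) D (cat p q f g) = (\<Prod>i\<in>{1..p}. D (cat p q f g i)) * (\<Prod>i\<in>{p + 1..p + q}. D (cat p q f g i))"
    unfolding Dp_def by (subst prod.union_disjoint[symmetric]) (auto intro!: prod.cong)
  also have "(\<Prod>i\<in>{p + 1..p + q}. D (cat p q f g i)) = (\<Prod>i\<in>{1..q}. D (cat p q f g (i + p)))"
    by (rule prod.reindex_bij_witness[of _ "\<lambda>i. i + p" "\<lambda>i. i - p"]) auto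
  finally show ?thesis by (simp add: Dp_def cat_apply)
qed

lemma B_embed_hom: "B_embed p q \<in> hom (B p \<times>\<times> B q) (B (p + q))"
proof (rule homI)
  fix x y assume "x \<in> carrier (B p \<times>\<times> B q)" "y \<in> carrier (B p \<times>\<times> B q)"
  then obtain f \<sigma> g \<tau> f' \<sigma>' g' \<tau>' where x: "x = ((f, \<sigma>), (g, \<tau>))" "f \<in> Fv p" "g \<in> Fv q" "\<sigma> permutes {1..p}" "\<tau> permutes {1..q}"
    and y: "y = ((f', \<sigma>'), (g', \<tau>'))" "f' \<in> Fv p" "g' \<in> Fv q" "\<sigma>' permutes {1..p}" "\<tau>' permutes {1..q}"
    by (auto simp: carrier_B)
  show "B_embed p q x \<in> carrier (B (p + q))"
    using x sym_embed_permutes[OF x(4,5)] by (simp add: B_embed_cat carrier_B)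
  show "B_embed p q (x \<otimes>\<^bsub>B p \<times>\<times> B q\<^esub> y) = B_embed p q x \<otimes>\<^bsub>B (p + q)\<^esub> B_embed p q y"
    using x y by (simp add: B_embed_cat mult_B vsh_cat vadd_cat sym_embed_comp)
qed

text \<open>
  In the sum for \<open>B\<^sub>p\<^sub>+\<^sub>q\<close> the permutation parts determine the tuple \<open>(f, f')\<close>, so only the sum for the
  symmetric groups remains.
\<close>

lemma icf_inflation:
  assumes D: "F2_char D" and g: "(f0, \<gamma>) \<in> carrier (B (p + q))"
  shows "icf (B (p + q)) (B p \<times>\<times> B q) (B_embed p q) (\<lambda>(x, y). Dp p D (fst x) * Dp q D (fst y) * \<phi> (snd x, snd y)) (f0, \<gamma>)
    = Dp (p + q) D f0 * icf (sym_group (p + q)) (sym_group p \<times>\<times> sym_group q) (sym_embed p) \<phi> \<gamma>"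
proof -
  let ?n = "p + q"
  let ?S = "\<lambda>m. {\<sigma>. \<sigma> permutes {1..m::nat}}"
  have f0: "f0 \<in> Fv ?n" and \<gamma>: "\<gamma> permutes {1..?n}" using g by (auto simp: carrier_B)
  have key: "(\<Sum>f\<in>Fv p. \<Sum>f'\<in>Fv q.
      if (f0, \<gamma>) \<otimes>\<^bsub>B ?n\<^esub> (u, \<xi>) = (u, \<xi>) \<otimes>\<^bsub>B ?n\<^esub> B_embed p q ((f, \<sigma>), (f', \<sigma>')) then Dp p D f * Dp q D f' * \<phi> (\<sigma>, \<sigma>') else 0)
    = Dp ?n D f0 * (if \<gamma> \<circ> \<xi> = \<xi> \<circ> sym_embed p (\<sigma>, \<sigma>') then \<phi> (\<sigma>, \<sigma>') else 0)"
    if u: "u \<in> Fv ?n" and \<xi>: "\<xi> permutes {1..?n}" for u \<xi> \<sigma> \<sigma>'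
  proof (cases "\<gamma> \<circ> \<xi> = \<xi> \<circ> sym_embed p (\<sigma>, \<sigma>')")
    case False
    then show ?thesis by (simp add: B_embed_cat mult_B)
  next
    case True
    let ?w = "vadd ?n f0 (vsh ?n \<gamma> u)"
    \<comment> \<open>The unique tuple h that solves f0 + \<gamma> u = u + \<xi> h; every tuple is
      its own negative.\<close>
    let ?v = "vsh ?n (inv' \<xi>) (vadd ?n u ?w)"
    have v: "?v \<in> Fv ?n" using \<xi> by (simp add: permutes_inv)
    have iff: "?w = vadd ?n u (vsh ?n \<xi> h) \<longleftrightarrow> h = ?v" if h: "h \<in> Fv ?n" for h
    proof
      assume "?w = vadd ?n u (vsh ?n \<xi> h)"
      then have "vadd ?n u ?w = vsh ?n \<xi> h"
        using u h \<xi> by (simp add: vadd_assoc[symmetric] vadd_self vadd_zero)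
      then show "h = ?v" using vsh_inv(1)[OF \<xi> h] by simp
    next
      assume "h = ?v"
      then have "vsh ?n \<xi> h = vadd ?n u ?w" using vsh_inv(2)[OF \<xi>, of "vadd ?n u ?w"] by simp
      then show "?w = vadd ?n u (vsh ?n \<xi> h)"
        using u f0 by (simp add: vadd_assoc[symmetric] vadd_self vadd_zero)
    qed
    \<comment> \<open>Up to permuting coordinates \<open>u\<close> enters \<open>?v\<close> twice,
      and a character with values of square 1 forgets it.\<close>
    have "Dp ?n D ?v = Dp ?n D u * (Dp ?n D f0 * Dp ?n D u)"
      using \<xi> \<gamma> u f0 by (simp add: Dp_sh permutes_inv Dp_add[OF D])
    also have "Dp ?n D u * Dp ?n D u = 1"
      using Dp_add[OF D u u] vadd_self[OF u] Dp_zero[OF D] by simp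
    then have "Dp ?n D u * (Dp ?n D f0 * Dp ?n D u) = Dp ?n D f0"
      by (metis mult.assoc mult.commute mult_1)
    finally have Dv: "Dp ?n D ?v = Dp ?n D f0" .
    have "(\<Sum>f\<in>Fv p. \<Sum>f'\<in>Fv q.
        if (f0, \<gamma>) \<otimes>\<^bsub>B ?n\<^esub> (u, \<xi>) = (u, \<xi>) \<otimes>\<^bsub>B ?n\<^esub> B_embed p q ((f, \<sigma>), (f', \<sigma>')) then Dp p D f * Dp q D f' * \<phi> (\<sigma>, \<sigma>') else 0)
      = (\<Sum>f\<in>Fv p. \<Sum>f'\<in>Fv q. if ?w = vadd ?n u (vsh ?n \<xi> (cat p q f f')) then Dp ?n D (cat p q f f') * \<phi> (\<sigma>, \<sigma>') else 0)"
      using True by (simp only: B_embed_cat mult_B prod.inject Dp_cat simp_thms)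
    also have "\<dots> = (\<Sum>x\<in>Fv p \<times> Fv q. (\<lambda>h. if ?w = vadd ?n u (vsh ?n \<xi> h) then Dp ?n D h * \<phi> (\<sigma>, \<sigma>') else 0) ((\<lambda>(f, g). cat p q f g) x))"
      by (simp only: sum.cartesian_product case_prod_unfold)
    also have "\<dots> = (\<Sum>h\<in>Fv ?n. if ?w = vadd ?n u (vsh ?n \<xi> h) then Dp ?n D h * \<phi> (\<sigma>, \<sigma>') else 0)"
      by (rule sum.reindex_bij_betw[OF cat_bij])
    also have "\<dots> = (\<Sum>h\<in>Fv ?n. if h = ?v then Dp ?n D f0 * \<phi> (\<sigma>, \<sigma>') else 0)"
      by (intro sum.cong refl) (simp add: iff Dv)
    also have "\<dots> = Dp ?n D f0 * \<phi> (\<sigma>, \<sigma>')" using v finite_Fv by simp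
    finally show ?thesis using True by simp
  qed
  let ?A = "\<lambda>u \<xi> f \<sigma> f' \<sigma>'. if (f0, \<gamma>) \<otimes>\<^bsub>B ?n\<^esub> (u, \<xi>) = (u, \<xi>) \<otimes>\<^bsub>B ?n\<^esub> B_embed p q ((f, \<sigma>), (f', \<sigma>'))
      then Dp p D f * Dp q D f' * \<phi> (\<sigma>, \<sigma>') else 0"
  let ?C = "\<lambda>\<xi> \<sigma> \<sigma>'. if \<gamma> \<circ> \<xi> = \<xi> \<circ> sym_embed p (\<sigma>, \<sigma>') then \<phi> (\<sigma>, \<sigma>') else 0"
  have "(\<Sum>x\<in>carrier (B ?n). \<Sum>h\<in>carrier (B p \<times>\<times> B q). if (f0, \<gamma>) \<otimes>\<^bsub>B ?n\<^esub> x = x \<otimes>\<^bsub>B ?n\<^esub> B_embed p q h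
        then (\<lambda>(x, y). Dp p D (fst x) * Dp q D (fst y) * \<phi> (snd x, snd y)) h else 0)
    = (\<Sum>u\<in>Fv ?n. \<Sum>\<xi>\<in>?S ?n. \<Sum>f\<in>Fv p. \<Sum>\<sigma>\<in>?S p. \<Sum>f'\<in>Fv q. \<Sum>\<sigma>'\<in>?S q. ?A u \<xi> f \<sigma> f' \<sigma>')"
    unfolding carrier_B DirProd_def partial_object.simps sum.cartesian_product[symmetric]
    by (simp add: sum.cartesian_product' cong: if_cong)
  also have "\<dots> = (\<Sum>u\<in>Fv ?n. \<Sum>\<xi>\<in>?S ?n. \<Sum>\<sigma>\<in>?S p. \<Sum>\<sigma>'\<in>?S q. \<Sum>f\<in>Fv p. \<Sum>f'\<in>Fv q. ?A u \<xi> f \<sigma> f' \<sigma>')"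
  proof (intro sum.cong[OF refl])
    fix u \<xi>
    have "(\<Sum>f\<in>Fv p. \<Sum>\<sigma>\<in>?S p. \<Sum>f'\<in>Fv q. \<Sum>\<sigma>'\<in>?S q. ?A u \<xi> f \<sigma> f' \<sigma>')
      = (\<Sum>f\<in>Fv p. \<Sum>\<sigma>\<in>?S p. \<Sum>\<sigma>'\<in>?S q. \<Sum>f'\<in>Fv q. ?A u \<xi> f \<sigma> f' \<sigma>')"
      by (rule sum.cong[OF refl], rule sum.cong[OF refl], rule sum.swap)
    also have "\<dots> = (\<Sum>\<sigma>\<in>?S p. \<Sum>\<sigma>'\<in>?S q. \<Sum>f\<in>Fv p. \<Sum>f'\<in>Fv q. ?A u \<xi> f \<sigma> f' \<sigma>')" by (rule sum_rotate)
    finally show "(\<Sum>f\<in>Fv p. \<Sum>\<sigma>\<in>?S p. \<Sum>f'\<in>Fv q. \<Sum>\<sigma>'\<in>?S q. ?A u \<xi> f \<sigma> f' \<sigma>')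
      = (\<Sum>\<sigma>\<in>?S p. \<Sum>\<sigma>'\<in>?S q. \<Sum>f\<in>Fv p. \<Sum>f'\<in>Fv q. ?A u \<xi> f \<sigma> f' \<sigma>')" .
  qed
  also have "\<dots> = (\<Sum>u\<in>Fv ?n. \<Sum>\<xi>\<in>?S ?n. \<Sum>\<sigma>\<in>?S p. \<Sum>\<sigma>'\<in>?S q. Dp ?n D f0 * ?C \<xi> \<sigma> \<sigma>')"
    by (intro sum.cong[OF refl] key) auto
  \<comment> \<open>The tuple u has dropped out. The factor for its free choice will cancel the
    number of tuples contained in the order of the subgroup.\<close>
  also have "\<dots> = of_nat (card (Fv ?n)) * (Dp ?n D f0 * (\<Sum>\<xi>\<in>?S ?n. \<Sum>\<sigma>\<in>?S p. \<Sum>\<sigma>'\<in>?S q. ?C \<xi> \<sigma> \<sigma>'))"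
    by (simp only: sum_constant sum_distrib_left)
  also have "card (Fv ?n) = card (Fv p) * card (Fv q)"
    using bij_betw_same_card[OF cat_bij[of p q]] by (simp add: card_cartesian_product)
  finally have sum: "(\<Sum>x\<in>carrier (B ?n). \<Sum>h\<in>carrier (B p \<times>\<times> B q). if (f0, \<gamma>) \<otimes>\<^bsub>B ?n\<^esub> x = x \<otimes>\<^bsub>B ?n\<^esub> B_embed p q h
        then (\<lambda>(x, y). Dp p D (fst x) * Dp q D (fst y) * \<phi> (snd x, snd y)) h else 0)
    = of_nat (card (Fv p) * card (Fv q)) * (Dp ?n D f0 * (\<Sum>\<xi>\<in>?S ?n. \<Sum>\<sigma>\<in>?S p. \<Sum>\<sigma>'\<in>?S q. ?C \<xi> \<sigma> \<sigma>'))" .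
  have cardB: "card (carrier (B p \<times>\<times> B q)) = (card (Fv p) * card (Fv q)) * card (carrier (sym_group p \<times>\<times> sym_group q))"
    by (simp only: DirProd_def partial_object.simps card_cartesian_product carrier_B sym_group_def mult_ac)
  have nz: "card (Fv p) \<noteq> 0" "card (Fv q) \<noteq> 0" using finite_Fv vzero_in by (metis card_0_eq empty_iff)+
  have icfS: "icf (sym_group ?n) (sym_group p \<times>\<times> sym_group q) (sym_embed p) \<phi> \<gamma>
      = (\<Sum>\<xi>\<in>?S ?n. \<Sum>\<sigma>\<in>?S p. \<Sum>\<sigma>'\<in>?S q. ?C \<xi> \<sigma> \<sigma>') / of_nat (card (carrier (sym_group p \<times>\<times> sym_group q)))"
    unfolding icf_def by (simp add: DirProd_def sym_group_def sum.cartesian_product' cong: if_cong)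
  show ?thesis
    unfolding icf_def[of "B ?n"] sum icfS cardB using nz by simp
qed

section \<open>Induction to hyperoctahedral groups\<close>

definition v2 :: "int \<Rightarrow> int \<Rightarrow> nat \<Rightarrow> int" where
  "v2 a b = (\<lambda>i\<in>{1..2}. if i = 1 then a else b)"

definition sw :: "nat \<Rightarrow> nat" where "sw = transpose 1 2"

lemma index2: "i \<in> {1..2::nat} \<longleftrightarrow> i = 1 \<or> i = 2" by auto

lemma v2_apply: "v2 a b 1 = a" "v2 a b 2 = b" by (simp_all add: v2_def)

lemma v2_eq: "v2 a b = v2 c d \<longleftrightarrow> a = c \<and> b = d"
  using v2_apply by metis

lemma v2_in: "a \<in> {0..<2} \<Longrightarrow> b \<in> {0..<2} \<Longrightarrow> v2 a b \<in> Fv 2"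
  unfolding v2_def restrict_Fv_iff by simp

lemma Fv2: "Fv 2 = {v2 0 0, v2 0 1, v2 1 0, v2 1 1}"
proof (intro Set.set_eqI iffI)
  fix f assume f: "f \<in> Fv 2"
  have m: "f 1 \<in> {0..<2}" "f 2 \<in> {0..<2}" using Fv_mem[OF f, of 1] Fv_mem[OF f, of 2] by auto
  have "f = v2 (f 1) (f 2)"
  proof (rule Fv_ext[OF f v2_in[OF m]])
    show "f i = v2 (f 1) (f 2) i" if "i \<in> {1..2}" for i
      using that v2_apply unfolding index2 by auto
  qed
  moreover have "f 1 = 0 \<or> f 1 = 1" "f 2 = 0 \<or> f 2 = 1" using m by auto
  ultimately show "f \<in> {v2 0 0, v2 0 1, v2 1 0, v2 1 1}" by auto
qed (auto intro!: v2_in)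

lemma sum_Fv2: "sum h (Fv 2) = h (v2 0 0) + h (v2 0 1) + h (v2 1 0) + (h (v2 1 1) :: complex)"
  by (simp add: Fv2 v2_eq)

lemma vadd_v2: "vadd 2 (v2 a b) (v2 c d) = v2 ((a + c) mod 2) ((b + d) mod 2)"
  unfolding vadd_def v2_def by (rule restrict_ext) simp

lemma vzero_v2: "vzero 2 = v2 0 0"
  unfolding vzero_def v2_def by (rule restrict_ext) simp

lemma vsh_sw: "vsh 2 sw (v2 a b) = v2 b a"
  unfolding vsh_def v2_def by (rule restrict_ext) (auto simp: index2 sw_def Transposition.transpose_def)

lemma vsh_id_v2: "vsh 2 id (v2 a b) = v2 a b"
  unfolding vsh_def v2_def by (rule restrict_ext) (auto simp: index2)

lemma perms2: "{p. p permutes {1..2::nat}} = {id, sw}"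
proof -
  have "{1..2::nat} = {1, 2}" by auto
  then show ?thesis using permutes_doubleton_iff[of _ "1::nat" 2] by (auto simp: sw_def)
qed

lemma sw_ne: "sw \<noteq> id" "id \<noteq> sw"
proof -
  have "sw 1 \<noteq> id (1::nat)" by (simp add: sw_def)
  then show "sw \<noteq> id" "id \<noteq> sw" by metis+
qed

lemma sw_sw: "sw \<circ> sw = id"
  unfolding sw_def by (rule transpose_comp_involutory)

lemma sum_perms2: "sum h {p. p permutes {1..2::nat}} = h id + (h sw :: complex)"
  unfolding perms2 using sw_ne by simp

lemma perms01: "{p. p permutes {1..0::nat}} = {id}" "{p. p permutes {1..1::nat}} = {id}"
  by (auto simp: permutes_empty)

definition v1 :: "int \<Rightarrow> nat \<Rightarrow> int" where "v1 a = (\<lambda>i\<in>{1..1}. a)"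

lemma Fv1: "Fv 1 = {v1 0, v1 1}"
proof (intro Set.set_eqI iffI)
  fix f assume f: "f \<in> Fv 1"
  have m: "f 1 \<in> {0..<2}" using Fv_mem[OF f, of 1] by auto
  have "f = v1 (f 1)"
    by (rule Fv_ext[OF f]) (use m in \<open>auto simp: v1_def restrict_Fv_iff[of _ 1, simplified]\<close>)
  moreover have "f 1 = 0 \<or> f 1 = 1" using m by auto
  ultimately show "f \<in> {v1 0, v1 1}" by auto
next
  fix f assume "f \<in> {v1 0, v1 1}"
  then show "f \<in> Fv 1" unfolding v1_def using restrict_Fv_iff[of "\<lambda>_. 0" 1] restrict_Fv_iff[of "\<lambda>_. 1" 1] by auto
qed

lemma v1_ne: "v1 0 \<noteq> v1 1" by (auto simp: v1_def fun_eq_iff)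

lemma sum_Fv1: "sum h (Fv 1) = h (v1 0) + (h (v1 1) :: complex)"
  unfolding Fv1 using v1_ne by simp

lemma cat_v1: "cat 1 1 (v1 a) (v1 b) = v2 a b"
  unfolding cat_def v1_def v2_def by (rule ext) (auto simp: restrict_def)

definition bc :: "nat \<Rightarrow> nat \<Rightarrow> ((nat \<Rightarrow> nat) \<Rightarrow> complex) \<Rightarrow> ((nat \<Rightarrow> nat) \<Rightarrow> complex) \<Rightarrow> hyp \<Rightarrow> complex" where
  "bc l k \<phi> \<psi> = icf (B (l + k)) (B l \<times>\<times> B k) (B_embed l k)
     (\<lambda>(x, y). \<phi> (snd x) * (Dp k eps_F (fst y) * \<psi> (snd y)))"

lemma bc_cong:
  assumes "\<And>\<sigma>. \<sigma> permutes {1..l} \<Longrightarrow> \<phi> \<sigma> = \<phi>' \<sigma>" "\<And>\<sigma>. \<sigma> permutes {1..k} \<Longrightarrow> \<psi> \<sigma> = \<psi>' \<sigma>"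
  shows "bc l k \<phi> \<psi> g = bc l k \<phi>' \<psi>' g"
  unfolding bc_def by (rule icf_cong) (use assms in \<open>auto simp: carrier_B\<close>)

lemma bc_sum_left: "bc l k (\<lambda>\<sigma>. \<Sum>i\<in>I. \<phi> i \<sigma>) \<psi> g = (\<Sum>i\<in>I. bc l k (\<phi> i) \<psi> g)"
  unfolding bc_def icf_sum[symmetric]
  by (rule arg_cong[where f = "\<lambda>f. icf _ _ _ f g"]) (auto simp: sum_distrib_right)

lemma bc_sum_right: "bc l k \<phi> (\<lambda>\<sigma>. \<Sum>i\<in>I. \<psi> i \<sigma>) g = (\<Sum>i\<in>I. bc l k \<phi> (\<psi> i) g)"
  unfolding bc_def icf_sum[symmetric]
  by (rule arg_cong[where f = "\<lambda>f. icf _ _ _ f g"]) (auto simp: sum_distrib_left)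

lemma carrier_B0: "carrier (B 0) = {(vzero 0, id)}"
proof -
  have "Fv 0 = {vzero 0}"
    using Fv_ext[of _ 0 "vzero 0"] by auto
  then show ?thesis by (simp add: carrier_B)
qed

lemma sym_embed_right_zero: "\<sigma> permutes {1..l} \<Longrightarrow> sym_embed l (\<sigma>, id) = \<sigma>"
  using permutes_not_in[of \<sigma> "{1..l}"] by (auto simp: sym_embed_def fun_eq_iff)

lemma sym_embed_left_zero: "\<sigma> permutes {1..l} \<Longrightarrow> sym_embed 0 (id, \<sigma>) = \<sigma>"
  using permutes_not_in[of \<sigma> "{1..l}" 0] by (auto simp: sym_embed_def fun_eq_iff)

lemma cat_right_zero: "f \<in> Fv l \<Longrightarrow> cat l 0 f g = f"
  by (rule ext) (use Fv_arb[of f l] in \<open>auto simp: cat_def\<close>)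

lemma cat_left_zero: "f \<in> Fv l \<Longrightarrow> cat 0 l g f = f"
  by (rule ext) (use Fv_arb[of f l] in \<open>auto simp: cat_def\<close>)

text \<open>\<open>B 0\<close> is trivial, so the embedding is a bijection and induction changes
  nothing.\<close>

lemma bc_right_zero:
  assumes E: "representation (sym_group l) E" and g: "(f, \<gamma>) \<in> carrier (B l)"
  shows "bc l 0 (chr E) (\<lambda>_. 1) (f, \<gamma>) = chr E \<gamma>"
proof -
  note T = representation_twisted[OF E F2_char_triv] and cT = chr_twisted[OF E F2_char_triv]
  have emb: "B_embed l 0 h = fst h" if "h \<in> carrier (B l \<times>\<times> B 0)" for h
    using that by (auto simp: carrier_B0 carrier_B B_embed_cat cat_right_zero sym_embed_right_zero)
  have "icf (B l) (B l \<times>\<times> B 0) (B_embed l 0) (\<lambda>(x, y). chr E (snd x) * (Dp 0 eps_F (fst y) * 1)) (f, \<gamma>)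
    = chr (twisted l (\<lambda>_. 1) E) (f, \<gamma>)"
  proof (rule icf_iso[OF group_B finite_B _ g])
    have "bij_betw fst (carrier (B l) \<times> carrier (B 0)) (carrier (B l))"
      unfolding carrier_B0 by (rule bij_betw_byWitness[where f' = "\<lambda>x. (x, (vzero 0, id))"]) auto
    then show "bij_betw (B_embed l 0) (carrier (B l \<times>\<times> B 0)) (carrier (B l))"
      using emb by (subst bij_betw_cong[of _ _ fst]) (auto simp: DirProd_def)
    show "chr (twisted l (\<lambda>_. 1) E) (x \<otimes>\<^bsub>B l\<^esub> (f, \<gamma>) \<otimes>\<^bsub>B l\<^esub> inv\<^bsub>B l\<^esub> x) = chr (twisted l (\<lambda>_. 1) E) (f, \<gamma>)"
      if "x \<in> carrier (B l)" for x by (rule chr_conj[OF T g that])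
    fix h assume h: "h \<in> carrier (B l \<times>\<times> B 0)"
    then obtain a s where "h = ((a, s), (vzero 0, id))" "(a, s) \<in> carrier (B l)" by (auto simp: carrier_B0)
    then show "(\<lambda>(x, y). chr E (snd x) * (Dp 0 eps_F (fst y) * 1)) h = chr (twisted l (\<lambda>_. 1) E) (B_embed l 0 h)"
      using emb[OF h] cT by (simp add: Dp_def)
  qed
  then show ?thesis using cT[OF g] by (simp add: bc_def)
qed

lemma bc_left_zero:
  assumes E: "representation (sym_group l) E" and g: "(f, \<gamma>) \<in> carrier (B l)"
  shows "bc 0 l (\<lambda>_. 1) (chr E) (f, \<gamma>) = Dp l eps_F f * chr E \<gamma>"
proof -
  note T = representation_twisted[OF E F2_char_eps] and cT = chr_twisted[OF E F2_char_eps]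
  have emb: "B_embed 0 l h = snd h" if "h \<in> carrier (B 0 \<times>\<times> B l)" for h
    using that by (auto simp: carrier_B0 carrier_B B_embed_cat cat_left_zero sym_embed_left_zero)
  have "icf (B l) (B 0 \<times>\<times> B l) (B_embed 0 l) (\<lambda>(x, y). 1 * (Dp l eps_F (fst y) * chr E (snd y))) (f, \<gamma>)
    = chr (twisted l eps_F E) (f, \<gamma>)"
  proof (rule icf_iso[OF group_B finite_B _ g])
    have "bij_betw snd (carrier (B 0) \<times> carrier (B l)) (carrier (B l))"
      unfolding carrier_B0 by (rule bij_betw_byWitness[where f' = "\<lambda>x. ((vzero 0, id), x)"]) auto
    then show "bij_betw (B_embed 0 l) (carrier (B 0 \<times>\<times> B l)) (carrier (B l))"
      using emb by (subst bij_betw_cong[of _ _ snd]) (auto simp: DirProd_def)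
    show "chr (twisted l eps_F E) (x \<otimes>\<^bsub>B l\<^esub> (f, \<gamma>) \<otimes>\<^bsub>B l\<^esub> inv\<^bsub>B l\<^esub> x) = chr (twisted l eps_F E) (f, \<gamma>)"
      if "x \<in> carrier (B l)" for x by (rule chr_conj[OF T g that])
    fix h assume h: "h \<in> carrier (B 0 \<times>\<times> B l)"
    then obtain a s where "h = ((vzero 0, id), (a, s))" "(a, s) \<in> carrier (B l)" by (auto simp: carrier_B0)
    then show "(\<lambda>(x, y). 1 * (Dp l eps_F (fst y) * chr E (snd y))) h = chr (twisted l eps_F E) (B_embed 0 l h)"
      using emb[OF h] cT by (simp add: Dp_def)
  qed
  then show ?thesis using cT[OF g] by (simp add: bc_def)
qed

text \<open>Serves the cases where one of the blocks adjoined in \<open>bc_merge\<close> is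
  empty.\<close>

lemma icf_sym_right_zero:
  assumes E: "representation (sym_group l) E" and g: "\<gamma> permutes {1..l}"
  shows "icf (sym_group l) (sym_group l \<times>\<times> sym_group 0) (sym_embed l) (\<lambda>(s, t). chr E s * 1) \<gamma> = chr E \<gamma>"
proof (rule icf_iso[OF sym_group_is_group finite_sym_group])
  have C0: "carrier (sym_group 0) = {id}" by (auto simp: sym_group_def)
  have emb: "sym_embed l h = fst h" if "h \<in> carrier (sym_group l \<times>\<times> sym_group 0)" for h
    using that by (auto simp: C0 sym_group_carrier sym_embed_right_zero)
  have "bij_betw fst (carrier (sym_group l) \<times> carrier (sym_group 0)) (carrier (sym_group l))"
    unfolding C0 by (rule bij_betw_byWitness[where f' = "\<lambda>x. (x, id)"]) auto
  then show "bij_betw (sym_embed l) (carrier (sym_group l \<times>\<times> sym_group 0)) (carrier (sym_group l))"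
    using emb by (subst bij_betw_cong[of _ _ fst]) (auto simp: DirProd_def)
  show gG: "\<gamma> \<in> carrier (sym_group l)" using g by (simp add: sym_group_carrier)
  show "chr E (x \<otimes>\<^bsub>sym_group l\<^esub> \<gamma> \<otimes>\<^bsub>sym_group l\<^esub> inv\<^bsub>sym_group l\<^esub> x) = chr E \<gamma>" if "x \<in> carrier (sym_group l)" for x
    by (rule chr_conj[OF E gG that])
  show "(\<lambda>(s, t). chr E s * 1) h = chr E (sym_embed l h)" if "h \<in> carrier (sym_group l \<times>\<times> sym_group 0)" for h
    using emb[OF that] by (simp add: case_prod_unfold)
qed

text \<open>The embedded product of two copies of \<open>B 1\<close> is the normal subgroup of
  tuples, so elements outside it get 0; on it the two conjugates of the inducing character are
  added.\<close>

lemma bc_1_1: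
  assumes "a \<in> {0, 1}" "b \<in> {0, 1}" "\<gamma> = id \<or> \<gamma> = sw"
  shows "bc 1 1 (\<lambda>_. 1) (\<lambda>_. 1) (v2 a b, \<gamma>) = (if \<gamma> = id then eps_F a + eps_F b else 0)"
proof -
  have a: "a = 0 \<or> a = 1" and b: "b = 0 \<or> b = 1" using assms by auto
  have C1: "carrier (B 1) = Fv 1 \<times> {id}" unfolding carrier_B perms01 ..
  have c1: "card (Fv 1) = 2" unfolding Fv1 using v1_ne by simp
  have cc: "card (carrier (B 1 \<times>\<times> B 1)) = 4"
    unfolding DirProd_def partial_object.simps C1 using c1 by (simp add: card_cartesian_product)
  have i1: "sym_embed 1 (id, id) = id" by (rule sym_embed_id)
  have D: "Dp 1 eps_F (v1 a) = eps_F a" for a by (simp add: Dp_def v1_def)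
  have "(\<Sum>x\<in>carrier (B 2). \<Sum>h\<in>carrier (B 1 \<times>\<times> B 1). if (v2 a b, \<gamma>) \<otimes>\<^bsub>B 2\<^esub> x = x \<otimes>\<^bsub>B 2\<^esub> B_embed 1 1 h
      then (\<lambda>(x, y). 1 * (Dp 1 eps_F (fst y) * 1)) h else 0)
    = (\<Sum>u\<in>Fv 2. \<Sum>\<xi>\<in>{p. p permutes {1..2}}. \<Sum>f\<in>Fv 1. \<Sum>f'\<in>Fv 1.
        if (v2 a b, \<gamma>) \<otimes>\<^bsub>B 2\<^esub> (u, \<xi>) = (u, \<xi>) \<otimes>\<^bsub>B 2\<^esub> B_embed 1 1 ((f, id), (f', id)) then Dp 1 eps_F f' else 0)"
    unfolding DirProd_def partial_object.simps C1 carrier_B[of 2] by (simp add: sum.cartesian_product' cong: if_cong)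
  \<comment> \<open>The factor 4 is the order of the product of two copies of
    \<open>B 1\<close>.\<close>
  also have "\<dots> = 4 * (if \<gamma> = id then eps_F a + eps_F b else 0)"
    unfolding sum_Fv2 sum_perms2 sum_Fv1 B_embed_cat cat_v1 i1 mult_B D
    using a b assms(3)
    by (elim disjE) (simp_all add: vadd_v2 vsh_sw vsh_id_v2 v2_eq sw_ne sw_sw eps_F_def)
  finally show ?thesis
    unfolding bc_def icf_def one_add_one cc by (simp only:) simp
qed

text \<open>Checked on the eight elements of \<open>B 2\<close>: with e(a), e(b) the signs
  \<open>eps_F a\<close>, \<open>eps_F b\<close>, both sides are \<psi>(\<gamma>) (1 + e(a) e(b)),
  plus e(a) + e(b) when \<gamma> is the identity.\<close>

lemma S2bar_induction:
  assumes \<psi>: "representation (sym_group 2) (char_rep \<psi>)" and g: "g \<in> carrier (B 2)"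
  shows "icf (B 2) S2bar id (\<lambda>h. \<psi> (snd h)) g =
    bc 2 0 \<psi> (\<lambda>_. 1) g + bc 0 2 (\<lambda>_. 1) \<psi> g + bc 1 1 (\<lambda>_. 1) (\<lambda>_. 1) g"
proof -
  obtain f \<gamma> where gf: "g = (f, \<gamma>)" "f \<in> Fv 2" "\<gamma> \<in> {p. p permutes {1..2}}" using g by (auto simp: carrier_B)
  obtain a b where f: "f = v2 a b" and ab: "a \<in> {0, 1}" "b \<in> {0, 1}" using gf(2) unfolding Fv2 by auto
  have \<gamma>: "\<gamma> = id \<or> \<gamma> = sw" using gf(3) unfolding perms2 by auto
  have a: "a = 0 \<or> a = 1" and b: "b = 0 \<or> b = 1" using ab by auto
  have CS: "carrier S2bar = {vzero 2} \<times> {p. p permutes {1..2}}"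
    by (simp add: S2bar_def vzero_def sym_group_def)
  have \<psi>1: "\<psi> id = 1"
    using rep_one[OF \<psi>, of "\<lambda>_. 1"] by (simp add: char_rep_def cscale_def sym_group_one fun_eq_iff)
  have "(\<Sum>x\<in>carrier (B 2). \<Sum>h\<in>carrier S2bar. if g \<otimes>\<^bsub>B 2\<^esub> x = x \<otimes>\<^bsub>B 2\<^esub> id h then \<psi> (snd h) else 0)
    = (\<Sum>u\<in>Fv 2. \<Sum>\<xi>\<in>{p. p permutes {1..2}}. \<Sum>\<tau>\<in>{p. p permutes {1..2}}.
        if (v2 a b, \<gamma>) \<otimes>\<^bsub>B 2\<^esub> (u, \<xi>) = (u, \<xi>) \<otimes>\<^bsub>B 2\<^esub> (vzero 2, \<tau>) then \<psi> \<tau> else 0)"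
    unfolding CS carrier_B[of 2] gf(1) f by (simp add: sum.cartesian_product' cong: if_cong)
  also have "\<dots> = 2 * (\<psi> \<gamma> + eps_F a * eps_F b * \<psi> \<gamma> + (if \<gamma> = id then eps_F a + eps_F b else 0))"
    unfolding sum_Fv2 sum_perms2 mult_B vzero_v2
    using a b \<gamma>
    by (elim disjE) (simp_all add: vadd_v2 vsh_sw vsh_id_v2 v2_eq sw_ne sw_sw eps_F_def \<psi>1)
  finally have lhs: "icf (B 2) S2bar id (\<lambda>h. \<psi> (snd h)) g
      = \<psi> \<gamma> + eps_F a * eps_F b * \<psi> \<gamma> + (if \<gamma> = id then eps_F a + eps_F b else 0)"
    unfolding icf_def CS perms2 using sw_ne by simp
  have gB: "(v2 a b, \<gamma>) \<in> carrier (B 2)" using g gf(1) f by simp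
  have \<psi>c: "\<psi> = chr (char_rep \<psi>)" by (rule ext) (rule chr_char_rep[symmetric])
  have D: "Dp 2 eps_F (v2 a b) = eps_F a * eps_F b"
  proof -
    have "{1..2::nat} = {1, 2}" by auto
    then show ?thesis by (simp add: Dp_def v2_def)
  qed
  have b1: "bc 2 0 \<psi> (\<lambda>_. 1) (v2 a b, \<gamma>) = \<psi> \<gamma>"
    using bc_right_zero[OF \<psi> gB] unfolding \<psi>c[symmetric] .
  have b2: "bc 0 2 (\<lambda>_. 1) \<psi> (v2 a b, \<gamma>) = eps_F a * eps_F b * \<psi> \<gamma>"
    using bc_left_zero[OF \<psi> gB] unfolding \<psi>c[symmetric] D .
  show ?thesis
    unfolding lhs unfolding gf(1) f b1 b2 bc_1_1[OF ab \<gamma>] ..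
qed

text \<open>
  The block permutation carrying the order \<open>l, a, k, b\<close> of consecutive blocks to \<open>l, k, a, b\<close>.
\<close>

definition blk :: "nat \<Rightarrow> nat \<Rightarrow> nat \<Rightarrow> nat \<Rightarrow> nat" where
  "blk l a k i = (if i \<le> l then i else if i \<le> l + a then i + k else if i \<le> l + a + k then i - a else i)"

lemma blk_inverse: "blk l k a (blk l a k i) = i"
  by (auto simp: blk_def)

lemma blk_permutes: "blk l a k permutes {1..l + k + (a + b)}"
proof -
  have "bij (blk l a k)" by (rule o_bij[of "blk l k a"]) (auto simp: fun_eq_iff blk_inverse)
  moreover have "blk l a k i = i" if "i \<notin> {1..l + k + (a + b)}" for i using that by (auto simp: blk_def)
  ultimately show ?thesis unfolding permutes_def bij_iff by blast
qed

lemma inv_blk: "inv' (blk l a k) = blk l k a"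
  by (rule inv_unique_comp) (auto simp: fun_eq_iff blk_inverse)

lemma four_blocks:
  fixes i :: nat
  assumes "i \<in> {1..l + k + (a + b)}"
  obtains "i \<in> {1..l}" | j where "i = j + l" "j \<in> {1..k}" | j where "i = j + (l + k)" "j \<in> {1..a}"
    | j where "i = j + a + (l + k)" "j \<in> {1..b}"
proof -
  have "i \<in> {1..l} \<or> i - l \<in> {1..k} \<and> i = (i - l) + l \<or> i - (l + k) \<in> {1..a} \<and> i = (i - (l + k)) + (l + k)
    \<or> i - (l + k + a) \<in> {1..b} \<and> i = (i - (l + k + a)) + a + (l + k)"
    using assms by auto
  then show ?thesis using that by blast
qed

text \<open>The block permutation conjugates two nested embeddings of four symmetric groups into
  each other. This is the permutation part of the exchange in \<open>bc_merge\<close>;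
  \<open>blk_cat\<close> is the tuple part.\<close>

lemma blk_sym_embed:
  assumes s: "s1 permutes {1..l}" "s2 permutes {1..k}" "s3 permutes {1..a}" "s4 permutes {1..b}"
  shows "sym_embed (l + k) (sym_embed l (s1, s2), sym_embed a (s3, s4)) \<circ> blk l a k
    = blk l a k \<circ> sym_embed (l + a) (sym_embed l (s1, s3), sym_embed k (s2, s4))"
proof
  fix i
  let ?E = "sym_embed (l + k) (sym_embed l (s1, s2), sym_embed a (s3, s4))"
  let ?F = "sym_embed (l + a) (sym_embed l (s1, s3), sym_embed k (s2, s4))"
  have E: "?E permutes {1..l + k + (a + b)}" and F: "?F permutes {1..l + a + (k + b)}"
    by (intro sym_embed_permutes s)+
  have im: "s1 j \<in> {1..l}" if "j \<in> {1..l}" for j using permutes_in_image[OF s(1), of j] that by blast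
  have im2: "s2 j \<in> {1..k}" if "j \<in> {1..k}" for j using permutes_in_image[OF s(2), of j] that by blast
  have im3: "s3 j \<in> {1..a}" if "j \<in> {1..a}" for j using permutes_in_image[OF s(3), of j] that by blast
  have im4: "s4 j \<in> {1..b}" if "j \<in> {1..b}" for j using permutes_in_image[OF s(4), of j] that by blast
  show "(?E \<circ> blk l a k) i = (blk l a k \<circ> ?F) i"
  proof (cases "i \<in> {1..l + a + (k + b)}")
    case True
    then show ?thesis
    proof (rule four_blocks)
      assume i: "i \<in> {1..l}"
      then show ?thesis using im[OF i] by (simp add: sym_embed_def blk_def)
    next
      fix j assume i: "i = j + l" and j: "j \<in> {1..a}"
      then show ?thesis using im3[OF j] by (simp add: sym_embed_def blk_def)
    next
      fix j assume i: "i = j + (l + a)" and j: "j \<in> {1..k}"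
      then show ?thesis using im2[OF j] by (simp add: sym_embed_def blk_def)
    next
      fix j assume i: "i = j + k + (l + a)" and j: "j \<in> {1..b}"
      then show ?thesis using im4[OF j] by (simp add: sym_embed_def blk_def)
    qed
  next
    case False
    have eq: "l + a + (k + b) = l + k + (a + b)" by simp
    have "blk l a k i = i" using permutes_not_in[OF blk_permutes] False unfolding eq by blast
    then show ?thesis using permutes_not_in[OF E, of i] permutes_not_in[OF F, of i] False unfolding eq by simp
  qed
qed

lemma blk_cat:
  "cat (l + k) (a + b) (cat l k f1 f2) (cat a b f3 f4)
    = vsh (l + k + (a + b)) (blk l a k) (cat (l + a) (k + b) (cat l a f1 f3) (cat k b f2 f4))"
proof
  fix i
  show "cat (l + k) (a + b) (cat l k f1 f2) (cat a b f3 f4) i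
    = vsh (l + k + (a + b)) (blk l a k) (cat (l + a) (k + b) (cat l a f1 f3) (cat k b f2 f4)) i"
  proof (cases "i \<in> {1..l + k + (a + b)}")
    case True
    then show ?thesis
    proof (rule four_blocks)
      assume "i \<in> {1..l}"
      then show ?thesis by (simp add: vsh_def inv_blk cat_def blk_def)
    next
      fix j assume "i = j + l" "j \<in> {1..k}"
      then show ?thesis by (simp add: vsh_def inv_blk cat_def blk_def)
    next
      fix j assume "i = j + (l + k)" "j \<in> {1..a}"
      then show ?thesis by (simp add: vsh_def inv_blk cat_def blk_def)
    next
      fix j assume "i = j + a + (l + k)" "j \<in> {1..b}"
      then show ?thesis by (simp add: vsh_def inv_blk cat_def blk_def)
    qed
  qed (auto simp: vsh_def cat_def)
qed

text \<open>Induction products are formed separately in the untwisted and in the sign-twisted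
  component. The two sides arise from inducing from four factors in two stages, grouped once as (l,
  k), (a, b) and once as (l, a), (k, b).\<close>

lemma bc_merge:
  assumes g: "g \<in> carrier (B (l + k + (a + b)))"
  shows "icf (B (l + k + (a + b))) (B (l + k) \<times>\<times> B (a + b)) (B_embed (l + k) (a + b)) (\<lambda>(u, v). bc l k \<phi> \<psi> u * bc a b \<phi>' \<psi>' v) g
    = bc (l + a) (k + b)
        (icf (sym_group (l + a)) (sym_group l \<times>\<times> sym_group a) (sym_embed l) (\<lambda>(s, t). \<phi> s * \<phi>' t))
        (icf (sym_group (k + b)) (sym_group k \<times>\<times> sym_group b) (sym_embed k) (\<lambda>(s, t). \<psi> s * \<psi>' t)) g"
proof -
  let ?n = "l + k + (a + b)"
  have n: "l + a + (k + b) = ?n" by simp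
  let ?c = "\<lambda>k \<phi> \<psi>. \<lambda>(x, y). \<phi> (snd x) * (Dp k eps_F (fst y) * \<psi> (snd y)) :: complex"
  let ?H1 = "(B l \<times>\<times> B k) \<times>\<times> (B a \<times>\<times> B b)" and ?H2 = "(B l \<times>\<times> B a) \<times>\<times> (B k \<times>\<times> B b)"
  let ?e1 = "\<lambda>z. B_embed (l + k) (a + b) ((\<lambda>(p, q). (B_embed l k p, B_embed a b q)) z)"
  let ?e2 = "\<lambda>z. B_embed (l + a) (k + b) ((\<lambda>(p, q). (B_embed l a p, B_embed k b q)) z)"
  let ?d = "\<lambda>p q D \<phi> \<phi>'. \<lambda>(x, y). Dp p D (fst x) * Dp q D (fst y) * (\<lambda>(s, t). \<phi> s * \<phi>' t) (snd x, snd y) :: complex"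
  have in1: "(\<lambda>(p, q). (B_embed l k p, B_embed a b q)) z \<in> carrier (B (l + k) \<times>\<times> B (a + b))" if "z \<in> carrier ?H1" for z
    using that hom_in_carrier[OF B_embed_hom] by fastforce
  have in2: "(\<lambda>(p, q). (B_embed l a p, B_embed k b q)) z \<in> carrier (B (l + a) \<times>\<times> B (k + b))" if "z \<in> carrier ?H2" for z
    using that hom_in_carrier[OF B_embed_hom] by fastforce
  have grp: "group (B p \<times>\<times> B q)" and fin: "finite (carrier (B p \<times>\<times> B q))" for p q
    by (intro DirProd_group group_B finite_DirProd finite_B)+
  have hom2: "B_embed (l + a) (k + b) \<in> hom (B (l + a) \<times>\<times> B (k + b)) (B ?n)"
    unfolding n[symmetric] by (rule B_embed_hom)
  have "(\<lambda>(u, v). bc l k \<phi> \<psi> u * bc a b \<phi>' \<psi>' v)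
    = icf (B (l + k) \<times>\<times> B (a + b)) ?H1 (\<lambda>(p, q). (B_embed l k p, B_embed a b q)) (\<lambda>(p, q). ?c k \<phi> \<psi> p * ?c b \<phi>' \<psi>' q)"
    unfolding bc_def by (rule ext) (simp only: split_paired_all case_prod_conv icf_prod)
  then have "icf (B ?n) (B (l + k) \<times>\<times> B (a + b)) (B_embed (l + k) (a + b)) (\<lambda>(u, v). bc l k \<phi> \<psi> u * bc a b \<phi>' \<psi>' v) g
    = icf (B ?n) (B (l + k) \<times>\<times> B (a + b)) (B_embed (l + k) (a + b))
        (icf (B (l + k) \<times>\<times> B (a + b)) ?H1 (\<lambda>(p, q). (B_embed l k p, B_embed a b q)) (\<lambda>(p, q). ?c k \<phi> \<psi> p * ?c b \<phi>' \<psi>' q)) g"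
    by (simp only:)
  also have "\<dots> = icf (B ?n) ?H1 ?e1 (\<lambda>(p, q). ?c k \<phi> \<psi> p * ?c b \<phi>' \<psi>' q) g"
    by (rule icf_trans[OF group_B grp fin B_embed_hom in1 g])
  \<comment> \<open>Conjugation by the block permutation regroups the factors: the two untwisted
    ones come first, the two twisted ones last.\<close>
  also have "\<dots> = icf (B ?n) ?H2 ?e2 (\<lambda>(p, q). ?d l a (\<lambda>_. 1) \<phi> \<phi>' p * ?d k b eps_F \<psi> \<psi>' q) g"
  proof (rule icf_reindex[where \<theta> = "\<lambda>((x, y), (z, w)). ((x, z), (y, w))" and w = "(vzero ?n, blk l a k)"])
    show "bij_betw (\<lambda>((x, y), (z, w)). ((x, z), (y, w))) (carrier ?H1) (carrier ?H2)"
      by (rule bij_betw_byWitness[where f' = "\<lambda>((x, z), (y, w)). ((x, y), (z, w))"]) auto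
    show "(vzero ?n, blk l a k) \<in> carrier (B ?n)" using blk_permutes by (simp add: carrier_B)
    fix h assume h: "h \<in> carrier ?H1"
    then obtain f1 s1 f2 s2 f3 s3 f4 s4 where heq: "h = (((f1, s1), (f2, s2)), ((f3, s3), (f4, s4)))"
      and f: "f1 \<in> Fv l" "f2 \<in> Fv k" "f3 \<in> Fv a" "f4 \<in> Fv b"
      and s: "s1 permutes {1..l}" "s2 permutes {1..k}" "s3 permutes {1..a}" "s4 permutes {1..b}"
      by (auto simp: carrier_B)
    show "?e1 h \<in> carrier (B ?n)" by (rule hom_in_carrier[OF B_embed_hom in1[OF h]])
    have "(\<lambda>((x, y), (z, w)). ((x, z), (y, w))) h \<in> carrier ?H2" using h heq by simp
    from hom_in_carrier[OF B_embed_hom in2[OF this]]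
    show "?e2 ((\<lambda>((x, y), (z, w)). ((x, z), (y, w))) h) \<in> carrier (B ?n)" unfolding n .
    have p2: "sym_embed (l + a) (sym_embed l (s1, s3), sym_embed k (s2, s4)) permutes {1..?n}"
      unfolding n[symmetric] by (intro sym_embed_permutes s)
    have p1: "sym_embed (l + k) (sym_embed l (s1, s2), sym_embed a (s3, s4)) permutes {1..?n}"
      by (intro sym_embed_permutes s)
    have c2: "cat (l + a) (k + b) (cat l a f1 f3) (cat k b f2 f4) \<in> Fv ?n"
      unfolding n[symmetric] by (intro cat_in f)
    have c1: "cat (l + k) (a + b) (cat l k f1 f2) (cat a b f3 f4) \<in> Fv ?n" by (intro cat_in f)
    show "?e1 h \<otimes>\<^bsub>B ?n\<^esub> (vzero ?n, blk l a k) = (vzero ?n, blk l a k) \<otimes>\<^bsub>B ?n\<^esub> ?e2 ((\<lambda>((x, y), (z, w)). ((x, z), (y, w))) h)"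
      unfolding heq case_prod_conv B_embed_cat mult_B vsh_zero[OF p1] vadd_zero(2)[OF c1]
        vadd_zero(1)[OF vsh_in[OF blk_permutes c2]] blk_cat[of l k a b f1 f2 f3 f4] blk_sym_embed[OF s]
      by (simp only: vadd_zero(2)[OF vsh_in[OF blk_permutes c2]])
    show "(\<lambda>(p, q). ?c k \<phi> \<psi> p * ?c b \<phi>' \<psi>' q) h
      = (\<lambda>(p, q). ?d l a (\<lambda>_. 1) \<phi> \<phi>' p * ?d k b eps_F \<psi> \<psi>' q) ((\<lambda>((x, y), (z, w)). ((x, z), (y, w))) h)"
      unfolding heq by simp
  qed (rule group_B g)+
  also have "\<dots> = icf (B (l + a + (k + b))) (B (l + a) \<times>\<times> B (k + b)) (B_embed (l + a) (k + b))
      (icf (B (l + a) \<times>\<times> B (k + b)) ?H2 (\<lambda>(p, q). (B_embed l a p, B_embed k b q)) (\<lambda>(p, q). ?d l a (\<lambda>_. 1) \<phi> \<phi>' p * ?d k b eps_F \<psi> \<psi>' q)) g"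
    unfolding n by (rule icf_trans[OF group_B grp fin hom2 in2 g, symmetric])
  \<comment> \<open>The inner induction now joins factors with the same twist, so
    \<open>icf_inflation\<close> reduces it to symmetric groups.\<close>
  also have "\<dots> = bc (l + a) (k + b)
        (icf (sym_group (l + a)) (sym_group l \<times>\<times> sym_group a) (sym_embed l) (\<lambda>(s, t). \<phi> s * \<phi>' t))
        (icf (sym_group (k + b)) (sym_group k \<times>\<times> sym_group b) (sym_embed k) (\<lambda>(s, t). \<psi> s * \<psi>' t)) g"
    unfolding bc_def
  proof (rule icf_cong)
    fix h assume "h \<in> carrier (B (l + a) \<times>\<times> B (k + b))"
    then obtain f s f' s' where h: "h = ((f, s), (f', s'))" "(f, s) \<in> carrier (B (l + a))" "(f', s') \<in> carrier (B (k + b))"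
      by auto
    show "icf (B (l + a) \<times>\<times> B (k + b)) ?H2 (\<lambda>(p, q). (B_embed l a p, B_embed k b q))
        (\<lambda>(p, q). ?d l a (\<lambda>_. 1) \<phi> \<phi>' p * ?d k b eps_F \<psi> \<psi>' q) h
      = ?c (k + b) (icf (sym_group (l + a)) (sym_group l \<times>\<times> sym_group a) (sym_embed l) (\<lambda>(s, t). \<phi> s * \<phi>' t))
        (icf (sym_group (k + b)) (sym_group k \<times>\<times> sym_group b) (sym_embed k) (\<lambda>(s, t). \<psi> s * \<psi>' t)) h"
      unfolding h(1) icf_prod icf_inflation[OF F2_char_triv h(2)] icf_inflation[OF F2_char_eps h(3)]
      by simp
  qed
  finally show ?thesis .
qed

text \<open>A polytabloid that is an eigenvector of every permutation spans the module, because all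
  other polytabloids are its translates.\<close>

lemma chr_Specht_one_dim:
  assumes lam: "lam \<turnstile> m" and t: "t \<in> tableaux lam" and \<sigma>: "\<sigma> permutes {1..m}"
    and c: "\<And>\<sigma>. \<sigma> permutes {1..m} \<Longrightarrow> pact \<sigma> (polytabloid t) = cscale (c \<sigma>) (polytabloid t)"
  shows "chr (Specht lam) \<sigma> = c \<sigma>"
proof -
  have m: "sum_list lam = m" using lam by (simp add: is_partition_def)
  let ?e = "polytabloid t" and ?V = "space (Specht lam)"
  have "?e (tb t) = 1" using polytabloid_value[OF lam t column_stabilizer_group(1)[OF lam t]] by simp
  then have e0: "?e \<noteq> 0" by auto
  have sp: "?V = cfun.span {?e}"
  proof
    have "polytabloid s \<in> cfun.span {?e}" if s: "s \<in> tableaux lam" for s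
    proof -
      obtain \<tau> where \<tau>: "\<tau> permutes {1..m}" "s = map (map \<tau>) t"
        by (rule tableaux_transitive[OF lam t s]) (rule that; assumption)
      then have "polytabloid s = cscale (c \<tau>) ?e"
        using pact_polytabloid[OF t, of \<tau>] c[OF \<tau>(1)] m by simp
      then show ?thesis by (simp add: cfun.span_scale cfun.span_base)
    qed
    then show "?V \<subseteq> cfun.span {?e}"
      unfolding space_Specht by (intro cfun.span_minimal) auto
    show "cfun.span {?e} \<subseteq> ?V"
      using polytabloid_in[OF t] by (intro cfun.span_minimal fds_subspace[OF fds_Specht]) auto
  qed
  have "cfun.independent {?e}" using e0 cfun.dependent_single by blast
  then have "card {?e} = cfun.dim ?V" using sp by (intro cfun.basis_card_eq_dim) (auto intro: cfun.span_base)
  moreover have "card (bas ?V) = cfun.dim ?V"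
    using bas[OF fds_Specht] by (intro cfun.basis_card_eq_dim) (auto intro: bas_in[OF fds_Specht])
  ultimately have card: "card (bas ?V) = 1" by simp
  have "act (Specht lam) \<sigma> v = cscale (c \<sigma>) v" if v: "v \<in> ?V" for v
  proof -
    obtain a where a: "v = cscale a ?e" using v unfolding sp cfun.span_singleton by blast
    have "pact \<sigma> (cscale a ?e) = cscale a (pact \<sigma> ?e)" by (simp add: cscale_def)
    then show ?thesis unfolding act_Specht a by (simp only: c[OF \<sigma>] cscale_cscale mult.commute)
  qed
  then have "chr (Specht lam) \<sigma> = tr ?V (\<lambda>v. cscale (c \<sigma>) v)"
    unfolding chr_def by (intro tr_cong[OF fds_Specht])
  also have "\<dots> = c \<sigma>"
    using tr_scale[OF fds_Specht lin_id[OF subset_refl], where c = "c \<sigma>"] tr_id[OF fds_Specht, of lam] card by simp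
  finally show ?thesis .
qed

lemma chr_Specht_row:
  assumes lam: "lam \<turnstile> m" and len: "length lam \<le> 1" and \<sigma>: "\<sigma> permutes {1..m}"
  shows "chr (Specht lam) \<sigma> = 1"
proof -
  have m: "sum_list lam = m" using lam by (simp add: is_partition_def)
  obtain t where t: "t \<in> tableaux lam" using tableaux_nonempty by blast
  have r: "rw t x = 0" if "x \<in> {1..m}" for x using pos(1)[OF t, of x] that len m by auto
  have C: "column_stabilizer t = {id}"
  proof
    show "column_stabilizer t \<subseteq> {id}"
    proof
      fix \<pi> assume p: "\<pi> \<in> column_stabilizer t"
      have pp: "\<pi> permutes {1..m}" by (rule column_stabilizer_group(3)[OF lam t p])
      have "\<pi> x = x" for x
      proof (cases "x \<in> {1..m}")
        case True
        have px: "\<pi> x \<in> {1..m}" using True permutes_in_image[OF pp] by blast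
        have "cl t (\<pi> x) = cl t x" using p True unfolding column_stabilizer_iff[OF lam t] by blast
        then show ?thesis using pos_eqD[OF t, of "\<pi> x" x] r[OF px] r[OF True] px True m by simp
      qed (use permutes_not_in[OF pp] in blast)
      then show "\<pi> \<in> {id}" by auto
    qed
    show "{id} \<subseteq> column_stabilizer t" using column_stabilizer_group(1)[OF lam t] by simp
  qed
  have P: "polytabloid t T = (if T = tb t then 1 else 0)" for T
    unfolding polytabloid_def C by simp
  show ?thesis
  proof (rule chr_Specht_one_dim[OF lam t \<sigma>, where c = "\<lambda>_. 1"])
    fix \<tau> assume \<tau>: "\<tau> permutes {1..m}"
    have fixed: "pm \<tau> (tb t) = tb t"
    proof (rule nth_equalityI)
      fix i assume "i < length (pm \<tau> (tb t))"
      then have i: "i < length lam" using tableaux_rows(1)[OF t] by simp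
      have "tb t ! i = {1..m}" unfolding tb_nth[OF lam t i] using r i len by auto
      then show "pm \<tau> (tb t) ! i = tb t ! i"
        using i tableaux_rows(1)[OF t] permutes_image[OF \<tau>] by (simp add: nth_map del: atLeastAtMost_iff)
    qed simp
    have "pm (inv' \<tau>) T = tb t \<longleftrightarrow> T = tb t" for T
      using pm_inv[OF permutes_bij[OF \<tau>]] fixed by metis
    then show "pact \<tau> (polytabloid t) = cscale 1 (polytabloid t)" unfolding P by (simp add: P fun_eq_iff)
  qed
qed

text \<open>The column stabilizer is the whole group, and the polytabloid is antisymmetric under
  it.\<close>

lemma chr_Specht_column:
  assumes \<sigma>: "\<sigma> permutes {1..2}" shows "chr (Specht [1, 1]) \<sigma> = sign_char \<sigma>"
proof -
  have lam: "[1, 1] \<turnstile> 2" by (simp add: is_partition_def)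
  obtain t where t: "t \<in> tableaux [1, 1]" using tableaux_nonempty by blast
  note cs = column_stabilizer_group[OF lam t]
  have c: "cl t x = 0" if "x \<in> {1..2}" for x
  proof -
    have "x \<in> {1..sum_list [1, 1]}" using that by simp
    from pos(1,2)[OF t this] show ?thesis by (cases "rw t x") auto
  qed
  have all: "\<tau> \<in> column_stabilizer t" if \<tau>: "\<tau> permutes {1..2}" for \<tau>
    unfolding column_stabilizer_iff[OF lam t] using c permutes_in_image[OF \<tau>] \<tau> by metis
  show ?thesis
  proof (rule chr_Specht_one_dim[OF lam t \<sigma>])
    fix \<tau> :: "nat \<Rightarrow> nat" assume "\<tau> permutes {1..2}"
    from cs(5)[OF all[OF this]] have p: "inv' \<tau> \<in> column_stabilizer t" .
    have s: "sign (inv' \<tau>) = sign \<tau>" using permutation_if[OF \<open>\<tau> permutes {1..2}\<close>] by (rule sign_inverse)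
    \<comment> \<open>The polytabloid is its own antisymmetrization up to the nonzero factor
      \<open>?N\<close>, so the sign rule for \<open>ksum\<close> passes to it.\<close>
    let ?N = "of_nat (card (column_stabilizer t)) :: complex"
    have N: "?N \<noteq> 0" using cs(1,2) by auto
    have "?N * polytabloid t (pm (inv' \<tau>) T) = ?N * (of_int (sign \<tau>) * polytabloid t T)" for T
      using ksum_translate[OF lam t p, of "polytabloid t" T] unfolding ksum_polytabloid[OF lam t] cscale_def s
      by (simp add: mult.left_commute)
    then have "polytabloid t (pm (inv' \<tau>) T) = of_int (sign \<tau>) * polytabloid t T" for T
      using N by (metis mult_left_cancel)
    then show "pact \<tau> (polytabloid t) = cscale (sign_char \<tau>) (polytabloid t)"
      by (simp only: cscale_def sign_char_def fun_eq_iff) blast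
  qed
qed

lemma
  assumes l: "sum_list lam = l" and k: "sum_list mu = k" and n: "l + k = n"
  shows representation_BSpecht: "representation (B n) (BSpecht lam mu)"
    and chr_BSpecht: "g \<in> carrier (B n) \<Longrightarrow> chr (BSpecht lam mu) g = bc l k (chr (Specht lam)) (chr (Specht mu)) g"
proof -
  let ?X = "twisted l (\<lambda>_. 1) (Specht lam)" and ?Y = "twisted k eps_F (Specht mu)"
  note X = representation_twisted[OF representation_Specht[OF l] F2_char_triv]
    and Y = representation_twisted[OF representation_Specht[OF k] F2_char_eps]
  interpret t: tensor_data "B l" "B k" ?X ?Y using X Y by unfold_locales
  interpret i: induction_data "B (l + k)" "B l \<times>\<times> B k" "B_embed l k" "?X \<boxtimes> ?Y"
    unfolding induction_data_def induction_data_axioms_def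
    using group_B DirProd_group[OF group_B group_B] finite_B finite_DirProd[OF finite_B finite_B]
      B_embed_hom t.representation_tensor by blast
  have eq: "BSpecht lam mu = ind (B (l + k)) (B l \<times>\<times> B k) (B_embed l k) (?X \<boxtimes> ?Y)"
    by (simp add: BSpecht_def Let_def l k)
  show "representation (B n) (BSpecht lam mu)" unfolding eq n[symmetric] by (rule i.representation_ind)
  assume "g \<in> carrier (B n)"
  then have "chr (BSpecht lam mu) g = icf (B (l + k)) (B l \<times>\<times> B k) (B_embed l k) (chr (?X \<boxtimes> ?Y)) g"
    unfolding eq n[symmetric] by (rule i.chr_ind)
  also have "\<dots> = bc l k (chr (Specht lam)) (chr (Specht mu)) g"
    unfolding bc_def
  proof (rule icf_cong)
    fix h assume "h \<in> carrier (B l \<times>\<times> B k)"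
    then obtain f s f' s' where h: "h = ((f, s), (f', s'))" "(f, s) \<in> carrier (B l)" "(f', s') \<in> carrier (B k)" by auto
    show "chr (?X \<boxtimes> ?Y) h = (\<lambda>(x, y). chr (Specht lam) (snd x) * (Dp k eps_F (fst y) * chr (Specht mu) (snd y))) h"
      unfolding h(1) t.chr_tensor[OF h(2,3)] chr_twisted[OF representation_Specht[OF l] F2_char_triv h(2)]
        chr_twisted[OF representation_Specht[OF k] F2_char_eps h(3)] by simp
  qed
  finally show "chr (BSpecht lam mu) g = bc l k (chr (Specht lam)) (chr (Specht mu)) g" .
qed

lemma carrier_S2bar_eq: "carrier S2bar = {vzero 2} \<times> {p. p permutes {1..2}}"
  by (simp add: S2bar_def vzero_def sym_group_def)

lemma S2bar_sub: "h \<in> carrier S2bar \<Longrightarrow> h \<in> carrier (B 2)"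
  by (auto simp: carrier_S2bar_eq carrier_B)

lemma mult_S2bar: "x \<otimes>\<^bsub>S2bar\<^esub> y = x \<otimes>\<^bsub>B 2\<^esub> y"
  by (simp add: S2bar_def)

lemma finite_S2bar: "finite (carrier S2bar)"
  unfolding carrier_S2bar_eq by (simp add: finite_permutations)

text \<open>A linear character \<psi> and a partition \<alpha> of 2 affording it are kept general,
  which treats the trivial and the sign case at once.\<close>

lemma ind_S2bar:
  assumes W: "representation S2bar W" and \<psi>: "representation (sym_group 2) (char_rep \<psi>)"
    and chrW: "\<And>h. h \<in> carrier S2bar \<Longrightarrow> chr W h = \<psi> (snd h)"
    and alpha: "sum_list \<alpha> = 2" "\<And>\<sigma>. \<sigma> permutes {1..2} \<Longrightarrow> chr (Specht \<alpha>) \<sigma> = \<psi> \<sigma>"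
  shows "rep_iso (B 2) (ind (B 2) S2bar id W) (BSpecht \<alpha> [] \<oplus>\<^sub>r BSpecht [] \<alpha> \<oplus>\<^sub>r BSpecht [1] [1])"
proof -
  interpret i: induction_data "B 2" S2bar id W
    unfolding induction_data_def induction_data_axioms_def
    using group_B rep_group[OF W] finite_B finite_S2bar W S2bar_sub
    by (auto simp: hom_def mult_S2bar)
  have p0: "[] \<turnstile> 0" and p1: "[1] \<turnstile> 1" by (simp_all add: is_partition_def)
  have r1: "representation (B 2) (BSpecht \<alpha> [])" and r2: "representation (B 2) (BSpecht [] \<alpha>)"
    and r3: "representation (B 2) (BSpecht [1] [1])"
    by (intro representation_BSpecht[OF alpha(1), where k = 0] representation_BSpecht[where l = 0 and k = 2]
        representation_BSpecht[where l = 1 and k = 1] alpha(1); simp)+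
  have e: "chr (Specht []) \<sigma> = 1" if "\<sigma> permutes {1..0}" for \<sigma>
    using chr_Specht_row[OF p0 _ that] by simp
  have o: "chr (Specht [1]) \<sigma> = 1" if "\<sigma> permutes {1..1}" for \<sigma>
    using chr_Specht_row[OF p1 _ that] by simp
  show ?thesis
  proof (rule chr_eq_imp_rep_iso[OF i.representation_ind _ finite_B])
    show "representation (B 2) (BSpecht \<alpha> [] \<oplus>\<^sub>r BSpecht [] \<alpha> \<oplus>\<^sub>r BSpecht [1] [1])"
      by (intro representation_plus r1 r2 r3)
    fix g assume g: "g \<in> carrier (B 2)"
    have "chr (ind (B 2) S2bar id W) g = icf (B 2) S2bar id (\<lambda>h. \<psi> (snd h)) g"
      unfolding i.chr_ind[OF g] by (rule icf_cong) (rule chrW)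
    also have "\<dots> = bc 2 0 \<psi> (\<lambda>_. 1) g + bc 0 2 (\<lambda>_. 1) \<psi> g + bc 1 1 (\<lambda>_. 1) (\<lambda>_. 1) g"
      by (rule S2bar_induction[OF \<psi> g])
    also have "bc 2 0 \<psi> (\<lambda>_. 1) g = chr (BSpecht \<alpha> []) g"
      using chr_BSpecht[OF alpha(1), of "[]" 0 2 g] g bc_cong[of 2 "chr (Specht \<alpha>)" \<psi> 0 "chr (Specht [])" "\<lambda>_. 1" g] alpha(2) e by simp
    also have "bc 0 2 (\<lambda>_. 1) \<psi> g = chr (BSpecht [] \<alpha>) g"
      using chr_BSpecht[OF _ alpha(1), of "[]" 0 2 g] g bc_cong[of 0 "chr (Specht [])" "\<lambda>_. 1" 2 "chr (Specht \<alpha>)" \<psi> g] alpha(2) e by simp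
    also have "bc 1 1 (\<lambda>_. 1) (\<lambda>_. 1) g = chr (BSpecht [1] [1]) g"
    proof -
      have "chr (BSpecht [1] [1]) g = bc 1 1 (chr (Specht [1])) (chr (Specht [1])) g"
        by (rule chr_BSpecht[where n = 2]) (use g in simp_all)
      also have "\<dots> = bc 1 1 (\<lambda>_. 1) (\<lambda>_. 1) g" by (rule bc_cong; rule o)
      finally show ?thesis ..
    qed
    finally show "chr (ind (B 2) S2bar id W) g = chr (BSpecht \<alpha> [] \<oplus>\<^sub>r BSpecht [] \<alpha> \<oplus>\<^sub>r BSpecht [1] [1]) g"
      unfolding chr_plus[OF r1 representation_plus[OF r2 r3] g] chr_plus[OF r2 r3 g] by (simp only: add.assoc)
  qed
qed

text \<open>The decomposition over \<open>B 2\<close> is inserted as the class function identity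
  \<open>S2bar_induction\<close>, and each of its three terms is combined with the given pair of
  partitions by \<open>bc_merge\<close>.\<close>

lemma ind_BSpecht_S2bar:
  assumes lam: "lam \<turnstile> l" and mu: "mu \<turnstile> k" and n: "n = l + k + 2"
    and W: "representation S2bar W" and \<psi>: "representation (sym_group 2) (char_rep \<psi>)"
    and chrW: "\<And>h. h \<in> carrier S2bar \<Longrightarrow> chr W h = \<psi> (snd h)"
  shows "rep_iso (B n) (ind (B n) (B (l + k) \<times>\<times> S2bar) (B_embed (l + k) 2) (BSpecht lam mu \<boxtimes> W))
    ((\<Oplus>\<^sub>r \<tau>\<in>sym_ind_parts 2 (char_rep \<psi>) lam. BSpecht \<tau> mu) \<oplus>\<^sub>r
     (\<Oplus>\<^sub>r \<rho>\<in>sym_ind_parts 2 (char_rep \<psi>) mu. BSpecht lam \<rho>) \<oplus>\<^sub>r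
     (\<Oplus>\<^sub>r (\<tau>, \<rho>)\<in>bar lam \<times> bar mu. BSpecht \<tau> \<rho>))" (is "rep_iso _ ?L (?R1 \<oplus>\<^sub>r ?R2 \<oplus>\<^sub>r ?R3)")
proof -
  have sl: "sum_list lam = l" and sk: "sum_list mu = k" using lam mu by (simp_all add: is_partition_def)
  note BS = representation_BSpecht[OF sl sk refl]
  note RL = representation_Specht[OF sl] and RM = representation_Specht[OF sk]
  have triv1: "representation (sym_group 1) triv_rep"
    by (rule representation_char_rep[OF sym_group_is_group]) simp_all
  interpret b1: branching l 2 lam \<psi> using lam \<psi> by unfold_locales simp_all
  interpret b2: branching k 2 mu \<psi> using mu \<psi> by unfold_locales simp_all
  interpret b3: branching l 1 lam "\<lambda>_. 1" using lam triv1 by unfold_locales simp_all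
  interpret b4: branching k 1 mu "\<lambda>_. 1" using mu triv1 by unfold_locales simp_all
  interpret t: tensor_data "B (l + k)" S2bar "BSpecht lam mu" W using BS W by unfold_locales
  have homS: "B_embed (l + k) 2 \<in> hom (B (l + k) \<times>\<times> S2bar) (B (l + k + 2))"
  proof (rule homI)
    fix x y assume xy: "x \<in> carrier (B (l + k) \<times>\<times> S2bar)" "y \<in> carrier (B (l + k) \<times>\<times> S2bar)"
    then have x': "x \<in> carrier (B (l + k) \<times>\<times> B 2)" and y': "y \<in> carrier (B (l + k) \<times>\<times> B 2)" using S2bar_sub by auto
    show "B_embed (l + k) 2 x \<in> carrier (B (l + k + 2))" by (rule hom_in_carrier[OF B_embed_hom x'])
    have "x \<otimes>\<^bsub>B (l + k) \<times>\<times> S2bar\<^esub> y = x \<otimes>\<^bsub>B (l + k) \<times>\<times> B 2\<^esub> y"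
      by (cases x; cases y) (simp add: mult_S2bar)
    then show "B_embed (l + k) 2 (x \<otimes>\<^bsub>B (l + k) \<times>\<times> S2bar\<^esub> y) = B_embed (l + k) 2 x \<otimes>\<^bsub>B (l + k + 2)\<^esub> B_embed (l + k) 2 y"
      using hom_mult[OF B_embed_hom x' y'] by simp
  qed
  interpret i: induction_data "B (l + k + 2)" "B (l + k) \<times>\<times> S2bar" "B_embed (l + k) 2" "BSpecht lam mu \<boxtimes> W"
    unfolding induction_data_def induction_data_axioms_def
    using group_B DirProd_group[OF group_B rep_group[OF W]] finite_B finite_DirProd[OF finite_B finite_S2bar]
      homS t.representation_tensor by blast
  let ?P = "sym_ind_parts 2 (char_rep \<psi>)"
  have bar3: "bar lam = sym_ind_parts 1 triv_rep lam" and bar4: "bar mu = sym_ind_parts 1 triv_rep mu"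
    by (simp_all add: bar_def)
  have finB: "finite (bar lam \<times> bar mu)" unfolding bar3 bar4 using b3.finite_parts b4.finite_parts by blast
  have s1: "sum_list \<tau> = l + 2" if "\<tau> \<in> ?P lam" for \<tau> using b1.parts_partition[OF that] by (simp add: is_partition_def)
  have s2: "sum_list \<tau> = k + 2" if "\<tau> \<in> ?P mu" for \<tau> using b2.parts_partition[OF that] by (simp add: is_partition_def)
  have s3: "sum_list \<tau> = l + 1" if "\<tau> \<in> bar lam" for \<tau> using b3.parts_partition that unfolding bar3 by (simp add: is_partition_def)
  have s4: "sum_list \<tau> = k + 1" if "\<tau> \<in> bar mu" for \<tau> using b4.parts_partition that unfolding bar4 by (simp add: is_partition_def)
  have r1: "representation (B n) (BSpecht \<tau> mu)" if "\<tau> \<in> ?P lam" for \<tau>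
    by (rule representation_BSpecht[OF s1[OF that] sk]) (simp add: n)
  have r2: "representation (B n) (BSpecht lam \<rho>)" if "\<rho> \<in> ?P mu" for \<rho>
    by (rule representation_BSpecht[OF sl s2[OF that]]) (simp add: n)
  have r3: "representation (B n) (BSpecht (fst x) (snd x))" if "x \<in> bar lam \<times> bar mu" for x
    by (rule representation_BSpecht[OF s3 s4, of "fst x" "snd x"]) (use that n in auto)
  have R3: "?R3 = rep_Sum (bar lam \<times> bar mu) (\<lambda>x. BSpecht (fst x) (snd x))" by (simp add: case_prod_unfold)
  have RR: "representation (B n) ?R1" "representation (B n) ?R2" "representation (B n) ?R3"
    unfolding R3 using representation_Sum[OF b1.finite_parts group_B r1] representation_Sum[OF b2.finite_parts group_B r2]
      representation_Sum[OF finB group_B r3] by auto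
  let ?lam = "chr (Specht lam)" and ?mu = "chr (Specht mu)"
  let ?J = "icf (B n) (B (l + k) \<times>\<times> B 2) (B_embed (l + k) 2)"
  show ?thesis
  proof (rule chr_eq_imp_rep_iso[OF _ _ finite_B])
    show "representation (B n) ?L" unfolding n by (rule i.representation_ind)
    show "representation (B n) (?R1 \<oplus>\<^sub>r ?R2 \<oplus>\<^sub>r ?R3)" by (intro representation_plus RR)
    fix g assume g: "g \<in> carrier (B n)"
    have g': "g \<in> carrier (B (l + k + 2))" using g n by simp
    have "chr ?L g = icf (B n) (B (l + k) \<times>\<times> S2bar) (B_embed (l + k) 2) (chr (BSpecht lam mu \<boxtimes> W)) g"
      unfolding n by (rule i.chr_ind[OF g'])
    also have "\<dots> = icf (B n) (B (l + k) \<times>\<times> S2bar) (B_embed (l + k) 2) (\<lambda>(u, w). bc l k ?lam ?mu u * \<psi> (snd w)) g"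
    proof (rule icf_cong)
      fix h assume "h \<in> carrier (B (l + k) \<times>\<times> S2bar)"
      then obtain u w where h: "h = (u, w)" "u \<in> carrier (B (l + k))" "w \<in> carrier S2bar" by auto
      show "chr (BSpecht lam mu \<boxtimes> W) h = (\<lambda>(u, w). bc l k ?lam ?mu u * \<psi> (snd w)) h"
        unfolding h(1) t.chr_tensor[OF h(2,3)] chr_BSpecht[OF sl sk refl h(2)] chrW[OF h(3)] by simp
    qed
    \<comment> \<open>Induction in stages through the product of \<open>B (l + k)\<close> and
      \<open>B 2\<close>, with the identity on the first factor.\<close>
    also have "\<dots> = ?J (icf (B (l + k) \<times>\<times> B 2) (B (l + k) \<times>\<times> S2bar) (\<lambda>(a, b). (id a, id b)) (\<lambda>(u, w). bc l k ?lam ?mu u * \<psi> (snd w))) g"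
    proof -
      have "(\<lambda>h. B_embed (l + k) 2 ((\<lambda>(a, b). (id a, id b)) h)) = B_embed (l + k) 2" by (rule ext) (simp add: case_prod_unfold)
      moreover have "?J (icf (B (l + k) \<times>\<times> B 2) (B (l + k) \<times>\<times> S2bar) (\<lambda>(a, b). (id a, id b)) (\<lambda>(u, w). bc l k ?lam ?mu u * \<psi> (snd w))) g
        = icf (B n) (B (l + k) \<times>\<times> S2bar) (\<lambda>h. B_embed (l + k) 2 ((\<lambda>(a, b). (id a, id b)) h)) (\<lambda>(u, w). bc l k ?lam ?mu u * \<psi> (snd w)) g"
        unfolding n
        by (rule icf_trans[OF group_B DirProd_group[OF group_B group_B] finite_DirProd[OF finite_B finite_B] B_embed_hom _ g'])
           (auto simp: S2bar_sub)
      ultimately show ?thesis by (simp only:)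
    qed
    also have "\<dots> = ?J (\<lambda>h. ((\<lambda>(u, v). bc l k ?lam ?mu u * bc 2 0 \<psi> (\<lambda>_. 1) v) h
        + (\<lambda>(u, v). bc l k ?lam ?mu u * bc 0 2 (\<lambda>_. 1) \<psi> v) h) + (\<lambda>(u, v). bc l k ?lam ?mu u * bc 1 1 (\<lambda>_. 1) (\<lambda>_. 1) v) h) g"
    proof (rule icf_cong)
      fix h assume "h \<in> carrier (B (l + k) \<times>\<times> B 2)"
      then obtain u v where h: "h = (u, v)" "u \<in> carrier (B (l + k))" "v \<in> carrier (B 2)" by auto
      \<comment> \<open>Inducing a character from a group to itself returns it, so only the factor
        over \<open>S2bar\<close> changes.\<close>
      have "icf (B (l + k)) (B (l + k)) id (bc l k ?lam ?mu) u = chr (BSpecht lam mu) u"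
        by (rule icf_iso[OF group_B finite_B bij_betw_id h(2)])
           (auto simp: chr_BSpecht[OF sl sk refl] intro: chr_conj[OF BS h(2)])
      then have "icf (B (l + k)) (B (l + k)) id (bc l k ?lam ?mu) u = bc l k ?lam ?mu u"
        unfolding chr_BSpecht[OF sl sk refl h(2)] .
      then show "icf (B (l + k) \<times>\<times> B 2) (B (l + k) \<times>\<times> S2bar) (\<lambda>(a, b). (id a, id b)) (\<lambda>(u, w). bc l k ?lam ?mu u * \<psi> (snd w)) h
        = ((\<lambda>(u, v). bc l k ?lam ?mu u * bc 2 0 \<psi> (\<lambda>_. 1) v) h
        + (\<lambda>(u, v). bc l k ?lam ?mu u * bc 0 2 (\<lambda>_. 1) \<psi> v) h) + (\<lambda>(u, v). bc l k ?lam ?mu u * bc 1 1 (\<lambda>_. 1) (\<lambda>_. 1) v) h"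
        unfolding h(1) icf_prod S2bar_induction[OF \<psi> h(3)] by (simp only: case_prod_conv distrib_left)
    qed
    also have "\<dots> = ?J (\<lambda>(u, v). bc l k ?lam ?mu u * bc 2 0 \<psi> (\<lambda>_. 1) v) g
        + ?J (\<lambda>(u, v). bc l k ?lam ?mu u * bc 0 2 (\<lambda>_. 1) \<psi> v) g
        + ?J (\<lambda>(u, v). bc l k ?lam ?mu u * bc 1 1 (\<lambda>_. 1) (\<lambda>_. 1) v) g"
      by (simp only: icf_add)
    \<comment> \<open>Blocks of sizes 2 and 0: both new coordinates join the untwisted
      component.\<close>
    also have "?J (\<lambda>(u, v). bc l k ?lam ?mu u * bc 2 0 \<psi> (\<lambda>_. 1) v) g = chr ?R1 g"
    proof -
      have "?J (\<lambda>(u, v). bc l k ?lam ?mu u * bc 2 0 \<psi> (\<lambda>_. 1) v) g = bc (l + 2) k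
        (icf (sym_group (l + 2)) (sym_group l \<times>\<times> sym_group 2) (sym_embed l) (\<lambda>(s, t). ?lam s * \<psi> t))
        (icf (sym_group k) (sym_group k \<times>\<times> sym_group 0) (sym_embed k) (\<lambda>(s, t). ?mu s * 1)) g"
        using bc_merge[of g l k 2 0 ?lam ?mu \<psi> "\<lambda>_. 1"] g' unfolding n add_0_right by blast
      also have "\<dots> = bc (l + 2) k (\<lambda>\<sigma>. \<Sum>\<tau>\<in>?P lam. chr (Specht \<tau>) \<sigma>) ?mu g"
      proof (rule bc_cong)
        show "icf (sym_group (l + 2)) (sym_group l \<times>\<times> sym_group 2) (sym_embed l) (\<lambda>(s, t). ?lam s * \<psi> t) \<sigma>
          = (\<Sum>\<tau>\<in>?P lam. chr (Specht \<tau>) \<sigma>)" if "\<sigma> permutes {1..l + 2}" for \<sigma>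
          by (rule b1.icf_Specht) (simp only: sym_group_carrier that)
        show "icf (sym_group k) (sym_group k \<times>\<times> sym_group 0) (sym_embed k) (\<lambda>(s, t). ?mu s * 1) \<sigma> = ?mu \<sigma>"
          if "\<sigma> permutes {1..k}" for \<sigma> by (rule icf_sym_right_zero[OF RM that])
      qed
      also have "\<dots> = (\<Sum>\<tau>\<in>?P lam. chr (BSpecht \<tau> mu) g)"
        unfolding bc_sum_left using g by (intro sum.cong refl chr_BSpecht[symmetric] s1 sk) (simp_all add: n)
      also have "\<dots> = chr ?R1 g" by (rule chr_Sum[OF b1.finite_parts group_B r1 g, symmetric])
      finally show ?thesis .
    qed
    \<comment> \<open>Blocks of sizes 0 and 2: both new coordinates join the sign-twisted
      component.\<close>
    also have "?J (\<lambda>(u, v). bc l k ?lam ?mu u * bc 0 2 (\<lambda>_. 1) \<psi> v) g = chr ?R2 g"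
    proof -
      have "?J (\<lambda>(u, v). bc l k ?lam ?mu u * bc 0 2 (\<lambda>_. 1) \<psi> v) g = bc l (k + 2)
        (icf (sym_group l) (sym_group l \<times>\<times> sym_group 0) (sym_embed l) (\<lambda>(s, t). ?lam s * 1))
        (icf (sym_group (k + 2)) (sym_group k \<times>\<times> sym_group 2) (sym_embed k) (\<lambda>(s, t). ?mu s * \<psi> t)) g"
        using bc_merge[of g l k 0 2 ?lam ?mu "\<lambda>_. 1" \<psi>] g' unfolding n add_0_right add_0_left by blast
      also have "\<dots> = bc l (k + 2) ?lam (\<lambda>\<sigma>. \<Sum>\<rho>\<in>?P mu. chr (Specht \<rho>) \<sigma>) g"
      proof (rule bc_cong)
        show "icf (sym_group (k + 2)) (sym_group k \<times>\<times> sym_group 2) (sym_embed k) (\<lambda>(s, t). ?mu s * \<psi> t) \<sigma>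
          = (\<Sum>\<rho>\<in>?P mu. chr (Specht \<rho>) \<sigma>)" if "\<sigma> permutes {1..k + 2}" for \<sigma>
          by (rule b2.icf_Specht) (simp only: sym_group_carrier that)
        show "icf (sym_group l) (sym_group l \<times>\<times> sym_group 0) (sym_embed l) (\<lambda>(s, t). ?lam s * 1) \<sigma> = ?lam \<sigma>"
          if "\<sigma> permutes {1..l}" for \<sigma> by (rule icf_sym_right_zero[OF RL that])
      qed
      also have "\<dots> = (\<Sum>\<rho>\<in>?P mu. chr (BSpecht lam \<rho>) g)"
        unfolding bc_sum_right using g by (intro sum.cong refl chr_BSpecht[symmetric] s2 sl) (simp_all add: n)
      also have "\<dots> = chr ?R2 g" by (rule chr_Sum[OF b2.finite_parts group_B r2 g, symmetric])
      finally show ?thesis .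
    qed
    \<comment> \<open>One new coordinate joins each component. The character \<psi> no longer
      appears, which is why this term is the same in both cases of the claim.\<close>
    also have "?J (\<lambda>(u, v). bc l k ?lam ?mu u * bc 1 1 (\<lambda>_. 1) (\<lambda>_. 1) v) g = chr ?R3 g"
    proof -
      have "?J (\<lambda>(u, v). bc l k ?lam ?mu u * bc 1 1 (\<lambda>_. 1) (\<lambda>_. 1) v) g = bc (l + 1) (k + 1)
        (icf (sym_group (l + 1)) (sym_group l \<times>\<times> sym_group 1) (sym_embed l) (\<lambda>(s, t). ?lam s * 1))
        (icf (sym_group (k + 1)) (sym_group k \<times>\<times> sym_group 1) (sym_embed k) (\<lambda>(s, t). ?mu s * 1)) g"
        using bc_merge[of g l k 1 1 ?lam ?mu "\<lambda>_. 1" "\<lambda>_. 1"] g' unfolding n one_add_one by blast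
      also have "\<dots> = bc (l + 1) (k + 1) (\<lambda>\<sigma>. \<Sum>\<tau>\<in>bar lam. chr (Specht \<tau>) \<sigma>) (\<lambda>\<sigma>. \<Sum>\<rho>\<in>bar mu. chr (Specht \<rho>) \<sigma>) g"
      proof (rule bc_cong)
        show "icf (sym_group (l + 1)) (sym_group l \<times>\<times> sym_group 1) (sym_embed l) (\<lambda>(s, t). ?lam s * 1) \<sigma>
          = (\<Sum>\<tau>\<in>bar lam. chr (Specht \<tau>) \<sigma>)" if "\<sigma> permutes {1..l + 1}" for \<sigma>
          unfolding bar3 by (rule b3.icf_Specht) (simp only: sym_group_carrier that)
        show "icf (sym_group (k + 1)) (sym_group k \<times>\<times> sym_group 1) (sym_embed k) (\<lambda>(s, t). ?mu s * 1) \<sigma>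
          = (\<Sum>\<rho>\<in>bar mu. chr (Specht \<rho>) \<sigma>)" if "\<sigma> permutes {1..k + 1}" for \<sigma>
          unfolding bar4 by (rule b4.icf_Specht) (simp only: sym_group_carrier that)
      qed
      also have "\<dots> = (\<Sum>\<tau>\<in>bar lam. \<Sum>\<rho>\<in>bar mu. chr (BSpecht \<tau> \<rho>) g)"
        unfolding bc_sum_left bc_sum_right
        using g by (intro sum.cong refl chr_BSpecht[symmetric] s3 s4) (simp_all add: n)
      also have "\<dots> = (\<Sum>x\<in>bar lam \<times> bar mu. chr (BSpecht (fst x) (snd x)) g)"
        by (simp add: sum.cartesian_product case_prod_unfold)
      also have "\<dots> = chr ?R3 g"
        unfolding R3 by (rule chr_Sum[OF finB group_B r3 g, symmetric])
      finally show ?thesis .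
    qed
    finally show "chr ?L g = chr (?R1 \<oplus>\<^sub>r ?R2 \<oplus>\<^sub>r ?R3) g"
      unfolding chr_plus[OF RR(1) representation_plus[OF RR(2,3)] g] chr_plus[OF RR(2,3) g] by (simp only: add.assoc)
  qed
qed

lemma representation_triv: "representation (sym_group 2) triv_rep"
  by (rule representation_char_rep[OF sym_group_is_group]) simp_all

lemma representation_sign: "representation (sym_group 2) (char_rep sign_char)"
proof (rule representation_char_rep[OF sym_group_is_group])
  fix g h assume "g \<in> carrier (sym_group 2)" "h \<in> carrier (sym_group 2)"
  then have "permutation g" "permutation h" by (auto simp: sym_group_carrier intro: permutation_if)
  then show "sign_char (g \<otimes>\<^bsub>sym_group 2\<^esub> h) = sign_char g * sign_char h"
    by (simp add: sign_char_def sym_group_mult sign_compose)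
qed (simp add: sign_char_def sym_group_one)

lemma chr_S2bar_triv:
  assumes W: "representation S2bar W" and iso: "rep_iso S2bar W triv_rep" and h: "h \<in> carrier S2bar"
  shows "chr W h = 1"
proof -
  have "representation S2bar triv_rep" by (rule representation_char_rep[OF rep_group[OF W]]) simp_all
  then show ?thesis using chr_rep_iso[OF W _ iso h] by (simp add: chr_char_rep)
qed

lemma chr_S2bar_sign:
  assumes W: "representation S2bar W" and iso: "rep_iso S2bar W eps_S2" and h: "h \<in> carrier S2bar"
  shows "chr W h = sign_char (snd h)"
proof -
  have "representation S2bar eps_S2"
    unfolding eps_S2_def
  proof (rule representation_char_rep[OF rep_group[OF W]])
    show "(\<lambda>(f, \<sigma>). sign_char \<sigma>) \<one>\<^bsub>S2bar\<^esub> = 1" by (simp add: S2bar_def one_B sign_char_def)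
    fix x y assume "x \<in> carrier S2bar" "y \<in> carrier S2bar"
    then obtain f \<sigma> f' \<tau> where xy: "x = (f, \<sigma>)" "y = (f', \<tau>)" "\<sigma> permutes {1..2}" "\<tau> permutes {1..2}"
      by (auto simp: carrier_S2bar_eq)
    then show "(\<lambda>(f, \<sigma>). sign_char \<sigma>) (x \<otimes>\<^bsub>S2bar\<^esub> y) = (\<lambda>(f, \<sigma>). sign_char \<sigma>) x * (\<lambda>(f, \<sigma>). sign_char \<sigma>) y"
      using permutation_if[OF xy(3)] permutation_if[OF xy(4)]
      by (simp add: mult_S2bar mult_B sign_char_def sign_compose)
  qed
  then show ?thesis using chr_rep_iso[OF W _ iso h] by (simp add: chr_char_rep eps_S2_def case_prod_unfold)
qed

theorem corollary7p9:
  fixes n :: nat and lam \<mu> :: "nat list" and W :: "(hyp, 'w) rep"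
  assumes "n \<ge> 4"
    and "lam \<turnstile> sum_list lam" and "\<mu> \<turnstile> sum_list \<mu>" and "sum_list lam + sum_list \<mu> = n - 2"
    and "irreducible_rep S2bar W"
  shows
    "(rep_iso S2bar W triv_rep \<longrightarrow>
        rep_iso (B 2) (ind (B 2) S2bar id W)
          (BSpecht [2] [] \<oplus>\<^sub>r BSpecht [] [2] \<oplus>\<^sub>r BSpecht [1] [1])) \<and>
     (rep_iso S2bar W eps_S2 \<longrightarrow>
        rep_iso (B 2) (ind (B 2) S2bar id W)
          (BSpecht [1, 1] [] \<oplus>\<^sub>r BSpecht [] [1, 1] \<oplus>\<^sub>r BSpecht [1] [1])) \<and>
     (rep_iso S2bar W triv_rep \<longrightarrow>
        rep_iso (B n)
          (ind (B n) (B (n - 2) \<times>\<times> S2bar) (B_embed (n - 2) 2) (BSpecht lam \<mu> \<boxtimes> W))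
          ((\<Oplus>\<^sub>r \<tau>\<in>barbar lam. BSpecht \<tau> \<mu>) \<oplus>\<^sub>r (\<Oplus>\<^sub>r \<rho>\<in>barbar \<mu>. BSpecht lam \<rho>) \<oplus>\<^sub>r
           (\<Oplus>\<^sub>r (\<tau>, \<rho>)\<in>bar lam \<times> bar \<mu>. BSpecht \<tau> \<rho>))) \<and>
     (rep_iso S2bar W eps_S2 \<longrightarrow>
        rep_iso (B n)
          (ind (B n) (B (n - 2) \<times>\<times> S2bar) (B_embed (n - 2) 2) (BSpecht lam \<mu> \<boxtimes> W))
          ((\<Oplus>\<^sub>r \<tau>\<in>tildebar lam. BSpecht \<tau> \<mu>) \<oplus>\<^sub>r (\<Oplus>\<^sub>r \<rho>\<in>tildebar \<mu>. BSpecht lam \<rho>) \<oplus>\<^sub>r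
           (\<Oplus>\<^sub>r (\<tau>, \<rho>)\<in>bar lam \<times> bar \<mu>. BSpecht \<tau> \<rho>)))"
proof -
  have W: "representation S2bar W" using assms(5) by (simp add: irreducible_rep_def)
  \<comment> \<open>The subtraction n - 2 is one of natural numbers; the lower bound on n makes it
    reversible.\<close>
  have n: "n = sum_list lam + sum_list \<mu> + 2" using assms(1,4) by simp
  have two: "[2] \<turnstile> 2" by (simp add: is_partition_def)
  have c2: "chr (Specht [2]) \<sigma> = 1" if "\<sigma> permutes {1..2}" for \<sigma>
    using chr_Specht_row[OF two _ that] by simp
  show ?thesis
  proof (intro conjI impI)
    assume iso: "rep_iso S2bar W triv_rep"
    note chrW = chr_S2bar_triv[OF W iso]
    show "rep_iso (B 2) (ind (B 2) S2bar id W) (BSpecht [2] [] \<oplus>\<^sub>r BSpecht [] [2] \<oplus>\<^sub>r BSpecht [1] [1])"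
      by (rule ind_S2bar[OF W representation_triv chrW]) (simp_all add: c2)
    show "rep_iso (B n) (ind (B n) (B (n - 2) \<times>\<times> S2bar) (B_embed (n - 2) 2) (BSpecht lam \<mu> \<boxtimes> W))
          ((\<Oplus>\<^sub>r \<tau>\<in>barbar lam. BSpecht \<tau> \<mu>) \<oplus>\<^sub>r (\<Oplus>\<^sub>r \<rho>\<in>barbar \<mu>. BSpecht lam \<rho>) \<oplus>\<^sub>r
           (\<Oplus>\<^sub>r (\<tau>, \<rho>)\<in>bar lam \<times> bar \<mu>. BSpecht \<tau> \<rho>))"
      unfolding assms(4)[symmetric] barbar_def
      by (rule ind_BSpecht_S2bar[OF assms(2,3) n W representation_triv chrW])
  next
    assume iso: "rep_iso S2bar W eps_S2"
    note chrW = chr_S2bar_sign[OF W iso]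
    show "rep_iso (B 2) (ind (B 2) S2bar id W) (BSpecht [1, 1] [] \<oplus>\<^sub>r BSpecht [] [1, 1] \<oplus>\<^sub>r BSpecht [1] [1])"
      by (rule ind_S2bar[OF W representation_sign chrW _ chr_Specht_column])
         (simp_all only: sum_list.Cons sum_list.Nil add_0_right one_add_one)
    show "rep_iso (B n) (ind (B n) (B (n - 2) \<times>\<times> S2bar) (B_embed (n - 2) 2) (BSpecht lam \<mu> \<boxtimes> W))
          ((\<Oplus>\<^sub>r \<tau>\<in>tildebar lam. BSpecht \<tau> \<mu>) \<oplus>\<^sub>r (\<Oplus>\<^sub>r \<rho>\<in>tildebar \<mu>. BSpecht lam \<rho>) \<oplus>\<^sub>r
           (\<Oplus>\<^sub>r (\<tau>, \<rho>)\<in>bar lam \<times> bar \<mu>. BSpecht \<tau> \<rho>))"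
      unfolding assms(4)[symmetric] tildebar_def
      by (rule ind_BSpecht_S2bar[OF assms(2,3) n W representation_sign chrW])
  qed
qed

end
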